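(* Unless $P = NP$, for no constant $l$ does there exist a polynomial-time $l$-approximation algorithm for the problem of computing the local minimum degree $\delta_{loc}(G)$ of a given bipartite graph $G$.
   Context: All graphs are finite, simple and undirected. The local complementation of a graph $G$ at a vertex $u$ is the graph $G * u = G \,\Delta\, K_{\mathcal{N}(u)}$, i.e. the edge set is replaced by its symmetric difference with the edge set of the complete graph on the neighborhood $\mathcal{N}(u)$ of $u$. Two graphs are locally equivalent, $G \equiv_{LC} G'$, if one can be obtained from the other by a finite sequence of local complementations. The local minimum degree is $\delta_{loc}(G) = \min\{\delta(G') : G' \equiv_{LC} G\}$, where $\delta(G')$ denotes the minimum degree of $G'$. An $l$-approximation algorithm outputs a value within a factor $l$ of the optimum $\delta_{loc}(G)$. *)

theory Defs
  imports Complex_Main "HOL-Computational_Algebra.Polynomial"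
begin

section \<open>Simple graphs and local complementation\<close>

type_synonym 'a ugraph = "'a set \<times> 'a set set"

abbreviation verts :: "'a ugraph \<Rightarrow> 'a set" where "verts \<equiv> fst"
abbreviation edges :: "'a ugraph \<Rightarrow> 'a set set" where "edges \<equiv> snd"

definition complete_edges :: "'a set \<Rightarrow> 'a set set" where
  "complete_edges A = {e. e \<subseteq> A \<and> card e = 2}"

definition simple_graph :: "'a ugraph \<Rightarrow> bool" where
  "simple_graph G \<longleftrightarrow> finite (verts G) \<and> edges G \<subseteq> complete_edges (verts G)"

definition bipartite :: "'a ugraph \<Rightarrow> bool" where
  "bipartite G \<longleftrightarrow> (\<exists>A B. A \<union> B = verts G \<and> A \<inter> B = {} \<and>
     (\<forall>e\<in>edges G. \<exists>a\<in>A. \<exists>b\<in>B. e = {a, b}))"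

definition nbhd :: "'a ugraph \<Rightarrow> 'a \<Rightarrow> 'a set" where
  "nbhd G u = {v. {u, v} \<in> edges G}"

definition min_degree :: "'a ugraph \<Rightarrow> nat" where
  "min_degree G = Min ((\<lambda>v. card (nbhd G v)) ` verts G)"

definition local_complement :: "'a ugraph \<Rightarrow> 'a \<Rightarrow> 'a ugraph" where
  "local_complement G u = (verts G, sym_diff (edges G) (complete_edges (nbhd G u)))"

definition locally_equivalent :: "'a ugraph \<Rightarrow> 'a ugraph \<Rightarrow> bool" where
  "locally_equivalent = (\<lambda>G H. \<exists>u\<in>verts G. H = local_complement G u)\<^sup>*\<^sup>*"

definition local_min_degree :: "'a ugraph \<Rightarrow> nat" where
  "local_min_degree G = Min (min_degree ` {G'. locally_equivalent G G'})"

lemma edge_in_complete_edges: "{u, v} \<in> complete_edges A \<longleftrightarrow> u \<in> A \<and> v \<in> A \<and> u \<noteq> v"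
  by (cases "u = v") (auto simp: complete_edges_def)

lemma nbhd_irrefl: "simple_graph G \<Longrightarrow> u \<notin> nbhd G u"
  unfolding simple_graph_def nbhd_def using edge_in_complete_edges[of u u] by blast

lemma nbhd_subset_verts: "simple_graph G \<Longrightarrow> nbhd G u \<subseteq> verts G"
  unfolding simple_graph_def nbhd_def using edge_in_complete_edges[of u] by blast

lemma simple_graph_local_complement:
  assumes "simple_graph G"
  shows "simple_graph (local_complement G u)"
proof -
  have "complete_edges (nbhd G u) \<subseteq> complete_edges (verts G)"
    using nbhd_subset_verts[OF assms] unfolding complete_edges_def by blast
  then show ?thesis
    using assms unfolding simple_graph_def local_complement_def fst_conv snd_conv by blast
qed

lemma nbhd_local_complement_self:
  assumes "simple_graph G"
  shows "nbhd (local_complement G u) u = nbhd G u"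
proof -
  have "{u, v} \<notin> complete_edges (nbhd G u)" for v
    using nbhd_irrefl[OF assms, of u] by (simp add: edge_in_complete_edges)
  then show ?thesis
    unfolding nbhd_def local_complement_def by (simp add: nbhd_def)
qed

lemma local_complement_involutive:
  assumes "simple_graph G"
  shows "local_complement (local_complement G u) u = G"
proof -
  have "local_complement (local_complement G u) u =
    (verts G, sym_diff (sym_diff (edges G) (complete_edges (nbhd G u))) (complete_edges (nbhd G u)))"
    unfolding local_complement_def[of "local_complement G u"] nbhd_local_complement_self[OF assms]
    by (simp only: local_complement_def fst_conv snd_conv)
  moreover have "sym_diff (sym_diff A B) B = A" for A B :: "'a set set"
    by blast
  ultimately show ?thesis by simp
qed

lemma locally_equivalent_simple_verts:
  assumes "locally_equivalent G H" "simple_graph G"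
  shows "simple_graph H \<and> verts H = verts G"
  using assms(1) unfolding locally_equivalent_def
proof (induction rule: rtranclp_induct)
  case base
  then show ?case using assms(2) by simp
next
  case (step H K)
  then obtain u where "K = local_complement H u" by blast
  moreover have "verts (local_complement H u) = verts H"
    by (simp add: local_complement_def)
  ultimately show ?case
    using step.IH simple_graph_local_complement[of H u] by simp
qed

lemma locally_equivalent_sym:
  assumes "locally_equivalent G H" "simple_graph G"
  shows "locally_equivalent H G"
  using assms(1) unfolding locally_equivalent_def
proof (induction rule: rtranclp_induct)
  case base
  then show ?case by simp
next
  case (step H K)
  then obtain u where u: "u \<in> verts H" "K = local_complement H u" by blast
  have "simple_graph H"
    using step.hyps(1) assms(2) locally_equivalent_simple_verts
    unfolding locally_equivalent_def by blast
  then have "local_complement K u = H"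
    using u by (simp add: local_complement_involutive)
  moreover have "u \<in> verts K"
    using u by (simp add: local_complement_def)
  ultimately have "\<exists>u\<in>verts K. H = local_complement K u" by blast
  then show ?case
    using step.IH by (rule converse_rtranclp_into_rtranclp)
qed

lemma finite_locally_equivalent:
  assumes "simple_graph G"
  shows "finite {G'. locally_equivalent G G'}"
proof (rule finite_subset)
  show "{G'. locally_equivalent G G'} \<subseteq> {verts G} \<times> Pow (Pow (verts G))"
  proof
    fix G' assume "G' \<in> {G'. locally_equivalent G G'}"
    then have "simple_graph G' \<and> verts G' = verts G"
      using locally_equivalent_simple_verts[of G G'] assms by simp
    then show "G' \<in> {verts G} \<times> Pow (Pow (verts G))"
      by (cases G') (auto simp: simple_graph_def complete_edges_def)
  qed
  show "finite ({verts G} \<times> Pow (Pow (verts G)))"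
    using assms by (simp add: simple_graph_def)
qed

section \<open>Turing machines\<close>

text \<open>
  Deterministic multi-tape machines with two-way infinite tapes. The states
  \<open>q < states M\<close> are the running states, \<open>0\<close> is the start state, and \<open>states M\<close> is the halting
  state. Tape symbols are \<open>0\<close> (blank), \<open>1\<close> and \<open>2\<close> (the bits \<open>False\<close> and \<open>True\<close>), and any
  further symbols below \<open>symbols M\<close>. The input is on the first tape, the output on the last one.
\<close>

datatype move = Go_Left | Stay | Go_Right

record turing_machine =
  tapes :: nat
  states :: nat
  symbols :: nat
  delta :: "nat \<Rightarrow> nat list \<Rightarrow> nat \<times> (nat \<times> move) list"

definition wf_tm :: "turing_machine \<Rightarrow> bool" where
  "wf_tm M \<longleftrightarrow> 1 \<le> tapes M \<and> 3 \<le> symbols M \<and>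
     (\<forall>q ss. q < states M \<and> length ss = tapes M \<and> set ss \<subseteq> {..<symbols M} \<longrightarrow>
        (case delta M q ss of (q', as) \<Rightarrow>
           q' \<le> states M \<and> length as = tapes M \<and> (\<forall>(s, d)\<in>set as. s < symbols M)))"

text \<open>A tape is the position of its head together with its contents.\<close>

type_synonym tape = "int \<times> (int \<Rightarrow> nat)"
type_synonym config = "nat \<times> tape list"

fun read_tape :: "tape \<Rightarrow> nat" where
  "read_tape (h, f) = f h"

fun move_head :: "move \<Rightarrow> int \<Rightarrow> int" where
  "move_head Go_Left h = h - 1"
| "move_head Stay h = h"
| "move_head Go_Right h = h + 1"

fun act :: "nat \<times> move \<Rightarrow> tape \<Rightarrow> tape" where
  "act (s, d) (h, f) = (move_head d h, f(h := s))"

fun step :: "turing_machine \<Rightarrow> config \<Rightarrow> config" where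
  "step M (q, ts) =
     (if q < states M
      then (case delta M q (map read_tape ts) of (q', as) \<Rightarrow> (q', map2 act as ts))
      else (q, ts))"

definition bit_symbol :: "bool \<Rightarrow> nat" where
  "bit_symbol b = (if b then 2 else 1)"

definition blank_tape :: tape where
  "blank_tape = (0, \<lambda>_. 0)"

definition input_tape :: "bool list \<Rightarrow> tape" where
  "input_tape x =
     (0, \<lambda>i. if 0 \<le> i \<and> i < int (length x) then bit_symbol (x ! nat i) else 0)"

definition init_config :: "turing_machine \<Rightarrow> bool list \<Rightarrow> config" where
  "init_config M x = (0, input_tape x # replicate (tapes M - 1) blank_tape)"

definition tape_holds :: "tape \<Rightarrow> bool list \<Rightarrow> bool" where
  "tape_holds t y \<longleftrightarrow>
     (\<forall>i<length y. snd t (int i) = bit_symbol (y ! i)) \<and> snd t (int (length y)) = 0"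

text \<open>Since \<open>step\<close> leaves halted configurations unchanged, this says that the machine halts within
  \<open>t\<close> steps.\<close>

definition outputs_within :: "turing_machine \<Rightarrow> bool list \<Rightarrow> nat \<Rightarrow> bool list \<Rightarrow> bool" where
  "outputs_within M x t y \<longleftrightarrow>
     (case (step M ^^ t) (init_config M x) of (q, ts) \<Rightarrow>
        \<not> q < states M \<and> tape_holds (last ts) y)"

section \<open>The classes P and NP\<close>

definition polytime_computable :: "(bool list \<Rightarrow> bool list) \<Rightarrow> bool" where
  "polytime_computable f \<longleftrightarrow> (\<exists>M (p :: nat poly). wf_tm M \<and>
     (\<forall>x. outputs_within M x (poly p (length x)) (f x)))"

definition class_P :: "bool list set set" where
  "class_P = {L. polytime_computable (\<lambda>x. [x \<in> L])}"

text \<open>An injective code for pairs: the bits of the first component are preceded by \<open>True\<close>, its end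
  is marked by \<open>False\<close>.\<close>

definition encode_pair :: "bool list \<Rightarrow> bool list \<Rightarrow> bool list" where
  "encode_pair x u = concat (map (\<lambda>b. [True, b]) x) @ False # u"

definition class_NP :: "bool list set set" where
  "class_NP = {L. \<exists>R\<in>class_P. \<exists>p :: nat poly. \<forall>x.
     x \<in> L \<longleftrightarrow> (\<exists>u. length u \<le> poly p (length x) \<and> encode_pair x u \<in> R)}"

section \<open>Approximating the local minimum degree\<close>

text \<open>The adjacency matrix of a graph with vertex set \<open>{..<n}\<close>, row by row.\<close>

definition encode_graph :: "nat ugraph \<Rightarrow> bool list" where
  "encode_graph G = (let n = card (verts G) in
     concat (map (\<lambda>i. map (\<lambda>j. {i, j} \<in> edges G) [0..<n]) [0..<n]))"

definition within_factor :: "real \<Rightarrow> nat \<Rightarrow> nat \<Rightarrow> bool" where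
  "within_factor l opt v \<longleftrightarrow> real opt \<le> l * real v \<and> real v \<le> l * real opt"

text \<open>
  The output is read as a binary number, least significant bit first. Nothing is required of the
  machine on inputs that do not encode a nonempty bipartite graph.
\<close>

definition polytime_approximates_local_min_degree :: "real \<Rightarrow> turing_machine \<Rightarrow> bool" where
  "polytime_approximates_local_min_degree l M \<longleftrightarrow> wf_tm M \<and> (\<exists>p :: nat poly.
     \<forall>(G :: nat ugraph) n. simple_graph G \<and> bipartite G \<and> verts G = {..<n} \<and> 0 < n \<longrightarrow>
       (\<exists>y. outputs_within M (encode_graph G) (poly p (length (encode_graph G))) y \<and>
            within_factor l (local_min_degree G) (horner_sum of_bool 2 y)))"

end

theory Submission
  imports Defs "HOL-Library.Z2" "HOL-Computational_Algebra.Polynomial_Factorial"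
begin

text \<open>
  No PCP theorem is needed. An accepting computation of a verifier is a solution of a system of
  quadratic equations over the field with two elements, that is, a symmetric matrix of rank one
  satisfying linear equations. Encode matrices \<open>X\<close> as \<open>E X E\<^sup>T\<close> with an almost balanced code \<open>E\<close>, in
  which every weight lies between \<open>11 h / 12\<close> and \<open>h\<close>, and append the equations, each repeated so
  often that one violation is already too heavy. A solution then gives a word of weight at most \<open>h\<^sup>2\<close>,
  whereas a matrix of rank at least two has weight at least \<open>5 h\<^sup>2 / 4\<close>; tensor powers amplify this gap
  between minimum distances beyond every constant.

  The local minimum degree of a graph is one less than the least size of a set \<open>D \<union> Odd D\<close> with \<open>D\<close>
  nonempty. In a bipartite graph made from the code and a large point-line geometry without quadrangles
  this size is, up to the small dimension, the minimum distance of the code. An approximation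
  of the local minimum degree thus separates members from non-members of any language in NP, and the
  reduction is carried out on the machine model by compiling structured programs.
\<close>

section \<open>Structured programs on named tapes\<close>

text \<open>Tensor powers amplify minimum distances, but not distances to a fixed word, so the whole
  reduction has to stay homogeneous: the constant 1 becomes a variable that all others imply, and
  the zero solution is excluded only by asking for a nonzero word. The factor 5/4 comes from rank
  two: two different nonzero rows have a joint support of at least 3/2 times the distance d, and d
  \<ge> 11 h / 12 gives 3/2 * (11/12)^2 > 5/4; 12 is the least denominator that allows this. On the
  graph side, a set with its odd neighbourhood may use vertices that have nothing to do with the
  code. The geometry makes this expensive: two lines share at most one point, so a few lines (or
  points) cannot cancel each other's large neighbourhoods. On the machine side, the approximation
  algorithm is an arbitrary machine that leaves its head anywhere on the output tape; it has to be
  brought back and the output scanned. The number found there is only compared with a power of two,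
  which is a question about bit positions.\<close>

datatype tp = Inp | Out | Ctr nat | Wrk nat

datatype com =
    Done
  | Move tp move
  | Put tp nat
  | Seq com com
  | IfR tp nat com com
  | WhileN tp nat com
  | Run turing_machine nat

type_synonym store = "tp \<Rightarrow> tape"

definition idle :: "(tp \<Rightarrow> nat) \<Rightarrow> tp \<Rightarrow> nat \<times> move" where
  "idle \<rho> = (\<lambda>t. (\<rho> t, Stay))"

text \<open>While a machine is run on the work tapes, the counters 0 and 1 record how often the head of its
  last tape moves to the right and to the left: the cell 0 of that tape carries no mark by which its
  head could be brought back there.\<close>

definition run_act :: "turing_machine \<Rightarrow> (nat \<times> move) list \<Rightarrow> (tp \<Rightarrow> nat) \<Rightarrow> tp \<Rightarrow> nat \<times> move" where
  "run_act M as \<rho> = (\<lambda>t. case t of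
      Wrk j \<Rightarrow> if j < tapes M then as ! j else (\<rho> t, Stay)
    | Ctr j \<Rightarrow> (\<rho> t, if j = 0 \<and> snd (last as) = Go_Right \<or> j = 1 \<and> snd (last as) = Go_Left
                   then Go_Right else Stay)
    | _ \<Rightarrow> (\<rho> t, Stay))"

text \<open>The remaining program serves as the control state. Every tape acts in every step; an
  idle tape rewrites the symbol just read. The \<open>min\<close> for an embedded machine keeps its
  state in range even for readings outside the alphabet, about which \<open>wf_tm\<close> says
  nothing.\<close>

fun nxt :: "com \<Rightarrow> (tp \<Rightarrow> nat) \<Rightarrow> com \<times> (tp \<Rightarrow> nat \<times> move)" where
  "nxt Done \<rho> = (Done, idle \<rho>)"
| "nxt (Move t d) \<rho> = (Done, (idle \<rho>)(t := (\<rho> t, d)))"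
| "nxt (Put t a) \<rho> = (Done, (idle \<rho>)(t := (a, Stay)))"
| "nxt (Seq c1 c2) \<rho> =
     (if c1 = Done then (c2, idle \<rho>) else (Seq (fst (nxt c1 \<rho>)) c2, snd (nxt c1 \<rho>)))"
| "nxt (IfR t a c1 c2) \<rho> = (if \<rho> t = a then c1 else c2, idle \<rho>)"
| "nxt (WhileN t a c) \<rho> = (if \<rho> t = a then Done else Seq c (WhileN t a c), idle \<rho>)"
| "nxt (Run M q) \<rho> =
     (if q < states M
      then (let (q', as) = delta M q (map (\<lambda>j. \<rho> (Wrk j)) [0..<tapes M])
            in (Run M (min q' (states M)), run_act M as \<rho>))
      else (Done, idle \<rho>))"

definition stp :: "com \<times> store \<Rightarrow> com \<times> store" where
  "stp cs = (let \<rho> = (\<lambda>t. read_tape (snd cs t)); r = nxt (fst cs) \<rho>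
             in (fst r, \<lambda>t. act (snd r t) (snd cs t)))"

lemma act_idle [simp]: "act (read_tape T, Stay) T = T"
  by (cases T) simp

lemma stp_idle: "nxt c (\<lambda>t. read_tape (s t)) = (c', idle (\<lambda>t. read_tape (s t))) \<Longrightarrow> stp (c, s) = (c', s)"
  by (simp add: stp_def idle_def Let_def)

text \<open>An upper bound on the time is enough, because \<open>Done\<close> is a fixed point of
  \<open>stp\<close>; \<open>halts_pow\<close> turns it into an exact number of steps.\<close>

definition halts :: "com \<Rightarrow> store \<Rightarrow> nat \<Rightarrow> store \<Rightarrow> bool" where
  "halts c s n s' \<longleftrightarrow> (\<exists>m\<le>n. (stp ^^ m) (c, s) = (Done, s'))"

lemma stp_Done [simp]: "stp (Done, s) = (Done, s)"
  by (simp add: stp_idle)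

lemma stp_pow_Done [simp]: "(stp ^^ n) (Done, s) = (Done, s)"
  by (induction n) auto

lemma halts_mono: "halts c s n s' \<Longrightarrow> n \<le> m \<Longrightarrow> halts c s m s'"
  unfolding halts_def by (meson le_trans)

lemma halts_pow: "halts c s n s' \<Longrightarrow> (stp ^^ n) (c, s) = (Done, s')"
proof -
  assume "halts c s n s'"
  then obtain m where m: "m \<le> n" "(stp ^^ m) (c, s) = (Done, s')"
    unfolding halts_def by blast
  have "(stp ^^ n) (c, s) = (stp ^^ (n - m)) ((stp ^^ m) (c, s))"
    using m(1) by (simp flip: funpow_add comp_apply[of "stp ^^ (n - m)"])
  then show ?thesis using m by simp
qed

lemma halts_step: "stp (c, s) = (c', s1) \<Longrightarrow> halts c' s1 n s' \<Longrightarrow> halts c s (Suc n) s'"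
  unfolding halts_def by (metis Suc_le_mono funpow_Suc_right comp_apply)

lemma halts_Done: "halts Done s n s"
  unfolding halts_def by auto

lemma halts_Move: "halts (Move t d) s 1 (s(t := (move_head d (fst (s t)), snd (s t))))"
proof -
  have "stp (Move t d, s) = (Done, s(t := (move_head d (fst (s t)), snd (s t))))"
    by (cases "s t") (auto simp: stp_def Let_def idle_def fun_eq_iff)
  then show ?thesis using halts_step halts_Done by (metis One_nat_def)
qed

lemma halts_Put: "halts (Put t a) s 1 (s(t := (fst (s t), (snd (s t))(fst (s t) := a))))"
proof -
  have "stp (Put t a, s) = (Done, s(t := (fst (s t), (snd (s t))(fst (s t) := a))))"
    by (cases "s t") (auto simp: stp_def Let_def idle_def fun_eq_iff)
  then show ?thesis using halts_step halts_Done by (metis One_nat_def)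
qed

lemma halts_Seq:
  assumes "halts c1 s n s1" "halts c2 s1 m s2" "n + m + 1 \<le> k"
  shows "halts (Seq c1 c2) s k s2"
proof -
  obtain j where "j \<le> n" "(stp ^^ j) (c1, s) = (Done, s1)"
    using assms(1) unfolding halts_def by blast
  then have "halts (Seq c1 c2) s (j + m + 1) s2"
  proof (induction j arbitrary: c1 s n)
    case 0
    then have "stp (Seq c1 c2, s) = (c2, s1)" by (auto simp: stp_idle)
    then show ?case using halts_step assms(2) by fastforce
  next
    case (Suc j)
    show ?case
    proof (cases "c1 = Done")
      case True
      then have "s1 = s" using Suc.prems by simp
      then have "stp (Seq c1 c2, s) = (c2, s1)" using True by (auto simp: stp_idle)
      then have "halts (Seq c1 c2) s (Suc m) s2" using halts_step assms(2) by fastforce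
      then show ?thesis by (rule halts_mono) simp
    next
      case False
      obtain c' s' where c': "stp (c1, s) = (c', s')" by fastforce
      then have "stp (Seq c1 c2, s) = (Seq c' c2, s')"
        using False by (auto simp: stp_def Let_def)
      moreover have "halts (Seq c' c2) s' (j + m + 1) s2"
        using Suc.IH[of j c' s'] Suc.prems c' by (simp add: funpow_swap1 del: funpow.simps) (simp add: funpow_Suc_right del: funpow.simps)
      ultimately show ?thesis using halts_step by fastforce
    qed
  qed
  then show ?thesis by (rule halts_mono) (use \<open>j \<le> n\<close> assms(3) in simp)
qed

lemma halts_IfR:
  assumes "halts (if read_tape (s t) = a then c1 else c2) s n s'" "n + 1 \<le> k"
  shows "halts (IfR t a c1 c2) s k s'"
  by (rule halts_mono[OF halts_step[OF stp_idle assms(1)]]) (use assms(2) in simp_all)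

lemma halts_While_stop: "read_tape (s t) = a \<Longrightarrow> halts (WhileN t a c) s 1 s"
proof -
  assume "read_tape (s t) = a"
  then have "stp (WhileN t a c, s) = (Done, s)" by (auto simp: stp_idle)
  then show ?thesis using halts_step halts_Done by (metis One_nat_def)
qed

lemma halts_While_step:
  assumes "read_tape (s t) \<noteq> a" "halts c s n s1" "halts (WhileN t a c) s1 m s2" "n + m + 2 \<le> k"
  shows "halts (WhileN t a c) s k s2"
proof -
  have "halts (Seq c (WhileN t a c)) s (n + m + 1) s2"
    using assms(2,3) by (rule halts_Seq) simp
  from halts_step[OF stp_idle this] have "halts (WhileN t a c) s (Suc (n + m + 1)) s2"
    using assms(1) by simp
  then show ?thesis by (rule halts_mono) (use assms(4) in simp)
qed

text \<open>The stores are indexed by the number of iterations still to come, so the loop leads from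
  \<open>S v\<close> down to \<open>S 0\<close>.\<close>

lemma halts_While_family:
  assumes "\<And>i. i < v \<Longrightarrow> read_tape (S (Suc i) t) \<noteq> a \<and> halts c (S (Suc i)) n (S i)"
    and "read_tape (S 0 t) = a" and "v * (n + 2) + 1 \<le> k"
  shows "halts (WhileN t a c) (S v) k (S 0)"
proof -
  have "halts (WhileN t a c) (S v) (v * (n + 2) + 1) (S 0)"
    using assms(1)
  proof (induction v)
    case 0
    then show ?case using halts_While_stop assms(2) by simp
  next
    case (Suc v)
    show ?case
      by (rule halts_While_step[of _ _ _ _ n "S v" "v * (n + 2) + 1"]) (use Suc in auto)
  qed
  then show ?thesis by (rule halts_mono) (rule assms(3))
qed

subsection \<open>Compilation into a Turing machine\<close>

fun tps :: "com \<Rightarrow> tp set" where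
  "tps Done = {}"
| "tps (Move t d) = {t}"
| "tps (Put t a) = {t}"
| "tps (Seq c1 c2) = tps c1 \<union> tps c2"
| "tps (IfR t a c1 c2) = {t} \<union> tps c1 \<union> tps c2"
| "tps (WhileN t a c) = {t} \<union> tps c"
| "tps (Run M q) = Wrk ` {..<tapes M} \<union> {Ctr 0, Ctr 1}"

fun okc :: "nat \<Rightarrow> com \<Rightarrow> bool" where
  "okc S Done = True"
| "okc S (Move t d) = True"
| "okc S (Put t a) = (a < S)"
| "okc S (Seq c1 c2) = (okc S c1 \<and> okc S c2)"
| "okc S (IfR t a c1 c2) = (okc S c1 \<and> okc S c2)"
| "okc S (WhileN t a c) = okc S c"
| "okc S (Run M q) = (wf_tm M \<and> symbols M = S \<and> q \<le> states M)"

text \<open>A finite superset of the programs that can remain during a run; it becomes the state set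
  of the compiled machine.\<close>

fun reach :: "com \<Rightarrow> com set" where
  "reach Done = {Done}"
| "reach (Move t d) = {Move t d, Done}"
| "reach (Put t a) = {Put t a, Done}"
| "reach (Seq c1 c2) = (\<lambda>c. Seq c c2) ` reach c1 \<union> reach c2"
| "reach (IfR t a c1 c2) = insert (IfR t a c1 c2) (reach c1 \<union> reach c2)"
| "reach (WhileN t a c) = {WhileN t a c, Done} \<union> (\<lambda>c'. Seq c' (WhileN t a c)) ` reach c"
| "reach (Run M q) = insert Done (Run M ` {..states M})"

lemma finite_reach: "finite (reach c)"
  by (induction c) auto

lemma self_reach: "okc S c \<Longrightarrow> c \<in> reach c"
  by (induction c) auto

lemma reach_nxt: "okc S c \<Longrightarrow> c' \<in> reach c \<Longrightarrow> fst (nxt c' \<rho>) \<in> reach c"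
proof (induction c arbitrary: c')
  case (Seq c1 c2)
  then show ?case using self_reach[of S c2] by auto
next
  case (IfR t a c1 c2)
  then show ?case using self_reach[of S c1] self_reach[of S c2] by auto
next
  case (WhileN t a c)
  have 1: "c \<in> reach c" using WhileN self_reach[of S c] by simp
  consider "c' = WhileN t a c" | "c' = Done" | c1 where "c' = Seq c1 (WhileN t a c)" "c1 \<in> reach c"
    using WhileN.prems by auto
  then show ?case
  proof cases
    case 3
    then show ?thesis using WhileN by (cases "c1 = Done") auto
  qed (use 1 in \<open>cases "\<rho> t = a"; simp\<close>)+
next
  case (Run M q)
  then consider "c' = Done" | x where "c' = Run M x" by auto
  then show ?case
  proof cases
    case (2 x)
    then show ?thesis by (cases "x < states M") (auto simp: Let_def split: prod.splits)
  qed simp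
qed (auto split: if_splits)

lemma reach_okc: "okc S c \<Longrightarrow> c' \<in> reach c \<Longrightarrow> okc S c' \<and> tps c' \<subseteq> tps c"
proof (induction c arbitrary: c')
  case (Seq c1 c2)
  from Seq.prems consider c where "c' = Seq c c2" "c \<in> reach c1" | "c' \<in> reach c2" by auto
  then show ?case
  proof cases
    case 1
    then show ?thesis using Seq.IH(1)[of c] Seq.prems by auto
  next
    case 2
    then show ?thesis using Seq.IH(2)[of c'] Seq.prems by auto
  qed
next
  case (IfR t a c1 c2)
  from IfR.prems consider "c' = IfR t a c1 c2" | "c' \<in> reach c1" | "c' \<in> reach c2" by auto
  then show ?case
  proof cases
    case 2
    then show ?thesis using IfR.IH(1)[of c'] IfR.prems by auto
  next
    case 3
    then show ?thesis using IfR.IH(2)[of c'] IfR.prems by auto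
  qed (use IfR.prems in auto)
next
  case (WhileN t a c)
  from WhileN.prems consider "c' = WhileN t a c" | "c' = Done" | c1 where "c' = Seq c1 (WhileN t a c)" "c1 \<in> reach c"
    by auto
  then show ?case
  proof cases
    case (3 c1)
    then show ?thesis using WhileN.IH[of c1] WhileN.prems by auto
  qed (use WhileN.prems in auto)
qed auto

text \<open>Tapes outside \<open>tps c\<close> influence neither the control nor the other tapes. A
  machine that carries only a finite layout of tapes can therefore simulate the program.\<close>

lemma nxt_cong:
  assumes "\<And>t. t \<in> tps c \<Longrightarrow> \<rho> t = \<rho>' t"
  shows "fst (nxt c \<rho>) = fst (nxt c \<rho>') \<and> (\<forall>t. \<rho> t = \<rho>' t \<longrightarrow> snd (nxt c \<rho>) t = snd (nxt c \<rho>') t)"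
  using assms
proof (induction c)
  case (Run M q)
  have *: "map (\<lambda>j. \<rho> (Wrk j)) [0..<tapes M] = map (\<lambda>j. \<rho>' (Wrk j)) [0..<tapes M]"
    using Run by simp
  show ?case unfolding nxt.simps *
    by (auto simp: Let_def idle_def run_act_def case_prod_beta split: tp.split)
qed (auto simp: idle_def)

lemma nxt_range:
  assumes "okc S c" "\<And>t. \<rho> t < S"
  shows "fst (snd (nxt c \<rho>) t) < S"
  using assms
proof (induction c)
  case (Run M q)
  show ?case
  proof (cases "q < states M")
    case True
    obtain q' as where qa: "delta M q (map (\<lambda>j. \<rho> (Wrk j)) [0..<tapes M]) = (q', as)" by fastforce
    have "length as = tapes M \<and> (\<forall>(s, d)\<in>set as. s < S)"
      using Run True qa unfolding wf_tm_def okc.simps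
      by (elim conjE allE[of _ q] allE[of _ "map (\<lambda>j. \<rho> (Wrk j)) [0..<tapes M]"]) auto
    then have "j < tapes M \<Longrightarrow> fst (as ! j) < S" for j
      using nth_mem[of j as] by (auto simp: case_prod_beta)
    then show ?thesis using True qa Run by (auto simp: run_act_def split: tp.splits)
  qed (use Run in \<open>auto simp: idle_def\<close>)
qed (auto simp: idle_def)

text \<open>States are the programs in \<open>reach c\<close>, numbered so that \<open>c\<close>
  becomes the start state 0 and \<open>Done\<close> the halting state. One program step is one
  machine step, so time bounds carry over unchanged.\<close>

theorem compile_com:
  assumes ok: "okc S c" and S: "3 \<le> S" and lay: "tps c \<subseteq> set lay" "distinct lay" "lay \<noteq> []"
    and nD: "c \<noteq> Done"
  shows "\<exists>M. wf_tm M \<and> tapes M = length lay \<and>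
    (\<forall>s s' n. halts c s n s' \<longrightarrow> (step M ^^ n) (0, map s lay) = (states M, map s' lay))"
proof -
  let ?R = "reach c - {Done}"
  define m where "m = card ?R"
  have cR: "c \<in> ?R" using self_reach ok nD by auto
  have "card (?R - {c}) = card {1..<m}" using cR finite_reach[of c] by (simp add: m_def)
  \<comment> \<open>Any numbering of the other programs will do; the machine model prescribes only
    the start and the halting state.\<close>
  then obtain g where g: "bij_betw g (?R - {c}) {1..<m}"
    using finite_same_card_bij[of "?R - {c}" "{1..<m}"] finite_reach[of c] by auto
  define h where "h = g(c := 0, Done := m)"
  have "m > 0" using cR finite_reach[of c] by (auto simp: m_def card_gt_0_iff)
  moreover have "bij_betw h (?R - {c}) {1..<m}"
    using g by (rule bij_betw_cong[THEN iffD1, rotated]) (auto simp: h_def)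
  ultimately have "bij_betw h (insert c (?R - {c})) (insert 0 {1..<m})"
    using nD by (intro bij_betw_combine[of h "{c}" "{0}", simplified]) (auto simp: h_def bij_betw_def)
  moreover have "insert 0 {1..<m} = {..<m}" using \<open>m > 0\<close> by auto
  ultimately have h: "bij_betw h ?R {..<m}" using cR by (simp add: insert_absorb)
  have h0: "h c = 0" using nD by (simp add: h_def)
  have hD: "h Done = m" by (simp add: h_def)
  have hle: "c' \<in> reach c \<Longrightarrow> h c' \<le> m" for c'
    using bij_betwE[OF h] hD by (cases "c' = Done") (auto simp: less_imp_le)
  define k where "k = the_inv_into ?R h"
  have kh: "c' \<in> ?R \<Longrightarrow> k (h c') = c'" for c'
    unfolding k_def using h by (auto simp: bij_betw_def the_inv_into_f_f)
  have kR: "q < m \<Longrightarrow> k q \<in> ?R" for q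
    unfolding k_def using h by (metis bij_betw_def lessThan_iff order_refl the_inv_into_into)
  \<comment> \<open>Translates a list of symbols in layout order back into a reading of named tapes;
    tapes outside the layout read 0.\<close>
  define rd where "rd = (\<lambda>(ss::nat list) t. case map_of (zip lay ss) t of Some a \<Rightarrow> a | None \<Rightarrow> 0)"
  define M where "M = \<lparr>tapes = length lay, states = m, symbols = S,
    delta = (\<lambda>q ss. (h (fst (nxt (k q) (rd ss))), map (snd (nxt (k q) (rd ss))) lay))\<rparr>"
  have rd_lt: "rd ss t < S" if "set ss \<subseteq> {..<S}" for ss t
  proof (cases "map_of (zip lay ss) t")
    case (Some a)
    then have "a \<in> set ss" by (meson map_of_SomeD set_zip_rightD)
    then show ?thesis using Some that by (auto simp: rd_def)
  qed (use S in \<open>simp add: rd_def\<close>)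
  have wf: "wf_tm M"
    unfolding wf_tm_def
  proof (intro conjI allI impI)
    show "1 \<le> tapes M" using lay by (cases lay) (auto simp: M_def)
    show "3 \<le> symbols M" using S by (simp add: M_def)
    fix q ss assume a: "q < states M \<and> length ss = tapes M \<and> set ss \<subseteq> {..<symbols M}"
    have "k q \<in> reach c" using kR a by (auto simp: M_def)
    then have "h (fst (nxt (k q) (rd ss))) \<le> m" "okc S (k q)"
      using reach_nxt[OF ok] hle reach_okc[OF ok] by auto
    moreover have "fst (snd (nxt (k q) (rd ss)) t) < S" for t
      using nxt_range[OF \<open>okc S (k q)\<close>] rd_lt a by (auto simp: M_def)
    ultimately show "case delta M q ss of (q', as) \<Rightarrow>
           q' \<le> states M \<and> length as = tapes M \<and> (\<forall>(s, d)\<in>set as. s < symbols M)"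
      by (auto simp: M_def) (metis fst_conv)
  qed
  have one: "step M (h c', map s lay) = (h (fst (stp (c', s))), map (snd (stp (c', s))) lay)"
    if c': "c' \<in> reach c" for c' s
  proof (cases "c' = Done")
    case True
    then show ?thesis using hD by (simp add: M_def)
  next
    case False
    then have hm: "h c' < m" using h c' by (auto simp: bij_betw_def)
    have rd_eq: "rd (map read_tape (map s lay)) t = read_tape (s t)" if "t \<in> set lay" for t
      using that by (simp add: rd_def map_of_zip_map o_def)
    have tl: "tps c' \<subseteq> set lay" using reach_okc[OF ok c'] lay by auto
    note nc = nxt_cong[of c' "rd (map read_tape (map s lay))" "\<lambda>t. read_tape (s t)"]
    have 1: "fst (nxt c' (rd (map read_tape (map s lay)))) = fst (nxt c' (\<lambda>t. read_tape (s t)))"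
      using nc rd_eq tl by blast
    have 2: "snd (nxt c' (rd (map read_tape (map s lay)))) t = snd (nxt c' (\<lambda>t. read_tape (s t))) t"
      if "t \<in> set lay" for t
      using nc rd_eq tl that by blast
    have "map2 act (map (snd (nxt c' (rd (map read_tape (map s lay))))) lay) (map s lay)
        = map (\<lambda>t. act (snd (nxt c' (\<lambda>t. read_tape (s t))) t) (s t)) lay"
      using 2 by (auto simp: zip_map_map zip_same_conv_map)
    moreover have "k (h c') = c'" using kh c' False by auto
    ultimately show ?thesis using hm 1 by (simp add: M_def stp_def Let_def)
  qed
  have many: "(step M ^^ n) (h c', map s lay) = (h (fst ((stp ^^ n) (c', s))), map (snd ((stp ^^ n) (c', s))) lay)
     \<and> fst ((stp ^^ n) (c', s)) \<in> reach c"
    if c': "c' \<in> reach c" for c' s n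
  proof (induction n)
    case 0
    then show ?case using c' by simp
  next
    case (Suc n)
    obtain c1 s1 where c1: "(stp ^^ n) (c', s) = (c1, s1)" by fastforce
    then have "c1 \<in> reach c" using Suc by simp
    then have "fst (stp (c1, s1)) \<in> reach c"
      using reach_nxt[OF ok] by (simp add: stp_def Let_def)
    then show ?case using Suc c1 one[OF \<open>c1 \<in> reach c\<close>] by simp
  qed
  have "(step M ^^ n) (0, map s lay) = (states M, map s' lay)" if "halts c s n s'" for s s' n
    using many[of c n s] halts_pow[OF that] cR h0 hD by (auto simp: M_def)
  then show ?thesis using wf by (intro exI[of _ M]) (auto simp: M_def)
qed

subsection \<open>Counters\<close>

text \<open>A counter is the head position on a tape whose only mark is at cell 0: increment,
  decrement and the test for zero take one step each and never write.\<close>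

definition ctr :: "nat \<Rightarrow> tape" where
  "ctr v = (int v, (\<lambda>_. 0)(0 := 1))"

definition with_ctrs :: "store \<Rightarrow> (nat \<Rightarrow> nat) \<Rightarrow> store" where
  "with_ctrs s r = (\<lambda>t. case t of Ctr j \<Rightarrow> ctr (r j) | _ \<Rightarrow> s t)"

abbreviation Inc :: "nat \<Rightarrow> com" where "Inc j \<equiv> Move (Ctr j) Go_Right"
abbreviation Dec :: "nat \<Rightarrow> com" where "Dec j \<equiv> Move (Ctr j) Go_Left"

definition Loop :: "nat \<Rightarrow> com \<Rightarrow> com" where
  "Loop j c = WhileN (Ctr j) 1 (Seq (Dec j) c)"

lemma read_ctr [simp]: "read_tape (ctr v) = (if v = 0 then 1 else 0)"
  by (simp add: ctr_def)

lemma with_ctrs_simps [simp]: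
  "with_ctrs s r (Ctr j) = ctr (r j)" "with_ctrs s r Inp = s Inp"
  "with_ctrs s r Out = s Out" "with_ctrs s r (Wrk j) = s (Wrk j)"
  by (simp_all add: with_ctrs_def)

lemma with_ctrs_upd:
  "(with_ctrs s r)(Ctr j := ctr v) = with_ctrs s (r(j := v))"
  "(with_ctrs s r)(Inp := T) = with_ctrs (s(Inp := T)) r"
  "(with_ctrs s r)(Out := T) = with_ctrs (s(Out := T)) r"
  "(with_ctrs s r)(Wrk j := T) = with_ctrs (s(Wrk j := T)) r"
  by (auto simp: with_ctrs_def fun_eq_iff split: tp.splits)

lemma halts_cong: "halts c s n s1 \<Longrightarrow> s1 = s2 \<Longrightarrow> n \<le> m \<Longrightarrow> halts c s m s2"
  using halts_mono by blast

lemma halts_Inc: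
  assumes "r' = r(j := Suc (r j))" "1 \<le> k"
  shows "halts (Inc j) (with_ctrs s r) k (with_ctrs s r')"
proof (rule halts_cong[OF halts_Move _ assms(2)])
  have "(move_head Go_Right (fst (ctr (r j))), snd (ctr (r j))) = ctr (Suc (r j))"
    by (simp add: ctr_def)
  then show "(with_ctrs s r)(Ctr j := (move_head Go_Right (fst (with_ctrs s r (Ctr j))), snd (with_ctrs s r (Ctr j)))) =
    with_ctrs s r'"
    by (simp add: with_ctrs_upd assms(1) del: move_head.simps)
qed

lemma halts_Dec:
  assumes "r j > 0" "r' = r(j := r j - 1)" "1 \<le> k"
  shows "halts (Dec j) (with_ctrs s r) k (with_ctrs s r')"
proof (rule halts_cong[OF halts_Move _ assms(3)])
  have "(move_head Go_Left (fst (ctr (r j))), snd (ctr (r j))) = ctr (r j - 1)"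
    using assms(1) by (simp add: ctr_def of_nat_diff)
  then show "(with_ctrs s r)(Ctr j := (move_head Go_Left (fst (with_ctrs s r (Ctr j))), snd (with_ctrs s r (Ctr j)))) =
    with_ctrs s r'"
    by (simp add: with_ctrs_upd assms(2) del: move_head.simps)
qed

lemma halts_IfZero:
  assumes "halts (if r j = 0 then c1 else c2) (with_ctrs s r) n s'" "n + 1 \<le> k"
  shows "halts (IfR (Ctr j) 1 c1 c2) (with_ctrs s r) k s'"
  using assms by (intro halts_IfR[of _ _ _ _ _ n]) (auto split: if_splits)

text \<open>\<open>s\<close> and \<open>r\<close> are indexed by completed iterations. The counter
  \<open>j\<close> is decremented before the body runs, hence \<open>v - Suc i\<close> during
  iteration \<open>i\<close>; its update is split off so that \<open>r\<close> only describes the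
  other counters.\<close>

lemma halts_Loop:
  assumes "\<And>i. i < v \<Longrightarrow> halts c (with_ctrs (s i) ((r i)(j := v - Suc i))) n
      (with_ctrs (s (Suc i)) ((r (Suc i))(j := v - Suc i)))"
    and "R = (r 0)(j := v)" "R' = (r v)(j := 0)" "S = s 0" "S' = s v" "v * (n + 4) + 1 \<le> k"
  shows "halts (Loop j c) (with_ctrs S R) k (with_ctrs S' R')"
proof -
  define T where "T = (\<lambda>i. with_ctrs (s (v - i)) ((r (v - i))(j := i)))"
  have "halts (WhileN (Ctr j) 1 (Seq (Dec j) c)) (T v) (v * (n + 4) + 1) (T 0)"
  proof (rule halts_While_family[where n = "n + 2"])
    fix i assume i: "i < v"
    have e: "Suc (v - Suc i) = v - i" "v - Suc (v - Suc i) = i" using i by auto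
    have "halts (Dec j) (T (Suc i)) 1 (with_ctrs (s (v - Suc i)) ((r (v - Suc i))(j := i)))"
      unfolding T_def by (rule halts_Dec) auto
    moreover have "halts c (with_ctrs (s (v - Suc i)) ((r (v - Suc i))(j := i))) n (T i)"
      using assms(1)[of "v - Suc i"] i by (simp add: T_def e)
    ultimately have "halts (Seq (Dec j) c) (T (Suc i)) (n + 2) (T i)"
      by (rule halts_Seq) simp
    then show "read_tape (T (Suc i) (Ctr j)) \<noteq> 1 \<and> halts (Seq (Dec j) c) (T (Suc i)) (n + 2) (T i)"
      by (simp add: T_def)
  qed (auto simp: T_def algebra_simps)
  moreover have "T v = with_ctrs S R" "T 0 = with_ctrs S' R'" using assms by (auto simp: T_def)
  ultimately show ?thesis
    unfolding Loop_def using halts_mono[OF _ assms(6)] by simp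
qed

definition Clear :: "nat \<Rightarrow> com" where "Clear j = Loop j Done"

lemma halts_Clear:
  assumes "r' = r(j := 0)" "r j * 4 + 1 \<le> k"
  shows "halts (Clear j) (with_ctrs s r) k (with_ctrs s r')"
  unfolding Clear_def
  by (rule halts_Loop[where v = "r j" and s = "\<lambda>_. s" and r = "\<lambda>_. r" and n = 0])
    (use assms halts_Done in auto)

text \<open>Reading a counter destroys it, so the value is moved to \<open>b\<close> and
  \<open>t\<close> together and then moved back from \<open>t\<close>.\<close>

definition Copy :: "nat \<Rightarrow> nat \<Rightarrow> nat \<Rightarrow> com" where
  "Copy a b t = Seq (Loop a (Seq (Inc b) (Inc t))) (Loop t (Inc a))"

lemma halts_Copy:
  assumes "a \<noteq> b" "a \<noteq> t" "b \<noteq> t" "r t = 0" "r' = r(b := r b + r a)" "r a * 12 + 3 \<le> k"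
  shows "halts (Copy a b t) (with_ctrs s r) k (with_ctrs s r')"
  unfolding Copy_def
proof (rule halts_Seq)
  define v where "v = r a"
  show "halts (Loop a (Seq (Inc b) (Inc t))) (with_ctrs s r) (r a * 7 + 1)
      (with_ctrs s (r(b := r b + r a, t := r a, a := 0)))"
  proof (rule halts_Loop[where v = "r a" and s = "\<lambda>_. s" and r = "\<lambda>i. r(b := r b + i, t := i)" and n = 3])
    fix i
    show "halts (Seq (Inc b) (Inc t)) (with_ctrs s ((r(b := r b + i, t := i))(a := r a - Suc i))) 3
          (with_ctrs s ((r(b := r b + Suc i, t := Suc i))(a := r a - Suc i)))"
      by (rule halts_Seq[OF halts_Inc[OF refl order_refl] halts_Inc[OF _ order_refl]])
        (use assms in \<open>auto simp: fun_eq_iff\<close>)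
  qed (use assms in \<open>auto simp: fun_eq_iff\<close>)
  show "halts (Loop t (Inc a)) (with_ctrs s (r(b := r b + r a, t := r a, a := 0))) (r a * 5 + 1) (with_ctrs s r')"
  proof (rule halts_Loop[where v = "r a" and s = "\<lambda>_. s" and r = "\<lambda>i. r(b := r b + r a, a := i)" and n = 1])
    fix i
    show "halts (Inc a) (with_ctrs s ((r(b := r b + r a, a := i))(t := r a - Suc i))) 1
          (with_ctrs s ((r(b := r b + r a, a := Suc i))(t := r a - Suc i)))"
      by (rule halts_Inc) (use assms in \<open>auto simp: fun_eq_iff\<close>)
  qed (use assms in \<open>auto simp: fun_eq_iff\<close>)
qed (use assms in auto)

section \<open>Polynomially bounded functions\<close>

text \<open>A single power of \<open>m\<close> as bound: for \<open>m \<ge> 2\<close> constants and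
  sums are absorbed by a larger exponent, so no coefficients have to be tracked.\<close>

definition pbounded :: "(nat \<Rightarrow> nat) \<Rightarrow> bool" where
  "pbounded f \<longleftrightarrow> (\<exists>c. \<forall>m\<ge>2. f m \<le> m ^ c)"

lemma pbounded_mono: "pbounded g \<Longrightarrow> (\<And>m. m \<ge> 2 \<Longrightarrow> f m \<le> g m) \<Longrightarrow> pbounded f"
  unfolding pbounded_def by (meson le_trans)

lemma pbounded_id [intro]: "pbounded (\<lambda>m. m)"
  unfolding pbounded_def by (rule exI[of _ 1]) simp

lemma pbounded_const [intro]: "pbounded (\<lambda>m. k)"
  unfolding pbounded_def
proof (intro exI allI impI)
  fix m :: nat assume "2 \<le> m"
  then have "2 ^ k \<le> m ^ k" by (simp add: power_mono)
  then show "k \<le> m ^ k" using less_exp[of k] by linarith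
qed

lemma pbounded_mult [intro]:
  assumes "pbounded f" "pbounded g"
  shows "pbounded (\<lambda>m. f m * g m)"
proof -
  obtain a b where "\<forall>m\<ge>2. f m \<le> m ^ a" "\<forall>m\<ge>2. g m \<le> m ^ b"
    using assms unfolding pbounded_def by auto
  then show ?thesis
    unfolding pbounded_def by (intro exI[of _ "a + b"]) (auto simp: power_add intro: mult_le_mono)
qed

lemma pbounded_add [intro]:
  assumes "pbounded f" "pbounded g"
  shows "pbounded (\<lambda>m. f m + g m)"
proof -
  have "pbounded (\<lambda>m. (f m + 1) * (g m + 1))"
  proof -
    obtain a b where ab: "\<forall>m\<ge>2. f m \<le> m ^ a" "\<forall>m\<ge>2. g m \<le> m ^ b"
      using assms unfolding pbounded_def by auto
    have "y + 1 \<le> m ^ Suc c" if "y \<le> m ^ c" "2 \<le> m" for y m c :: nat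
    proof -
      have "m ^ c \<ge> 1" using that by simp
      then have "m ^ c + 1 \<le> 2 * m ^ c" by simp
      also have "\<dots> \<le> m * m ^ c" using that by simp
      finally show ?thesis using that by simp
    qed
    then have "pbounded (\<lambda>m. f m + 1)" "pbounded (\<lambda>m. g m + 1)"
      using ab unfolding pbounded_def by blast+
    then show ?thesis by (rule pbounded_mult)
  qed
  then show ?thesis by (rule pbounded_mono) simp
qed

lemma pbounded_Suc [intro]: "pbounded f \<Longrightarrow> pbounded (\<lambda>m. Suc (f m))"
  using pbounded_add[OF _ pbounded_const, of f 1] by simp

lemma pbounded_power [intro]: "pbounded f \<Longrightarrow> pbounded (\<lambda>m. f m ^ k)"
  by (induction k) auto

lemma pbounded_poly [intro]: "pbounded f \<Longrightarrow> pbounded (\<lambda>m. poly p (f m))"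
  by (induction p) auto

lemmas pbounded_intros = pbounded_add pbounded_mult pbounded_power pbounded_Suc pbounded_poly
  pbounded_id pbounded_const

lemma poly_nat_mono: "a \<le> b \<Longrightarrow> poly (p :: nat poly) a \<le> poly p b"
  by (induction p) (auto intro: add_mono mult_mono)

section \<open>Arithmetic expressions\<close>

text \<open>Iteration is bounded explicitly, which keeps all values polynomial in the input length.\<close>

datatype exp =
    Var nat
  | Const nat
  | Len
  | Sym exp
  | Add exp exp
  | Sub exp exp
  | Mul exp exp
  | Rec exp exp exp exp

definition inp :: "bool list \<Rightarrow> nat \<Rightarrow> nat" where
  "inp x i = (if i < length x then bit_symbol (x ! i) else 0)"

text \<open>Truncating at \<open>b\<close> after every step rules out growth as by repeated squaring
  and gives a bound independent of the number of iterations.\<close>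

definition biter :: "nat \<Rightarrow> nat \<Rightarrow> (nat \<Rightarrow> nat \<Rightarrow> nat) \<Rightarrow> nat \<Rightarrow> nat" where
  "biter a b f n = rec_nat a (\<lambda>i y. min (f i y) b) n"

lemma biter_simps [simp]: "biter a b f 0 = a" "biter a b f (Suc n) = min (f n (biter a b f n)) b"
  by (simp_all add: biter_def)

lemma biter_le: "biter a b f n \<le> a + b"
  by (cases n) auto

fun ev :: "exp \<Rightarrow> bool list \<Rightarrow> (nat \<Rightarrow> nat) \<Rightarrow> nat" where
  "ev (Var k) x v = v k"
| "ev (Const c) x v = c"
| "ev Len x v = length x"
| "ev (Sym e) x v = inp x (ev e x v)"
| "ev (Add e1 e2) x v = ev e1 x v + ev e2 x v"
| "ev (Sub e1 e2) x v = ev e1 x v - ev e2 x v"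
| "ev (Mul e1 e2) x v = ev e1 x v * ev e2 x v"
| "ev (Rec e0 eb en e) x v =
     biter (ev e0 x v) (ev eb x v) (\<lambda>i y. ev e x (case_nat i (case_nat y v))) (ev en x v)"

primrec Incs :: "nat \<Rightarrow> nat \<Rightarrow> com" where
  "Incs 0 j = Done"
| "Incs (Suc n) j = Seq (Inc j) (Incs n j)"

text \<open>Counters below \<open>d\<close> hold variables; those from \<open>d\<close> on are
  scratch, zero before and after except for the result in \<open>d\<close>. In \<open>Rec\<close>
  the accumulator is \<open>d\<close>, the bound \<open>d + 1\<close>, the remaining iterations
  \<open>d + 2\<close> and the index \<open>d + 3\<close>; truncation is done by moving at most as
  many units into \<open>d\<close> as the copy of the bound in \<open>d + 5\<close> allows.\<close>

fun cmp :: "exp \<Rightarrow> (nat \<Rightarrow> nat) \<Rightarrow> nat \<Rightarrow> com" where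
  "cmp (Var k) \<rho> d = Copy (\<rho> k) d (d + 1)"
| "cmp (Const c) \<rho> d = Incs c d"
| "cmp Len \<rho> d = Seq (WhileN Inp 0 (Seq (Move Inp Go_Right) (Inc d)))
     (Seq (Move Inp Go_Left) (Seq (WhileN Inp 0 (Move Inp Go_Left)) (Move Inp Go_Right)))"
| "cmp (Sym e) \<rho> d = Seq (cmp e \<rho> d) (Seq (Loop d (Seq (Move Inp Go_Right) (Inc (d + 1))))
     (Seq (IfR Inp 1 (Inc d) (IfR Inp 2 (Seq (Inc d) (Inc d)) Done))
       (Loop (d + 1) (Move Inp Go_Left))))"
| "cmp (Add e1 e2) \<rho> d = Seq (cmp e1 \<rho> d) (Seq (cmp e2 \<rho> (d + 1)) (Loop (d + 1) (Inc d)))"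
| "cmp (Sub e1 e2) \<rho> d = Seq (cmp e1 \<rho> d) (Seq (cmp e2 \<rho> (d + 1))
     (Loop (d + 1) (IfR (Ctr d) 1 Done (Dec d))))"
| "cmp (Mul e1 e2) \<rho> d = Seq (cmp e1 \<rho> (d + 1)) (Seq (cmp e2 \<rho> (d + 2))
     (Seq (Loop (d + 1) (Copy (d + 2) d (d + 3))) (Clear (d + 2))))"
| "cmp (Rec e0 eb en e) \<rho> d = Seq (cmp e0 \<rho> d) (Seq (cmp eb \<rho> (d + 1)) (Seq (cmp en \<rho> (d + 2))
     (Seq (Loop (d + 2) (Seq (cmp e (case_nat (d + 3) (case_nat d \<rho>)) (d + 4)) (Seq (Clear d)
        (Seq (Copy (d + 1) (d + 5) (d + 6))
          (Seq (Loop (d + 4) (IfR (Ctr (d + 5)) 1 Done (Seq (Dec (d + 5)) (Inc d))))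
            (Seq (Clear (d + 5)) (Inc (d + 3))))))))
       (Seq (Clear (d + 1)) (Clear (d + 3))))))"

text \<open>One exponent serves every \<open>m\<close> that bounds the input length and the
  variables, so a caller may enlarge \<open>m\<close>, as the loop of \<open>Rec\<close>
  does.\<close>

definition computes :: "exp \<Rightarrow> nat \<Rightarrow> bool" where
  "computes e c \<longleftrightarrow> (\<forall>s x r d \<rho> m. s Inp = input_tape x \<longrightarrow> length x \<le> m \<longrightarrow> 2 \<le> m \<longrightarrow>
     (\<forall>k. \<rho> k < d \<and> r (\<rho> k) \<le> m) \<longrightarrow> (\<forall>j\<ge>d. r j = 0) \<longrightarrow>
     ev e x (\<lambda>k. r (\<rho> k)) \<le> m ^ c \<and>
     halts (cmp e \<rho> d) (with_ctrs s r) (m ^ c) (with_ctrs s (r(d := ev e x (\<lambda>k. r (\<rho> k))))))"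

lemma computesD:
  assumes "computes e c" "s Inp = input_tape x" "length x \<le> m" "2 \<le> m"
    "\<forall>k. \<rho> k < d" "\<forall>k. r (\<rho> k) \<le> m" "\<forall>j\<ge>d. r j = 0"
  shows "ev e x (\<lambda>k. r (\<rho> k)) \<le> m ^ c"
    "halts (cmp e \<rho> d) (with_ctrs s r) (m ^ c) (with_ctrs s (r(d := ev e x (\<lambda>k. r (\<rho> k)))))"
  using assms unfolding computes_def by blast+

lemma computesI:
  assumes "pbounded f"
    and "\<And>s x r d \<rho> m. \<lbrakk>s Inp = input_tape x; length x \<le> m; 2 \<le> m; \<forall>k. \<rho> k < d;
      \<forall>k. r (\<rho> k) \<le> m; \<forall>j\<ge>d. r j = 0\<rbrakk> \<Longrightarrow> ev e x (\<lambda>k. r (\<rho> k)) \<le> f m \<and>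
     halts (cmp e \<rho> d) (with_ctrs s r) (f m) (with_ctrs s (r(d := ev e x (\<lambda>k. r (\<rho> k)))))"
  shows "\<exists>c. computes e c"
proof -
  obtain c where c: "\<forall>m\<ge>2. f m \<le> m ^ c" using assms(1) unfolding pbounded_def by blast
  have "computes e c"
    unfolding computes_def
  proof (intro allI impI)
    fix s :: store and x and r \<rho> :: "nat \<Rightarrow> nat" and d m
    assume a: "s Inp = input_tape x" "length x \<le> m" "2 \<le> m"
      "\<forall>k. \<rho> k < d \<and> r (\<rho> k) \<le> m" "\<forall>j\<ge>d. r j = 0"
    have f: "f m \<le> m ^ c" using c a by blast
    have "ev e x (\<lambda>k. r (\<rho> k)) \<le> f m \<and>
     halts (cmp e \<rho> d) (with_ctrs s r) (f m) (with_ctrs s (r(d := ev e x (\<lambda>k. r (\<rho> k)))))"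
      by (rule assms(2)) (use a in auto)
    then show "ev e x (\<lambda>k. r (\<rho> k)) \<le> m ^ c \<and>
     halts (cmp e \<rho> d) (with_ctrs s r) (m ^ c) (with_ctrs s (r(d := ev e x (\<lambda>k. r (\<rho> k)))))"
      using f halts_mono by (meson le_trans)
  qed
  then show ?thesis ..
qed

lemma computes_Var: "\<exists>c. computes (Var k) c"
proof (rule computesI[of "\<lambda>m. m * 12 + 3"])
  fix s :: store and x and r \<rho> :: "nat \<Rightarrow> nat" and d m
  assume a: "\<forall>k. \<rho> k < d" "\<forall>k. r (\<rho> k) \<le> m" "\<forall>j\<ge>d. r j = 0"
  have "halts (cmp (Var k) \<rho> d) (with_ctrs s r) (m * 12 + 3) (with_ctrs s (r(d := r (\<rho> k))))"
    unfolding cmp.simps by (rule halts_Copy) (use a(1)[rule_format, of k] a(2,3) in auto)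
  then show "ev (Var k) x (\<lambda>k. r (\<rho> k)) \<le> m * 12 + 3 \<and> halts (cmp (Var k) \<rho> d) (with_ctrs s r) (m * 12 + 3)
    (with_ctrs s (r(d := ev (Var k) x (\<lambda>k. r (\<rho> k)))))"
    using a(2)[rule_format, of k] by simp
qed (intro pbounded_intros)

lemma halts_Incs: "halts (Incs n j) (with_ctrs s r) (2 * n) (with_ctrs s (r(j := r j + n)))"
proof (induction n arbitrary: r)
  case 0
  then show ?case using halts_Done by simp
next
  case (Suc n)
  have "halts (Incs (Suc n) j) (with_ctrs s r) (2 * Suc n) (with_ctrs s ((r(j := Suc (r j)))(j := (r(j := Suc (r j))) j + n)))"
    unfolding Incs.simps by (rule halts_Seq[OF halts_Inc[OF refl order_refl] Suc]) simp
  moreover have "(r(j := Suc (r j)))(j := (r(j := Suc (r j))) j + n) = r(j := r j + Suc n)" by auto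
  ultimately show ?case by metis
qed

lemma computes_Const: "\<exists>c. computes (Const k) c"
proof (rule computesI[of "\<lambda>m. 2 * k"])
  fix s :: store and x and r \<rho> :: "nat \<Rightarrow> nat" and d m
  assume "\<forall>j\<ge>d. r j = 0"
  then show "ev (Const k) x (\<lambda>k. r (\<rho> k)) \<le> 2 * k \<and> halts (cmp (Const k) \<rho> d) (with_ctrs s r) (2 * k)
    (with_ctrs s (r(d := ev (Const k) x (\<lambda>k. r (\<rho> k)))))"
    using halts_Incs[of k d s r] by simp
qed (intro pbounded_intros)

lemma halts_Move_Inp:
  assumes "s Inp = (h, f)" "s' = s(Inp := (move_head dir h, f))" "1 \<le> k"
  shows "halts (Move Inp dir) (with_ctrs s r) k (with_ctrs s' r)"
  by (rule halts_cong[OF halts_Move _ assms(3)]) (use assms in \<open>simp add: with_ctrs_upd\<close>)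

lemma input_tape_0: "snd (input_tape x) (int i) = inp x i"
  by (simp add: input_tape_def inp_def)

lemma input_tape_neg: "snd (input_tape x) (- 1) = 0"
  by (simp add: input_tape_def)

lemma inp_0_iff: "inp x i = 0 \<longleftrightarrow> length x \<le> i"
  by (simp add: inp_def bit_symbol_def)

lemma computes_Len: "\<exists>c. computes Len c"
proof (rule computesI[of "\<lambda>m. 20 * m + 20"])
  fix s :: store and x and r \<rho> :: "nat \<Rightarrow> nat" and d m
  assume a: "s Inp = input_tape x" "length x \<le> m" "\<forall>j\<ge>d. r j = 0"
  define n where "n = length x"
  define f where "f = snd (input_tape x)"
  have f: "f (int i) = inp x i" "f (- 1) = 0" for i
    by (auto simp: f_def input_tape_0 input_tape_neg)
  have s: "s Inp = (0, f)" using a by (simp add: f_def input_tape_def)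
  let ?s = "\<lambda>h. s(Inp := (h, f))"
  have 1: "halts (WhileN Inp 0 (Seq (Move Inp Go_Right) (Inc d))) (with_ctrs s r) (n * 5 + 1)
     (with_ctrs (?s (int n)) (r(d := n)))"
  proof -
    have "halts (WhileN Inp 0 (Seq (Move Inp Go_Right) (Inc d))) (with_ctrs (?s (int (n - n))) (r(d := n - n))) (n * 5 + 1)
     (with_ctrs (?s (int (n - 0))) (r(d := n - 0)))"
    proof (rule halts_While_family[where n = 3])
      fix i assume i: "i < n"
      have e: "Suc (n - Suc i) = n - i" using i by simp
      have "halts (Move Inp Go_Right) (with_ctrs (?s (int (n - Suc i))) (r(d := n - Suc i))) 1
         (with_ctrs (?s (int (n - i))) (r(d := n - Suc i)))"
        by (rule halts_Move_Inp[where h = "int (n - Suc i)"]) (use e in auto)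
      moreover have "halts (Inc d) (with_ctrs (?s (int (n - i))) (r(d := n - Suc i))) 1 (with_ctrs (?s (int (n - i))) (r(d := n - i)))"
        by (rule halts_Inc) (use e in auto)
      ultimately have "halts (Seq (Move Inp Go_Right) (Inc d)) (with_ctrs (?s (int (n - Suc i))) (r(d := n - Suc i))) 3
          (with_ctrs (?s (int (n - i))) (r(d := n - i)))"
        by (rule halts_Seq) simp
      moreover have "f (int (n - Suc i)) \<noteq> 0" using i by (simp add: f inp_0_iff n_def del: of_nat_diff)
      ultimately show "read_tape (with_ctrs (?s (int (n - Suc i))) (r(d := n - Suc i)) Inp) \<noteq> 0 \<and>
        halts (Seq (Move Inp Go_Right) (Inc d)) (with_ctrs (?s (int (n - Suc i))) (r(d := n - Suc i))) 3
          (with_ctrs (?s (int (n - i))) (r(d := n - i)))" by (simp del: of_nat_diff)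
    qed (auto simp: f inp_0_iff n_def)
    moreover have "?s 0 = s" using s by auto
    moreover have "r(d := 0) = r" using a(3) by auto
    ultimately show ?thesis by simp
  qed
  \<comment> \<open>The head stands on the blank behind the input, which would stop the leftward
    walk at once.\<close>
  have 2: "halts (Move Inp Go_Left) (with_ctrs (?s (int n)) (r(d := n))) 1 (with_ctrs (?s (int n - 1)) (r(d := n)))"
    by (rule halts_Move_Inp[where h = "int n"]) auto
  have 3: "halts (WhileN Inp 0 (Move Inp Go_Left)) (with_ctrs (?s (int n - 1)) (r(d := n))) (n * 3 + 1)
      (with_ctrs (?s (int 0 - 1)) (r(d := n)))"
  proof (rule halts_While_family[where n = 1 and v = n and S = "\<lambda>i. with_ctrs (?s (int i - 1)) (r(d := n))"])
    fix i assume i: "i < n"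
    have "halts (Move Inp Go_Left) (with_ctrs (?s (int (Suc i) - 1)) (r(d := n))) 1 (with_ctrs (?s (int i - 1)) (r(d := n)))"
      by (rule halts_Move_Inp[where h = "int (Suc i) - 1"]) auto
    then show "read_tape (with_ctrs (?s (int (Suc i) - 1)) (r(d := n)) Inp) \<noteq> 0 \<and>
      halts (Move Inp Go_Left) (with_ctrs (?s (int (Suc i) - 1)) (r(d := n))) 1 (with_ctrs (?s (int i - 1)) (r(d := n)))"
      using i by (simp add: f inp_0_iff n_def)
  qed (auto simp: f)
  have 4: "halts (Move Inp Go_Right) (with_ctrs (?s (int 0 - 1)) (r(d := n))) 1 (with_ctrs s (r(d := n)))"
    by (rule halts_Move_Inp[where h = "int 0 - 1"]) (use s in auto)
  have "halts (cmp Len \<rho> d) (with_ctrs s r) (20 * m + 20) (with_ctrs s (r(d := n)))"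
    unfolding cmp.simps
    by (rule halts_Seq[OF 1 halts_Seq[OF 2 halts_Seq[OF 3 4 order_refl] order_refl]]) (use a(2) n_def in simp)
  then show "ev Len x (\<lambda>k. r (\<rho> k)) \<le> 20 * m + 20 \<and> halts (cmp Len \<rho> d) (with_ctrs s r) (20 * m + 20)
    (with_ctrs s (r(d := ev Len x (\<lambda>k. r (\<rho> k)))))"
    using a(2) by (simp add: n_def)
qed (intro pbounded_intros)

lemma computes_Sym:
  assumes "computes e c"
  shows "\<exists>c. computes (Sym e) c"
proof (rule computesI[of "\<lambda>m. 20 * m ^ c + 30"])
  fix s :: store and x and r \<rho> :: "nat \<Rightarrow> nat" and d m
  assume a: "s Inp = input_tape x" "length x \<le> m" "2 \<le> m" "\<forall>k. \<rho> k < d" "\<forall>k. r (\<rho> k) \<le> m"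
    "\<forall>j\<ge>d. r j = 0"
  define n where "n = ev e x (\<lambda>k. r (\<rho> k))"
  have n: "n \<le> m ^ c" "halts (cmp e \<rho> d) (with_ctrs s r) (m ^ c) (with_ctrs s (r(d := n)))"
    using computesD[where s = s and r = r and \<rho> = \<rho> and d = d, OF assms a] by (simp_all add: n_def)
  define f where "f = snd (input_tape x)"
  have f: "f (int i) = inp x i" for i
    by (auto simp: f_def input_tape_0)
  have s: "s Inp = (0, f)" using a by (simp add: f_def input_tape_def)
  let ?s = "\<lambda>h. s(Inp := (h, f))"
  have r0: "r d = 0" "r (Suc d) = 0" using a(6) by auto
  have 1: "halts (Loop d (Seq (Move Inp Go_Right) (Inc (d + 1)))) (with_ctrs s (r(d := n))) (n * 7 + 1)
     (with_ctrs (?s (int n)) (r(d + 1 := n)))"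
  proof (rule halts_Loop[where v = n and n = 3 and s = "\<lambda>i. ?s (int i)" and r = "\<lambda>i. r(d + 1 := i)"])
    fix i
    show "halts (Seq (Move Inp Go_Right) (Inc (d + 1))) (with_ctrs (?s (int i)) ((r(d + 1 := i))(d := n - Suc i))) 3
       (with_ctrs (?s (int (Suc i))) ((r(d + 1 := Suc i))(d := n - Suc i)))"
      by (rule halts_Seq[OF halts_Move_Inp[OF _ _ order_refl] halts_Inc[OF _ order_refl]]) (auto simp: fun_eq_iff)
  qed (use s r0 in \<open>auto simp: fun_eq_iff\<close>)
  have 2: "halts (IfR Inp 1 (Inc d) (IfR Inp 2 (Seq (Inc d) (Inc d)) Done)) (with_ctrs (?s (int n)) (r(d + 1 := n))) 5
      (with_ctrs (?s (int n)) (r(d + 1 := n, d := inp x n)))"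
  proof -
    have "inp x n = 0 \<or> inp x n = 1 \<or> inp x n = 2" by (simp add: inp_def bit_symbol_def)
    moreover have "halts (Inc d) (with_ctrs (?s (int n)) (r(d + 1 := n))) 1 (with_ctrs (?s (int n)) (r(d + 1 := n, d := 1)))"
      by (rule halts_Inc) (auto simp: r0)
    moreover have "halts (Seq (Inc d) (Inc d)) (with_ctrs (?s (int n)) (r(d + 1 := n))) 3 (with_ctrs (?s (int n)) (r(d + 1 := n, d := 2)))"
      by (rule halts_Seq[OF halts_Inc[OF refl order_refl] halts_Inc[OF _ order_refl]]) (auto simp: r0)
    moreover have "halts Done (with_ctrs (?s (int n)) (r(d + 1 := n))) 1 (with_ctrs (?s (int n)) (r(d + 1 := n, d := 0)))"
      using halts_Done r0 by (metis fun_upd_triv fun_upd_twist n_not_Suc_n Suc_eq_plus1)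
    ultimately show ?thesis
      by (intro halts_IfR[where n = 4]) (auto simp: f intro!: halts_IfR[where n = 3] intro: halts_mono)
  qed
  have 3: "halts (Loop (d + 1) (Move Inp Go_Left)) (with_ctrs (?s (int n)) (r(d + 1 := n, d := inp x n))) (n * 5 + 1)
     (with_ctrs s (r(d := inp x n)))"
  proof (rule halts_Loop[where v = n and n = 1 and s = "\<lambda>i. ?s (int n - int i)" and r = "\<lambda>i. r(d := inp x n)"])
    fix i
    show "halts (Move Inp Go_Left) (with_ctrs (?s (int n - int i)) ((r(d := inp x n))(d + 1 := n - Suc i))) 1
       (with_ctrs (?s (int n - int (Suc i))) ((r(d := inp x n))(d + 1 := n - Suc i)))"
      by (rule halts_Move_Inp) auto
  qed (use s r0 in \<open>auto simp: fun_eq_iff\<close>)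
  have "halts (cmp (Sym e) \<rho> d) (with_ctrs s r) (20 * m ^ c + 30) (with_ctrs s (r(d := inp x n)))"
    unfolding cmp.simps
    by (rule halts_Seq[OF n(2) halts_Seq[OF 1 halts_Seq[OF 2 3 order_refl] order_refl]]) (use n(1) in simp)
  moreover have "inp x n \<le> 2" by (simp add: inp_def bit_symbol_def)
  ultimately show "ev (Sym e) x (\<lambda>k. r (\<rho> k)) \<le> 20 * m ^ c + 30 \<and> halts (cmp (Sym e) \<rho> d) (with_ctrs s r) (20 * m ^ c + 30)
    (with_ctrs s (r(d := ev (Sym e) x (\<lambda>k. r (\<rho> k)))))"
    by (simp add: n_def)
qed (intro pbounded_intros)

lemma computes_Add:
  assumes "computes e1 c1" "computes e2 c2"
  shows "\<exists>c. computes (Add e1 e2) c"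
proof (rule computesI[of "\<lambda>m. m ^ c1 + 10 * m ^ c2 + 10"])
  fix s :: store and x and r \<rho> :: "nat \<Rightarrow> nat" and d m
  assume a: "s Inp = input_tape x" "length x \<le> m" "2 \<le> m" "\<forall>k. \<rho> k < d" "\<forall>k. r (\<rho> k) \<le> m"
    "\<forall>j\<ge>d. r j = 0"
  define n1 where "n1 = ev e1 x (\<lambda>k. r (\<rho> k))"
  define n2 where "n2 = ev e2 x (\<lambda>k. r (\<rho> k))"
  have 1: "n1 \<le> m ^ c1" "halts (cmp e1 \<rho> d) (with_ctrs s r) (m ^ c1) (with_ctrs s (r(d := n1)))"
    using computesD[where s = s and r = r and \<rho> = \<rho> and d = d, OF assms(1) a] by (simp_all add: n1_def)
  have e: "(r(d := n1)) (\<rho> k) = r (\<rho> k)" for k using a(4)[rule_format, of k] by auto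
  have 2: "n2 \<le> m ^ c2" "halts (cmp e2 \<rho> (d + 1)) (with_ctrs s (r(d := n1))) (m ^ c2) (with_ctrs s (r(d := n1, d + 1 := n2)))"
    using computesD[where s = s and \<rho> = \<rho> and d = "d + 1" and r = "r(d := n1)", OF assms(2) a(1-3)] a(4-6) unfolding e
    by (simp_all add: n2_def less_Suc_eq)
  have 3: "halts (Loop (d + 1) (Inc d)) (with_ctrs s (r(d := n1, d + 1 := n2))) (n2 * 5 + 1) (with_ctrs s (r(d := n1 + n2)))"
  proof (rule halts_Loop[where v = n2 and n = 1 and s = "\<lambda>i. s" and r = "\<lambda>i. r(d := n1 + i)"])
    fix i
    show "halts (Inc d) (with_ctrs s ((r(d := n1 + i))(d + 1 := n2 - Suc i))) 1
       (with_ctrs s ((r(d := n1 + Suc i))(d + 1 := n2 - Suc i)))"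
      by (rule halts_Inc) (auto simp: fun_eq_iff)
  qed (use a(6) in \<open>auto simp: fun_eq_iff\<close>)
  have "halts (cmp (Add e1 e2) \<rho> d) (with_ctrs s r) (m ^ c1 + 10 * m ^ c2 + 10) (with_ctrs s (r(d := n1 + n2)))"
    unfolding cmp.simps
    by (rule halts_Seq[OF 1(2) halts_Seq[OF 2(2) 3 order_refl]]) (use 1(1) 2(1) in simp)
  then show "ev (Add e1 e2) x (\<lambda>k. r (\<rho> k)) \<le> m ^ c1 + 10 * m ^ c2 + 10 \<and>
    halts (cmp (Add e1 e2) \<rho> d) (with_ctrs s r) (m ^ c1 + 10 * m ^ c2 + 10)
    (with_ctrs s (r(d := ev (Add e1 e2) x (\<lambda>k. r (\<rho> k)))))"
    using 1(1) 2(1) by (simp add: n1_def n2_def)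
qed (intro pbounded_intros)

lemma computes_Sub:
  assumes "computes e1 c1" "computes e2 c2"
  shows "\<exists>c. computes (Sub e1 e2) c"
proof (rule computesI[of "\<lambda>m. m ^ c1 + 10 * m ^ c2 + 10"])
  fix s :: store and x and r \<rho> :: "nat \<Rightarrow> nat" and d m
  assume a: "s Inp = input_tape x" "length x \<le> m" "2 \<le> m" "\<forall>k. \<rho> k < d" "\<forall>k. r (\<rho> k) \<le> m"
    "\<forall>j\<ge>d. r j = 0"
  define n1 where "n1 = ev e1 x (\<lambda>k. r (\<rho> k))"
  define n2 where "n2 = ev e2 x (\<lambda>k. r (\<rho> k))"
  have 1: "n1 \<le> m ^ c1" "halts (cmp e1 \<rho> d) (with_ctrs s r) (m ^ c1) (with_ctrs s (r(d := n1)))"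
    using computesD[where s = s and r = r and \<rho> = \<rho> and d = d, OF assms(1) a] by (simp_all add: n1_def)
  have e: "(r(d := n1)) (\<rho> k) = r (\<rho> k)" for k using a(4)[rule_format, of k] by auto
  have 2: "n2 \<le> m ^ c2" "halts (cmp e2 \<rho> (d + 1)) (with_ctrs s (r(d := n1))) (m ^ c2) (with_ctrs s (r(d := n1, d + 1 := n2)))"
    using computesD[where s = s and \<rho> = \<rho> and d = "d + 1" and r = "r(d := n1)", OF assms(2) a(1-3)] a(4-6) unfolding e
    by (simp_all add: n2_def less_Suc_eq)
  have 3: "halts (Loop (d + 1) (IfR (Ctr d) 1 Done (Dec d))) (with_ctrs s (r(d := n1, d + 1 := n2))) (n2 * 6 + 1) (with_ctrs s (r(d := n1 - n2)))"
  proof (rule halts_Loop[where v = n2 and n = 2 and s = "\<lambda>i. s" and r = "\<lambda>i. r(d := n1 - i)"])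
    fix i
    show "halts (IfR (Ctr d) 1 Done (Dec d)) (with_ctrs s ((r(d := n1 - i))(d + 1 := n2 - Suc i))) 2
       (with_ctrs s ((r(d := n1 - Suc i))(d + 1 := n2 - Suc i)))"
    proof (cases "n1 - i = 0")
      case True
      then have "n1 - Suc i = n1 - i" by simp
      then show ?thesis using True halts_Done by (intro halts_IfZero[where n = 1]) auto
    next
      case False
      then have "halts (Dec d) (with_ctrs s ((r(d := n1 - i))(d + 1 := n2 - Suc i))) 1
       (with_ctrs s ((r(d := n1 - Suc i))(d + 1 := n2 - Suc i)))"
        by (intro halts_Dec) (auto simp: fun_eq_iff)
      then show ?thesis using False by (intro halts_IfZero[where n = 1]) auto
    qed
  qed (use a(6) in \<open>auto simp: fun_eq_iff\<close>)
  have "halts (cmp (Sub e1 e2) \<rho> d) (with_ctrs s r) (m ^ c1 + 10 * m ^ c2 + 10) (with_ctrs s (r(d := n1 - n2)))"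
    unfolding cmp.simps
    by (rule halts_Seq[OF 1(2) halts_Seq[OF 2(2) 3 order_refl]]) (use 1(1) 2(1) in simp)
  then show "ev (Sub e1 e2) x (\<lambda>k. r (\<rho> k)) \<le> m ^ c1 + 10 * m ^ c2 + 10 \<and>
    halts (cmp (Sub e1 e2) \<rho> d) (with_ctrs s r) (m ^ c1 + 10 * m ^ c2 + 10)
    (with_ctrs s (r(d := ev (Sub e1 e2) x (\<lambda>k. r (\<rho> k)))))"
    using 1(1) 2(1) by (simp add: n1_def n2_def)
qed (intro pbounded_intros)

lemma computes_Mul:
  assumes "computes e1 c1" "computes e2 c2"
  shows "\<exists>c. computes (Mul e1 e2) c"
proof (rule computesI[of "\<lambda>m. m ^ c1 + m ^ c2 + m ^ c1 * (m ^ c2 * 12 + 7) + 4 * m ^ c2 + 10"])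
  fix s :: store and x and r \<rho> :: "nat \<Rightarrow> nat" and d m
  assume a: "s Inp = input_tape x" "length x \<le> m" "2 \<le> m" "\<forall>k. \<rho> k < d" "\<forall>k. r (\<rho> k) \<le> m"
    "\<forall>j\<ge>d. r j = 0"
  define n1 where "n1 = ev e1 x (\<lambda>k. r (\<rho> k))"
  define n2 where "n2 = ev e2 x (\<lambda>k. r (\<rho> k))"
  have 1: "n1 \<le> m ^ c1" "halts (cmp e1 \<rho> (d + 1)) (with_ctrs s r) (m ^ c1) (with_ctrs s (r(d + 1 := n1)))"
    using computesD[where s = s and \<rho> = \<rho> and d = "d + 1" and r = r, OF assms(1) a(1-3)] a(4-6) by (simp_all add: n1_def less_Suc_eq)
  have e: "(r(d + 1 := n1)) (\<rho> k) = r (\<rho> k)" for k using a(4)[rule_format, of k] by auto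
  have 2: "n2 \<le> m ^ c2" "halts (cmp e2 \<rho> (d + 2)) (with_ctrs s (r(d + 1 := n1))) (m ^ c2) (with_ctrs s (r(d + 1 := n1, d + 2 := n2)))"
    using computesD[where s = s and \<rho> = \<rho> and d = "d + 2" and r = "r(d + 1 := n1)", OF assms(2) a(1-3)] a(4-6) unfolding e
    by (simp_all add: n2_def less_Suc_eq)
  have 3: "halts (Loop (d + 1) (Copy (d + 2) d (d + 3))) (with_ctrs s (r(d + 1 := n1, d + 2 := n2))) (n1 * ((n2 * 12 + 3) + 4) + 1)
     (with_ctrs s (r(d := n1 * n2, d + 2 := n2)))"
  proof (rule halts_Loop[where v = n1 and n = "n2 * 12 + 3" and s = "\<lambda>i. s" and r = "\<lambda>i. r(d := i * n2, d + 2 := n2)"])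
    fix i
    show "halts (Copy (d + 2) d (d + 3)) (with_ctrs s ((r(d := i * n2, d + 2 := n2))(d + 1 := n1 - Suc i))) (n2 * 12 + 3)
       (with_ctrs s ((r(d := Suc i * n2, d + 2 := n2))(d + 1 := n1 - Suc i)))"
      by (rule halts_Copy) (use a(6) in \<open>auto simp: fun_eq_iff\<close>)
  qed (use a(6) in \<open>auto simp: fun_eq_iff\<close>)
  have 4: "halts (Clear (d + 2)) (with_ctrs s (r(d := n1 * n2, d + 2 := n2))) (n2 * 4 + 1) (with_ctrs s (r(d := n1 * n2)))"
    by (rule halts_Clear) (use a(6) in \<open>auto simp: fun_eq_iff\<close>)
  have le: "n1 * n2 \<le> m ^ c1 * m ^ c2" "n1 * (n2 * 12 + 7) \<le> m ^ c1 * (m ^ c2 * 12 + 7)"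
    using 1(1) 2(1) by (intro mult_le_mono; simp)+
  have "halts (cmp (Mul e1 e2) \<rho> d) (with_ctrs s r) (m ^ c1 + m ^ c2 + m ^ c1 * (m ^ c2 * 12 + 7) + 4 * m ^ c2 + 10) (with_ctrs s (r(d := n1 * n2)))"
    unfolding cmp.simps
    by (rule halts_Seq[OF 1(2) halts_Seq[OF 2(2) halts_Seq[OF 3 4 order_refl] order_refl]]) (use 2(1) le in \<open>simp add: algebra_simps\<close>)
  then show "ev (Mul e1 e2) x (\<lambda>k. r (\<rho> k)) \<le> m ^ c1 + m ^ c2 + m ^ c1 * (m ^ c2 * 12 + 7) + 4 * m ^ c2 + 10 \<and>
    halts (cmp (Mul e1 e2) \<rho> d) (with_ctrs s r) (m ^ c1 + m ^ c2 + m ^ c1 * (m ^ c2 * 12 + 7) + 4 * m ^ c2 + 10)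
    (with_ctrs s (r(d := ev (Mul e1 e2) x (\<lambda>k. r (\<rho> k)))))"
    using le by (simp add: n1_def n2_def algebra_simps)
qed (intro pbounded_intros)

text \<open>Loop index and accumulator are variables of the body, so the body is charged for
  \<open>w m\<close>, a bound on everything that lives in the loop, in place of \<open>m\<close>.
  Truncation makes \<open>w m\<close> valid for all iterations alike.\<close>

lemma computes_Rec:
  assumes "computes e0 c0" "computes eb cb" "computes en cn" "computes e c"
  shows "\<exists>c. computes (Rec e0 eb en e) c"
proof -
  define w where "w = (\<lambda>m::nat. m + m ^ c0 + m ^ cb + m ^ cn)"
  define t where "t = (\<lambda>m. 9 * w m ^ c + 20 * w m + 12)"
  show ?thesis
  proof (rule computesI[of "\<lambda>m. w m * (t m + 4) + 20 * w m + 20"])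
    fix s :: store and x and r \<rho> :: "nat \<Rightarrow> nat" and d m
    assume a: "s Inp = input_tape x" "length x \<le> m" "2 \<le> m" "\<forall>k. \<rho> k < d" "\<forall>k. r (\<rho> k) \<le> m"
      "\<forall>j\<ge>d. r j = 0"
    define v where "v = (\<lambda>k. r (\<rho> k))"
    define n0 where "n0 = ev e0 x v"
    define nb where "nb = ev eb x v"
    define nn where "nn = ev en x v"
    define g where "g = (\<lambda>i y. ev e x (case_nat i (case_nat y v)))"
    define b where "b = biter n0 nb g"
    have 1: "n0 \<le> m ^ c0" "halts (cmp e0 \<rho> d) (with_ctrs s r) (m ^ c0) (with_ctrs s (r(d := n0)))"
      using computesD[where s = s and r = r and \<rho> = \<rho> and d = d, OF assms(1) a] by (simp_all add: n0_def v_def)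
    have e: "(r(d := n0)) (\<rho> k) = r (\<rho> k)" "(r(d := n0, Suc d := nb)) (\<rho> k) = r (\<rho> k)" for k
      using a(4)[rule_format, of k] by auto
    have 2: "nb \<le> m ^ cb" "halts (cmp eb \<rho> (d + 1)) (with_ctrs s (r(d := n0))) (m ^ cb) (with_ctrs s (r(d := n0, Suc d := nb)))"
      using computesD[where s = s and \<rho> = \<rho> and d = "d + 1" and r = "r(d := n0)", OF assms(2) a(1-3)] a(4-6)
      unfolding e by (simp_all add: nb_def v_def less_Suc_eq)
    have 3: "nn \<le> m ^ cn" "halts (cmp en \<rho> (d + 2)) (with_ctrs s (r(d := n0, Suc d := nb))) (m ^ cn)
        (with_ctrs s (r(d := n0, Suc d := nb, d + 2 := nn)))"
      using computesD[where s = s and \<rho> = \<rho> and d = "d + 2" and r = "r(d := n0, Suc d := nb)", OF assms(3) a(1-3)] a(4-6)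
      unfolding e by (simp_all add: nn_def v_def less_Suc_eq)
    have w: "n0 + nb + nn \<le> w m" "m \<le> w m" using 1 2 3 by (auto simp: w_def)
    have bw: "b i \<le> n0 + nb" for i unfolding b_def by (rule biter_le)
    have 4: "halts (Loop (d + 2) (Seq (cmp e (case_nat (d + 3) (case_nat d \<rho>)) (d + 4)) (Seq (Clear d)
        (Seq (Copy (d + 1) (d + 5) (d + 6))
          (Seq (Loop (d + 4) (IfR (Ctr (d + 5)) 1 Done (Seq (Dec (d + 5)) (Inc d))))
            (Seq (Clear (d + 5)) (Inc (d + 3))))))))
        (with_ctrs s (r(d := n0, Suc d := nb, d + 2 := nn))) (w m * (t m + 4) + 1)
        (with_ctrs s (r(d := b nn, Suc d := nb, d + 3 := nn)))"
    proof (rule halts_Loop[where v = nn and n = "t m" and s = "\<lambda>_. s" and r = "\<lambda>i. r(d := b i, Suc d := nb, d + 3 := i)"])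
      fix i assume i: "i < nn"
      define R where "R = r(d := b i, Suc d := nb, d + 3 := i, d + 2 := nn - Suc i)"
      define G where "G = g i (b i)"
      let ?\<rho> = "case_nat (d + 3) (case_nat d \<rho>)"
      have env: "(\<lambda>k. R (?\<rho> k)) = case_nat i (case_nat (b i) v)"
      proof
        fix k
        show "R (?\<rho> k) = case_nat i (case_nat (b i) v) k"
          using a(4)[rule_format, of "k - 2"] by (auto simp: R_def v_def split: nat.splits)
      qed
      have Rle: "\<forall>k. R (?\<rho> k) \<le> w m"
        using env[THEN fun_cong] a(5) w bw[of i] i by (auto simp: v_def split: nat.splits intro: order_trans)
      have \<rho>4: "\<forall>k. ?\<rho> k < d + 4" using a(4) by (auto split: nat.splits intro: trans_less_add1)
      have R0: "\<forall>j\<ge>d + 4. R j = 0" using a(6) by (auto simp: R_def)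
      have le: "length x \<le> w m" "2 \<le> w m" using a(2,3) w(2) by auto
      have 1: "G \<le> w m ^ c" "halts (cmp e ?\<rho> (d + 4)) (with_ctrs s R) (w m ^ c) (with_ctrs s (R(d + 4 := G)))"
        using computesD[where s = s and \<rho> = ?\<rho> and d = "d + 4" and r = R, OF assms(4) a(1) le \<rho>4 Rle R0]
        unfolding env by (simp_all add: G_def g_def)
      have 2: "halts (Clear d) (with_ctrs s (R(d + 4 := G))) (4 * w m + 1) (with_ctrs s (R(d + 4 := G, d := 0)))"
        by (rule halts_Clear) (use bw[of i] w(1) in \<open>auto simp: R_def\<close>)
      have 3: "halts (Copy (d + 1) (d + 5) (d + 6)) (with_ctrs s (R(d + 4 := G, d := 0))) (12 * w m + 3)
          (with_ctrs s (R(d + 4 := G, d := 0, d + 5 := nb)))"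
        by (rule halts_Copy) (use a(6) w(1) in \<open>auto simp: R_def fun_eq_iff\<close>)
      have 4: "halts (Loop (d + 4) (IfR (Ctr (d + 5)) 1 Done (Seq (Dec (d + 5)) (Inc d))))
          (with_ctrs s (R(d + 4 := G, d := 0, d + 5 := nb))) (w m ^ c * 8 + 1)
          (with_ctrs s (R(d := min G nb, d + 5 := nb - G)))"
      proof (rule halts_Loop[where v = G and n = 4 and s = "\<lambda>_. s" and r = "\<lambda>k. R(d := min k nb, d + 5 := nb - k)"])
        fix k
        let ?A = "R(d := min k nb, d + 5 := nb - k, d + 4 := G - Suc k)"
        let ?B = "R(d := min (Suc k) nb, d + 5 := nb - Suc k, d + 4 := G - Suc k)"
        show "halts (IfR (Ctr (d + 5)) 1 Done (Seq (Dec (d + 5)) (Inc d))) (with_ctrs s ?A) 4 (with_ctrs s ?B)"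
        proof (cases "nb \<le> k")
          case True
          then have "min k nb = min (Suc k) nb" "nb - k = nb - Suc k" by auto
          then have "?A = ?B" by metis
          then show ?thesis using True halts_Done by (intro halts_IfZero[where n = 1]) auto
        next
          case False
          have "halts (Seq (Dec (d + 5)) (Inc d)) (with_ctrs s ?A) 3 (with_ctrs s ?B)"
            by (rule halts_Seq[OF halts_Dec[OF _ refl order_refl] halts_Inc[OF _ order_refl]])
              (use False in \<open>auto simp: fun_eq_iff\<close>)
          then show ?thesis using False by (intro halts_IfZero[where n = 3]) auto
        qed
      qed (use R0 1(1) in \<open>auto simp: fun_eq_iff\<close>)
      have 5: "halts (Clear (d + 5)) (with_ctrs s (R(d := min G nb, d + 5 := nb - G))) (4 * w m + 1) (with_ctrs s (R(d := min G nb)))"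
        by (rule halts_Clear) (use w(1) R0 in \<open>auto simp: fun_eq_iff\<close>)
      have 6: "halts (Inc (d + 3)) (with_ctrs s (R(d := min G nb))) 1
         (with_ctrs s (r(d := b (Suc i), Suc d := nb, d + 3 := Suc i, d + 2 := nn - Suc i)))"
        by (rule halts_Inc) (auto simp: R_def fun_eq_iff b_def G_def)
      show "halts (Seq (cmp e ?\<rho> (d + 4)) (Seq (Clear d)
        (Seq (Copy (d + 1) (d + 5) (d + 6))
          (Seq (Loop (d + 4) (IfR (Ctr (d + 5)) 1 Done (Seq (Dec (d + 5)) (Inc d))))
            (Seq (Clear (d + 5)) (Inc (d + 3))))))) (with_ctrs s (r(d := b i, Suc d := nb, d + 3 := i, d + 2 := nn - Suc i))) (t m)
          (with_ctrs s (r(d := b (Suc i), Suc d := nb, d + 3 := Suc i, d + 2 := nn - Suc i)))"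
        unfolding R_def[symmetric]
        by (rule halts_Seq[OF 1(2) halts_Seq[OF 2 halts_Seq[OF 3 halts_Seq[OF 4 halts_Seq[OF 5 6
              order_refl] order_refl] order_refl] order_refl]]) (simp add: t_def)
    next
      show "nn * (t m + 4) + 1 \<le> w m * (t m + 4) + 1" using w(1) by simp
    qed (use a(6) in \<open>auto simp: fun_eq_iff b_def\<close>)
    have 5: "halts (Clear (d + 1)) (with_ctrs s (r(d := b nn, Suc d := nb, d + 3 := nn))) (4 * w m + 1)
        (with_ctrs s (r(d := b nn, d + 3 := nn)))"
      by (rule halts_Clear) (use a(6) w(1) in \<open>auto simp: fun_eq_iff\<close>)
    have 6: "halts (Clear (d + 3)) (with_ctrs s (r(d := b nn, d + 3 := nn))) (4 * w m + 1) (with_ctrs s (r(d := b nn)))"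
      by (rule halts_Clear) (use a(6) w(1) in \<open>auto simp: fun_eq_iff\<close>)
    have "halts (cmp (Rec e0 eb en e) \<rho> d) (with_ctrs s r) (w m * (t m + 4) + 20 * w m + 20) (with_ctrs s (r(d := b nn)))"
      unfolding cmp.simps
      by (rule halts_Seq[OF 1(2) halts_Seq[OF 2(2) halts_Seq[OF 3(2) halts_Seq[OF 4 halts_Seq[OF 5 6
              order_refl] order_refl] order_refl] order_refl]]) (simp add: w_def)
    moreover have "ev (Rec e0 eb en e) x (\<lambda>k. r (\<rho> k)) = b nn"
      by (simp add: b_def n0_def nb_def nn_def g_def v_def)
    moreover have "b nn \<le> w m * (t m + 4) + 20 * w m + 20"
      using bw[of nn] w(1) by (simp add: trans_le_add2)
    ultimately show "ev (Rec e0 eb en e) x (\<lambda>k. r (\<rho> k)) \<le> w m * (t m + 4) + 20 * w m + 20 \<and>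
      halts (cmp (Rec e0 eb en e) \<rho> d) (with_ctrs s r) (w m * (t m + 4) + 20 * w m + 20)
      (with_ctrs s (r(d := ev (Rec e0 eb en e) x (\<lambda>k. r (\<rho> k)))))"
      by simp
  qed (unfold w_def t_def, intro pbounded_intros)
qed

theorem computes_exp: "\<exists>c. computes e c"
proof (induction e)
  case (Sym e)
  then show ?case using computes_Sym by blast
next
  case (Add e1 e2)
  then show ?case using computes_Add by blast
next
  case (Sub e1 e2)
  then show ?case using computes_Sub by blast
next
  case (Mul e1 e2)
  then show ?case using computes_Mul by blast
next
  case (Rec e0 eb en e)
  then show ?case using computes_Rec by blast
qed (use computes_Var computes_Const computes_Len in auto)

lemma okc_cmp [simp]: "okc S (cmp e \<rho> d)"
proof -
  have [simp]: "okc S (Incs n j)" for n j by (induction n) auto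
  show "okc S (cmp e \<rho> d)" by (induction e arbitrary: \<rho> d) (auto simp: Loop_def Copy_def Clear_def)
qed

lemma tps_Loop [simp]: "tps (Loop j c) = insert (Ctr j) (tps c)"
  by (simp add: Loop_def)

lemma tps_cmp: "tps (cmp e \<rho> d) \<subseteq> insert Inp (range Ctr)"
proof -
  have [simp]: "tps (Incs n j) \<subseteq> insert Inp (range Ctr)" for n j by (induction n) auto
  show ?thesis by (induction e arbitrary: \<rho> d) (auto simp: Copy_def Clear_def)
qed

lemma finite_tps: "finite (tps c)"
  by (induction c) auto

section \<open>Deciders built around a given machine\<close>

lemma halts_Run_stop: "\<not> q < states M \<Longrightarrow> halts (Run M q) s (Suc n) s"
proof -
  assume "\<not> q < states M"
  then have "stp (Run M q, s) = (Done, s)" by (auto simp: stp_idle)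
  then show ?thesis using halts_step halts_Done by blast
qed

text \<open>The counters 0 and 1 allow the head of the last tape to be brought back afterwards. The
  final clause, that cells at distance at least the running time are untouched, later bounds the
  length of the output.\<close>

lemma halts_Run:
  assumes "wf_tm M" "q \<le> states M" "map (\<lambda>j. s (Wrk j)) [0..<tapes M] = ts"
    "\<forall>t\<in>set ts. \<forall>p. snd t p < symbols M" "s (Ctr 0) = ctr a0" "s (Ctr 1) = ctr b0"
    "(step M ^^ n) (q, ts) = (q', ts')" "\<not> q' < states M"
  shows "\<exists>s' a b. halts (Run M q) s (n + 1) s' \<and> map (\<lambda>j. s' (Wrk j)) [0..<tapes M] = ts' \<and>
    (\<forall>t. t \<notin> tps (Run M q) \<longrightarrow> s' t = s t) \<and> s' (Ctr 0) = ctr (a0 + a) \<and> s' (Ctr 1) = ctr (b0 + b) \<and>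
    fst (last ts') = fst (last ts) + int a - int b \<and> a \<le> n \<and> b \<le> n \<and>
    (\<forall>p. int n \<le> \<bar>p - fst (last ts)\<bar> \<longrightarrow> snd (last ts') p = snd (last ts) p)"
  using assms
proof (induction n arbitrary: q s ts a0 b0)
  case 0
  then have "halts (Run M q) s (0 + 1) s"
    using halts_Run_stop by simp
  then show ?case using 0 by (intro exI[of _ s] exI[of _ 0]) auto
next
  case (Suc n)
  show ?case
  proof (cases "q < states M")
    case False
    then have "(step M ^^ k) (q, ts) = (q, ts)" for k by (induction k) auto
    then have "ts' = ts" using Suc.prems(7) by (metis prod.inject)
    moreover have "halts (Run M q) s (Suc n + 1) s"
      using False halts_Run_stop by simp
    ultimately show ?thesis using Suc.prems by (intro exI[of _ s] exI[of _ 0]) auto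
  next
    case True
    let ?T = "tapes M"
    obtain q1 as where qa: "delta M q (map read_tape ts) = (q1, as)" by fastforce
    have ts: "length ts = ?T" "ts ! j = s (Wrk j)" if "j < ?T" for j
      using Suc.prems(3) that by auto
    have len: "length ts = ?T" using Suc.prems(3) by auto
    have T: "?T > 0" using Suc.prems(1) by (simp add: wf_tm_def)
    have rd: "map (\<lambda>j. read_tape (s (Wrk j))) [0..<?T] = map read_tape ts"
      using Suc.prems(3) by auto
    have "read_tape t < symbols M" if "t \<in> set ts" for t
      using Suc.prems(4) that by (cases t) force
    then have "set (map read_tape ts) \<subseteq> {..<symbols M}" by auto
    then have w: "q1 \<le> states M" "length as = ?T" "\<forall>(a, d)\<in>set as. a < symbols M"
      using Suc.prems(1) True qa len unfolding wf_tm_def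
      by (elim conjE allE[of _ q] allE[of _ "map read_tape ts"]; simp)+
    define \<rho> where "\<rho> = (\<lambda>t. read_tape (s t))"
    define s1 where "s1 = (\<lambda>t. act (run_act M as \<rho> t) (s t))"
    have st: "stp (Run M q, s) = (Run M q1, s1)"
      using True qa w by (simp add: stp_def Let_def rd s1_def \<rho>_def)
    define ts1 where "ts1 = map2 act as ts"
    have m1: "map (\<lambda>j. s1 (Wrk j)) [0..<?T] = ts1"
      using w len ts by (auto simp: ts1_def s1_def run_act_def intro!: nth_equalityI)
    have r1: "\<forall>t\<in>set ts1. \<forall>p. snd t p < symbols M"
    proof (intro ballI allI)
      fix t p assume "t \<in> set ts1"
      then obtain \<alpha> T where \<alpha>: "t = act \<alpha> T" "(\<alpha>, T) \<in> set (zip as ts)"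
        unfolding ts1_def by auto
      obtain a d h f where "\<alpha> = (a, d)" "T = (h, f)" by fastforce
      with \<alpha> have "t = act (a, d) (h, f)" "(a, d) \<in> set as" "(h, f) \<in> set ts"
        by (auto dest: set_zip_leftD set_zip_rightD)
      then show "snd t p < symbols M" using w(3) Suc.prems(4) by force
    qed
    define da db where "da = (of_bool (snd (last as) = Go_Right) :: nat)"
      and "db = (of_bool (snd (last as) = Go_Left) :: nat)"
    have c1: "s1 (Ctr 0) = ctr (a0 + da)" "s1 (Ctr 1) = ctr (b0 + db)"
      using Suc.prems(5,6) by (auto simp: s1_def run_act_def \<rho>_def da_def db_def ctr_def)
    have "(step M ^^ n) (q1, ts1) = (q', ts')"
      using Suc.prems(7) True qa by (simp add: funpow_swap1 ts1_def)
    from Suc.IH[OF Suc.prems(1) w(1) m1 r1 c1 this Suc.prems(8)]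
    obtain s' a b where IH: "halts (Run M q1) s1 (n + 1) s'" "map (\<lambda>j. s' (Wrk j)) [0..<?T] = ts'"
      "\<forall>t. t \<notin> tps (Run M q1) \<longrightarrow> s' t = s1 t" "s' (Ctr 0) = ctr (a0 + da + a)" "s' (Ctr 1) = ctr (b0 + db + b)"
      "fst (last ts') = fst (last ts1) + int a - int b" "a \<le> n" "b \<le> n"
      "\<forall>p. int n \<le> \<bar>p - fst (last ts1)\<bar> \<longrightarrow> snd (last ts') p = snd (last ts1) p" by blast
    have "as \<noteq> []" "ts \<noteq> []" using w(2) len T by auto
    then have "last (zip as ts) = (last as, last ts)"
      using w(2) len by (simp add: last_zip)
    then have l1: "last ts1 = act (last as) (last ts)"
      using w(2) len T \<open>as \<noteq> []\<close> \<open>ts \<noteq> []\<close> unfolding ts1_def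
      by (subst last_map) auto
    obtain a' d' where ad: "last as = (a', d')" by fastforce
    obtain h f where hf: "last ts = (h, f)" by fastforce
    have hd: "fst (last ts1) = fst (last ts) + int da - int db"
      using l1 ad hf by (cases d') (auto simp: da_def db_def)
    have out: "s1 t = s t" if "t \<notin> tps (Run M q)" for t
      using that by (auto simp: s1_def run_act_def \<rho>_def split: tp.splits)
    show ?thesis
    proof (intro exI conjI)
      show "halts (Run M q) s (Suc n + 1) s'" using halts_step[OF st IH(1)] by simp
      show "s' (Ctr 0) = ctr (a0 + (da + a))" "s' (Ctr 1) = ctr (b0 + (db + b))" using IH by (simp_all add: add.assoc)
      show "fst (last ts') = fst (last ts) + int (da + a) - int (db + b)" using IH(6) hd by simp
      show "da + a \<le> Suc n" "db + b \<le> Suc n" using IH(7,8) by (auto simp: da_def db_def)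
      show "\<forall>t. t \<notin> tps (Run M q) \<longrightarrow> s' t = s t" using IH(3) out by simp
      show "map (\<lambda>j. s' (Wrk j)) [0..<tapes M] = ts'" by (rule IH)
      show "\<forall>p. int (Suc n) \<le> \<bar>p - fst (last ts)\<bar> \<longrightarrow> snd (last ts') p = snd (last ts) p"
      proof (intro allI impI)
        fix p assume p: "int (Suc n) \<le> \<bar>p - fst (last ts)\<bar>"
        then have "int n \<le> \<bar>p - fst (last ts1)\<bar>" using hd by (auto simp: da_def db_def)
        then have "snd (last ts') p = snd (last ts1) p" using IH(9) by blast
        also have "\<dots> = snd (last ts) p" using l1 ad hf p by auto
        finally show "snd (last ts') p = snd (last ts) p" .
      qed
    qed
  qed
qed

section \<open>Preparing the tapes, writing the computed input, scanning the output\<close>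

primrec Marks :: "nat \<Rightarrow> com" where
  "Marks 0 = Done"
| "Marks (Suc n) = Seq (Put (Ctr n) 1) (Marks n)"

lemma halts_Marks:
  "(\<And>j. j < n \<Longrightarrow> s (Ctr j) = blank_tape) \<Longrightarrow>
   halts (Marks n) s (2 * n) (\<lambda>t. case t of Ctr j \<Rightarrow> if j < n then ctr 0 else s t | _ \<Rightarrow> s t)"
proof (induction n arbitrary: s)
  case 0
  have "(\<lambda>t. case t of Ctr j \<Rightarrow> if j < 0 then ctr 0 else s t | _ \<Rightarrow> s t) = s"
    by (auto split: tp.splits)
  then show ?case using halts_Done by simp
next
  case (Suc n)
  let ?s = "s(Ctr n := ctr 0)"
  have "halts (Put (Ctr n) 1) s 1 ?s"
    by (rule halts_cong[OF halts_Put]) (use Suc.prems[of n] in \<open>auto simp: blank_tape_def ctr_def\<close>)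
  moreover have "halts (Marks n) ?s (2 * n) (\<lambda>t. case t of Ctr j \<Rightarrow> if j < n then ctr 0 else ?s t | _ \<Rightarrow> ?s t)"
    by (rule Suc.IH) (use Suc.prems in auto)
  moreover have "(\<lambda>t. case t of Ctr j \<Rightarrow> if j < n then ctr 0 else ?s t | _ \<Rightarrow> ?s t) =
     (\<lambda>t. case t of Ctr j \<Rightarrow> if j < Suc n then ctr 0 else s t | _ \<Rightarrow> s t)"
    by (auto split: tp.splits simp: less_Suc_eq)
  ultimately show ?case by (auto intro!: halts_Seq[where n = 1 and m = "2 * n"])
qed

lemma halts_Move_Wrk:
  assumes "s (Wrk j) = (h, f)" "s' = s(Wrk j := (move_head dir h, f))" "1 \<le> k"
  shows "halts (Move (Wrk j) dir) (with_ctrs s r) k (with_ctrs s' r)"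
  by (rule halts_cong[OF halts_Move _ assms(3)]) (use assms in \<open>simp add: with_ctrs_upd\<close>)

lemma halts_Put_Wrk:
  assumes "s (Wrk j) = (h, f)" "s' = s(Wrk j := (h, f(h := a)))" "1 \<le> k"
  shows "halts (Put (Wrk j) a) (with_ctrs s r) k (with_ctrs s' r)"
  by (rule halts_cong[OF halts_Put _ assms(3)]) (use assms in \<open>simp add: with_ctrs_upd\<close>)

text \<open>Counters 0 and 1 are left at zero for the run of the machine. Counter 2 stays zero and
  is the value of all other variables; 3 counts the positions still to be written, 4 is the current
  one. The word contains no blank, so the blank before cell 0 guides the head back.\<close>

definition Emit :: "exp \<Rightarrow> exp \<Rightarrow> com" where
  "Emit el eb = Seq (cmp el (\<lambda>k. 2) 3) (Seq (Loop 3
     (Seq (cmp eb (\<lambda>k. if k = 0 then 4 else 2) 5)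
       (Seq (IfR (Ctr 5) 1 (Put (Wrk 0) 1) (Seq (Put (Wrk 0) 2) (Clear 5)))
         (Seq (Move (Wrk 0) Go_Right) (Inc 4)))))
     (Seq (Clear 4) (Seq (Move (Wrk 0) Go_Left)
       (Seq (WhileN (Wrk 0) 0 (Move (Wrk 0) Go_Left)) (Move (Wrk 0) Go_Right)))))"

definition env1 :: "nat \<Rightarrow> nat \<Rightarrow> nat" where "env1 i = (\<lambda>k. if k = 0 then i else 0)"

definition emitted :: "exp \<Rightarrow> exp \<Rightarrow> bool list \<Rightarrow> bool list" where
  "emitted el eb x = map (\<lambda>i. ev eb x (env1 i) \<noteq> 0) [0..<ev el x (\<lambda>_. 0)]"

lemma input_tape_append:
  "snd (input_tape (y @ [b])) = (snd (input_tape y))(int (length y) := bit_symbol b)"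
  by (auto simp: input_tape_def fun_eq_iff nth_append)

lemma halts_Emit:
  assumes "computes el cl" "computes eb cb"
  shows "\<exists>f. pbounded f \<and> (\<forall>s x. s Inp = input_tape x \<longrightarrow> s (Wrk 0) = blank_tape \<longrightarrow>
    ev el x (\<lambda>_. 0) \<le> f (length x + 2) \<and>
    halts (Emit el eb) (with_ctrs s (\<lambda>_. 0)) (f (length x + 2))
      (with_ctrs (s(Wrk 0 := input_tape (emitted el eb x))) (\<lambda>_. 0)))"
proof -
  define u where "u = (\<lambda>m::nat. m + m ^ cl)"
  define t where "t = (\<lambda>m. 5 * u m ^ cb + 20)"
  define F where "F = (\<lambda>m. m ^ cl + (u m * (t m + 4) + 20 * u m + 20))"
  have "ev el x (\<lambda>_. 0) \<le> F (length x + 2) \<and> halts (Emit el eb) (with_ctrs s (\<lambda>_. 0)) (F (length x + 2))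
      (with_ctrs (s(Wrk 0 := input_tape (emitted el eb x))) (\<lambda>_. 0))"
    if s: "s Inp = input_tape x" "s (Wrk 0) = blank_tape" for s x
  proof -
    define m where "m = length x + 2"
    define l where "l = ev el x (\<lambda>_. 0)"
    define y where "y = emitted el eb x"
    have ly: "length y = l" by (simp add: y_def l_def emitted_def)
    have m: "length x \<le> m" "2 \<le> m" by (auto simp: m_def)
    have 1: "l \<le> m ^ cl" "halts (cmp el (\<lambda>k. 2) 3) (with_ctrs s (\<lambda>_. 0)) (m ^ cl) (with_ctrs s ((\<lambda>_. 0)(3 := l)))"
      using computesD[where s = s and r = "\<lambda>_. 0" and \<rho> = "\<lambda>_. 2" and d = 3, OF assms(1) s(1) m] by (simp_all add: l_def)
    have lu: "l \<le> u m" "m \<le> u m" using 1 by (auto simp: u_def)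
    let ?s = "\<lambda>i. s(Wrk 0 := (int i, snd (input_tape (take i y))))"
    let ?r = "\<lambda>i. (\<lambda>_::nat. 0::nat)(4 := i)"
    have 2: "halts (Loop 3
     (Seq (cmp eb (\<lambda>k. if k = 0 then 4 else 2) 5)
       (Seq (IfR (Ctr 5) 1 (Put (Wrk 0) 1) (Seq (Put (Wrk 0) 2) (Clear 5)))
         (Seq (Move (Wrk 0) Go_Right) (Inc 4)))))
      (with_ctrs s ((\<lambda>_. 0)(3 := l))) (u m * (t m + 4) + 1) (with_ctrs (?s l) (?r l))"
    proof (rule halts_Loop[where v = l and n = "t m" and s = ?s and r = ?r])
      fix i assume i: "i < l"
      define R where "R = (?r i)(3 := l - Suc i)"
      define b where "b = ev eb x (env1 i)"
      let ?\<rho> = "\<lambda>k::nat. if k = 0 then 4 else 2 :: nat"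
      have env: "(\<lambda>k. R (?\<rho> k)) = env1 i" by (auto simp: R_def env1_def)
      have Rle: "\<forall>k. R (?\<rho> k) \<le> u m" using env[THEN fun_cong] i lu by (auto simp: env1_def)
      have a: "length x \<le> u m" "2 \<le> u m" using m lu by auto
      have \<rho>: "\<forall>k. ?\<rho> k < 5" by auto
      have R0: "\<forall>j\<ge>5. R j = 0" by (auto simp: R_def)
      have si: "?s i Inp = input_tape x" using s by simp
      have 1: "b \<le> u m ^ cb" "halts (cmp eb ?\<rho> 5) (with_ctrs (?s i) R) (u m ^ cb) (with_ctrs (?s i) (R(5 := b)))"
        using computesD[where s = "?s i" and \<rho> = ?\<rho> and d = 5 and r = R, OF assms(2) si a \<rho> Rle R0]
        unfolding env by (simp_all add: b_def)
      have yi: "y ! i = (b \<noteq> 0)" using i by (simp add: y_def emitted_def l_def b_def)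
      have "take (Suc i) y = take i y @ [y ! i]" using i ly by (simp add: take_Suc_conv_app_nth)
      then have f: "snd (input_tape (take (Suc i) y)) = (snd (input_tape (take i y)))(int i := bit_symbol (y ! i))"
        using i ly by (simp add: input_tape_append)
      let ?s' = "s(Wrk 0 := (int i, snd (input_tape (take (Suc i) y))))"
      have 2: "halts (IfR (Ctr 5) 1 (Put (Wrk 0) 1) (Seq (Put (Wrk 0) 2) (Clear 5))) (with_ctrs (?s i) (R(5 := b)))
         (4 * u m ^ cb + 5) (with_ctrs ?s' R)"
      proof (rule halts_IfZero[where n = "4 * u m ^ cb + 4"])
        show "halts (if (R(5 := b)) 5 = 0 then Put (Wrk 0) 1 else Seq (Put (Wrk 0) 2) (Clear 5)) (with_ctrs (?s i) (R(5 := b)))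
           (4 * u m ^ cb + 4) (with_ctrs ?s' R)"
        proof (cases "b = 0")
          case True
          then have "R(5 := b) = R" using R0 by auto
          then show ?thesis using True yi R0 f
            by (auto intro!: halts_Put_Wrk simp: bit_symbol_def)
        next
          case False
          have "halts (Put (Wrk 0) 2) (with_ctrs (?s i) (R(5 := b))) 1 (with_ctrs ?s' (R(5 := b)))"
            by (rule halts_Put_Wrk) (use False yi f in \<open>auto simp: bit_symbol_def\<close>)
          moreover have "halts (Clear 5) (with_ctrs ?s' (R(5 := b))) (4 * u m ^ cb + 1) (with_ctrs ?s' R)"
            by (rule halts_Clear) (use R0 1(1) in auto)
          ultimately show ?thesis using False by (auto intro: halts_Seq)
        qed
      qed simp
      have 3: "halts (Move (Wrk 0) Go_Right) (with_ctrs ?s' R) 1 (with_ctrs (?s (Suc i)) R)"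
        by (rule halts_Move_Wrk[where h = "int i"]) auto
      have 4: "halts (Inc 4) (with_ctrs (?s (Suc i)) R) 1 (with_ctrs (?s (Suc i)) ((?r (Suc i))(3 := l - Suc i)))"
        by (rule halts_Inc) (auto simp: R_def fun_eq_iff)
      show "halts (Seq (cmp eb ?\<rho> 5)
       (Seq (IfR (Ctr 5) 1 (Put (Wrk 0) 1) (Seq (Put (Wrk 0) 2) (Clear 5)))
         (Seq (Move (Wrk 0) Go_Right) (Inc 4)))) (with_ctrs (?s i) ((?r i)(3 := l - Suc i))) (t m)
         (with_ctrs (?s (Suc i)) ((?r (Suc i))(3 := l - Suc i)))"
        unfolding R_def[symmetric]
        by (rule halts_Seq[OF 1(2) halts_Seq[OF 2 halts_Seq[OF 3 4 order_refl] order_refl]]) (simp add: t_def)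
    next
      show "l * (t m + 4) + 1 \<le> u m * (t m + 4) + 1" using lu by simp
      have "input_tape [] = blank_tape" by (auto simp: input_tape_def blank_tape_def)
      then show "s = ?s 0" using s(2) by (auto simp: blank_tape_def)
    qed (auto simp: fun_eq_iff)
    let ?w = "\<lambda>h. s(Wrk 0 := (h, snd (input_tape y)))"
    have e: "?s l = ?w (int l)" using ly by simp
    have 3: "halts (Clear 4) (with_ctrs (?s l) (?r l)) (4 * u m + 1) (with_ctrs (?w (int l)) (\<lambda>_. 0))"
      unfolding e by (rule halts_Clear) (use lu in \<open>auto simp: fun_eq_iff\<close>)
    have 4: "halts (Move (Wrk 0) Go_Left) (with_ctrs (?w (int l)) (\<lambda>_. 0)) 1 (with_ctrs (?w (int l - 1)) (\<lambda>_. 0))"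
      by (rule halts_Move_Wrk[where h = "int l"]) auto
    have 5: "halts (WhileN (Wrk 0) 0 (Move (Wrk 0) Go_Left)) (with_ctrs (?w (int l - 1)) (\<lambda>_. 0)) (3 * u m + 1)
       (with_ctrs (?w (int 0 - 1)) (\<lambda>_. 0))"
    proof (rule halts_While_family[where n = 1 and v = l and S = "\<lambda>i. with_ctrs (?w (int i - 1)) (\<lambda>_. 0)"])
      fix i assume i: "i < l"
      have "halts (Move (Wrk 0) Go_Left) (with_ctrs (?w (int (Suc i) - 1)) (\<lambda>_. 0)) 1 (with_ctrs (?w (int i - 1)) (\<lambda>_. 0))"
        by (rule halts_Move_Wrk[where h = "int (Suc i) - 1"]) auto
      then show "read_tape (with_ctrs (?w (int (Suc i) - 1)) (\<lambda>_. 0) (Wrk 0)) \<noteq> 0 \<and>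
        halts (Move (Wrk 0) Go_Left) (with_ctrs (?w (int (Suc i) - 1)) (\<lambda>_. 0)) 1 (with_ctrs (?w (int i - 1)) (\<lambda>_. 0))"
        using i ly by (simp add: input_tape_0 inp_0_iff)
    qed (use lu in \<open>auto simp: input_tape_neg\<close>)
    have it: "input_tape y = (0, snd (input_tape y))" by (simp add: input_tape_def)
    have 6: "halts (Move (Wrk 0) Go_Right) (with_ctrs (?w (int 0 - 1)) (\<lambda>_. 0)) 1 (with_ctrs (s(Wrk 0 := input_tape y)) (\<lambda>_. 0))"
      by (rule halts_Move_Wrk[where h = "int 0 - 1" and f = "snd (input_tape y)"]) (use it in auto)
    have "halts (Emit el eb) (with_ctrs s (\<lambda>_. 0)) (F m) (with_ctrs (s(Wrk 0 := input_tape y)) (\<lambda>_. 0))"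
      unfolding Emit_def
      by (rule halts_Seq[OF 1(2) halts_Seq[OF 2 halts_Seq[OF 3 halts_Seq[OF 4 halts_Seq[OF 5 6
              order_refl] order_refl] order_refl] order_refl]]) (simp add: F_def)
    moreover have "l \<le> F m" using 1(1) by (simp add: F_def)
    ultimately show ?thesis by (simp add: m_def y_def l_def)
  qed
  moreover have "pbounded F" unfolding F_def t_def u_def by (intro pbounded_intros)
  ultimately show ?thesis by (intro exI[of _ F]) blast
qed

definition Unwind :: "nat \<Rightarrow> com" where
  "Unwind j = Seq (Loop 0 (Move (Wrk j) Go_Left)) (Loop 1 (Move (Wrk j) Go_Right))"

lemma halts_Unwind:
  assumes "s (Wrk j) = (int a - int b, f)" "r 0 = a" "r 1 = b" "r' = r(0 := 0, 1 := 0)" "a \<le> n" "b \<le> n"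
  shows "halts (Unwind j) (with_ctrs s r) (10 * n + 5) (with_ctrs (s(Wrk j := (0, f))) r')"
  unfolding Unwind_def
proof (rule halts_Seq)
  show "halts (Loop 0 (Move (Wrk j) Go_Left)) (with_ctrs s r) (5 * n + 1) (with_ctrs (s(Wrk j := (- int b, f))) (r(0 := 0)))"
  proof (rule halts_Loop[where v = a and n = 1 and r = "\<lambda>_. r" and s = "\<lambda>i. s(Wrk j := (int a - int i - int b, f))"])
    fix i
    show "halts (Move (Wrk j) Go_Left) (with_ctrs (s(Wrk j := (int a - int i - int b, f))) (r(0 := a - Suc i))) 1
      (with_ctrs (s(Wrk j := (int a - int (Suc i) - int b, f))) (r(0 := a - Suc i)))"
      by (rule halts_Move_Wrk) auto
  qed (use assms in auto)
  show "halts (Loop 1 (Move (Wrk j) Go_Right)) (with_ctrs (s(Wrk j := (- int b, f))) (r(0 := 0))) (5 * n + 1)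
    (with_ctrs (s(Wrk j := (0, f))) r')"
  proof (rule halts_Loop[where v = b and n = 1 and r = "\<lambda>_. r(0 := 0)" and s = "\<lambda>i. s(Wrk j := (int i - int b, f))"])
    fix i
    show "halts (Move (Wrk j) Go_Right) (with_ctrs (s(Wrk j := (int i - int b, f))) (r(0 := 0, 1 := b - Suc i))) 1
      (with_ctrs (s(Wrk j := (int (Suc i) - int b, f))) (r(0 := 0, 1 := b - Suc i)))"
      by (rule halts_Move_Wrk) auto
  qed (use assms in auto)
qed simp

text \<open>Counter 3 counts down the threshold position; counter 4 counts the \<open>True\<close>
  cells met once it is zero. Later only the test of counter 4 for zero matters.\<close>

definition Scan :: "nat \<Rightarrow> com" where
  "Scan j = WhileN (Wrk j) 0 (Seq (IfR (Wrk j) 2 (IfR (Ctr 3) 1 (Inc 4) Done) Done)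
     (Seq (IfR (Ctr 3) 1 Done (Dec 3)) (Move (Wrk j) Go_Right)))"

lemma halts_Scan:
  assumes "tape_holds (0, f) y" "s (Wrk j) = (0, f)"
    and r': "r' = (\<lambda>_. 0)(3 := \<tau> - length y, 4 := (\<Sum>i<length y. of_bool (\<tau> \<le> i \<and> y ! i)))"
  shows "halts (Scan j) (with_ctrs s ((\<lambda>_. 0)(3 := \<tau>))) (10 * length y + 1)
    (with_ctrs (s(Wrk j := (int (length y), f))) r')"
proof -
  define n where "n = length y"
  define R where "R = (\<lambda>i. (\<lambda>_::nat. 0)(3 := \<tau> - i, 4 := (\<Sum>i<i. of_bool (\<tau> \<le> i \<and> y ! i) :: nat)))"
  let ?S = "\<lambda>i. with_ctrs (s(Wrk j := (int i, f))) (R i)"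
  have f: "f (int i) = bit_symbol (y ! i)" if "i < n" for i using assms(1) that by (simp add: tape_holds_def n_def)
  have fn: "f (int n) = 0" using assms(1) by (simp add: tape_holds_def n_def)
  have "halts (Scan j) (?S (n - n)) (n * (8 + 2) + 1) (?S (n - 0))"
    unfolding Scan_def
  proof (rule halts_While_family[where n = 8])
    fix k assume k: "k < n"
    define i where "i = n - Suc k"
    have i: "i < n" "n - k = Suc i" using k by (auto simp: i_def)
    let ?s = "s(Wrk j := (int i, f))"
    let ?R' = "(R i)(4 := R (Suc i) 4)"
    have 1: "halts (IfR (Wrk j) 2 (IfR (Ctr 3) 1 (Inc 4) Done) Done) (with_ctrs ?s (R i)) 3 (with_ctrs ?s ?R')"
    proof (rule halts_IfR[where n = 2])
      have inc: "halts (Inc 4) (with_ctrs ?s (R i)) 1 (with_ctrs ?s ?R')" if "y ! i" "\<tau> \<le> i"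
        by (rule halts_Inc) (use that in \<open>auto simp: R_def fun_eq_iff simp del: sum_of_bool_eq\<close>)
      have eq: "?R' = R i" if "\<not> (y ! i \<and> \<tau> \<le> i)"
        using that by (auto simp: R_def fun_eq_iff simp del: sum_of_bool_eq)
      show "halts (if read_tape (with_ctrs ?s (R i) (Wrk j)) = 2 then IfR (Ctr 3) 1 (Inc 4) Done else Done) (with_ctrs ?s (R i)) 2 (with_ctrs ?s ?R')"
      proof (cases "y ! i")
        case True
        have "R i 3 = 0 \<longleftrightarrow> \<tau> \<le> i" by (auto simp: R_def)
        then have "halts (IfR (Ctr 3) 1 (Inc 4) Done) (with_ctrs ?s (R i)) 2 (with_ctrs ?s ?R')"
          using inc eq True halts_Done by (intro halts_IfZero[where n = 1]) auto
        then show ?thesis using f[OF i(1)] True by (simp add: bit_symbol_def)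
      next
        case False
        then show ?thesis using f[OF i(1)] halts_Done eq by (simp add: bit_symbol_def)
      qed
    qed simp
    have 2: "halts (IfR (Ctr 3) 1 Done (Dec 3)) (with_ctrs ?s ?R') 2 (with_ctrs ?s (R (Suc i)))"
    proof (rule halts_IfZero[where n = 1])
      show "halts (if ?R' 3 = 0 then Done else Dec 3) (with_ctrs ?s ?R') 1 (with_ctrs ?s (R (Suc i)))"
      proof (cases "\<tau> \<le> i")
        case True
        then have "?R' = R (Suc i)" by (auto simp: R_def fun_eq_iff)
        moreover have "?R' 3 = 0" using True by (simp add: R_def)
        ultimately show ?thesis using halts_Done by simp
      next
        case False
        have "halts (Dec 3) (with_ctrs ?s ?R') 1 (with_ctrs ?s (R (Suc i)))"
          by (rule halts_Dec) (use False in \<open>auto simp: R_def fun_eq_iff\<close>)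
        moreover have "?R' 3 \<noteq> 0" using False by (simp add: R_def)
        ultimately show ?thesis by simp
      qed
    qed simp
    have 3: "halts (Move (Wrk j) Go_Right) (with_ctrs ?s (R (Suc i))) 1 (?S (Suc i))"
      by (rule halts_Move_Wrk[where h = "int i"]) auto
    have "halts (Seq (IfR (Wrk j) 2 (IfR (Ctr 3) 1 (Inc 4) Done) Done)
     (Seq (IfR (Ctr 3) 1 Done (Dec 3)) (Move (Wrk j) Go_Right))) (?S i) 8 (?S (Suc i))"
      by (rule halts_Seq[OF 1 halts_Seq[OF 2 3 order_refl]]) simp
    moreover have "read_tape (?S i (Wrk j)) \<noteq> 0" using f[OF i(1)] by (simp add: bit_symbol_def)
    ultimately show "read_tape (?S (n - Suc k) (Wrk j)) \<noteq> 0 \<and> halts (Seq (IfR (Wrk j) 2 (IfR (Ctr 3) 1 (Inc 4) Done) Done)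
     (Seq (IfR (Ctr 3) 1 Done (Dec 3)) (Move (Wrk j) Go_Right))) (?S (n - Suc k)) 8 (?S (n - k))"
      unfolding i(2) i_def by blast
  qed (auto simp: fn)
  moreover have "?S (n - n) = with_ctrs s ((\<lambda>_. 0)(3 := \<tau>))"
  proof -
    have "R 0 = (\<lambda>_. 0)(3 := \<tau>)" by (auto simp: R_def)
    moreover have "s(Wrk j := (0, f)) = s" using assms(2) by auto
    ultimately show ?thesis by simp
  qed
  moreover have "R n = r'" by (simp add: r' R_def n_def)
  ultimately show ?thesis by (simp add: n_def mult.commute)
qed

text \<open>A normal form stronger than deciding in polynomial time: the machine stops in the state
  \<open>states M\<close>, and its last tape is blank except for the answer under the head. The
  quadratic system can then express acceptance by a single cell.\<close>

definition decides :: "turing_machine \<Rightarrow> nat poly \<Rightarrow> bool list set \<Rightarrow> bool" where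
  "decides M p L \<longleftrightarrow> wf_tm M \<and> (\<forall>x. \<exists>ts. (step M ^^ poly p (length x)) (init_config M x) = (states M, ts) \<and>
     length ts = tapes M \<and> last ts = (0, (\<lambda>_. 0)(0 := bit_symbol (x \<in> L))))"

lemma pbounded_poly_bound:
  assumes "pbounded f"
  shows "\<exists>p :: nat poly. \<forall>n. f (n + 2) \<le> poly p n"
proof -
  obtain c where c: "\<forall>m\<ge>2. f m \<le> m ^ c" using assms unfolding pbounded_def by blast
  show ?thesis
  proof (intro exI allI)
    fix n
    show "f (n + 2) \<le> poly ([:2, 1:] ^ c) n" using c[rule_format, of "n + 2"] by (simp add: add.commute)
  qed
qed

lemma step_pow_halted: "(step M ^^ n) c = (states M, ts) \<Longrightarrow> n \<le> m \<Longrightarrow> (step M ^^ m) c = (states M, ts)"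
proof -
  assume a: "(step M ^^ n) c = (states M, ts)" "n \<le> m"
  have "(step M ^^ m) c = (step M ^^ (m - n)) ((step M ^^ n) c)"
    using a(2) by (simp flip: funpow_add comp_apply[of "step M ^^ (m - n)"])
  moreover have "(step M ^^ k) (states M, ts) = (states M, ts)" for k by (induction k) auto
  ultimately show ?thesis using a(1) by simp
qed

text \<open>A machine is run on a computed input; the answer depends on whether its output contains a
  \<open>True\<close> at or beyond a computed position.\<close>

theorem ex_decides:
  assumes wf: "wf_tm M"
    and spec: "\<And>x. \<exists>y. outputs_within M (emitted el eb x) (poly p (length (emitted el eb x))) y \<and>
      (x \<in> L \<longleftrightarrow> ((\<exists>i<length y. ev et x (\<lambda>_. 0) \<le> i \<and> y ! i) = acc))"
  shows "\<exists>M' p'. decides M' p' L"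
proof -
  define T where "T = tapes M"
  define k where "k = T - 1"
  have T: "T > 0" "3 \<le> symbols M" using wf by (auto simp: T_def wf_tm_def)
  obtain cl cb ct where c: "computes el cl" "computes eb cb" "computes et ct" using computes_exp by meson
  obtain F where F: "pbounded F" "\<And>s x. s Inp = input_tape x \<Longrightarrow> s (Wrk 0) = blank_tape \<Longrightarrow>
    ev el x (\<lambda>_. 0) \<le> F (length x + 2) \<and> halts (Emit el eb) (with_ctrs s (\<lambda>_. 0)) (F (length x + 2))
      (with_ctrs (s(Wrk 0 := input_tape (emitted el eb x))) (\<lambda>_. 0))"
    using halts_Emit[OF c(1,2)] by blast
  define B where "B = Seq (Emit el eb) (Seq (cmp et (\<lambda>_. 2) 3) (Seq (Run M 0) (Seq (Unwind k) (Seq (Scan k)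
     (IfR (Ctr 4) 1 (Put Out (bit_symbol (\<not> acc))) (Put Out (bit_symbol acc)))))))"
  have "finite (Ctr -` tps B)" by (rule finite_vimageI[OF finite_tps]) (simp add: inj_def)
  then obtain C where C: "Ctr -` tps B \<subseteq> {..<C}" using finite_nat_iff_bounded by blast
  define lay where "lay = Inp # map Ctr [0..<C] @ map Wrk [0..<T] @ [Out]"
  have tB: "tps B \<subseteq> insert Inp (insert Out (range Ctr \<union> Wrk ` {..<T}))"
    using T unfolding B_def Emit_def Unwind_def Scan_def Clear_def
    by (auto simp: T_def k_def dest!: tps_cmp[THEN subsetD])
  have tM: "tps (Marks n) = Ctr ` {..<n}" for n by (induction n) auto
  have oM: "okc S (Marks n)" if "3 \<le> S" for S n using that by (induction n) auto
  have "\<exists>M'. wf_tm M' \<and> tapes M' = length lay \<and>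
    (\<forall>s s' n. halts (Seq (Marks C) B) s n s' \<longrightarrow> (step M' ^^ n) (0, map s lay) = (states M', map s' lay))"
  proof (rule compile_com[where S = "symbols M"])
    show "okc (symbols M) (Seq (Marks C) B)"
      using wf T(2) oM[of "symbols M" C]
      by (auto simp: B_def Emit_def Unwind_def Scan_def Clear_def Loop_def bit_symbol_def)
    show "distinct lay" by (auto simp: lay_def distinct_map inj_on_def)
    have "t \<in> set lay" if "t \<in> tps B" for t
    proof (cases t)
      case (Ctr j)
      then have "j \<in> Ctr -` tps B" using that by simp
      then show ?thesis using C Ctr by (auto simp: lay_def)
    qed (use that tB in \<open>auto simp: lay_def\<close>)
    then show "tps (Seq (Marks C) B) \<subseteq> set lay" using tM[of C] by (auto simp: lay_def)
  qed (use T in \<open>auto simp: lay_def\<close>)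
  then obtain M' where M': "wf_tm M'" "tapes M' = length lay"
    "\<And>s s' n. halts (Seq (Marks C) B) s n s' \<Longrightarrow> (step M' ^^ n) (0, map s lay) = (states M', map s' lay)"
    by blast
  define tm where "tm = (\<lambda>m. poly p (F m))"
  define G where "G = (\<lambda>m. 2 * C + F m + m ^ ct + 11 * tm m + 10 * (tm m + F m) + 30)"
  have "pbounded G" unfolding G_def tm_def by (intro pbounded_intros F(1))
  then obtain p' where p': "\<And>n. G (n + 2) \<le> poly p' n" using pbounded_poly_bound by blast
  have "decides M' p' L"
    unfolding decides_def
  proof (intro conjI allI)
    fix x :: "bool list"
    define m where "m = length x + 2"
    define z where "z = emitted el eb x"
    define \<tau> where "\<tau> = ev et x (\<lambda>_. 0)"
    define t where "t = poly p (length z)"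
    obtain y where y: "outputs_within M z t y" "x \<in> L \<longleftrightarrow> ((\<exists>i<length y. \<tau> \<le> i \<and> y ! i) = acc)"
      using spec[of x] unfolding z_def t_def \<tau>_def by blast
    obtain q ts where ts: "(step M ^^ t) (init_config M z) = (q, ts)" "\<not> q < states M" "tape_holds (last ts) y"
      using y(1) by (auto simp: outputs_within_def)
    \<comment> \<open>Counters from \<open>C\<close> on are on no tape of the machine; taking them
      as already marked makes the store after \<open>Marks\<close> a \<open>with_ctrs\<close> store
      for all counters.\<close>
    define s0 where "s0 = (\<lambda>t. case t of Inp \<Rightarrow> input_tape x | Ctr j \<Rightarrow> if j < C then blank_tape else ctr 0 | _ \<Rightarrow> blank_tape)"
    define \<sigma> where "\<sigma> = (\<lambda>t. if t = Inp then input_tape x else blank_tape)"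
    define \<sigma>1 where "\<sigma>1 = \<sigma>(Wrk 0 := input_tape z)"
    let ?r = "(\<lambda>_::nat. 0::nat)(3 := \<tau>)"
    have "halts (Marks C) s0 (2 * C) (\<lambda>t. case t of Ctr j \<Rightarrow> if j < C then ctr 0 else s0 t | _ \<Rightarrow> s0 t)"
      by (rule halts_Marks) (simp add: s0_def)
    also have "(\<lambda>t. case t of Ctr j \<Rightarrow> if j < C then ctr 0 else s0 t | _ \<Rightarrow> s0 t) = with_ctrs \<sigma> (\<lambda>_. 0)"
      by (auto simp: s0_def \<sigma>_def with_ctrs_def fun_eq_iff split: tp.splits)
    finally have 1: "halts (Marks C) s0 (2 * C) (with_ctrs \<sigma> (\<lambda>_. 0))" .
    have 2: "ev el x (\<lambda>_. 0) \<le> F m" "halts (Emit el eb) (with_ctrs \<sigma> (\<lambda>_. 0)) (F m) (with_ctrs \<sigma>1 (\<lambda>_. 0))"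
      using F(2)[of \<sigma> x] by (auto simp: \<sigma>_def \<sigma>1_def z_def m_def)
    have lz: "length z \<le> F m" using 2(1) by (simp add: z_def emitted_def)
    then have t: "t \<le> tm m" unfolding t_def tm_def by (rule poly_nat_mono)
    have \<sigma>1I: "\<sigma>1 Inp = input_tape x" by (simp add: \<sigma>1_def \<sigma>_def)
    have m: "length x \<le> m" "2 \<le> m" by (auto simp: m_def)
    have 3: "halts (cmp et (\<lambda>_. 2) 3) (with_ctrs \<sigma>1 (\<lambda>_. 0)) (m ^ ct) (with_ctrs \<sigma>1 ?r)"
      using computesD(2)[where s = \<sigma>1 and r = "\<lambda>_. 0" and \<rho> = "\<lambda>_. 2" and d = 3, OF c(3) \<sigma>1I m] by (simp add: \<tau>_def)
    have init: "init_config M z = (0, map (\<lambda>j. with_ctrs \<sigma>1 ?r (Wrk j)) [0..<tapes M])"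
    proof -
      have "[0..<tapes M] = 0 # [1..<tapes M]" using T by (simp add: T_def upt_conv_Cons)
      then show ?thesis
        by (auto simp: init_config_def \<sigma>1_def \<sigma>_def intro!: nth_equalityI)
    qed
    define ts0 where "ts0 = map (\<lambda>j. with_ctrs \<sigma>1 ?r (Wrk j)) [0..<tapes M]"
    have rng: "\<forall>t\<in>set ts0. \<forall>p. snd t p < symbols M"
      using T(2) by (auto simp: ts0_def \<sigma>1_def \<sigma>_def blank_tape_def input_tape_def bit_symbol_def)
    have C01: "with_ctrs \<sigma>1 ?r (Ctr 0) = ctr 0" "with_ctrs \<sigma>1 ?r (Ctr 1) = ctr 0" by auto
    from halts_Run[OF wf le0 ts0_def[symmetric] rng C01 ts(1)[unfolded init ts0_def[symmetric]] ts(2)]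
    obtain s' a b where R: "halts (Run M 0) (with_ctrs \<sigma>1 ?r) (t + 1) s'" "map (\<lambda>j. s' (Wrk j)) [0..<tapes M] = ts"
      "\<forall>t. t \<notin> tps (Run M 0) \<longrightarrow> s' t = with_ctrs \<sigma>1 ?r t" "s' (Ctr 0) = ctr (0 + a)" "s' (Ctr 1) = ctr (0 + b)"
      "fst (last ts) = fst (last ts0) + int a - int b" "a \<le> t" "b \<le> t"
      "\<forall>p. int t \<le> \<bar>p - fst (last ts0)\<bar> \<longrightarrow> snd (last ts) p = snd (last ts0) p" by blast
    define r1 where "r1 = ?r(0 := a, 1 := b)"
    have s'eq: "s' = with_ctrs s' r1"
    proof
      fix t
      show "s' t = with_ctrs s' r1 t"
        using R(3)[rule_format, of t] R(4,5) by (cases t) (auto simp: r1_def image_iff)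
    qed
    have k: "k < tapes M" "last [0..<tapes M] = k" using T by (auto simp: k_def T_def)
    have lts: "last ts = s' (Wrk k)" "last ts0 = \<sigma>1 (Wrk k)"
      using R(2) k T by (auto simp: ts0_def T_def last_map)
    have l0: "fst (last ts0) = 0" by (simp add: lts \<sigma>1_def \<sigma>_def blank_tape_def input_tape_def)
    define f where "f = snd (last ts)"
    have wk: "s' (Wrk k) = (int a - int b, f)" using lts R(6) l0 by (auto simp: f_def prod_eq_iff)
    have 4: "halts (Run M 0) (with_ctrs \<sigma>1 ?r) (t + 1) (with_ctrs s' r1)" using R(1) s'eq by simp
    have 5: "halts (Unwind k) (with_ctrs s' r1) (10 * t + 5) (with_ctrs (s'(Wrk k := (0, f))) ?r)"
      by (rule halts_Unwind[where s = s', OF wk]) (use R(7,8) in \<open>auto simp: r1_def fun_eq_iff\<close>)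
    have hold: "tape_holds (0, f) y" using ts(3) by (simp add: tape_holds_def f_def)
    \<comment> \<open>The cell \<open>t + length z\<close> cannot be reached within \<open>t\<close>
      steps and was blank initially, even if the output tape is also the input tape; so
      \<open>y\<close> cannot extend over it.\<close>
    have ly: "length y \<le> t + length z"
    proof (rule ccontr)
      assume n: "\<not> length y \<le> t + length z"
      then have "f (int (t + length z)) \<noteq> 0"
        using hold by (simp add: tape_holds_def bit_symbol_def del: of_nat_add)
      moreover have "f (int (t + length z)) = snd (last ts0) (int (t + length z))"
        using R(9) l0 by (simp add: f_def)
      moreover have "snd (last ts0) (int (t + length z)) = 0"
        by (auto simp: lts \<sigma>1_def \<sigma>_def blank_tape_def input_tape_def)
      ultimately show False by simp
    qed
    define w where "w = (\<Sum>i<length y. of_bool (\<tau> \<le> i \<and> y ! i) :: nat)"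
    define r2 where "r2 = (\<lambda>_::nat. 0)(3 := \<tau> - length y, 4 := w)"
    define s2 where "s2 = s'(Wrk k := (int (length y), f))"
    have 6: "halts (Scan k) (with_ctrs (s'(Wrk k := (0, f))) ?r) (10 * length y + 1) (with_ctrs s2 r2)"
      using halts_Scan[OF hold, of "s'(Wrk k := (0, f))" k r2 \<tau>] by (simp add: r2_def w_def s2_def)
    have "(\<exists>i<length y. \<tau> \<le> i \<and> y ! i) \<longleftrightarrow> w \<noteq> 0" by (auto simp: w_def)
    then have "x \<in> L \<longleftrightarrow> (w \<noteq> 0) = acc" using y(2) by (simp only:)
    then have acc: "(if r2 4 = 0 then bit_symbol (\<not> acc) else bit_symbol acc) = bit_symbol (x \<in> L)"
      by (cases "w = 0"; cases acc) (simp_all add: r2_def)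
    have "s2 Out = blank_tape"
      using R(3)[rule_format, of Out] by (auto simp: s2_def \<sigma>1_def \<sigma>_def)
    then have put: "halts (Put Out c) (with_ctrs s2 r2) 1 (with_ctrs (s2(Out := (0, (\<lambda>_. 0)(0 := c)))) r2)" for c
      by (intro halts_cong[OF halts_Put]) (simp_all add: with_ctrs_upd blank_tape_def)
    define s3 where "s3 = with_ctrs (s2(Out := (0, (\<lambda>_. 0)(0 := bit_symbol (x \<in> L))))) r2"
    have 7: "halts (IfR (Ctr 4) 1 (Put Out (bit_symbol (\<not> acc))) (Put Out (bit_symbol acc))) (with_ctrs s2 r2) 2 s3"
    proof (rule halts_IfZero[where n = 1])
      show "halts (if r2 4 = 0 then Put Out (bit_symbol (\<not> acc)) else Put Out (bit_symbol acc)) (with_ctrs s2 r2) 1 s3"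
        unfolding s3_def acc[symmetric] using put by simp
    qed simp
    have "halts (Seq (Marks C) B) s0 (G m) s3"
      unfolding B_def
      by (rule halts_Seq[OF 1 halts_Seq[OF 2(2) halts_Seq[OF 3 halts_Seq[OF 4 halts_Seq[OF 5 halts_Seq[OF 6 7
              order_refl] order_refl] order_refl] order_refl] order_refl]]) (use t ly lz in \<open>simp add: G_def\<close>)
    then have "(step M' ^^ G m) (0, map s0 lay) = (states M', map s3 lay)" by (rule M'(3))
    moreover have "init_config M' x = (0, map s0 lay)"
      using M'(2) by (auto simp: init_config_def lay_def s0_def intro!: nth_equalityI simp: nth_append nth_Cons split: nat.splits)
    ultimately have "(step M' ^^ poly p' (length x)) (init_config M' x) = (states M', map s3 lay)"
      using p'[of "length x"] step_pow_halted unfolding m_def by metis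
    moreover have "last (map s3 lay) = (0, (\<lambda>_. 0)(0 := bit_symbol (x \<in> L)))"
      by (simp add: lay_def s3_def)
    ultimately show "\<exists>ts. (step M' ^^ poly p' (length x)) (init_config M' x) = (states M', ts) \<and>
        length ts = tapes M' \<and> last ts = (0, (\<lambda>_. 0)(0 := bit_symbol (x \<in> L)))"
      using M'(2) by (intro exI[of _ "map s3 lay"]) simp
  qed (rule M'(1))
  then show ?thesis by blast
qed

lemma decides_class_P:
  assumes "decides M p L"
  shows "L \<in> class_P"
proof -
  have "outputs_within M x (poly p (length x)) [x \<in> L]" for x
  proof -
    obtain ts where "(step M ^^ poly p (length x)) (init_config M x) = (states M, ts)"
      "last ts = (0, (\<lambda>_. 0)(0 := bit_symbol (x \<in> L)))"
      using assms unfolding decides_def by blast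
    then show ?thesis by (simp add: outputs_within_def tape_holds_def)
  qed
  then show ?thesis using assms unfolding class_P_def polytime_computable_def decides_def by blast
qed

text \<open>The identity as preprocessing and the threshold 0 bring any polynomial-time decider into
  normal form; subtracting 1 turns the symbols 1 and 2 into truth values.\<close>

lemma class_P_decides:
  assumes "L \<in> class_P"
  shows "\<exists>M p. decides M p L"
proof -
  obtain M p where M: "wf_tm M" "\<And>x. outputs_within M x (poly p (length x)) [x \<in> L]"
    using assms unfolding class_P_def polytime_computable_def by blast
  have em: "emitted Len (Sub (Sym (Var 0)) (Const 1)) x = x" for x
    by (auto simp: emitted_def env1_def inp_def bit_symbol_def intro!: nth_equalityI)
  show ?thesis
    by (rule ex_decides[where el = Len and eb = "Sub (Sym (Var 0)) (Const 1)" and et = "Const 0" and acc = True, OF M(1)])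
      (use M(2) em in \<open>auto intro!: exI\<close>)
qed

section \<open>Closure properties of the functions given by expressions\<close>

text \<open>Closure properties are stated through existence of an expression, so that the reduction
  never has to be written as one. The variables in \<open>v\<close> are de Bruijn indices: a binder
  puts its variable at index 0.\<close>

definition pf :: "(bool list \<Rightarrow> (nat \<Rightarrow> nat) \<Rightarrow> nat) \<Rightarrow> bool" where
  "pf f \<longleftrightarrow> (\<exists>e. \<forall>x v. ev e x v = f x v)"

definition pp :: "(bool list \<Rightarrow> (nat \<Rightarrow> nat) \<Rightarrow> bool) \<Rightarrow> bool" where
  "pp Q \<longleftrightarrow> pf (\<lambda>x v. of_bool (Q x v))"

fun ren :: "(nat \<Rightarrow> nat) \<Rightarrow> exp \<Rightarrow> exp" where
  "ren \<xi> (Var k) = Var (\<xi> k)"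
| "ren \<xi> (Const c) = Const c"
| "ren \<xi> Len = Len"
| "ren \<xi> (Sym e) = Sym (ren \<xi> e)"
| "ren \<xi> (Add e1 e2) = Add (ren \<xi> e1) (ren \<xi> e2)"
| "ren \<xi> (Sub e1 e2) = Sub (ren \<xi> e1) (ren \<xi> e2)"
| "ren \<xi> (Mul e1 e2) = Mul (ren \<xi> e1) (ren \<xi> e2)"
| "ren \<xi> (Rec e0 eb en e) = Rec (ren \<xi> e0) (ren \<xi> eb) (ren \<xi> en)
     (ren (case_nat 0 (case_nat (Suc 0) (\<lambda>k. Suc (Suc (\<xi> k))))) e)"

lemma ev_ren: "ev (ren \<xi> e) x v = ev e x (\<lambda>k. v (\<xi> k))"
proof (induction e arbitrary: \<xi> v)
  case (Rec e0 eb en e)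
  have "(\<lambda>k. case_nat i (case_nat y v) (case_nat 0 (case_nat (Suc 0) (\<lambda>k. Suc (Suc (\<xi> k)))) k)) =
    case_nat i (case_nat y (\<lambda>k. v (\<xi> k)))" for i y
    by (auto split: nat.splits)
  then show ?case by (simp only: ren.simps ev.simps Rec)
qed auto

fun sb :: "(nat \<Rightarrow> exp) \<Rightarrow> exp \<Rightarrow> exp" where
  "sb \<sigma> (Var k) = \<sigma> k"
| "sb \<sigma> (Const c) = Const c"
| "sb \<sigma> Len = Len"
| "sb \<sigma> (Sym e) = Sym (sb \<sigma> e)"
| "sb \<sigma> (Add e1 e2) = Add (sb \<sigma> e1) (sb \<sigma> e2)"
| "sb \<sigma> (Sub e1 e2) = Sub (sb \<sigma> e1) (sb \<sigma> e2)"
| "sb \<sigma> (Mul e1 e2) = Mul (sb \<sigma> e1) (sb \<sigma> e2)"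
| "sb \<sigma> (Rec e0 eb en e) = Rec (sb \<sigma> e0) (sb \<sigma> eb) (sb \<sigma> en)
     (sb (case_nat (Var 0) (case_nat (Var (Suc 0)) (\<lambda>k. ren (\<lambda>j. Suc (Suc j)) (\<sigma> k)))) e)"

lemma ev_sb: "ev (sb \<sigma> e) x v = ev e x (\<lambda>k. ev (\<sigma> k) x v)"
proof (induction e arbitrary: \<sigma> v)
  case (Rec e0 eb en e)
  have "(\<lambda>k. ev (case_nat (Var 0) (case_nat (Var (Suc 0)) (\<lambda>k. ren (\<lambda>j. Suc (Suc j)) (\<sigma> k))) k) x (case_nat i (case_nat y v))) =
    case_nat i (case_nat y (\<lambda>k. ev (\<sigma> k) x v))" for i y
    by (auto simp: ev_ren split: nat.splits)
  then show ?case by (simp only: sb.simps ev.simps Rec)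
qed auto

lemma pf_ren: "pf f \<Longrightarrow> pf (\<lambda>x v. f x (\<lambda>k. v (\<xi> k)))"
  unfolding pf_def using ev_ren by metis

lemma pf_subst:
  assumes "pf F" "\<And>k. pf (g k)"
  shows "pf (\<lambda>x v. F x (\<lambda>k. g k x v))"
proof -
  obtain e where e: "\<And>x v. ev e x v = F x v" using assms(1) unfolding pf_def by blast
  obtain \<sigma> where \<sigma>: "\<And>k x v. ev (\<sigma> k) x v = g k x v" using assms(2) unfolding pf_def by metis
  show ?thesis unfolding pf_def by (rule exI[of _ "sb \<sigma> e"]) (simp add: ev_sb e \<sigma>)
qed

lemma pf_var: "pf (\<lambda>x v. v k)"
  unfolding pf_def by (rule exI[of _ "Var k"]) simp

lemma pf_const: "pf (\<lambda>x v. c)"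
  unfolding pf_def by (rule exI[of _ "Const c"]) simp

lemma pf_comp1:
  assumes "pf (\<lambda>x v. G x (v 0))" "pf a"
  shows "pf (\<lambda>x v. G x (a x v))"
  using pf_subst[OF assms(1), of "\<lambda>k. a"] assms by simp

lemma pf_comp2:
  assumes "pf (\<lambda>x v. G x (v 0) (v 1))" "pf a" "pf b"
  shows "pf (\<lambda>x v. G x (a x v) (b x v))"
  using pf_subst[OF assms(1), of "\<lambda>k. if k = 0 then a else b"] assms by simp

lemma pf_comp3:
  assumes "pf (\<lambda>x v. G x (v 0) (v 1) (v 2))" "pf a" "pf b" "pf c"
  shows "pf (\<lambda>x v. G x (a x v) (b x v) (c x v))"
  using pf_subst[OF assms(1), of "\<lambda>k. if k = 0 then a else if k = 1 then b else c"] assms by simp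

lemma pp_comp2: "pp (\<lambda>x v. G x (v 0) (v 1)) \<Longrightarrow> pf a \<Longrightarrow> pf b \<Longrightarrow> pp (\<lambda>x v. G x (a x v) (b x v))"
  unfolding pp_def by (rule pf_comp2)

lemma pp_comp3: "pp (\<lambda>x v. G x (v 0) (v 1) (v 2)) \<Longrightarrow> pf a \<Longrightarrow> pf b \<Longrightarrow> pf c \<Longrightarrow>
  pp (\<lambda>x v. G x (a x v) (b x v) (c x v))"
  unfolding pp_def by (rule pf_comp3)

lemma pf_len: "pf (\<lambda>x v. length x)"
  unfolding pf_def by (rule exI[of _ Len]) simp

lemma pf_inp: "pf f \<Longrightarrow> pf (\<lambda>x v. inp x (f x v))"
  unfolding pf_def by (metis ev.simps(4))

lemma pf_add: "pf f \<Longrightarrow> pf g \<Longrightarrow> pf (\<lambda>x v. f x v + g x v)"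
  unfolding pf_def by (metis ev.simps(5))

lemma pf_sub: "pf f \<Longrightarrow> pf g \<Longrightarrow> pf (\<lambda>x v. f x v - g x v)"
  unfolding pf_def by (metis ev.simps(6))

lemma pf_mult: "pf f \<Longrightarrow> pf g \<Longrightarrow> pf (\<lambda>x v. f x v * g x v)"
  unfolding pf_def by (metis ev.simps(7))

lemma pf_Suc: "pf f \<Longrightarrow> pf (\<lambda>x v. Suc (f x v))"
  using pf_add[OF _ pf_const, of f 1] by simp

lemma pf_power: "pf f \<Longrightarrow> pf (\<lambda>x v. f x v ^ k)"
  by (induction k) (auto intro: pf_const pf_mult)

lemma pf_poly: "pf f \<Longrightarrow> pf (\<lambda>x v. poly p (f x v))"
  by (induction p) (auto intro: pf_const pf_mult pf_add)

lemma pf_biter: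
  assumes "pf a" "pf b" "pf n" "pf (\<lambda>x w. F x (\<lambda>k. w (Suc (Suc k))) (w 0) (w 1))"
  shows "pf (\<lambda>x v. biter (a x v) (b x v) (F x v) (n x v))"
proof -
  obtain ea eb en e where e: "\<And>x v. ev ea x v = a x v" "\<And>x v. ev eb x v = b x v" "\<And>x v. ev en x v = n x v"
    "\<And>x w. ev e x w = F x (\<lambda>k. w (Suc (Suc k))) (w 0) (w 1)"
    using assms unfolding pf_def by metis
  show ?thesis unfolding pf_def by (rule exI[of _ "Rec ea eb en e"]) (simp add: e)
qed

lemma pf_of_bool: "pp Q \<Longrightarrow> pf (\<lambda>x v. of_bool (Q x v))"
  by (simp add: pp_def)

lemma pp_le: "pf f \<Longrightarrow> pf g \<Longrightarrow> pp (\<lambda>x v. f x v \<le> g x v)"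
proof -
  assume "pf f" "pf g"
  then have "pf (\<lambda>x v. 1 - (f x v - g x v))" by (intro pf_sub pf_const)
  moreover have "of_bool (a \<le> b) = 1 - (a - b)" for a b :: nat by auto
  ultimately show ?thesis by (simp add: pp_def)
qed

lemma pp_not: "pp Q \<Longrightarrow> pp (\<lambda>x v. \<not> Q x v)"
proof -
  assume "pp Q"
  then have "pf (\<lambda>x v. 1 - of_bool (Q x v))" unfolding pp_def by (intro pf_sub pf_const)
  moreover have "of_bool (\<not> q) = 1 - (of_bool q :: nat)" for q by auto
  ultimately show ?thesis by (simp add: pp_def)
qed

lemma pp_conj: "pp P \<Longrightarrow> pp Q \<Longrightarrow> pp (\<lambda>x v. P x v \<and> Q x v)"
  unfolding pp_def using pf_mult by (simp add: of_bool_conj)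

lemma pp_disj: "pp P \<Longrightarrow> pp Q \<Longrightarrow> pp (\<lambda>x v. P x v \<or> Q x v)"
  using pp_not[OF pp_conj[OF pp_not pp_not], of P Q] by simp

lemma pp_imp:
  assumes "pp P" "pp Q"
  shows "pp (\<lambda>x v. P x v \<longrightarrow> Q x v)"
  using pp_disj[OF pp_not[OF assms(1)] assms(2)] by (simp only: imp_conv_disj)

lemma pp_iff:
  assumes "pp P" "pp Q"
  shows "pp (\<lambda>x v. P x v = Q x v)"
  using pp_conj[OF pp_imp[OF assms] pp_imp[OF assms(2,1)]] by (simp only: iff_conv_conj_imp)

lemma pp_less: "pf f \<Longrightarrow> pf g \<Longrightarrow> pp (\<lambda>x v. f x v < g x v)"
  using pp_not[OF pp_le, of g f] by (simp add: not_le)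

lemma pp_eq: "pf f \<Longrightarrow> pf g \<Longrightarrow> pp (\<lambda>x v. f x v = g x v)"
  using pp_conj[OF pp_le[of f g] pp_le[of g f]] by (simp add: eq_iff)

lemma pf_if: "pp Q \<Longrightarrow> pf f \<Longrightarrow> pf g \<Longrightarrow> pf (\<lambda>x v. if Q x v then f x v else g x v)"
proof -
  assume "pp Q" "pf f" "pf g"
  then have "pf (\<lambda>x v. of_bool (Q x v) * f x v + of_bool (\<not> Q x v) * g x v)"
    by (intro pf_add pf_mult pf_of_bool pp_not)
  moreover have "of_bool q * a + of_bool (\<not> q) * b = (if q then a else b)" for q and a b :: nat by auto
  ultimately show ?thesis by simp
qed

text \<open>Truncation at the number of terms changes nothing, since every term is at most 1.
  Bounded quantifiers, division and the logarithm all rest on this.\<close>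

lemma pf_count:
  assumes "pf n" "pp (\<lambda>x w. B x (\<lambda>k. w (Suc k)) (w 0))"
  shows "pf (\<lambda>x v. \<Sum>i<n x v. of_bool (B x v i))"
proof -
  have "pf (\<lambda>x w. of_bool (B x (\<lambda>k. w (case_nat 0 (\<lambda>k. Suc (Suc k)) (Suc k))) (w (case_nat 0 (\<lambda>k. Suc (Suc k)) 0))))"
    using pf_ren[OF assms(2)[unfolded pp_def], of "case_nat 0 (\<lambda>k. Suc (Suc k))"] .
  then have *: "pf (\<lambda>x v. biter 0 (n x v) (\<lambda>i y. y + of_bool (B x v i)) (n x v))"
    by (intro pf_biter pf_const assms(1) pf_add pf_var) simp
  have b: "biter 0 m (\<lambda>i y. y + of_bool (Q i)) k = (\<Sum>i<k. of_bool (Q i)) \<and> (\<Sum>i<k. of_bool (Q i) :: nat) \<le> k"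
    if "k \<le> m" for m k Q
    using that
  proof (induction k)
    case (Suc k)
    then have "(\<Sum>i<Suc k. of_bool (Q i) :: nat) \<le> Suc k" by (simp del: sum_of_bool_eq)
    then show ?case using Suc by (simp del: sum_of_bool_eq)
  qed simp
  have "biter 0 (n x v) (\<lambda>i y. y + of_bool (B x v i)) (n x v) = (\<Sum>i<n x v. of_bool (B x v i))" for x v
    using b[of "n x v" "n x v" "B x v"] by blast
  then show ?thesis using * by (simp del: sum_of_bool_eq)
qed

lemma pp_ex:
  assumes "pf n" "pp (\<lambda>x w. B x (\<lambda>k. w (Suc k)) (w 0))"
  shows "pp (\<lambda>x v. \<exists>i<n x v. B x v i)"
proof -
  have "pp (\<lambda>x v. (\<Sum>i<n x v. of_bool (B x v i)) \<noteq> (0::nat))"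
    by (intro pp_not pp_eq pf_count assms pf_const)
  moreover have "((\<Sum>i<k. of_bool (Q i)) = (0::nat)) = (\<not> (\<exists>i<k. Q i))" for k :: nat and Q
    by (auto simp: sum_eq_0_iff simp del: sum_of_bool_eq)
  ultimately show ?thesis by (simp only: not_not)
qed

lemma pp_all:
  assumes "pf n" "pp (\<lambda>x w. B x (\<lambda>k. w (Suc k)) (w 0))"
  shows "pp (\<lambda>x v. \<forall>i<n x v. B x v i)"
  using pp_not[OF pp_ex[OF assms(1) pp_not[OF assms(2)]]] by simp

lemma pf_min: "pf f \<Longrightarrow> pf g \<Longrightarrow> pf (\<lambda>x v. min (f x v) (g x v))"
  using pf_if[OF pp_le, of f g f g] by (simp add: min_def)

section \<open>Division, truncated powers of two and finite tables\<close>

lemma div_eq_count: "a div b = (\<Sum>i<a. of_bool (b \<noteq> 0 \<and> Suc i * b \<le> a))" for a b :: nat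
proof (cases "b = 0")
  case False
  have "{..<a} \<inter> {i. b \<noteq> 0 \<and> Suc i * b \<le> a} = {..<a div b}"
  proof -
    have "Suc i * b \<le> a \<longleftrightarrow> i < a div b" for i
      using False by (metis less_eq_div_iff_mult_less_eq neq0_conv Suc_le_eq)
    moreover have "i < a div b \<Longrightarrow> i < a" for i by (meson div_le_dividend less_le_trans)
    ultimately show ?thesis using False by auto
  qed
  then show ?thesis by simp
qed simp

lemma pf_div: "pf f \<Longrightarrow> pf g \<Longrightarrow> pf (\<lambda>x v. f x v div g x v)"
proof -
  assume fg: "pf f" "pf g"
  have "pf (\<lambda>x v. \<Sum>i<v 0. of_bool (v 1 \<noteq> 0 \<and> Suc i * v 1 \<le> v 0))"
    by (intro pf_count pf_var pp_conj pp_not pp_eq pp_le pf_const pf_mult pf_Suc)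
  then have "pf (\<lambda>x v. v 0 div v 1)" by (simp only: div_eq_count)
  from pf_comp2[OF this fg] show ?thesis .
qed

lemma pf_mod: "pf f \<Longrightarrow> pf g \<Longrightarrow> pf (\<lambda>x v. f x v mod g x v)"
  using pf_sub[OF _ pf_mult[OF pf_div], of f f g g] by (simp add: minus_div_mult_eq_mod)

lemma pp_even: "pf f \<Longrightarrow> pp (\<lambda>x v. even (f x v))"
  using pp_eq[OF pf_mod[OF _ pf_const] pf_const, of f 2 0] by (simp add: even_iff_mod_2_eq_zero)

text \<open>A free power would leave the polynomially bounded functions, so powers of two are
  available only together with an upper bound.\<close>

lemma pf_pow2_min: "pf f \<Longrightarrow> pf g \<Longrightarrow> pf (\<lambda>x v. min (2 ^ f x v) (g x v))"
proof -
  assume fg: "pf f" "pf g"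
  have b: "biter (min 1 b) b (\<lambda>i y. 2 * y) n = min (2 ^ n) b" for b n
    by (induction n) (auto simp: min_def)
  have "pf (\<lambda>x v. biter (min 1 (v 1)) (v 1) (\<lambda>i y. 2 * y) (v 0))"
    by (intro pf_biter pf_min pf_mult pf_var pf_const)
  then have "pf (\<lambda>x v. min (2 ^ v 0) (v 1))" by (simp only: b)
  from pf_comp2[OF this fg] show ?thesis .
qed

lemma pf_div_pow2: "pf f \<Longrightarrow> pf g \<Longrightarrow> pf (\<lambda>x v. f x v div 2 ^ g x v)"
proof -
  assume fg: "pf f" "pf g"
  have b: "biter a a (\<lambda>i y. y div 2) n = a div 2 ^ n" for a n :: nat
  proof (induction n)
    case (Suc n)
    have "a div 2 ^ n div 2 = a div 2 ^ Suc n" by (metis div_mult2_eq power_Suc2)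
    then show ?case using Suc by (metis biter_simps(2) div_le_dividend min.absorb1)
  qed simp
  have "pf (\<lambda>x v. biter (v 0) (v 0) (\<lambda>i y. y div 2) (v 1))"
    by (intro pf_biter pf_div pf_var pf_const)
  then have "pf (\<lambda>x v. v 0 div 2 ^ v 1)" by (simp only: b)
  from pf_comp2[OF this fg] show ?thesis .
qed

text \<open>Finite functions are hardwired by case distinction; the transition function of the fixed
  verifier enters the reduction in this way.\<close>

lemma pf_table: "pf f \<Longrightarrow> pf (\<lambda>x v. if f x v < N then t (f x v) else 0)"
proof (induction N)
  case 0
  then show ?case using pf_const by simp
next
  case (Suc N)
  have "pf (\<lambda>x v. if f x v = N then t N else if f x v < N then t (f x v) else 0)"
    by (rule pf_if[OF pp_eq[OF Suc.prems pf_const] pf_const Suc.IH[OF Suc.prems]])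
  moreover have "(if a < Suc N then t a else 0) = (if a = N then t N else if a < N then t a else 0)" for a
    by auto
  ultimately show ?case by simp
qed

lemma pf_table2:
  assumes "pf f" "pf g"
  shows "pf (\<lambda>x v. if f x v < N \<and> g x v < K then t (f x v) (g x v) else 0)"
proof -
  have 1: "pf (\<lambda>x v. if f x v * K + g x v < N * K then t ((f x v * K + g x v) div K) ((f x v * K + g x v) mod K) else 0)"
    by (rule pf_table[of "\<lambda>x v. f x v * K + g x v" "N * K" "\<lambda>c. t (c div K) (c mod K)"])
      (intro assms pf_const pf_add pf_mult)
  have 2: "pp (\<lambda>x v. f x v < N \<and> g x v < K)"
    by (intro pp_conj pp_less assms pf_const)
  have "(if a < N \<and> b < K then if a * K + b < N * K then t ((a * K + b) div K) ((a * K + b) mod K) else 0 else 0) =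
     (if a < N \<and> b < K then t a b else 0)" for a b
  proof (cases "a < N \<and> b < K")
    case True
    then have "a * K + b < Suc a * K" by simp
    also have "\<dots> \<le> N * K" using True by (intro mult_right_mono) auto
    finally show ?thesis using True by simp
  qed auto
  then show ?thesis using pf_if[OF 2 1 pf_const, of 0] by (simp only:)
qed

lemma pp_const: "pp (\<lambda>x v. c)"
  unfolding pp_def by (rule pf_const)

lemmas pf_intros = pf_of_bool pf_add pf_sub pf_mult pf_Suc pf_power pf_poly pf_if pf_count pf_min
  pf_div_pow2 pf_pow2_min pf_div pf_mod pf_inp pf_len pf_var pf_const
  pp_not pp_conj pp_disj pp_imp pp_iff pp_ex pp_all pp_le pp_less pp_eq pp_even pp_const

section \<open>The pair code read position by position\<close>

lemma encode_pair_Cons: "encode_pair (b # x) u = True # b # encode_pair x u"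
  by (simp add: encode_pair_def)

lemma encode_pair_Nil: "encode_pair [] u = False # u"
  by (simp add: encode_pair_def)

lemma length_encode_pair: "length (encode_pair x u) = 2 * length x + 1 + length u"
  by (induction x) (simp_all add: encode_pair_Cons encode_pair_Nil)

lemma inp_Cons [simp]: "inp (b # x) 0 = bit_symbol b" "inp (b # x) (Suc i) = inp x i"
  by (simp_all add: inp_def)

lemma inp_encode_pair:
  "i < length x \<Longrightarrow> inp (encode_pair x u) (2 * i) = 2"
  "i < length x \<Longrightarrow> inp (encode_pair x u) (Suc (2 * i)) = inp x i"
  "inp (encode_pair x u) (2 * length x) = 1"
  "inp (encode_pair x u) (Suc (2 * length x + j)) = inp u j"
proof -
  have "inp (encode_pair x u) (2 * i) = 2 \<and> inp (encode_pair x u) (Suc (2 * i)) = inp x i" if "i < length x" for i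
    using that
  proof (induction x arbitrary: i)
    case (Cons b x)
    then show ?case by (cases i) (simp_all add: encode_pair_Cons bit_symbol_def)
  qed simp
  moreover have "inp (encode_pair x u) (2 * length x) = 1 \<and> inp (encode_pair x u) (Suc (2 * length x + j)) = inp u j"
    by (induction x) (simp_all add: encode_pair_Cons encode_pair_Nil bit_symbol_def)
  ultimately show "i < length x \<Longrightarrow> inp (encode_pair x u) (2 * i) = 2"
    "i < length x \<Longrightarrow> inp (encode_pair x u) (Suc (2 * i)) = inp x i"
    "inp (encode_pair x u) (2 * length x) = 1"
    "inp (encode_pair x u) (Suc (2 * length x + j)) = inp u j" by blast+
qed

section \<open>Local complementation and sets with their odd neighbourhood\<close>

definition odd_nbhd :: "'a ugraph \<Rightarrow> 'a set \<Rightarrow> 'a set" where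
  "odd_nbhd G D = {v. odd (card (nbhd G v \<inter> D))}"

text \<open>In terms of graph states, this is the support of the stabilizer operator with X-part
  \<open>D\<close>. Local complementation acts by local operations and so preserves the family of
  these supports; the proofs below do this by counting modulo 2.\<close>

definition cover :: "'a ugraph \<Rightarrow> 'a set \<Rightarrow> 'a set" where
  "cover G D = D \<union> odd_nbhd G D"

lemma verts_local_complement [simp]: "verts (local_complement G u) = verts G"
  by (simp add: local_complement_def)

lemma nbhd_sym: "v \<in> nbhd G u \<longleftrightarrow> u \<in> nbhd G v"
  by (simp add: nbhd_def insert_commute)

lemma nbhd_nonempty_verts: "simple_graph G \<Longrightarrow> nbhd G v \<noteq> {} \<Longrightarrow> v \<in> verts G"
  using nbhd_sym[of _ G v] nbhd_subset_verts[of G] by auto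

lemma finite_nbhd: "simple_graph G \<Longrightarrow> finite (nbhd G v)"
  using nbhd_subset_verts finite_subset unfolding simple_graph_def by metis

lemma nbhd_local_complement:
  "w \<in> nbhd (local_complement G u) v \<longleftrightarrow> (w \<in> nbhd G v) \<noteq> (v \<in> nbhd G u \<and> w \<in> nbhd G u \<and> v \<noteq> w)"
  by (auto simp: nbhd_def local_complement_def edge_in_complete_edges)

lemma odd_card_sym_diff:
  "finite A \<Longrightarrow> finite B \<Longrightarrow> odd (card (sym_diff A B)) \<longleftrightarrow> odd (card A) \<noteq> odd (card B)"
proof -
  assume f: "finite A" "finite B"
  have "card A = card (A - B) + card (A \<inter> B)" "card B = card (B - A) + card (A \<inter> B)"
    using card_Diff_subset_Int[of A B] card_Diff_subset_Int[of B A] f card_mono[of A "A \<inter> B"] card_mono[of B "A \<inter> B"]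
    by (auto simp: Int_commute)
  moreover have "card (sym_diff A B) = card (A - B) + card (B - A)"
    using f by (subst card_Un_disjoint) auto
  ultimately show ?thesis by auto
qed

lemma odd_nbhd_local_complement:
  assumes "simple_graph G"
  shows "v \<in> odd_nbhd (local_complement G u) D \<longleftrightarrow>
    (v \<in> odd_nbhd G D) \<noteq> (v \<in> nbhd G u \<and> (u \<in> odd_nbhd G D) \<noteq> (v \<in> D))"
proof (cases "v \<in> nbhd G u")
  case True
  let ?N = "nbhd G u"
  have fin: "finite ?N" "finite (nbhd G v)" using finite_nbhd[OF assms] by auto
  have "nbhd (local_complement G u) v \<inter> D = sym_diff (nbhd G v \<inter> D) (sym_diff (?N \<inter> D) ({v} \<inter> D))"
    using True nbhd_irrefl[OF assms] by (auto simp: nbhd_local_complement)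
  then have "odd (card (nbhd (local_complement G u) v \<inter> D)) \<longleftrightarrow>
     (odd (card (nbhd G v \<inter> D)) \<noteq> (odd (card (?N \<inter> D)) \<noteq> odd (card ({v} \<inter> D))))"
    using fin by (simp only: odd_card_sym_diff finite_Int finite_Un finite_Diff finite.intros simp_thms)
  moreover have "odd (card ({v} \<inter> D)) \<longleftrightarrow> v \<in> D" by (cases "v \<in> D") auto
  ultimately show ?thesis using True by (simp add: odd_nbhd_def)
next
  case False
  then have "nbhd (local_complement G u) v = nbhd G v" by (auto simp: nbhd_local_complement)
  then show ?thesis using False by (simp add: odd_nbhd_def)
qed

lemma odd_nbhd_toggle:
  assumes "simple_graph G"
  shows "v \<in> odd_nbhd G (sym_diff D {u}) \<longleftrightarrow> (v \<in> odd_nbhd G D) \<noteq> (u \<in> nbhd G v)"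
proof -
  have "nbhd G v \<inter> sym_diff D {u} = sym_diff (nbhd G v \<inter> D) (nbhd G v \<inter> {u})" by auto
  then have "odd (card (nbhd G v \<inter> sym_diff D {u})) \<longleftrightarrow> odd (card (nbhd G v \<inter> D)) \<noteq> odd (card (nbhd G v \<inter> {u}))"
    using finite_nbhd[OF assms] by (simp only: odd_card_sym_diff finite_Int simp_thms)
  moreover have "odd (card (nbhd G v \<inter> {u})) \<longleftrightarrow> u \<in> nbhd G v" by (cases "u \<in> nbhd G v") auto
  ultimately show ?thesis by (simp add: odd_nbhd_def)
qed

lemma cover_local_complement_even:
  assumes "simple_graph G" "u \<notin> odd_nbhd G D"
  shows "cover (local_complement G u) D = cover G D"
  using assms by (auto simp: cover_def odd_nbhd_local_complement)

text \<open>After toggling \<open>u\<close> in \<open>D\<close>, the odd neighbourhood changes only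
  at neighbours of \<open>u\<close> that lie in \<open>D\<close>, where the union does not see it;
  \<open>u\<close> itself stays in the odd neighbourhood.\<close>

lemma cover_local_complement_odd:
  assumes "simple_graph G" "u \<in> odd_nbhd G D"
  shows "cover (local_complement G u) (sym_diff D {u}) = cover G D"
proof -
  have irr: "u \<notin> nbhd G u" using nbhd_irrefl[OF assms(1)] .
  have "v \<in> odd_nbhd (local_complement G u) (sym_diff D {u}) \<longleftrightarrow> (v \<in> odd_nbhd G D) \<noteq> (v \<in> nbhd G u \<and> v \<in> D)" for v
    using odd_nbhd_toggle[OF simple_graph_local_complement[OF assms(1)], of v u D u]
      odd_nbhd_local_complement[OF assms(1), of v u D] assms(2) nbhd_sym[of u "local_complement G u" v]
      nbhd_local_complement_self[OF assms(1), of u] by auto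
  then show ?thesis using assms(2) irr unfolding cover_def by auto
qed

lemma cover_local_complement:
  assumes "simple_graph G" "D \<noteq> {}" "D \<subseteq> verts G" "u \<in> verts G"
  shows "\<exists>D'. D' \<noteq> {} \<and> D' \<subseteq> verts G \<and> cover (local_complement G u) D' = cover G D"
proof (cases "u \<in> odd_nbhd G D")
  case True
  have "sym_diff D {u} \<noteq> {}"
  proof
    assume "sym_diff D {u} = {}"
    then have "D = {u}" by auto
    then have "nbhd G u \<inter> D = {}" using nbhd_irrefl[OF assms(1)] by auto
    then show False using True by (simp add: odd_nbhd_def)
  qed
  then show ?thesis using cover_local_complement_odd[OF assms(1) True] assms
    by (intro exI[of _ "sym_diff D {u}"]) auto
next
  case False
  then show ?thesis using cover_local_complement_even[OF assms(1) False] assms by blast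
qed

lemma cover_locally_equivalent:
  assumes "locally_equivalent G H" "simple_graph G" "D \<noteq> {}" "D \<subseteq> verts G"
  shows "\<exists>D'. D' \<noteq> {} \<and> D' \<subseteq> verts G \<and> cover H D' = cover G D"
  using assms(1) unfolding locally_equivalent_def
proof (induction rule: rtranclp_induct)
  case base
  then show ?case using assms by blast
next
  case (step H K)
  then obtain u D' where u: "u \<in> verts H" "K = local_complement H u"
    and D': "D' \<noteq> {}" "D' \<subseteq> verts G" "cover H D' = cover G D" by blast
  have "simple_graph H \<and> verts H = verts G"
    using step.hyps(1) assms(2) locally_equivalent_simple_verts unfolding locally_equivalent_def by blast
  then show ?case using cover_local_complement[of H D' u] u D' by auto
qed

lemma cover_singleton: "cover G {v} = insert v (nbhd G v)"
proof -
  have "odd (card (nbhd G w \<inter> {v})) \<longleftrightarrow> w \<in> nbhd G v" for w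
    using nbhd_sym[of w G v] by (cases "v \<in> nbhd G w") auto
  then show ?thesis by (auto simp: cover_def odd_nbhd_def)
qed

lemma locally_equivalent_step:
  "u \<in> verts G \<Longrightarrow> locally_equivalent (local_complement G u) H \<Longrightarrow> locally_equivalent G H"
  unfolding locally_equivalent_def by (rule converse_rtranclp_into_rtranclp) auto

text \<open>A vertex of \<open>D\<close> with an odd number of neighbours in \<open>D\<close> can be
  removed from \<open>D\<close> by complementing at it, with the cover unchanged. If there is none,
  complementing at a vertex outside the odd neighbourhood that is adjacent to \<open>D\<close>
  creates one, again with the same cover. If that is impossible as well, all neighbours of
  \<open>D\<close> are odd, and any vertex of \<open>D\<close> has its closed neighbourhood inside
  the cover.\<close>

lemma shrink_to_vertex:
  assumes "simple_graph G" "D \<noteq> {}" "D \<subseteq> verts G"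
  shows "\<exists>H v. locally_equivalent G H \<and> v \<in> verts G \<and> insert v (nbhd H v) \<subseteq> cover G D"
  using assms
proof (induction "card D" arbitrary: G D rule: less_induct)
  case less
  note G = less.prems(1)
  have finD: "finite D" using less.prems finite_subset unfolding simple_graph_def by blast
  have drop: "\<exists>H v. locally_equivalent G' H \<and> v \<in> verts G' \<and> insert v (nbhd H v) \<subseteq> cover G' D"
    if G': "simple_graph G'" "verts G' = verts G" "D \<inter> odd_nbhd G' D \<noteq> {}" for G'
  proof -
    obtain u where u: "u \<in> D" "u \<in> odd_nbhd G' D" using G'(3) by blast
    have eq: "sym_diff D {u} = D - {u}" using u by auto
    have "D - {u} \<noteq> {}"
    proof
      assume "D - {u} = {}"
      then have "D = {u}" using u by auto
      then have "nbhd G' u \<inter> D = {}" using nbhd_irrefl[OF G'(1)] by auto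
      then show False using u by (simp add: odd_nbhd_def)
    qed
    moreover have "card (D - {u}) < card D" using u finD by (meson card_Diff1_less)
    moreover have "D - {u} \<subseteq> verts (local_complement G' u)" using less.prems(3) G'(2) by auto
    ultimately obtain H v where H: "locally_equivalent (local_complement G' u) H"
      "v \<in> verts (local_complement G' u)" "insert v (nbhd H v) \<subseteq> cover (local_complement G' u) (D - {u})"
      using less.hyps[of "D - {u}" "local_complement G' u"] simple_graph_local_complement[OF G'(1)] by blast
    have "u \<in> verts G'" using u less.prems(3) G'(2) by auto
    from locally_equivalent_step[OF this H(1)] show ?thesis
      using H(2,3) cover_local_complement_odd[OF G'(1) u(2)] eq
      by (intro exI[of _ H] exI[of _ v]) simp
  qed
  show ?case
  proof (cases "D \<inter> odd_nbhd G D = {}")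
    case False
    then show ?thesis by (rule drop[OF G refl])
  next
    case dis: True
    show ?thesis
    proof (cases "\<exists>w. w \<notin> odd_nbhd G D \<and> D \<inter> nbhd G w \<noteq> {}")
      case True
      then obtain w where w: "w \<notin> odd_nbhd G D" "D \<inter> nbhd G w \<noteq> {}" by blast
      have wV: "w \<in> verts G" using w(2) nbhd_nonempty_verts[OF G] by auto
      let ?G = "local_complement G w"
      have "D \<inter> odd_nbhd ?G D \<noteq> {}"
      proof -
        obtain y where y: "y \<in> D" "y \<in> nbhd G w" using w(2) by blast
        then have "y \<in> odd_nbhd ?G D"
          using odd_nbhd_local_complement[OF G, of y w D] w(1) dis by auto
        then show ?thesis using y(1) by blast
      qed
      from drop[OF simple_graph_local_complement[OF G] verts_local_complement this]
      obtain H v where H: "locally_equivalent ?G H" "v \<in> verts ?G" "insert v (nbhd H v) \<subseteq> cover ?G D"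
        by blast
      from locally_equivalent_step[OF wV H(1)] show ?thesis
        using H(2,3) cover_local_complement_even[OF G w(1)]
        by (intro exI[of _ H] exI[of _ v]) simp
    next
      case False
      obtain v where v: "v \<in> D" using less.prems by blast
      then have "nbhd G v \<subseteq> odd_nbhd G D" using False nbhd_sym[of _ G v] by auto
      then have "insert v (nbhd G v) \<subseteq> cover G D" using v by (auto simp: cover_def)
      moreover have "locally_equivalent G G" by (simp add: locally_equivalent_def)
      ultimately show ?thesis using v less.prems(3) by blast
    qed
  qed
qed

lemma finite_cover: "simple_graph G \<Longrightarrow> D \<subseteq> verts G \<Longrightarrow> finite (cover G D)"
proof -
  assume G: "simple_graph G" "D \<subseteq> verts G"
  have "v \<in> verts G" if "v \<in> odd_nbhd G D" for v
  proof -
    have "nbhd G v \<noteq> {}" using that by (auto simp: odd_nbhd_def)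
    then show ?thesis by (rule nbhd_nonempty_verts[OF G(1)])
  qed
  then have "cover G D \<subseteq> verts G" using G by (auto simp: cover_def)
  then show ?thesis using G finite_subset unfolding simple_graph_def by blast
qed

lemma min_degree_le: "simple_graph G \<Longrightarrow> v \<in> verts G \<Longrightarrow> min_degree G \<le> card (nbhd G v)"
  unfolding min_degree_def simple_graph_def by (intro Min_le) auto

lemma local_min_degree_less_cover:
  assumes "simple_graph G" "D \<noteq> {}" "D \<subseteq> verts G"
  shows "local_min_degree G < card (cover G D)"
proof -
  obtain H v where H: "locally_equivalent G H" "v \<in> verts G" "insert v (nbhd H v) \<subseteq> cover G D"
    using shrink_to_vertex[OF assms] by blast
  have sH: "simple_graph H" "verts H = verts G" using locally_equivalent_simple_verts[OF H(1) assms(1)] by auto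
  have "local_min_degree G \<le> min_degree H"
    unfolding local_min_degree_def
    by (rule Min_le) (use finite_locally_equivalent[OF assms(1)] H(1) in auto)
  also have "\<dots> \<le> card (nbhd H v)" using min_degree_le[OF sH(1)] H(2) sH(2) by simp
  also have "\<dots> < card (insert v (nbhd H v))"
    using finite_nbhd[OF sH(1)] nbhd_irrefl[OF sH(1)] by simp
  also have "\<dots> \<le> card (cover G D)" using H(3) finite_cover[OF assms(1,3)] by (rule card_mono[rotated])
  finally show ?thesis .
qed

text \<open>The closed neighbourhood of a vertex of least degree in an optimal graph is the cover of
  a singleton; since local complementations can be undone, it is also a cover in
  \<open>G\<close>.\<close>

lemma local_min_degree_ge:
  assumes "simple_graph G" "verts G \<noteq> {}"
    and "\<And>D. D \<noteq> {} \<Longrightarrow> D \<subseteq> verts G \<Longrightarrow> B \<le> card (cover G D)"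
  shows "B \<le> Suc (local_min_degree G)"
proof -
  have "min_degree ` {G'. locally_equivalent G G'} \<noteq> {}" unfolding locally_equivalent_def by blast
  then have "local_min_degree G \<in> min_degree ` {G'. locally_equivalent G G'}"
    unfolding local_min_degree_def using finite_locally_equivalent[OF assms(1)] by (intro Min_in) auto
  then obtain H where H: "locally_equivalent G H" "local_min_degree G = min_degree H" by blast
  have sH: "simple_graph H" "verts H = verts G" using locally_equivalent_simple_verts[OF H(1) assms(1)] by auto
  have "min_degree H \<in> (\<lambda>v. card (nbhd H v)) ` verts H"
    unfolding min_degree_def using sH assms(2) by (intro Min_in) (auto simp: simple_graph_def)
  then obtain v where v: "v \<in> verts H" "min_degree H = card (nbhd H v)" by blast
  obtain D where D: "D \<noteq> {}" "D \<subseteq> verts G" "cover G D = cover H {v}"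
    using cover_locally_equivalent[OF locally_equivalent_sym[OF H(1) assms(1)] sH(1), of "{v}"] v sH by auto
  have "card (cover H {v}) = Suc (min_degree H)"
    using v(2) finite_nbhd[OF sH(1)] nbhd_irrefl[OF sH(1)] by (simp add: cover_singleton)
  then show ?thesis using assms(3)[OF D(1,2)] D(3) H(2) by simp
qed

section \<open>Minimum distances over the field with two elements\<close>

declare sum_of_bool_eq [simp del] sum_mult_of_bool_eq [simp del] sum_of_bool_mult_eq [simp del]

definition wt :: "nat \<Rightarrow> (nat \<Rightarrow> bit) \<Rightarrow> nat" where
  "wt N f = (\<Sum>r<N. of_bool (f r = 1))"

definition mv :: "nat \<Rightarrow> (nat \<Rightarrow> nat \<Rightarrow> bool) \<Rightarrow> (nat \<Rightarrow> bit) \<Rightarrow> nat \<Rightarrow> bit" where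
  "mv K A x r = (\<Sum>c<K. of_bool (A r c) * x c)"

text \<open>The condition ranges over nonzero messages rather than nonzero codewords; for positive
  \<open>d\<close> it therefore includes that the encoding is injective.\<close>

definition mindist :: "nat \<Rightarrow> nat \<Rightarrow> (nat \<Rightarrow> nat \<Rightarrow> bool) \<Rightarrow> nat \<Rightarrow> bool" where
  "mindist N K A d \<longleftrightarrow> (\<forall>x. (\<exists>c<K. x c = 1) \<longrightarrow> d \<le> wt N (mv K A x))"

text \<open>The Kronecker product; the index \<open>b * N + a\<close> stands for the pair of
  \<open>a\<close> in the first and \<open>b\<close> in the second factor.\<close>

definition tens :: "(nat \<Rightarrow> nat \<Rightarrow> bool) \<Rightarrow> nat \<Rightarrow> nat \<Rightarrow> (nat \<Rightarrow> nat \<Rightarrow> bool) \<Rightarrow> nat \<Rightarrow> nat \<Rightarrow> bool" where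
  "tens A N K B r c \<longleftrightarrow> A (r mod N) (c mod K) \<and> B (r div N) (c div K)"

lemma wt_cong: "(\<And>r. r < N \<Longrightarrow> f r = g r) \<Longrightarrow> wt N f = wt N g"
  unfolding wt_def by (intro sum.cong) auto

lemma sum_lessThan_add: "(\<Sum>i<a + k. f i) = (\<Sum>i<a. f i) + (\<Sum>i<k. f (a + i))"
  for f :: "nat \<Rightarrow> 'a::comm_monoid_add"
  by (induction k) (auto simp: add.assoc)

lemma sum_lessThan_mult: "(\<Sum>i<m * k. f i) = (\<Sum>b<k. \<Sum>a<m. f (b * m + a))"
  for f :: "nat \<Rightarrow> 'a::comm_monoid_add"
proof (induction k)
  case (Suc k)
  have "(\<Sum>i<m * Suc k. f i) = (\<Sum>i<m * k + m. f i)" by (simp add: add.commute)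
  also have "\<dots> = (\<Sum>i<m * k. f i) + (\<Sum>i<m. f (k * m + i))"
    by (simp only: sum_lessThan_add mult.commute[of k m])
  finally show ?case by (simp only: Suc sum.lessThan_Suc)
qed simp

lemma wt_mult: "wt (M * N) f = (\<Sum>a<M. wt N (\<lambda>b. f (b * M + a)))"
  unfolding wt_def sum_lessThan_mult by (rule sum.swap)

lemma mv_tens:
  assumes "a < N"
  shows "mv (K * K') (tens A N K B) x (b * N + a) = mv K' B (\<lambda>j. mv K A (\<lambda>i. x (j * K + i)) a) b"
proof -
  have "mv (K * K') (tens A N K B) x (b * N + a) =
    (\<Sum>j<K'. \<Sum>i<K. of_bool (A a i \<and> B b j) * x (j * K + i))"
    unfolding mv_def sum_lessThan_mult tens_def using assms by (intro sum.cong refl) simp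
  also have "\<dots> = (\<Sum>j<K'. of_bool (B b j) * (\<Sum>i<K. of_bool (A a i) * x (j * K + i)))"
    by (intro sum.cong refl) (simp only: sum_distrib_left of_bool_conj mult.assoc mult.left_commute[of "of_bool (A a _)"])
  finally show ?thesis by (simp add: mv_def)
qed

text \<open>A position \<open>a\<close> in the support of some of the \<open>A\<close>-codewords
  yields a nonzero message for \<open>B\<close> and so contributes at least \<open>b\<close>.
  Keeping the union of the supports, not just one of them, is what later gives the factor 3/2 for
  rank two.\<close>

lemma wt_tens_ge:
  assumes "mindist N' K' B b"
  shows "(\<Sum>a<N. of_bool (\<exists>j<K'. mv K A (\<lambda>i. x (j * K + i)) a = 1)) * b \<le> wt (N * N') (mv (K * K') (tens A N K B) x)"
proof -
  have "(\<Sum>a<N. of_bool (\<exists>j<K'. mv K A (\<lambda>i. x (j * K + i)) a = 1)) * b =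
    (\<Sum>a<N. of_bool (\<exists>j<K'. mv K A (\<lambda>i. x (j * K + i)) a = 1) * b)"
    by (rule sum_distrib_right)
  also have "\<dots> \<le> (\<Sum>a<N. wt N' (mv K' B (\<lambda>j. mv K A (\<lambda>i. x (j * K + i)) a)))"
  proof (rule sum_mono)
    fix a
    show "of_bool (\<exists>j<K'. mv K A (\<lambda>i. x (j * K + i)) a = 1) * b \<le> wt N' (mv K' B (\<lambda>j. mv K A (\<lambda>i. x (j * K + i)) a))"
      using assms unfolding mindist_def by auto
  qed
  also have "\<dots> = wt (N * N') (mv (K * K') (tens A N K B) x)"
    unfolding wt_mult by (intro sum.cong refl wt_cong) (simp add: mv_tens)
  finally show ?thesis .
qed

lemma ex_mult_index: "(\<exists>c<K * K'. P c) \<longleftrightarrow> (\<exists>j<K'. \<exists>i<K. P (j * K + i))" for K K' :: nat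
proof
  assume "\<exists>c<K * K'. P c"
  then obtain c where c: "c < K * K'" "P c" by blast
  then have "K > 0" by (cases K) auto
  then have "c div K < K'" "c mod K < K" using c by (auto simp: less_mult_imp_div_less mult.commute)
  then show "\<exists>j<K'. \<exists>i<K. P (j * K + i)"
    using c(2) by (intro exI[of _ "c div K"] conjI exI[of _ "c mod K"]) auto
next
  assume "\<exists>j<K'. \<exists>i<K. P (j * K + i)"
  then obtain j i where ji: "j < K'" "i < K" "P (j * K + i)" by blast
  have "j * K + i < Suc j * K" using ji by simp
  also have "\<dots> \<le> K' * K" using ji by (intro mult_right_mono) auto
  finally show "\<exists>c<K * K'. P c" using ji(3) by (auto simp: mult.commute)
qed

lemma mindist_tens:
  assumes "mindist N K A a" "mindist N' K' B b"
  shows "mindist (N * N') (K * K') (tens A N K B) (a * b)"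
  unfolding mindist_def
proof (intro allI impI)
  fix x :: "nat \<Rightarrow> bit" assume "\<exists>c<K * K'. x c = 1"
  then obtain j where j: "j < K'" "\<exists>i<K. x (j * K + i) = 1" unfolding ex_mult_index by blast
  then have "a \<le> wt N (mv K A (\<lambda>i. x (j * K + i)))"
    using assms(1)[unfolded mindist_def, rule_format, of "\<lambda>i. x (j * K + i)"] by blast
  also have "\<dots> \<le> (\<Sum>a<N. of_bool (\<exists>j<K'. mv K A (\<lambda>i. x (j * K + i)) a = 1))"
    unfolding wt_def using j(1) by (intro sum_mono) auto
  finally have "a * b \<le> (\<Sum>a<N. of_bool (\<exists>j<K'. mv K A (\<lambda>i. x (j * K + i)) a = 1)) * b"
    by (rule mult_right_mono) simp
  then show "a * b \<le> wt (N * N') (mv (K * K') (tens A N K B) x)"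
    using wt_tens_ge[OF assms(2), of K A x N] by linarith
qed

lemma mv_tens_rank1:
  assumes "a < N" "0 < K"
  shows "mv (K * K') (tens A N K B) (\<lambda>c. x (c mod K) * y (c div K)) (b * N + a) = mv K A x a * mv K' B y b"
proof -
  have "mv (K * K') (tens A N K B) (\<lambda>c. x (c mod K) * y (c div K)) (b * N + a) =
    (\<Sum>j<K'. of_bool (B b j) * (\<Sum>i<K. of_bool (A a i) * (x i * y j)))"
    unfolding mv_tens[OF assms(1)] using assms(2) by (simp add: mv_def)
  also have "\<dots> = (\<Sum>j<K'. (of_bool (B b j) * y j) * (\<Sum>i<K. of_bool (A a i) * x i))"
  proof (intro sum.cong refl)
    fix j
    have "(\<Sum>i<K. of_bool (A a i) * (x i * y j)) = (\<Sum>i<K. of_bool (A a i) * x i) * y j"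
      by (simp only: sum_distrib_right mult.assoc)
    then show "of_bool (B b j) * (\<Sum>i<K. of_bool (A a i) * (x i * y j)) =
      of_bool (B b j) * y j * (\<Sum>i<K. of_bool (A a i) * x i)" by (simp only: ac_simps)
  qed
  also have "\<dots> = mv K' B y b * mv K A x a"
    unfolding mv_def by (rule sum_distrib_right[symmetric])
  finally show ?thesis by (simp only: mult.commute)
qed

lemma wt_tens_rank1:
  assumes "0 < K"
  shows "wt (N * N') (mv (K * K') (tens A N K B) (\<lambda>c. x (c mod K) * y (c div K))) = wt N (mv K A x) * wt N' (mv K' B y)"
proof -
  have "wt (N * N') (mv (K * K') (tens A N K B) (\<lambda>c. x (c mod K) * y (c div K))) =
    (\<Sum>a<N. wt N' (\<lambda>b. mv K A x a * mv K' B y b))"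
    unfolding wt_mult using assms by (intro sum.cong refl wt_cong mv_tens_rank1) auto
  also have "\<dots> = (\<Sum>a<N. of_bool (mv K A x a = 1) * wt N' (mv K' B y))"
    by (intro sum.cong refl) (auto simp: wt_def sum_distrib_left)
  finally show ?thesis by (simp add: wt_def sum_distrib_right)
qed

primrec tpow :: "(nat \<Rightarrow> nat \<Rightarrow> bool) \<Rightarrow> nat \<Rightarrow> nat \<Rightarrow> nat \<Rightarrow> nat \<Rightarrow> nat \<Rightarrow> bool" where
  "tpow A N K 0 = (\<lambda>r c. True)"
| "tpow A N K (Suc t) = tens A N K (tpow A N K t)"

lemma mindist_tpow: "mindist N K A a \<Longrightarrow> mindist (N ^ t) (K ^ t) (tpow A N K t) (a ^ t)"
proof (induction t)
  case 0
  then show ?case by (auto simp: mindist_def wt_def mv_def)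
next
  case (Suc t)
  then show ?case using mindist_tens[of N K A a] by simp
qed

text \<open>Weights of rank-one messages multiply exactly, so the upper bound is amplified at the
  same rate as the lower bound of \<open>mindist_tpow\<close>.\<close>

lemma wt_tpow:
  assumes "\<exists>c<K. x c = 1"
  shows "\<exists>y. (\<exists>c<K ^ t. y c = 1) \<and> wt (N ^ t) (mv (K ^ t) (tpow A N K t) y) = wt N (mv K A x) ^ t"
proof (induction t)
  case 0
  then show ?case by (intro exI[of _ "\<lambda>_. 1"]) (auto simp: wt_def mv_def)
next
  case (Suc t)
  then obtain y where y: "\<exists>c<K ^ t. y c = 1" "wt (N ^ t) (mv (K ^ t) (tpow A N K t) y) = wt N (mv K A x) ^ t" by blast
  have "\<exists>c<K * K ^ t. x (c mod K) * y (c div K) = 1"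
    unfolding ex_mult_index using assms y(1) by force
  moreover have "0 < K" using assms by auto
  ultimately show ?case using wt_tens_rank1[of K N "N ^ t" "K ^ t" A "tpow A N K t" x y] y(2)
    by (intro exI[of _ "\<lambda>c. x (c mod K) * y (c div K)"]) simp
qed

section \<open>Quadratic systems\<close>

text \<open>All equations are homogeneous of degree two, hence linear and homogeneous in the matrix
  with entries \<open>z i * z j\<close>. \<open>Z\<close> forbids pairs, \<open>Q\<close> says that
  \<open>z d = 1\<close> forces \<open>z a = z b\<close>, and \<open>S\<close>, once
  \<open>z 0 = 1\<close>, asks for an odd number of ones in an interval.\<close>

definition solves :: "nat \<Rightarrow> (nat \<Rightarrow> nat \<Rightarrow> bool) \<Rightarrow> (nat \<Rightarrow> nat \<Rightarrow> nat \<Rightarrow> bool) \<Rightarrow> (nat \<Rightarrow> nat \<Rightarrow> bool) \<Rightarrow> (nat \<Rightarrow> bit) \<Rightarrow> bool" where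
  "solves n Z Q S z \<longleftrightarrow> (\<exists>a<n. z a = 1) \<and>
     (\<forall>a<n. \<forall>b<n. Z a b \<longrightarrow> z a * z b = 0) \<and>
     (\<forall>d<n. \<forall>a<n. \<forall>b<n. Q d a b \<longrightarrow> z d * (z a + z b) = 0) \<and>
     (\<forall>a<n. \<forall>l<n. S a l \<longrightarrow> z 0 * ((\<Sum>i<l. z (a + i)) + z 0) = 0)"

text \<open>The coefficient of the matrix entry at \<open>i\<close>, \<open>j\<close> in a linear
  constraint; kind 0 expresses symmetry. Writing sums with \<open>\<noteq>\<close> makes coinciding
  positions cancel, as they must modulo 2.\<close>

definition constr :: "(nat \<Rightarrow> nat \<Rightarrow> bool) \<Rightarrow> (nat \<Rightarrow> nat \<Rightarrow> nat \<Rightarrow> bool) \<Rightarrow> (nat \<Rightarrow> nat \<Rightarrow> bool) \<Rightarrow>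
    nat \<Rightarrow> nat \<Rightarrow> nat \<Rightarrow> nat \<Rightarrow> nat \<Rightarrow> nat \<Rightarrow> bool" where
  "constr Z Q S k d a b i j =
     (if k = 0 then (i = a \<and> j = b) \<noteq> (i = b \<and> j = a)
      else if k = 1 then Z a b \<and> i = a \<and> j = b
      else if k = 2 then Q d a b \<and> (i = d \<and> j = a) \<noteq> (i = d \<and> j = b)
      else S a b \<and> (j = 0 \<and> a \<le> i \<and> i < a + b) \<noteq> (i = 0 \<and> j = 0))"

lemma of_bool_xor: "of_bool (p \<noteq> q) = of_bool p + (of_bool q :: bit)"
  by (cases p; cases q) auto

lemma sum_delta2:
  fixes X :: "nat \<Rightarrow> nat \<Rightarrow> bit"
  assumes "a < n" "b < n"
  shows "(\<Sum>i<n. \<Sum>j<n. of_bool (i = a \<and> j = b) * X i j) = X a b"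
proof -
  have "(\<Sum>j<n. of_bool (i = a \<and> j = b) * X i j) = (if i = a then X i b else 0)" for i
  proof -
    have "(\<Sum>j<n. of_bool (i = a \<and> j = b) * X i j) = (\<Sum>j<n. if j = b then of_bool (i = a) * X i j else 0)"
      by (intro sum.cong refl) auto
    then show ?thesis using assms(2) by (simp only: sum.delta finite_lessThan lessThan_iff if_True) auto
  qed
  then show ?thesis using assms(1) by (simp only: sum.delta finite_lessThan lessThan_iff if_True)
qed

definition cval :: "(nat \<Rightarrow> nat \<Rightarrow> bool) \<Rightarrow> (nat \<Rightarrow> nat \<Rightarrow> nat \<Rightarrow> bool) \<Rightarrow> (nat \<Rightarrow> nat \<Rightarrow> bool) \<Rightarrow>
    (nat \<Rightarrow> nat \<Rightarrow> bit) \<Rightarrow> nat \<Rightarrow> nat \<Rightarrow> nat \<Rightarrow> nat \<Rightarrow> bit" where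
  "cval Z Q S X k d a b =
     (if k = 0 then X a b + X b a
      else if k = 1 then of_bool (Z a b) * X a b
      else if k = 2 then of_bool (Q d a b) * (X d a + X d b)
      else of_bool (S a b) * ((\<Sum>i<b. X (a + i) 0) + X 0 0))"

lemma of_bool_constr:
  "(of_bool (constr Z Q S k d a b i j) :: bit) =
     (if k = 0 then of_bool (i = a \<and> j = b) + of_bool (i = b \<and> j = a)
      else if k = 1 then of_bool (Z a b) * of_bool (i = a \<and> j = b)
      else if k = 2 then of_bool (Q d a b) * (of_bool (i = d \<and> j = a) + of_bool (i = d \<and> j = b))
      else of_bool (S a b) * (of_bool (j = 0 \<and> a \<le> i \<and> i < a + b) + of_bool (i = 0 \<and> j = 0)))"
  unfolding constr_def of_bool_xor[symmetric] of_bool_conj[symmetric] by (simp only: split: if_split) blast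

lemma sum_column:
  fixes X :: "nat \<Rightarrow> nat \<Rightarrow> bit"
  assumes "0 < n" "a + b \<le> n"
  shows "(\<Sum>i<n. \<Sum>j<n. of_bool (j = 0 \<and> a \<le> i \<and> i < a + b) * X i j) = (\<Sum>i<b. X (a + i) 0)"
proof -
  have "(\<Sum>j<n. of_bool (j = 0 \<and> a \<le> i \<and> i < a + b) * X i j) = (if a \<le> i \<and> i < a + b then X i 0 else 0)" for i
  proof -
    have "(\<Sum>j<n. of_bool (j = 0 \<and> a \<le> i \<and> i < a + b) * X i j) =
      (\<Sum>j<n. if j = 0 then of_bool (a \<le> i \<and> i < a + b) * X i j else 0)"
      by (intro sum.cong refl) auto
    then show ?thesis using assms(1) by (simp only: sum.delta finite_lessThan lessThan_iff if_True) auto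
  qed
  then have "(\<Sum>i<n. \<Sum>j<n. of_bool (j = 0 \<and> a \<le> i \<and> i < a + b) * X i j) =
    (\<Sum>i<n. if a \<le> i \<and> i < a + b then X i 0 else 0)" by (simp only:)
  also have "\<dots> = (\<Sum>i<b. X (a + i) 0)"
  proof -
    obtain m where m: "n = a + b + m" using assms(2) le_Suc_ex by blast
    have "(\<Sum>i<a. if a \<le> i \<and> i < a + b then X i 0 else 0) = 0"
      "(\<Sum>i<m. if a \<le> a + b + i \<and> a + b + i < a + b then X (a + b + i) 0 else 0) = 0"
      "(\<Sum>i<b. if a \<le> a + i \<and> a + i < a + b then X (a + i) 0 else 0) = (\<Sum>i<b. X (a + i) 0)"
      by (auto intro!: sum.neutral sum.cong)
    then show ?thesis by (simp only: m sum_lessThan_add add_0_left add_0_right)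
  qed
  finally show ?thesis .
qed

lemma sum_constr:
  fixes X :: "nat \<Rightarrow> nat \<Rightarrow> bit"
  assumes "d < n" "a < n" "b < n" and S: "\<And>a l. S a l \<Longrightarrow> a + l \<le> n"
  shows "(\<Sum>i<n. \<Sum>j<n. of_bool (constr Z Q S k d a b i j) * X i j) = cval Z Q S X k d a b"
proof -
  define T where "T = (\<lambda>p. \<Sum>i<n. \<Sum>j<n. p i j * X i j)"
  have add: "T (\<lambda>i j. p i j + q i j) = T p + T q" for p q
    by (simp only: T_def distrib_right sum.distrib)
  have mult: "T (\<lambda>i j. c * p i j) = c * T p" for c p
    by (simp only: T_def mult.assoc sum_distrib_left)
  have delta: "T (\<lambda>i j. of_bool (i = a \<and> j = b)) = X a b" if "a < n" "b < n" for a b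
    unfolding T_def using that by (rule sum_delta2)
  have n0: "0 < n" using assms by simp
  have S: "of_bool (S a b) * T (\<lambda>i j. of_bool (j = 0 \<and> a \<le> i \<and> i < a + b)) = of_bool (S a b) * (\<Sum>i<b. X (a + i) 0)"
    unfolding T_def using sum_column[OF n0, of a b X] S[of a b] by (cases "S a b") (simp_all only: of_bool_eq mult_zero_left)
  have "(\<Sum>i<n. \<Sum>j<n. of_bool (constr Z Q S k d a b i j) * X i j) = T (\<lambda>i j. of_bool (constr Z Q S k d a b i j))"
    by (simp only: T_def)
  also have "\<dots> = cval Z Q S X k d a b"
    unfolding of_bool_constr cval_def
    by (cases "k = 0"; cases "k = 1"; cases "k = 2")
      (simp_all only: if_True if_False add mult delta assms(1-3) n0 distrib_left S simp_thms)
  finally show ?thesis .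
qed

text \<open>Every constraint is repeated in \<open>N\<^sup>2\<close> rows.\<close>

definition base_code :: "(nat \<Rightarrow> nat \<Rightarrow> bool) \<Rightarrow> nat \<Rightarrow> nat \<Rightarrow> (nat \<Rightarrow> nat \<Rightarrow> bool) \<Rightarrow> (nat \<Rightarrow> nat \<Rightarrow> nat \<Rightarrow> bool) \<Rightarrow>
    (nat \<Rightarrow> nat \<Rightarrow> bool) \<Rightarrow> nat \<Rightarrow> nat \<Rightarrow> bool" where
  "base_code E N n Z Q S r c \<longleftrightarrow>
     (if r div (N * N) = 0 then tens E N n E r c
      else constr Z Q S ((r div (N * N) - 1) div n ^ 3) ((r div (N * N) - 1) div n ^ 2 mod n)
        ((r div (N * N) - 1) div n mod n) ((r div (N * N) - 1) mod n) (c div n) (c mod n))"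

lemma wt_blocks: "wt (M * L) f = (\<Sum>b<L. wt M (\<lambda>a. f (b * M + a)))"
  unfolding wt_def by (rule sum_lessThan_mult)

lemma wt_block_le: "b < L \<Longrightarrow> wt M (\<lambda>a. f (b * M + a)) \<le> wt (M * L) f"
  unfolding wt_blocks by (rule member_le_sum) auto

lemma mv_base_code_0:
  assumes "r < N * N"
  shows "mv (n * n) (base_code E N n Z Q S) x r = mv (n * n) (tens E N n E) x r"
  using assms by (simp add: mv_def base_code_def)

lemma mv_base_code_Suc:
  assumes "a < N * N" "0 < n" and S: "\<And>a l. S a l \<Longrightarrow> a + l \<le> n"
  shows "mv (n * n) (base_code E N n Z Q S) x (Suc e * (N * N) + a) =
    cval Z Q S (\<lambda>i j. x (i * n + j)) (e div n ^ 3) (e div n ^ 2 mod n) (e div n mod n) (e mod n)"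
proof -
  let ?M = "N * N"
  have "(Suc e * ?M + a) div ?M = Suc e" using assms(1) by (intro div_nat_eqI) (auto simp: algebra_simps)
  then have b: "base_code E N n Z Q S (Suc e * ?M + a) c =
    constr Z Q S (e div n ^ 3) (e div n ^ 2 mod n) (e div n mod n) (e mod n) (c div n) (c mod n)" for c
    unfolding base_code_def by simp
  have "mv (n * n) (base_code E N n Z Q S) x (Suc e * ?M + a) =
    (\<Sum>i<n. \<Sum>j<n. of_bool (constr Z Q S (e div n ^ 3) (e div n ^ 2 mod n) (e div n mod n) (e mod n) i j) * x (i * n + j))"
    unfolding mv_def b sum_lessThan_mult by (intro sum.cong refl) simp
  also have "\<dots> = cval Z Q S (\<lambda>i j. x (i * n + j)) (e div n ^ 3) (e div n ^ 2 mod n) (e div n mod n) (e mod n)"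
    by (rule sum_constr) (use assms in auto)
  finally show ?thesis .
qed

lemma bit_add_self [simp]: "x + x = (0 :: bit)"
  by (cases x) auto

lemma bit_add_eq_0 [simp]: "x + y = 0 \<longleftrightarrow> x = (y :: bit)"
  by (cases x; cases y) auto

theorem base_code_weight_le:
  assumes z: "solves n Z Q S z" and S: "\<And>a l. S a l \<Longrightarrow> a + l \<le> n" and h: "wt N (mv n E z) \<le> h"
  shows "\<exists>x. (\<exists>c<n * n. x c = 1) \<and> wt (N * N * L) (mv (n * n) (base_code E N n Z Q S) x) \<le> h * h"
proof -
  \<comment> \<open>The rank-one matrix given by \<open>z\<close>, flattened: it meets every
    constraint, so only the tensor block has weight.\<close>
  define x where "x = (\<lambda>c. z (c mod n) * z (c div n))"
  obtain a where a: "a < n" "z a = 1" using z unfolding solves_def by blast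
  then have n: "0 < n" by simp
  have "\<exists>c<n * n. x c = 1"
    unfolding ex_mult_index x_def using a by (intro exI[of _ a] conjI) auto
  moreover have "wt (N * N * L) (mv (n * n) (base_code E N n Z Q S) x) \<le> h * h"
  proof -
    have X: "x (i * n + j) = z j * z i" if "j < n" for i j using that by (simp add: x_def)
    have c0: "cval Z Q S (\<lambda>i j. x (i * n + j)) k d a b = 0" if "d < n" "a < n" "b < n" for k d a b
    proof -
      have k1: "Z a b \<Longrightarrow> z a * z b = 0" and k2: "Q d a b \<Longrightarrow> z d * (z a + z b) = 0"
        and k3: "S a b \<Longrightarrow> z 0 * ((\<Sum>i<b. z (a + i)) + z 0) = 0"
        using z that unfolding solves_def by blast+
      have s: "(\<Sum>i<b. x ((a + i) * n + 0)) + x (0 * n + 0) = z 0 * ((\<Sum>i<b. z (a + i)) + z 0)"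
        using X[OF n] by (simp only: sum_distrib_left distrib_left)
      consider "k = 0" | "k = 1" | "k = 2" | "k > 2" by linarith
      then show ?thesis
      proof cases
        case 1
        then show ?thesis using X that by (auto simp: cval_def)
      next
        case 2
        then show ?thesis using X that k1 by (auto simp: cval_def mult.commute)
      next
        case 3
        have "x (d * n + a) + x (d * n + b) = z d * (z a + z b)" using X that by (simp only: distrib_left mult.commute)
        then show ?thesis using 3 k2 by (auto simp: cval_def)
      next
        case 4
        then show ?thesis using k3 s unfolding cval_def by (cases "S a b") simp_all
      qed
    qed
    have blk: "wt (N * N) (\<lambda>a. mv (n * n) (base_code E N n Z Q S) x (b * (N * N) + a)) \<le> (if b = 0 then h * h else 0)" for b
    proof (cases b)
      case 0
      have "wt (N * N) (\<lambda>a. mv (n * n) (base_code E N n Z Q S) x (b * (N * N) + a)) = wt (N * N) (mv (n * n) (tens E N n E) x)"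
        using 0 by (intro wt_cong) (simp add: mv_base_code_0)
      also have "\<dots> = wt N (mv n E z) * wt N (mv n E z)"
        unfolding x_def using wt_tens_rank1[OF n, of N N n E E z z] by simp
      also have "\<dots> \<le> h * h" using h by (intro mult_le_mono)
      finally show ?thesis using 0 by simp
    next
      case (Suc e)
      have "wt (N * N) (\<lambda>a. mv (n * n) (base_code E N n Z Q S) x (b * (N * N) + a)) = wt (N * N) (\<lambda>a. 0)"
        using n by (intro wt_cong) (simp only: Suc mv_base_code_Suc[OF _ n S] c0 mod_less_divisor)
      then show ?thesis by (simp add: wt_def)
    qed
    have "wt (N * N * L) (mv (n * n) (base_code E N n Z Q S) x) \<le> (\<Sum>b<L. if b = 0 then h * h else 0)"
      unfolding wt_blocks[of "N * N" L] by (intro sum_mono blk)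
    then show ?thesis by (cases "L = 0") auto
  qed
  ultimately show ?thesis by blast
qed

text \<open>Over two elements, each position of the joint support lies in exactly two of the
  supports of \<open>f\<close>, \<open>g\<close> and \<open>f + g\<close>.\<close>

lemma union_weight:
  assumes "d \<le> wt N f" "d \<le> wt N g" "d \<le> wt N (\<lambda>r. f r + g r)"
  shows "3 * d \<le> 2 * (\<Sum>r<N. of_bool (f r = 1 \<or> g r = 1))"
proof -
  have "of_bool (p = 1) + of_bool (q = 1) + of_bool (p + q = 1) = (2 * of_bool (p = 1 \<or> q = 1) :: nat)" for p q :: bit
    by (cases p; cases q) auto
  then have "(\<Sum>r<N. of_bool (f r = 1) + of_bool (g r = 1) + of_bool (f r + g r = 1)) = (\<Sum>r<N. 2 * of_bool (f r = 1 \<or> g r = 1) :: nat)"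
    by (simp only:)
  then have "wt N f + wt N g + wt N (\<lambda>r. f r + g r) = 2 * (\<Sum>r<N. of_bool (f r = 1 \<or> g r = 1))"
    unfolding wt_def by (simp only: sum.distrib sum_distrib_left)
  then show ?thesis using assms by linarith
qed

lemma mv_add: "mv K A (\<lambda>c. x c + y c) r = mv K A x r + mv K A y r"
  by (simp only: mv_def distrib_left sum.distrib)

text \<open>A symmetric matrix over the field with two elements has rank at most one iff its nonzero rows
  coincide, and then it is \<open>z z\<^sup>T\<close>. Two different nonzero rows span a code of support at least
  \<open>3 d / 2\<close>.\<close>

theorem mindist_base_code:
  assumes no: "\<And>z. \<not> solves n Z Q S z" and S: "\<And>a l. S a l \<Longrightarrow> a + l \<le> n" and E: "mindist N n E d"
    and B: "2 * B \<le> 3 * d * d" "B \<le> N * N"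
  shows "mindist (N * N * (1 + 4 * n ^ 3)) (n * n) (base_code E N n Z Q S) B"
  unfolding mindist_def
proof (intro allI impI)
  fix x :: "nat \<Rightarrow> bit" assume x: "\<exists>c<n * n. x c = 1"
  define X where "X = (\<lambda>i j. x (i * n + j))"
  obtain j0 i0 where j0: "j0 < n" "i0 < n" "X j0 i0 = 1" using x unfolding ex_mult_index X_def by blast
  then have n: "0 < n" by simp
  let ?F = "base_code E N n Z Q S"
  let ?w = "wt (N * N * (1 + 4 * n ^ 3)) (mv (n * n) ?F x)"
  show "B \<le> ?w"
  proof (cases "\<exists>k<4. \<exists>d<n. \<exists>a<n. \<exists>b<n. cval Z Q S X k d a b = 1")
    case True
    then obtain k d a b where kdab: "k < 4" "d < n" "a < n" "b < n" "cval Z Q S X k d a b = 1" by blast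
    \<comment> \<open>The number of the violated constraint in base \<open>n\<close>. Its block
      consists of ones only and alone has weight \<open>N * N\<close>.\<close>
    define e where "e = ((k * n + d) * n + a) * n + b"
    have 1: "e mod n = b" "e div n = (k * n + d) * n + a" using kdab by (auto simp: e_def)
    have 2: "e div n mod n = a" "e div n div n = k * n + d" using kdab 1 by auto
    have 3: "e div n div n mod n = d" "e div n div n div n = k" using kdab 2 by auto
    have 4: "e div n ^ 2 = e div n div n" "e div n ^ 3 = e div n div n div n"
      by (simp_all add: power2_eq_square power3_eq_cube div_mult2_eq)
    have "e < 4 * n ^ 3"
    proof -
      have "e div n ^ 3 < 4" using 3 4 kdab by simp
      then show ?thesis using n by (simp add: div_less_iff_less_mult mult.commute)
    qed
    then have "wt (N * N) (\<lambda>a. mv (n * n) ?F x (Suc e * (N * N) + a)) \<le> ?w"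
      by (intro wt_block_le) simp
    moreover have "wt (N * N) (\<lambda>a. mv (n * n) ?F x (Suc e * (N * N) + a)) = wt (N * N) (\<lambda>a. 1)"
    proof (rule wt_cong)
      fix r assume "r < N * N"
      from mv_base_code_Suc[OF this n S, where E = E and Z = Z and Q = Q and x = x and e = e]
      show "mv (n * n) ?F x (Suc e * (N * N) + r) = 1"
        using kdab(5) unfolding X_def 4 1(1) 2(1) 3 by simp
    qed
    ultimately show ?thesis using B(2) by (simp add: wt_def)
  next
    case False
    then have c0: "cval Z Q S X k d a b = 0" if "k < 4" "d < n" "a < n" "b < n" for k d a b
      using that bit_not_one_iff by blast
    have sym: "X a b = X b a" if "a < n" "b < n" for a b
      using c0[of 0 0 a b] that n by (cases "X a b"; cases "X b a") (simp_all add: cval_def)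
    \<comment> \<open>If all nonzero rows agreed with \<open>z\<close>, then symmetry and
      \<open>z i0 = 1\<close> would show that row \<open>i\<close> is nonzero exactly when
      \<open>z i = 1\<close>; the matrix would have rank one and \<open>z\<close> would be a
      solution.\<close>
    have "\<exists>j<n. \<exists>l<n. (\<exists>i<n. X j i = 1) \<and> (\<exists>i<n. X l i = 1) \<and> (\<exists>i<n. X j i \<noteq> X l i)"
    proof (rule ccontr)
      assume no2: "\<not> ?thesis"
      define z where "z = X j0"
      have r: "X i j = (if \<exists>i'<n. X i i' = 1 then z j else 0)" if "i < n" "j < n" for i j
      proof (cases "\<exists>i'<n. X i i' = 1")
        case True
        then have "X i j = X j0 j" using no2 that j0 by blast
        then show ?thesis using True by (simp add: z_def)
      next
        case False
        then have "X i j \<noteq> 1" using that by blast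
        then show ?thesis using False by auto
      qed
      have zi0: "z i0 = 1" using j0 by (simp add: z_def)
      have "X i0 j0 = 1" using sym[of i0 j0] j0 by simp
      then have ri0: "X i0 j = z j" if "j < n" for j using r[of i0 j] that j0 by auto
      have rank1: "X i j = z i * z j" if "i < n" "j < n" for i j
      proof -
        have "X i i0 = z i" using sym[of i i0] ri0[of i] that j0 by simp
        moreover define q where "q = (\<exists>i'<n. X i i' = 1)"
        moreover have A: "X i j = (if q then z j else 0)" "X i i0 = (if q then z i0 else 0)"
          unfolding q_def by (rule r; use that j0 in simp)+
        ultimately have "z i = (if q then 1 else 0)" using zi0 by (simp only:)
        then show ?thesis unfolding A(1) by (cases q) simp_all
      qed
      have "solves n Z Q S z"
        unfolding solves_def
      proof (intro conjI allI impI)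
        show "\<exists>a<n. z a = 1" using zi0 j0 by blast
        show "z a * z b = 0" if "a < n" "b < n" "Z a b" for a b
          using c0[of 1 0 a b] that n rank1[of a b] by (simp add: cval_def)
        show "z d * (z a + z b) = 0" if "d < n" "a < n" "b < n" "Q d a b" for d a b
          using c0[of 2 d a b] that rank1[of d a] rank1[of d b] by (cases "z d") (auto simp: cval_def)
        show "z 0 * ((\<Sum>i<l. z (a + i)) + z 0) = 0" if "a < n" "l < n" "S a l" for a l
        proof -
          have "(\<Sum>i<l. X (a + i) 0) + X 0 0 = (\<Sum>i<l. z (a + i) * z 0) + z 0 * z 0"
            using rank1 S[OF that(3)] n by (intro arg_cong2[where f = "(+)"] sum.cong) auto
          also have "\<dots> = z 0 * ((\<Sum>i<l. z (a + i)) + z 0)"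
            by (simp only: distrib_left sum_distrib_left mult.commute)
          finally show ?thesis using c0[of 3 0 a l] that n by (simp add: cval_def del: bit_add_eq_0)
        qed
      qed
      then show False using no by blast
    qed
    then obtain j l where jl: "j < n" "l < n" "\<exists>i<n. X j i = 1" "\<exists>i<n. X l i = 1" "\<exists>i<n. X j i \<noteq> X l i" by blast
    have "\<exists>i<n. X j i + X l i = 1" using jl(5) by (metis bit_add_eq_0 bit_not_one_iff)
    then have "d \<le> wt N (mv n E (\<lambda>i. X j i + X l i))"
      by (rule E[unfolded mindist_def, rule_format])
    also have "mv n E (\<lambda>i. X j i + X l i) = (\<lambda>r. mv n E (X j) r + mv n E (X l) r)"
      by (rule ext) (rule mv_add)
    finally have w: "d \<le> wt N (\<lambda>r. mv n E (X j) r + mv n E (X l) r)" .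
    have w': "d \<le> wt N (mv n E (X j))" "d \<le> wt N (mv n E (X l))"
      by (rule E[unfolded mindist_def, rule_format], fact)+
    let ?c = "\<Sum>r<N. of_bool (mv n E (X j) r = 1 \<or> mv n E (X l) r = 1) :: nat"
    let ?c' = "\<Sum>r<N. of_bool (\<exists>j<n. mv n E (\<lambda>i. x (j * n + i)) r = 1) :: nat"
    have "3 * d \<le> 2 * ?c" by (rule union_weight[OF w' w])
    moreover have "?c \<le> ?c'"
      using jl(1,2) unfolding X_def by (intro sum_mono) auto
    moreover have "?c' * d \<le> wt (N * N) (mv (n * n) (tens E N n E) x)"
      by (rule wt_tens_ge[OF E])
    ultimately have "3 * d * d \<le> 2 * wt (N * N) (mv (n * n) (tens E N n E) x)"
      by (metis (no_types, lifting) mult.assoc mult_le_mono1 mult_le_mono2 le_trans)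
    also have "wt (N * N) (mv (n * n) (tens E N n E) x) = wt (N * N) (\<lambda>a. mv (n * n) ?F x (0 * (N * N) + a))"
      by (intro wt_cong) (simp add: mv_base_code_0)
    also have "\<dots> \<le> ?w" by (rule wt_block_le) simp
    finally show ?thesis using B(1) by linarith
  qed
qed

section \<open>A bipartite graph realising a minimum distance\<close>

text \<open>Points \<open>(u, y)\<close> and lines \<open>(m, b)\<close> with \<open>u, m < w\<close> and \<open>y, b < w\<^sup>2\<close>, all coded as numbers below
  \<open>w\<^sup>3\<close>; the point lies on the line iff \<open>y = m u + b\<close> modulo \<open>w\<^sup>2\<close>.\<close>

definition incident :: "nat \<Rightarrow> nat \<Rightarrow> nat \<Rightarrow> bool" where
  "incident w p l \<longleftrightarrow> p < w ^ 3 \<and> l < w ^ 3 \<and>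
     ((l div w\<^sup>2) * (p div w\<^sup>2) + l mod w\<^sup>2) mod w\<^sup>2 = p mod w\<^sup>2"

text \<open>Combining the four congruences, \<open>w^2\<close> divides the product of the
  differences of the slopes and of the first coordinates. Both differences are below
  \<open>w\<close> in absolute value, so the product is zero as an integer. The large modulus
  replaces a field, and \<open>w\<close> may be arbitrary.\<close>

lemma incident_unique:
  assumes "incident w p l" "incident w p l'" "incident w p' l" "incident w p' l'"
  shows "p = p' \<or> l = l'"
proof -
  define W where "W = w\<^sup>2"
  define x x' m m' where "x = p div W" and "x' = p' div W" and "m = l div W" and "m' = l' div W"
  have W3: "w ^ 3 = w * W" by (simp add: W_def power2_eq_square power3_eq_cube)
  have bd: "x < w" "x' < w" "m < w" "m' < w"
    using assms unfolding incident_def W3 W_def[symmetric] x_def x'_def m_def m'_def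
    by (simp_all add: less_mult_imp_div_less)
  then have w: "w > 0" by simp
  then have W: "W > 0" by (simp add: W_def)
  have dv: "int W dvd int a - int b" if "a mod W = b mod W" for a b
    using that by (metis mod_eq_dvd_iff zmod_int)
  have eq: "a = b" if "int W dvd int a - int b" "a < W" "b < W" for a b
    using that by (metis mod_eq_dvd_iff zmod_int mod_less of_nat_eq_iff)
  have e: "int W dvd int (m * x + l mod W) - int (p mod W)" "int W dvd int (m' * x + l' mod W) - int (p mod W)"
      "int W dvd int (m * x' + l mod W) - int (p' mod W)" "int W dvd int (m' * x' + l' mod W) - int (p' mod W)"
    using assms unfolding incident_def W_def[symmetric] x_def[symmetric] x'_def[symmetric] m_def[symmetric] m'_def[symmetric]
    by (intro dv; simp)+
  have "int W dvd (int m - int m') * (int x - int x')"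
  proof -
    have "int W dvd (int (m * x + l mod W) - int (p mod W)) - (int (m' * x + l' mod W) - int (p mod W))
        - (int (m * x' + l mod W) - int (p' mod W)) + (int (m' * x' + l' mod W) - int (p' mod W))"
      by (rule dvd_add[OF dvd_diff[OF dvd_diff[OF e(1,2)] e(3)] e(4)])
    also have "\<dots> = (int m - int m') * (int x - int x')" by (simp add: algebra_simps)
    finally show ?thesis .
  qed
  moreover have "\<bar>(int m - int m') * (int x - int x')\<bar> < int W"
  proof -
    have "\<bar>int m - int m'\<bar> < int w" "\<bar>int x - int x'\<bar> < int w" using bd by auto
    then have "\<bar>int m - int m'\<bar> * \<bar>int x - int x'\<bar> < int w * int w"
      by (intro mult_strict_mono') auto
    then show ?thesis by (simp add: abs_mult W_def power2_eq_square)
  qed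
  ultimately have "(int m - int m') * (int x - int x') = 0"
    using zdvd_not_zless[of "\<bar>(int m - int m') * (int x - int x')\<bar>" "int W"] by force
  then consider "m = m'" | "x = x'" by auto
  then show ?thesis
  proof cases
    case 1
    have "int W dvd (int (m * x + l mod W) - int (p mod W)) - (int (m' * x + l' mod W) - int (p mod W))"
      by (rule dvd_diff[OF e(1,2)])
    then have "l mod W = l' mod W" using 1 W by (intro eq) auto
    then show ?thesis using 1 unfolding m_def m'_def by (metis div_mult_mod_eq)
  next
    case 2
    have "int W dvd (int (m * x' + l mod W) - int (p' mod W)) - (int (m * x + l mod W) - int (p mod W))"
      by (rule dvd_diff[OF e(3,1)])
    then have "p mod W = p' mod W" using 2 W by (intro eq) auto
    then show ?thesis using 2 unfolding x_def x'_def by (metis div_mult_mod_eq)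
  qed
qed

lemma card_incident_points:
  assumes "l < w ^ 3"
  shows "w \<le> card {p. incident w p l}"
proof -
  have w: "w > 0" using assms by (cases w) auto
  define W where "W = w\<^sup>2"
  have W: "W > 0" "w ^ 3 = w * W" using w by (auto simp: W_def power2_eq_square power3_eq_cube)
  define f where "f = (\<lambda>x. x * W + ((l div W) * x + l mod W) mod W)"
  have fd: "f x div W = x" "f x mod W = ((l div W) * x + l mod W) mod W" for x
    using W by (auto simp: f_def)
  have "f ` {..<w} \<subseteq> {p. incident w p l}"
  proof safe
    fix x assume "x < w"
    have "f x < Suc x * W" using W by (simp add: f_def)
    also have "\<dots> \<le> w * W" using \<open>x < w\<close> by (intro mult_right_mono) auto
    finally have "f x < w ^ 3" using W by simp
    then show "incident w (f x) l"
      unfolding incident_def W_def[symmetric] using assms fd by simp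
  qed
  moreover have "inj_on f {..<w}" using fd(1) by (metis inj_onI)
  moreover have "finite {p. incident w p l}" by (rule finite_subset[of _ "{..<w ^ 3}"]) (auto simp: incident_def)
  ultimately show ?thesis using card_inj_on_le[of f "{..<w}"] by simp
qed

lemma card_incident_lines:
  assumes "p < w ^ 3"
  shows "w \<le> card {l. incident w p l}"
proof -
  have w: "w > 0" using assms by (cases w) auto
  define W where "W = w\<^sup>2"
  have W: "W > 0" "w ^ 3 = w * W" using w by (auto simp: W_def power2_eq_square power3_eq_cube)
  \<comment> \<open>The line of slope \<open>m\<close> through \<open>p\<close>; multiplying by
    \<open>W - 1\<close> is negation modulo \<open>W\<close>.\<close>
  define f where "f = (\<lambda>m. m * W + (m * (p div W) * (W - 1) + p mod W) mod W)"
  have fd: "f m div W = m" "f m mod W = (m * (p div W) * (W - 1) + p mod W) mod W" for m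
    using W by (auto simp: f_def)
  have "f ` {..<w} \<subseteq> {l. incident w p l}"
  proof safe
    fix m assume "m < w"
    have "f m < Suc m * W" using W by (simp add: f_def)
    also have "\<dots> \<le> w * W" using \<open>m < w\<close> by (intro mult_right_mono) auto
    finally have "f m < w ^ 3" using W by simp
    moreover have "(m * (p div W) + (m * (p div W) * (W - 1) + p mod W) mod W) mod W = p mod W"
    proof -
      have "m * (p div W) + (m * (p div W) * (W - 1) + p mod W) = m * (p div W) * W + p mod W"
        using W by (cases W) auto
      then show ?thesis by (metis mod_add_right_eq mod_mult_self3 mod_mod_trivial)
    qed
    ultimately show "incident w p (f m)"
      unfolding incident_def W_def[symmetric] using assms fd by simp
  qed
  moreover have "inj_on f {..<w}" using fd(1) by (metis inj_onI)
  moreover have "finite {l. incident w p l}" by (rule finite_subset[of _ "{..<w ^ 3}"]) (auto simp: incident_def)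
  ultimately show ?thesis using card_inj_on_le[of f "{..<w}"] by simp
qed

text \<open>Each other element of \<open>D\<close> spoils at most one of the \<open>w\<close> neighbours of \<open>p\<close>.\<close>

lemma unique_neighbours:
  assumes "finite D" "p \<in> D" "finite (I p)" "w \<le> card (I p)"
    and "\<And>p' l l'. p' \<in> D \<Longrightarrow> p' \<noteq> p \<Longrightarrow> l \<in> I p \<Longrightarrow> l' \<in> I p \<Longrightarrow> l \<in> I p' \<Longrightarrow> l' \<in> I p' \<Longrightarrow> l = l'"
  shows "w + 1 \<le> card D + card {l \<in> I p. {q \<in> D. l \<in> I q} = {p}}"
proof -
  let ?A = "{l \<in> I p. {q \<in> D. l \<in> I q} = {p}}"
  let ?U = "\<Union>q\<in>D - {p}. I p \<inter> I q"
  have sub: "I p - ?A \<subseteq> ?U" using assms(2) by auto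
  have le1: "card (I p \<inter> I q) \<le> 1" if "q \<in> D - {p}" for q
  proof (rule card_le_Suc0_iff_eq[THEN iffD2, unfolded One_nat_def[symmetric]])
    show "finite (I p \<inter> I q)" using assms(3) by simp
    show "\<forall>a\<in>I p \<inter> I q. \<forall>a'\<in>I p \<inter> I q. a = a'" using assms(5)[of q] that by blast
  qed
  have "card (I p - ?A) \<le> card ?U"
    by (rule card_mono[OF _ sub]) (use assms(1,3) in auto)
  also have "\<dots> \<le> (\<Sum>q\<in>D - {p}. card (I p \<inter> I q))"
    by (rule card_UN_le) (use assms(1) in simp)
  also have "\<dots> \<le> (\<Sum>q\<in>D - {p}. 1)" by (rule sum_mono) (rule le1)
  finally have "card (I p - ?A) \<le> card (D - {p})" by simp
  moreover have "Suc (card (D - {p})) = card D"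
    by (rule card_Suc_Diff1[OF assms(1,2)])
  moreover have "card (I p) \<le> card (I p - ?A) + card ?A"
    using card_Un_le[of "I p - ?A" ?A] by (simp add: Un_absorb2 Collect_restrict)
  ultimately show ?thesis using assms(4) by linarith
qed

text \<open>The parameter of the geometry is \<open>2 * R\<close>, not \<open>R\<close>: when a set
  of points is considered, the \<open>R\<close> lines attached to the code have to be discarded, and
  the bound \<open>2 * R + 1\<close> still leaves more than \<open>R\<close>.\<close>

definition nlines :: "nat \<Rightarrow> nat" where "nlines R = (2 * R) ^ 3"

lemma incident_bounds: "incident (2 * R) p l \<Longrightarrow> p < nlines R \<and> l < nlines R"
  by (simp add: incident_def nlines_def)

text \<open>The vertices are \<open>K\<close> message coordinates, then the points, then the lines.
  The first \<open>R\<close> lines double as rows of the code, so message coordinates and points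
  form one side of the bipartition.\<close>

definition code_adj :: "(nat \<Rightarrow> nat \<Rightarrow> bool) \<Rightarrow> nat \<Rightarrow> nat \<Rightarrow> nat \<Rightarrow> nat \<Rightarrow> bool" where
  "code_adj A R K i j \<longleftrightarrow> i < K + nlines R \<and> K + nlines R \<le> j \<and> j < K + 2 * nlines R \<and>
     (if i < K then j - (K + nlines R) < R \<and> A (j - (K + nlines R)) i
      else incident (2 * R) (i - K) (j - (K + nlines R)))"

definition code_graph :: "(nat \<Rightarrow> nat \<Rightarrow> bool) \<Rightarrow> nat \<Rightarrow> nat \<Rightarrow> nat ugraph" where
  "code_graph A R K = ({..<K + 2 * nlines R}, {{i, j} | i j. code_adj A R K i j})"

lemma code_graph_edge: "{i, j} \<in> edges (code_graph A R K) \<longleftrightarrow> code_adj A R K i j \<or> code_adj A R K j i"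
  by (auto simp: code_graph_def doubleton_eq_iff)

lemma verts_code_graph: "verts (code_graph A R K) = {..<K + 2 * nlines R}"
  by (simp add: code_graph_def)

lemma simple_code_graph: "simple_graph (code_graph A R K)"
  unfolding simple_graph_def code_graph_def by (auto simp: edge_in_complete_edges code_adj_def)

lemma bipartite_code_graph: "bipartite (code_graph A R K)"
  unfolding bipartite_def
proof (intro exI conjI)
  let ?U = "K + nlines R"
  show "{..<?U} \<union> {?U..<K + 2 * nlines R} = verts (code_graph A R K)" by (auto simp: code_graph_def)
  show "\<forall>e\<in>edges (code_graph A R K). \<exists>a\<in>{..<?U}. \<exists>b\<in>{?U..<K + 2 * nlines R}. e = {a, b}"
    unfolding code_graph_def by (fastforce simp: code_adj_def)
qed auto

lemma nbhd_point:
  assumes "p < nlines R"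
  shows "nbhd (code_graph A R K) (K + p) = (\<lambda>l. K + nlines R + l) ` {l. incident (2 * R) p l}" (is "?N = ?I")
proof -
  have eq: "{K + p, v} \<in> edges (code_graph A R K) \<longleftrightarrow>
    K + nlines R \<le> v \<and> v < K + 2 * nlines R \<and> incident (2 * R) p (v - (K + nlines R))" for v
    using assms by (simp add: code_graph_edge code_adj_def)
  show ?thesis
  proof (intro equalityI subsetI)
    fix v assume "v \<in> ?N"
    then show "v \<in> ?I" unfolding nbhd_def mem_Collect_eq eq
      by (intro image_eqI[of _ _ "v - (K + nlines R)"]) auto
  next
    fix v assume "v \<in> ?I"
    then obtain l where "v = K + nlines R + l" "incident (2 * R) p l" by blast
    then show "v \<in> ?N" unfolding nbhd_def mem_Collect_eq eq using incident_bounds by auto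
  qed
qed

lemma nbhd_line:
  assumes "l < nlines R"
  shows "nbhd (code_graph A R K) (K + nlines R + l) =
    {c. c < K \<and> l < R \<and> A l c} \<union> (\<lambda>p. K + p) ` {p. incident (2 * R) p l}" (is "?N = ?C \<union> ?I")
proof -
  have eq: "{K + nlines R + l, v} \<in> edges (code_graph A R K) \<longleftrightarrow>
    v < K + nlines R \<and> (if v < K then l < R \<and> A l v else incident (2 * R) (v - K) l)" for v
    using assms by (simp add: code_graph_edge code_adj_def)
  show ?thesis
  proof (intro equalityI subsetI)
    fix v assume v: "v \<in> ?N"
    show "v \<in> ?C \<union> ?I"
    proof (cases "v < K")
      case True
      then show ?thesis using v unfolding nbhd_def mem_Collect_eq eq by simp
    next
      case False
      then show ?thesis using v unfolding nbhd_def mem_Collect_eq eq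
        by (intro UnI2 image_eqI[of _ _ "v - K"]) auto
    qed
  next
    fix v assume "v \<in> ?C \<union> ?I"
    then consider "v < K" "l < R" "A l v" | p where "v = K + p" "incident (2 * R) p l" by blast
    then show "v \<in> ?N" unfolding nbhd_def mem_Collect_eq eq using incident_bounds by cases auto
  qed
qed

lemma sum_of_bool_bit: "finite A \<Longrightarrow> (\<Sum>c\<in>A. of_bool (P c) :: bit) = of_bool (odd (card {c \<in> A. P c}))"
proof (induction A rule: finite_induct)
  case (insert a A)
  have "{c \<in> insert a A. P c} = (if P a then insert a {c \<in> A. P c} else {c \<in> A. P c})" by auto
  then show ?case using insert by auto
qed simp

lemma mv_odd: "mv K A x r = of_bool (odd (card {c. c < K \<and> A r c \<and> x c = 1}))"
proof -
  have "mv K A x r = (\<Sum>c<K. of_bool (A r c \<and> x c = 1))"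
    unfolding mv_def by (intro sum.cong refl) auto
  then show ?thesis by (simp add: sum_of_bool_bit)
qed

lemma wt_card: "wt N f = card {r. r < N \<and> f r = 1}"
proof -
  have "{..<N} \<inter> {r. f r = 1} = {r. r < N \<and> f r = 1}" by auto
  then show ?thesis by (simp add: wt_def sum_of_bool_eq)
qed

text \<open>For a set of message coordinates, the odd neighbourhood lies among the rows where the
  codeword is 1; the term \<open>K\<close> pays for the coordinates themselves.\<close>

theorem code_graph_upper:
  assumes x: "\<exists>c<K. x c = 1"
  shows "local_min_degree (code_graph A R K) < K + wt R (mv K A x)"
proof -
  let ?G = "code_graph A R K" and ?U = "K + nlines R"
  define D where "D = {c. c < K \<and> x c = 1}"
  have DK: "D \<subseteq> {..<K}" by (auto simp: D_def)
  have "odd_nbhd ?G D \<subseteq> (\<lambda>l. ?U + l) ` {l. l < R \<and> mv K A x l = 1}"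
  proof
    fix v assume v: "v \<in> odd_nbhd ?G D"
    then have "nbhd ?G v \<inter> D \<noteq> {}" by (auto simp: odd_nbhd_def)
    then obtain c where c: "c \<in> D" "{v, c} \<in> edges ?G" by (auto simp: nbhd_def)
    then have "c < K" using DK by auto
    then have cv: "code_adj A R K c v" using c(2) by (auto simp: code_graph_edge code_adj_def)
    then have l: "?U \<le> v" "v - ?U < R" using \<open>c < K\<close> by (auto simp: code_adj_def)
    have "nbhd ?G v \<inter> D = {c. c < K \<and> A (v - ?U) c \<and> x c = 1}"
      using cv l by (auto simp: nbhd_def code_graph_edge code_adj_def D_def)
    then have "mv K A x (v - ?U) = 1" using v by (simp add: odd_nbhd_def mv_odd)
    then show "v \<in> (\<lambda>l. ?U + l) ` {l. l < R \<and> mv K A x l = 1}"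
      using l by (intro image_eqI[of _ _ "v - ?U"]) auto
  qed
  then have "card (odd_nbhd ?G D) \<le> wt R (mv K A x)"
    unfolding wt_card by (intro order.trans[OF card_mono card_image_le]) auto
  moreover have "card D \<le> K" using card_mono[OF _ DK] by simp
  ultimately have "card (cover ?G D) \<le> K + wt R (mv K A x)"
    unfolding cover_def using card_Un_le[of D "odd_nbhd ?G D"] by linarith
  moreover have "D \<noteq> {}" using x by (auto simp: D_def)
  moreover have "D \<subseteq> verts ?G" using DK by (auto simp: verts_code_graph)
  ultimately show ?thesis using local_min_degree_less_cover[OF simple_code_graph, of D A R K] by linarith
qed

text \<open>If \<open>D\<close> contains a line, the points for which it is the only neighbour in
  \<open>D\<close> are odd, since points are adjacent to lines only. If \<open>D\<close> contains a
  point but no line, the same holds for lines beyond the first \<open>R\<close>, which see no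
  message coordinates. In both cases the cover is larger than \<open>R \<ge> d\<close>. Otherwise
  \<open>D\<close> is a nonzero message, and the odd rows are its codeword.\<close>

theorem code_graph_lower:
  assumes md: "mindist R K A d" and dR: "d \<le> R" "0 < R"
  shows "d \<le> Suc (local_min_degree (code_graph A R K))"
proof (rule local_min_degree_ge[OF simple_code_graph])
  let ?G = "code_graph A R K" and ?W = "nlines R"
  let ?U = "K + ?W"
  have W: "R \<le> ?W" using dR(2) by (simp add: nlines_def power3_eq_cube)
  then have "0 \<in> verts ?G" using dR(2) by (simp add: verts_code_graph)
  then show "verts ?G \<noteq> {}" by blast
  fix D assume D: "D \<noteq> {}" "D \<subseteq> verts ?G"
  have finD: "finite D" using D(2) finite_subset by (auto simp: verts_code_graph)
  have finC: "finite (cover ?G D)" by (rule finite_cover[OF simple_code_graph D(2)])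
  have finI: "finite {l. incident (2 * R) p l}" "finite {p. incident (2 * R) p l}" for p l
    by (rule finite_subset[of _ "{..<?W}"], auto dest: incident_bounds)+
  define L where "L = {l. ?U + l \<in> D}"
  define P where "P = {p. p < ?W \<and> K + p \<in> D}"
  have finL: "finite L" unfolding L_def using finite_vimageI[OF finD, of "(+) ?U"] by (simp add: vimage_def)
  have finP: "finite P" unfolding P_def by simp
  have LW: "l < ?W" if "l \<in> L" for l using that D(2) by (auto simp: L_def verts_code_graph)
  show "d \<le> card (cover ?G D)"
  proof (cases "L = {}")
    case False
    then obtain l0 where l0: "l0 \<in> L" by blast
    define S where "S = {p \<in> {p. incident (2 * R) p l0}. {q \<in> L. p \<in> {p. incident (2 * R) p q}} = {l0}}"
    have *: "2 * R + 1 \<le> card L + card S"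
      unfolding S_def
      by (rule unique_neighbours[where I = "\<lambda>l. {p. incident (2 * R) p l}", OF finL l0 finI(2) card_incident_points[OF LW[OF l0, unfolded nlines_def]]])
        (use incident_unique in blast)
    have SW: "p < ?W" if "p \<in> S" for p
      using that incident_bounds unfolding S_def by blast
    have S: "K + p \<in> odd_nbhd ?G D" if "p \<in> S" for p
    proof -
      have "nbhd ?G (K + p) \<inter> D = (\<lambda>l. ?U + l) ` {q \<in> L. incident (2 * R) p q}"
        unfolding nbhd_point[OF SW[OF that]] L_def by blast
      also have "\<dots> = {?U + l0}" using that by (auto simp: S_def)
      finally show ?thesis by (simp add: odd_nbhd_def)
    qed
    have "(\<lambda>l. ?U + l) ` L \<union> (\<lambda>p. K + p) ` S \<subseteq> cover ?G D"
      using S by (auto simp: cover_def L_def)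
    then have "card ((\<lambda>l. ?U + l) ` L \<union> (\<lambda>p. K + p) ` S) \<le> card (cover ?G D)" by (rule card_mono[OF finC])
    moreover have "card ((\<lambda>l. ?U + l) ` L \<union> (\<lambda>p. K + p) ` S) = card L + card S"
    proof -
      have "finite S" unfolding S_def using finI by simp
      moreover have "(\<lambda>l. ?U + l) ` L \<inter> (\<lambda>p. K + p) ` S = {}" using SW by fastforce
      ultimately show ?thesis using finL by (simp add: card_Un_disjoint card_image)
    qed
    ultimately show ?thesis using * dR by linarith
  next
    case L: True
    show ?thesis
    proof (cases "P = {}")
      case False
      then obtain p0 where p0: "p0 \<in> P" by blast
      then have p0W: "p0 < ?W" by (simp add: P_def)
      define S where "S = {l \<in> {l. incident (2 * R) p0 l}. {q \<in> P. l \<in> {l. incident (2 * R) q l}} = {p0}}"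
      have *: "2 * R + 1 \<le> card P + card S"
        unfolding S_def
        by (rule unique_neighbours[where I = "\<lambda>p. {l. incident (2 * R) p l}", OF finP p0 finI(1) card_incident_lines[OF p0W[unfolded nlines_def]]])
          (use incident_unique in blast)
      have S: "?U + l \<in> odd_nbhd ?G D" if "l \<in> S - {..<R}" for l
      proof -
        have "l < ?W" "\<not> l < R" using that incident_bounds unfolding S_def by blast+
        then have "nbhd ?G (?U + l) \<inter> D = (\<lambda>p. K + p) ` {q \<in> P. incident (2 * R) q l}"
          unfolding nbhd_line[OF \<open>l < ?W\<close>] P_def using incident_bounds by blast
        also have "\<dots> = {K + p0}" using that by (auto simp: S_def)
        finally show ?thesis by (simp add: odd_nbhd_def)
      qed
      have "(\<lambda>p. K + p) ` P \<union> (\<lambda>l. ?U + l) ` (S - {..<R}) \<subseteq> cover ?G D"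
        using S by (auto simp: cover_def P_def)
      then have "card ((\<lambda>p. K + p) ` P \<union> (\<lambda>l. ?U + l) ` (S - {..<R})) \<le> card (cover ?G D)" by (rule card_mono[OF finC])
      moreover have "card ((\<lambda>p. K + p) ` P \<union> (\<lambda>l. ?U + l) ` (S - {..<R})) = card P + card (S - {..<R})"
      proof -
        have "finite S" unfolding S_def using finI by simp
        moreover have "(\<lambda>p. K + p) ` P \<inter> (\<lambda>l. ?U + l) ` (S - {..<R}) = {}" by (auto simp: P_def)
        ultimately show ?thesis using finP by (simp add: card_Un_disjoint card_image)
      qed
      moreover have "card S - R \<le> card (S - {..<R})" using diff_card_le_card_Diff[of "{..<R}" S] by simp
      ultimately show ?thesis using * dR by linarith
    next
      case P: True
      have DK: "D \<subseteq> {..<K}"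
      proof
        fix v assume v: "v \<in> D"
        show "v \<in> {..<K}"
        proof (rule ccontr)
          assume "v \<notin> {..<K}"
          then consider "v - K < ?W" "v = K + (v - K)" | "v = ?U + (v - ?U)" by fastforce
          then show False
          proof cases
            case 1
            then have "v - K \<in> P" using v by (simp add: P_def)
            then show False using P by simp
          next
            case 2
            then have "v - ?U \<in> L" using v by (simp add: L_def)
            then show False using L by simp
          qed
        qed
      qed
      define x where "x = (\<lambda>c. of_bool (c \<in> D) :: bit)"
      have "\<exists>c<K. x c = 1" using D(1) DK by (auto simp: x_def)
      then have "d \<le> wt R (mv K A x)" using md unfolding mindist_def by blast
      also have "\<dots> = card ((\<lambda>l. ?U + l) ` {l. l < R \<and> mv K A x l = 1})"
        unfolding wt_card by (simp add: card_image)
      also have "\<dots> \<le> card (cover ?G D)"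
      proof (rule card_mono[OF finC], safe)
        fix l assume l: "l < R" "mv K A x l = 1"
        have "nbhd ?G (?U + l) \<inter> D = {c. c < K \<and> A l c \<and> x c = 1}"
          using l(1) DK unfolding nbhd_line[OF less_le_trans[OF l(1) W]] by (auto simp: x_def)
        then show "?U + l \<in> cover ?G D" using l(2) by (simp add: cover_def odd_nbhd_def mv_odd)
      qed
      finally show ?thesis .
    qed
  qed
qed

section \<open>Irreducible polynomials over the field with two elements\<close>

lemma bit_poly_add_self [simp]: "p + p = (0 :: bit poly)"
proof (rule poly_eqI)
  show "coeff (p + p) n = coeff 0 n" for n
    unfolding coeff_add coeff_0 by (cases "coeff p n") simp_all
qed

lemma bit_poly_add_power2: "(p + q) ^ 2 ^ k = p ^ 2 ^ k + (q :: bit poly) ^ 2 ^ k"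
proof (induction k)
  case (Suc k)
  have "(p + q) ^ 2 ^ Suc k = ((p + q) ^ 2 ^ k)\<^sup>2" by (simp add: power_mult[symmetric] mult.commute)
  also have "\<dots> = (p ^ 2 ^ k)\<^sup>2 + (q ^ 2 ^ k)\<^sup>2 + (p ^ 2 ^ k * q ^ 2 ^ k + p ^ 2 ^ k * q ^ 2 ^ k)"
    unfolding Suc by (simp add: power2_eq_square algebra_simps del: bit_poly_add_self)
  also have "\<dots> = p ^ 2 ^ Suc k + q ^ 2 ^ Suc k" by (simp add: power_mult[symmetric] mult.commute)
  finally show ?case .
qed simp

text \<open>Repeated squaring is additive and fixes constants, so its effect on any polynomial
  modulo \<open>g\<close> is determined by its effect on X.\<close>

lemma bit_poly_fermat:
  fixes g :: "bit poly"
  assumes "g dvd [:0, 1:] ^ 2 ^ s - [:0, 1:]"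
  shows "g dvd y ^ 2 ^ s - y"
proof (induction y)
  case 0
  then show ?case by (simp add: power_0_left)
next
  case (pCons a y)
  let ?X = "[:0, 1:] :: bit poly" and ?e = "(2::nat) ^ s"
  have c: "[:a:] ^ ?e = [:a:]" by (cases a) (simp_all add: power_0_left flip: one_pCons)
  have p: "pCons a y = [:a:] + ?X * y" by simp
  have "pCons a y ^ ?e - pCons a y = ?X ^ ?e * y ^ ?e - ?X * y"
    unfolding p bit_poly_add_power2 power_mult_distrib c by simp
  also have "\<dots> = (?X ^ ?e - ?X) * y ^ ?e + ?X * (y ^ ?e - y)" by (simp add: algebra_simps)
  finally have eq: "pCons a y ^ ?e - pCons a y = (?X ^ ?e - ?X) * y ^ ?e + ?X * (y ^ ?e - y)" .
  show ?case unfolding eq by (rule dvd_add[OF dvd_mult2[OF assms] dvd_mult[OF pCons(2)]])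
qed

text \<open>The bound on the number of roots in a field, phrased by divisibility so that the residue
  field modulo \<open>g\<close> need not be constructed. Synthetic division splits off a
  root.\<close>

lemma roots_mod_prime:
  fixes g :: "'a::idom"
  assumes "prime_elem g" "finite S"
    and "\<And>x y. x \<in> S \<Longrightarrow> y \<in> S \<Longrightarrow> g dvd x - y \<Longrightarrow> x = y"
    and "\<And>x. x \<in> S \<Longrightarrow> g dvd poly F x" "\<not> g dvd coeff F n" "degree F \<le> n"
  shows "card S \<le> n"
  using assms(2-)
proof (induction n arbitrary: F S)
  case 0
  have "S = {}"
  proof (rule ccontr)
    assume "S \<noteq> {}"
    then obtain x where "x \<in> S" by blast
    then have "g dvd poly F x" by (rule 0)
    moreover obtain c where "F = [:c:]" using 0 degree_eq_zeroE by blast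
    ultimately show False using 0 by simp
  qed
  then show ?case by simp
next
  case (Suc n)
  show ?case
  proof (cases "S = {}")
    case False
    then obtain r where r: "r \<in> S" by blast
    define Q where "Q = synthetic_div F r"
    have F: "F = [:- r, 1:] * Q + [:poly F r:]" unfolding Q_def by (rule synthetic_div_correct'[symmetric])
    have dQ: "degree Q \<le> n" using Suc.prems(5) by (simp add: Q_def degree_synthetic_div)
    have "coeff F (Suc n) = coeff ([:- r, 1:] * Q + [:poly F r:]) (Suc n)" using F by simp
    also have "\<dots> = coeff Q n" using dQ by (simp add: coeff_eq_0)
    finally have cQ: "\<not> g dvd coeff Q n" using Suc.prems(4) by simp
    have root: "g dvd poly Q x" if "x \<in> S - {r}" for x
    proof -
      have "poly F x = (x - r) * poly Q x + poly F r" by (subst F) (simp add: algebra_simps)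
      then have "(x - r) * poly Q x = poly F x - poly F r" by simp
      then have "g dvd (x - r) * poly Q x" using Suc.prems(3) that r by (simp add: dvd_diff)
      moreover have "\<not> g dvd x - r" using Suc.prems(2)[of x r] that r by auto
      ultimately show ?thesis using assms(1) prime_elem_dvd_mult_iff by blast
    qed
    have "card (S - {r}) \<le> n"
      by (rule Suc.IH[OF _ _ root cQ dQ]) (use Suc.prems in auto)
    then show ?thesis using Suc.prems(1) r by (simp add: card_Diff_singleton)
  qed simp
qed

text \<open>Numbers below \<open>2 ^ k\<close> represent the polynomials of degree below
  \<open>k\<close> by their bits; in this form machine arithmetic can speak about them.\<close>

definition bp :: "nat \<Rightarrow> nat \<Rightarrow> bit poly" where
  "bp k a = (\<Sum>j<k. monom (of_bool (Bit_Operations.bit a j)) j)"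

lemma coeff_bp: "coeff (bp k a) j = of_bool (j < k \<and> Bit_Operations.bit a j)"
proof -
  have "coeff (bp k a) j = (\<Sum>i<k. if i = j then of_bool (Bit_Operations.bit a i) else 0)"
    unfolding bp_def coeff_sum by (intro sum.cong refl) simp
  then show ?thesis by (simp only: sum.delta' sum.delta finite_lessThan lessThan_iff) auto
qed

lemma nat_bits_eq:
  fixes a b :: nat
  assumes "a < 2 ^ k" "b < 2 ^ k" "\<And>j. j < k \<Longrightarrow> Bit_Operations.bit a j = Bit_Operations.bit b j"
  shows "a = b"
proof (rule bit_eqI)
  fix n
  show "Bit_Operations.bit a n = Bit_Operations.bit b n"
  proof (cases "n < k")
    case False
    have "\<not> Bit_Operations.bit c n" if "c < 2 ^ k" for c :: nat
    proof -
      have "(2::nat) ^ k \<le> 2 ^ n" using False by (intro power_increasing) auto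
      then have "c < 2 ^ n" using that by linarith
      then show ?thesis by (simp add: bit_iff_odd)
    qed
    then show ?thesis using assms by blast
  qed (use assms in blast)
qed

lemma inj_on_bp: "inj_on (bp k) {..<2 ^ k}"
proof (rule inj_onI)
  fix a b assume ab: "a \<in> {..<2 ^ k}" "b \<in> {..<2 ^ k}" "bp k a = bp k b"
  show "a = b"
  proof (rule nat_bits_eq[of a k b])
    fix j assume "j < k"
    moreover have "coeff (bp k a) j = coeff (bp k b) j" using ab by simp
    ultimately show "Bit_Operations.bit a j = Bit_Operations.bit b j"
      by (cases "Bit_Operations.bit a j"; cases "Bit_Operations.bit b j") (simp_all add: coeff_bp)
  qed (use ab in auto)
qed

lemma bp_surj:
  assumes "\<And>j. k \<le> j \<Longrightarrow> coeff p j = 0"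
  shows "\<exists>a<2 ^ k. bp k a = p"
proof (intro exI conjI)
  let ?bs = "map (\<lambda>j. coeff p j = 1) [0..<k]"
  let ?a = "horner_sum of_bool 2 ?bs :: nat"
  show "?a < 2 ^ k" using horner_sum_of_bool_2_less[of ?bs] by simp
  show "bp k ?a = p"
  proof (rule poly_eqI)
    fix j
    show "coeff (bp k ?a) j = coeff p j"
      using assms[of j] by (cases "j < k"; cases "coeff p j") (auto simp: coeff_bp bit_horner_sum_bit_iff)
  qed
qed

lemma degree_bp_less: "0 < k \<Longrightarrow> degree (bp k a) < k"
proof -
  assume "0 < k"
  then have "degree (bp k a) \<le> k - 1" by (intro degree_le) (auto simp: coeff_bp)
  then show ?thesis using \<open>0 < k\<close> by simp
qed

text \<open>All \<open>2 ^ d\<close> residues modulo \<open>g\<close> are roots of a polynomial of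
  degree \<open>2 ^ s\<close>.\<close>

lemma irreducible_dvd_frobenius:
  fixes g :: "bit poly"
  assumes g: "irreducible g" "g dvd [:0, 1:] ^ 2 ^ s - [:0, 1:]" and s: "0 < s"
  shows "degree g \<le> s"
proof -
  define d where "d = degree g"
  define F where "F = ([:0, 1:] ^ 2 ^ s - [:0, 1:] :: bit poly poly)"
  have pr: "prime_elem g" by (rule field_poly_irreducible_imp_prime[OF g(1)])
  have d0: "0 < d"
    using g(1) unfolding d_def by (metis irreducible_def is_unit_iff_degree neq0_conv)
  have e: "(1::nat) < 2 ^ s" by (rule one_less_power) (use s in simp_all)
  have F1: "F = monom 1 (2 ^ s) - monom 1 1" by (simp add: F_def monom_altdef)
  have "card (bp d ` {..<2 ^ d}) \<le> 2 ^ s"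
  proof (rule roots_mod_prime[OF pr, where F = F])
    fix x y assume xy: "x \<in> bp d ` {..<2 ^ d}" "y \<in> bp d ` {..<2 ^ d}" "g dvd x - y"
    then have "degree (x - y) < d" using degree_bp_less[OF d0] degree_diff_less by blast
    then have "x - y = 0" using xy(3) dvd_imp_degree_le d_def by (metis leD)
    then show "x = y" by simp
  next
    fix x assume "x \<in> bp d ` {..<2 ^ d}"
    show "g dvd poly F x" using bit_poly_fermat[OF g(2), of x] by (simp add: F_def)
  next
    have "coeff F (2 ^ s) = 1" using e by (simp add: F1)
    then show "\<not> g dvd coeff F (2 ^ s)" using pr by (simp add: prime_elem_def)
    show "degree F \<le> 2 ^ s" using e unfolding F1 by (intro degree_le) auto
  qed simp
  then have "(2::nat) ^ d \<le> 2 ^ s" using inj_on_bp[of d] by (simp add: card_image)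
  then show ?thesis by (simp add: d_def)
qed

lemma finite_divisors: "(Q :: bit poly) \<noteq> 0 \<Longrightarrow> finite {g. g dvd Q}"
proof -
  assume Q: "Q \<noteq> 0"
  have "{g. g dvd Q} \<subseteq> bp (Suc (degree Q)) ` {..<2 ^ Suc (degree Q)}"
  proof
    fix g assume "g \<in> {g. g dvd Q}"
    then have "degree g \<le> degree Q" using Q by (simp add: dvd_imp_degree_le)
    then have "\<exists>a<2 ^ Suc (degree Q). bp (Suc (degree Q)) a = g" by (intro bp_surj coeff_eq_0) simp
    then show "g \<in> bp (Suc (degree Q)) ` {..<2 ^ Suc (degree Q)}" by blast
  qed
  then show ?thesis by (rule finite_subset) simp
qed

text \<open>The only unit over two elements is 1, so no divisor is counted twice through
  associates.\<close>

definition irr_divs :: "bit poly \<Rightarrow> bit poly set" where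
  "irr_divs Q = {g. irreducible g \<and> g dvd Q}"

lemma finite_irr_divs: "Q \<noteq> 0 \<Longrightarrow> finite (irr_divs Q)"
  unfolding irr_divs_def by (rule finite_subset[OF _ finite_divisors]) auto

lemma bit_poly_factor_cases:
  fixes Q :: "bit poly"
  assumes "Q \<noteq> 0"
  obtains "degree Q = 0" | "irreducible Q"
    | a b where "Q = a * b" "a \<noteq> 0" "b \<noteq> 0" "degree a < degree Q" "degree b < degree Q"
proof -
  consider "is_unit Q" | "irreducible Q" | "\<not> is_unit Q" "\<not> irreducible Q" by blast
  then show ?thesis
  proof cases
    case 1
    then show ?thesis using is_unit_iff_degree[OF assms] by (intro that(1)) simp
  next
    case 2
    then show ?thesis by (rule that(2))
  next
    case 3
    then have "\<exists>a b. Q = a * b \<and> \<not> is_unit a \<and> \<not> is_unit b"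
      using assms unfolding irreducible_def by simp
    then obtain a b where 3: "Q = a * b" "\<not> is_unit a" "\<not> is_unit b" by (elim exE conjE)
    then have "a \<noteq> 0" "b \<noteq> 0" using assms by auto
    then have "degree a \<noteq> 0" "degree b \<noteq> 0" using 3 by (metis is_unit_iff_degree)+
    moreover have "degree Q = degree a + degree b"
      unfolding 3(1) by (rule degree_mult_eq) fact+
    ultimately show ?thesis using that(3)[of a b] 3(1) \<open>a \<noteq> 0\<close> \<open>b \<noteq> 0\<close> by linarith
  qed
qed

lemma card_irr_divs_le: "Q \<noteq> 0 \<Longrightarrow> card (irr_divs Q) \<le> degree Q"
proof (induction "degree Q" arbitrary: Q rule: less_induct)
  case less
  from less.prems show ?case
  proof (cases rule: bit_poly_factor_cases)
    case 1
    have "irr_divs Q = {}"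
    proof -
      have "is_unit Q" using 1 less.prems by (simp add: is_unit_iff_degree)
      then have "is_unit g" if "g dvd Q" for g using that dvd_trans by blast
      then show ?thesis by (auto simp: irr_divs_def irreducible_def)
    qed
    then show ?thesis by simp
  next
    case 2
    have "irr_divs Q \<subseteq> {Q}"
    proof
      fix g assume "g \<in> irr_divs Q"
      then have g: "irreducible g" "g dvd Q" by (auto simp: irr_divs_def)
      then obtain h where h: "Q = g * h" by (auto elim: dvdE)
      then have "is_unit h" using 2 g unfolding irreducible_def by blast
      then obtain c where "h = [:c:]" "c \<noteq> 0" by (auto simp: is_unit_poly_iff)
      then have "h = 1" by (simp add: one_pCons)
      then show "g \<in> {Q}" using h by simp
    qed
    then have "card (irr_divs Q) \<le> 1" using card_mono[of "{Q}" "irr_divs Q"] by simp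
    also have "1 \<le> degree Q" using 2 less.prems unfolding irreducible_def
      by (metis is_unit_iff_degree less_one linorder_le_less_linear)
    finally show ?thesis .
  next
    case (3 a b)
    have "irr_divs Q \<subseteq> irr_divs a \<union> irr_divs b"
      using 3 field_poly_irreducible_imp_prime prime_elem_dvd_multD by (fastforce simp: irr_divs_def)
    then have "card (irr_divs Q) \<le> card (irr_divs a \<union> irr_divs b)"
      using finite_irr_divs 3 by (intro card_mono) auto
    also have "\<dots> \<le> card (irr_divs a) + card (irr_divs b)" by (rule card_Un_le)
    also have "\<dots> \<le> degree a + degree b" using less.hyps[of a] less.hyps[of b] 3 by (intro add_mono) auto
    also have "\<dots> = degree Q" using 3 by (simp add: degree_mult_eq)
    finally show ?thesis .
  qed
qed

lemma degree_le_irr_divs: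
  "Q \<noteq> 0 \<Longrightarrow> (\<And>g. irreducible g \<Longrightarrow> g dvd Q \<Longrightarrow> degree g \<le> s) \<Longrightarrow> (\<And>g. irreducible g \<Longrightarrow> \<not> g * g dvd Q) \<Longrightarrow>
   degree Q \<le> s * card (irr_divs Q)"
proof (induction "degree Q" arbitrary: Q rule: less_induct)
  case less
  from less.prems(1) show ?case
  proof (cases rule: bit_poly_factor_cases)
    case 2
    then have "Q \<in> irr_divs Q" by (simp add: irr_divs_def)
    then have "1 \<le> card (irr_divs Q)" using finite_irr_divs[OF less.prems(1)] by (auto simp: Suc_le_eq card_gt_0_iff)
    then have "s \<le> s * card (irr_divs Q)" by (cases "card (irr_divs Q)") auto
    then show ?thesis using less.prems(2)[OF 2 dvd_refl] by linarith
  next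
    case (3 a b)
    have ab: "g dvd Q" if "g dvd a \<or> g dvd b" for g using that 3(1) by auto
    have "degree Q = degree a + degree b" using 3 by (simp add: degree_mult_eq)
    also have "\<dots> \<le> s * card (irr_divs a) + s * card (irr_divs b)"
    proof (rule add_mono)
      show "degree a \<le> s * card (irr_divs a)"
        by (rule less.hyps) (use 3 ab less.prems in blast)+
      show "degree b \<le> s * card (irr_divs b)"
        by (rule less.hyps) (use 3 ab less.prems in blast)+
    qed
    also have "\<dots> = s * card (irr_divs a \<union> irr_divs b)"
    proof -
      have "irr_divs a \<inter> irr_divs b = {}"
      proof (rule ccontr)
        assume "irr_divs a \<inter> irr_divs b \<noteq> {}"
        then obtain g where "irreducible g" "g dvd a" "g dvd b" by (auto simp: irr_divs_def)
        then show False using less.prems(3) 3(1) mult_dvd_mono[of g a g b] by blast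
      qed
      then show ?thesis using finite_irr_divs 3 by (simp add: card_Un_disjoint distrib_left)
    qed
    also have "\<dots> \<le> s * card (irr_divs Q)"
      using finite_irr_divs[OF less.prems(1)] 3(1)
      by (intro mult_left_mono card_mono) (auto simp: irr_divs_def)
    finally show ?thesis .
  qed simp
qed

text \<open>A repeated factor would divide the derivative, which is the constant -1 in
  characteristic two.\<close>

lemma frobenius_squarefree:
  assumes "irreducible (g :: bit poly)" "0 < s"
  shows "\<not> g * g dvd [:0, 1:] ^ 2 ^ s - [:0, 1:]"
proof
  assume "g * g dvd [:0, 1:] ^ 2 ^ s - [:0, 1:]"
  then obtain w where w: "[:0, 1:] ^ 2 ^ s - [:0, 1:] = g * g * w" by (auto elim: dvdE)
  have "of_nat (2 ^ s) = (0 :: bit)" using assms(2) by (simp add: power_0_left)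
  then have "pderiv ([:0, 1:] ^ 2 ^ s - [:0, 1:] :: bit poly) = - 1"
    by (simp add: pderiv_diff pderiv_power pderiv_pCons one_pCons)
  moreover have "g dvd pderiv (g * g * w)" by (simp add: pderiv_mult algebra_simps dvd_add)
  ultimately have "g dvd - 1" using w by simp
  then show False using assms(1) by (simp add: irreducible_def)
qed

text \<open>The weak form of the prime polynomial theorem: X^(2^s) - X has no repeated factors, and
  its irreducible factors have degree at most \<open>s\<close>, so there must be many of
  them.\<close>

lemma card_irreducible_ge:
  assumes "0 < s"
  shows "2 ^ s \<le> s * card {g :: bit poly. irreducible g \<and> degree g \<le> s}"
proof -
  let ?P = "[:0, 1:] ^ 2 ^ s - [:0, 1:] :: bit poly"
  have e: "(1::nat) < 2 ^ s" by (rule one_less_power) (use assms in simp_all)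
  have P: "?P = monom 1 (2 ^ s) - monom 1 1" by (simp add: monom_altdef)
  have c: "coeff ?P (2 ^ s) = 1" unfolding P using e by simp
  then have P0: "?P \<noteq> 0" by auto
  have "2 ^ s \<le> degree ?P" using c by (intro le_degree) simp
  also have "\<dots> \<le> s * card (irr_divs ?P)"
    using irreducible_dvd_frobenius frobenius_squarefree assms by (intro degree_le_irr_divs P0) auto
  also have "\<dots> \<le> s * card {g :: bit poly. irreducible g \<and> degree g \<le> s}"
  proof (intro mult_left_mono card_mono)
    have "{g :: bit poly. irreducible g \<and> degree g \<le> s} \<subseteq> bp (Suc s) ` {..<2 ^ Suc s}"
    proof
      fix g :: "bit poly" assume "g \<in> {g. irreducible g \<and> degree g \<le> s}"
      then have "\<exists>a<2 ^ Suc s. bp (Suc s) a = g" by (intro bp_surj coeff_eq_0) simp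
      then show "g \<in> bp (Suc s) ` {..<2 ^ Suc s}" by blast
    qed
    then show "finite {g :: bit poly. irreducible g \<and> degree g \<le> s}" by (rule finite_subset) simp
    show "irr_divs ?P \<subseteq> {g. irreducible g \<and> degree g \<le> s}"
      using irreducible_dvd_frobenius assms by (auto simp: irr_divs_def)
  qed simp
  finally show ?thesis .
qed

section \<open>A balanced code from linear recurring sequences\<close>

definition ldot :: "nat \<Rightarrow> nat \<Rightarrow> nat \<Rightarrow> nat" where
  "ldot d a b = (\<Sum>j<d. of_bool (Bit_Operations.bit a j \<and> Bit_Operations.bit b j)) mod 2"

text \<open>The state of a shift register with characteristic polynomial \<open>X\<^sup>d + \<gamma>\<close>, where \<open>\<gamma>\<close> and the
  state are read as bit vectors.\<close>

primrec lstate :: "nat \<Rightarrow> nat \<Rightarrow> nat \<Rightarrow> nat \<Rightarrow> nat" where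
  "lstate d \<gamma> \<beta> 0 = \<beta> mod 2 ^ d"
| "lstate d \<gamma> \<beta> (Suc i) = lstate d \<gamma> \<beta> i div 2 + 2 ^ (d - 1) * ldot d (lstate d \<gamma> \<beta> i) \<gamma>"

definition lseq :: "nat \<Rightarrow> nat \<Rightarrow> nat \<Rightarrow> nat \<Rightarrow> bit" where
  "lseq d \<gamma> \<beta> i = of_bool (odd (lstate d \<gamma> \<beta> i))"

lemma lstate_less: "0 < d \<Longrightarrow> lstate d \<gamma> \<beta> i < 2 ^ d"
proof (induction i)
  case (Suc i)
  let ?\<sigma> = "lstate d \<gamma> \<beta> i"
  obtain e where e: "d = Suc e" using Suc.prems by (cases d) auto
  have d: "d - 1 = e" "(2::nat) ^ d = 2 ^ e + 2 ^ e" using e by simp_all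
  have "?\<sigma> div 2 < 2 ^ e" using Suc d(2) by (intro less_mult_imp_div_less) simp
  moreover have "ldot d ?\<sigma> \<gamma> \<le> 1" unfolding ldot_def by linarith
  then have "2 ^ e * ldot d ?\<sigma> \<gamma> \<le> 2 ^ e * 1" by (rule mult_left_mono) simp
  ultimately show ?case unfolding lstate.simps d by linarith
qed simp

lemma bit_lstate_Suc:
  assumes "0 < d"
  shows "Suc j < d \<Longrightarrow> Bit_Operations.bit (lstate d \<gamma> \<beta> (Suc i)) j = Bit_Operations.bit (lstate d \<gamma> \<beta> i) (Suc j)"
    and "Bit_Operations.bit (lstate d \<gamma> \<beta> (Suc i)) (d - 1) = odd (ldot d (lstate d \<gamma> \<beta> i) \<gamma>)"
proof -
  let ?\<sigma> = "lstate d \<gamma> \<beta> i" and ?c = "ldot d (lstate d \<gamma> \<beta> i) \<gamma>"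
  show "Bit_Operations.bit (lstate d \<gamma> \<beta> (Suc i)) j = Bit_Operations.bit ?\<sigma> (Suc j)" if "Suc j < d"
  proof -
    define k where "k = d - 2 - j"
    have k: "d - 1 = j + Suc k" using that by (simp add: k_def)
    have "lstate d \<gamma> \<beta> (Suc i) = ?\<sigma> div 2 + 2 ^ j * (2 ^ Suc k * ?c)"
      unfolding lstate.simps k power_add by (simp only: mult.assoc)
    then have "lstate d \<gamma> \<beta> (Suc i) div 2 ^ j = 2 ^ Suc k * ?c + ?\<sigma> div 2 div 2 ^ j"
      by (simp only: div_mult_self2[OF power_not_zero[OF zero_neq_numeral[symmetric]]])
    also have "?\<sigma> div 2 div 2 ^ j = ?\<sigma> div 2 ^ Suc j" by (simp add: div_mult2_eq)
    finally show ?thesis by (simp add: bit_iff_odd)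
  qed
  have "?\<sigma> div 2 < 2 ^ (d - 1)" using lstate_less[OF assms, of \<gamma> \<beta> i] assms by (cases d) auto
  then have "lstate d \<gamma> \<beta> (Suc i) div 2 ^ (d - 1) = ?c" by simp
  then show "Bit_Operations.bit (lstate d \<gamma> \<beta> (Suc i)) (d - 1) = odd ?c" by (simp add: bit_iff_odd)
qed

lemma bit_lstate:
  assumes "0 < d"
  shows "j < d \<Longrightarrow> of_bool (Bit_Operations.bit (lstate d \<gamma> \<beta> i) j) = lseq d \<gamma> \<beta> (i + j)"
proof (induction j arbitrary: i)
  case 0
  then show ?case by (simp add: lseq_def bit_0)
next
  case (Suc j)
  have "of_bool (Bit_Operations.bit (lstate d \<gamma> \<beta> i) (Suc j)) = lseq d \<gamma> \<beta> (Suc i + j)"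
    using bit_lstate_Suc(1)[OF assms Suc.prems, of \<gamma> \<beta> i] Suc.IH[of "Suc i"] Suc.prems by simp
  then show ?case by simp
qed

lemma lseq_initial:
  assumes "0 < d" "j < d"
  shows "lseq d \<gamma> \<beta> j = of_bool (Bit_Operations.bit \<beta> j)"
proof -
  have "Bit_Operations.bit (\<beta> mod 2 ^ d) j = Bit_Operations.bit \<beta> j"
    using assms(2) by (simp add: bit_take_bit_iff flip: take_bit_eq_mod)
  then show ?thesis using bit_lstate[OF assms, of \<gamma> \<beta> 0] by simp
qed

lemma of_bool_odd_sum: "(of_bool (odd (\<Sum>j<d. of_bool (P j) :: nat)) :: bit) = (\<Sum>j<d. of_bool (P j))" for d :: nat
  by (induction d) (auto simp: of_bool_xor[symmetric])

lemma lseq_rec: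
  assumes "0 < d"
  shows "lseq d \<gamma> \<beta> (i + d) = (\<Sum>j<d. of_bool (Bit_Operations.bit \<gamma> j) * lseq d \<gamma> \<beta> (i + j))"
proof -
  have "lseq d \<gamma> \<beta> (i + d) = lseq d \<gamma> \<beta> (Suc i + (d - 1))" using assms by simp
  also have "\<dots> = of_bool (Bit_Operations.bit (lstate d \<gamma> \<beta> (Suc i)) (d - 1))"
    using bit_lstate[OF assms, of "d - 1" \<gamma> \<beta> "Suc i"] assms by simp
  also have "\<dots> = (\<Sum>j<d. of_bool (Bit_Operations.bit (lstate d \<gamma> \<beta> i) j \<and> Bit_Operations.bit \<gamma> j))"
    unfolding bit_lstate_Suc(2)[OF assms] ldot_def of_bool_odd_sum[symmetric] by simp
  also have "\<dots> = (\<Sum>j<d. of_bool (Bit_Operations.bit \<gamma> j) * lseq d \<gamma> \<beta> (i + j))"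
    by (intro sum.cong refl) (simp only: of_bool_conj bit_lstate[OF assms] lessThan_iff mult.commute)
  finally show ?thesis .
qed

definition charpoly :: "nat \<Rightarrow> nat \<Rightarrow> bit poly" where
  "charpoly d \<gamma> = bp (Suc d) (2 ^ d + \<gamma>)"

lemma bit_add_power:
  fixes \<gamma> :: nat
  assumes "\<gamma> < 2 ^ d" "j \<le> d"
  shows "Bit_Operations.bit (2 ^ d + \<gamma>) j = (j = d \<or> Bit_Operations.bit \<gamma> j)"
proof (cases "j = d")
  case True
  then show ?thesis using assms by (simp add: bit_iff_odd)
next
  case False
  define k where "k = d - 1 - j"
  have k: "d = j + Suc k" using False assms(2) by (simp add: k_def)
  have "2 ^ d + \<gamma> = \<gamma> + 2 ^ j * 2 ^ Suc k" unfolding k by (simp add: power_add)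
  then have "(2 ^ d + \<gamma>) div 2 ^ j = \<gamma> div 2 ^ j + 2 ^ Suc k" by (simp del: power_Suc)
  then show ?thesis using False by (simp add: bit_iff_odd)
qed

lemma coeff_charpoly:
  assumes "\<gamma> < 2 ^ d"
  shows "coeff (charpoly d \<gamma>) j = of_bool (j = d \<or> j < d \<and> Bit_Operations.bit \<gamma> j)"
  using bit_add_power[OF assms, of j] unfolding charpoly_def coeff_bp by (auto simp: less_Suc_eq_le)

lemma degree_charpoly: "\<gamma> < 2 ^ d \<Longrightarrow> degree (charpoly d \<gamma>) = d"
  by (intro antisym degree_le le_degree) (auto simp: coeff_charpoly)

text \<open>The linear functional that sends X^i to \<open>U i\<close>. A bit of a codeword will be
  its value at the message polynomial.\<close>

definition functional :: "(nat \<Rightarrow> bit) \<Rightarrow> bit poly \<Rightarrow> bit" where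
  "functional U p = (\<Sum>i\<le>degree p. coeff p i * U i)"

lemma functional_bound: "degree p \<le> n \<Longrightarrow> functional U p = (\<Sum>i\<le>n. coeff p i * U i)"
  unfolding functional_def by (rule sum.mono_neutral_left) (auto simp: coeff_eq_0 not_le)

lemma functional_add: "functional U (p + q) = functional U p + functional U q"
proof -
  let ?n = "max (degree p) (degree q)"
  have "functional U (p + q) = (\<Sum>i\<le>?n. coeff (p + q) i * U i)"
    by (rule functional_bound) (simp add: degree_add_le_max)
  then show ?thesis
    by (simp only: functional_bound[of p ?n] functional_bound[of q ?n] max.cobounded1 max.cobounded2
        coeff_add distrib_right sum.distrib)
qed

lemma functional_smult: "functional U (smult a p) = a * functional U p"
proof -
  have "functional U (smult a p) = (\<Sum>i\<le>degree p. coeff (smult a p) i * U i)"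
    by (rule functional_bound) (rule degree_smult_le)
  then show ?thesis unfolding functional_def by (simp only: coeff_smult mult.assoc sum_distrib_left)
qed

lemma functional_shift: "functional U (pCons 0 p) = functional (\<lambda>i. U (Suc i)) p"
proof -
  have "functional U (pCons 0 p) = (\<Sum>i\<le>Suc (degree p). coeff (pCons 0 p) i * U i)"
    by (rule functional_bound) (rule degree_pCons_le)
  then show ?thesis unfolding functional_def sum.atMost_Suc_shift by simp
qed

text \<open>Multiplication by X shifts the sequence, and the shifted sequence obeys the same
  recurrence; hence the induction on the cofactor with \<open>U\<close> arbitrary.\<close>

lemma functional_recurrence:
  assumes "\<And>i. (\<Sum>j\<le>degree g. coeff g j * U (i + j)) = 0"
  shows "functional U (g * y) = 0"
  using assms
proof (induction y arbitrary: U)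
  case 0
  then show ?case by (simp add: functional_def)
next
  case (pCons a y)
  have "functional (\<lambda>i. U (Suc i)) (g * y) = 0"
    by (rule pCons.IH) (use pCons.prems[of "Suc _"] in simp)
  moreover have "functional U g = 0" using pCons.prems[of 0] by (simp add: functional_def)
  ultimately show ?case by (simp add: mult_pCons_right functional_add functional_smult functional_shift del: bit_add_eq_0)
qed

lemma lseq_annihilated:
  assumes "0 < d" "\<gamma> < 2 ^ d"
  shows "functional (lseq d \<gamma> \<beta>) (charpoly d \<gamma> * y) = 0"
proof (rule functional_recurrence)
  fix i
  let ?g = "charpoly d \<gamma>"
  have "(\<Sum>j\<le>degree ?g. coeff ?g j * lseq d \<gamma> \<beta> (i + j)) =
    (\<Sum>j<d. coeff ?g j * lseq d \<gamma> \<beta> (i + j)) + coeff ?g d * lseq d \<gamma> \<beta> (i + d)"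
    by (simp only: degree_charpoly[OF assms(2)] lessThan_Suc_atMost[symmetric] sum.lessThan_Suc)
  also have "(\<Sum>j<d. coeff ?g j * lseq d \<gamma> \<beta> (i + j)) = lseq d \<gamma> \<beta> (i + d)"
    unfolding lseq_rec[OF assms(1)] by (intro sum.cong refl) (simp add: coeff_charpoly[OF assms(2)])
  finally show "(\<Sum>j\<le>degree ?g. coeff ?g j * lseq d \<gamma> \<beta> (i + j)) = 0"
    by (simp add: coeff_charpoly[OF assms(2)])
qed

text \<open>Flipping one bit is an involution on the seeds that always changes the value.\<close>

lemma wt_half:
  assumes "i0 < s" and F: "\<And>\<beta>. F (flip_bit i0 \<beta>) = F \<beta> + 1"
  shows "wt (2 ^ s) F = 2 ^ (s - 1)"
proof -
  have inv: "flip_bit i0 (flip_bit i0 \<beta>) = \<beta>" for \<beta> :: nat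
    by (rule bit_eqI) (auto simp: bit_flip_bit_iff)
  have lt: "flip_bit i0 \<beta> < 2 ^ s" if "\<beta> < 2 ^ s" for \<beta> :: nat
  proof -
    have "take_bit s (flip_bit i0 \<beta>) = flip_bit i0 \<beta>"
    proof (rule bit_eqI)
      fix j
      have "Bit_Operations.bit \<beta> j \<Longrightarrow> j < s"
        using that by (metis bit_take_bit_iff take_bit_nat_eq_self_iff)
      then show "Bit_Operations.bit (take_bit s (flip_bit i0 \<beta>)) j = Bit_Operations.bit (flip_bit i0 \<beta>) j"
        using assms(1) by (auto simp: bit_take_bit_iff bit_flip_bit_iff)
    qed
    then show ?thesis by (simp add: take_bit_nat_eq_self_iff)
  qed
  have "bij_betw (flip_bit i0) {..<2 ^ s :: nat} {..<2 ^ s}"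
    by (rule bij_betw_byWitness[where f' = "flip_bit i0"]) (auto simp: inv lt)
  then have "wt (2 ^ s) F = (\<Sum>\<beta><2 ^ s. of_bool (F (flip_bit i0 \<beta>) = 1))"
    unfolding wt_def by (rule sum.reindex_bij_betw[symmetric])
  then have "2 * wt (2 ^ s) F = (\<Sum>\<beta><2 ^ s. of_bool (F \<beta> = 1) + of_bool (F (flip_bit i0 \<beta>) = 1))"
    unfolding sum.distrib by (simp add: wt_def)
  also have "\<dots> = (\<Sum>\<beta><2 ^ s :: nat. 1)"
  proof (intro sum.cong refl)
    fix \<beta>
    show "of_bool (F \<beta> = 1) + of_bool (F (flip_bit i0 \<beta>) = 1) = (1 :: nat)" unfolding F by (cases "F \<beta>") simp_all
  qed
  finally have "2 * wt (2 ^ s) F = 2 ^ s" by simp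
  then show ?thesis using assms(1) by (cases s) auto
qed

text \<open>Multiples of the characteristic polynomial vanish, so only the remainder of
  \<open>X\<close> counts. Its value is a nonzero linear form in the first \<open>d\<close> terms of
  the sequence, which are free bits of the seed. Seeds have \<open>s\<close> bits for every
  \<open>d\<close>, which gives all blocks the same size.\<close>

lemma wt_functional:
  assumes d: "0 < d" "d \<le> s" and \<gamma>: "\<gamma> < 2 ^ d"
  shows "wt (2 ^ s) (\<lambda>\<beta>. functional (lseq d \<gamma> \<beta>) X) = (if charpoly d \<gamma> dvd X then 0 else 2 ^ (s - 1))"
proof (cases "charpoly d \<gamma> dvd X")
  case True
  then obtain y where "X = charpoly d \<gamma> * y" by (auto elim: dvdE)
  then show ?thesis using True lseq_annihilated[OF d(1) \<gamma>] by (simp add: wt_def)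
next
  case False
  define \<rho> where "\<rho> = X mod charpoly d \<gamma>"
  have g0: "charpoly d \<gamma> \<noteq> 0" using degree_charpoly[OF \<gamma>] d by auto
  have \<rho>: "\<rho> \<noteq> 0" "degree \<rho> < d"
    using False degree_mod_less[OF g0, of X] degree_charpoly[OF \<gamma>] by (auto simp: \<rho>_def dvd_eq_mod_eq_0)
  have "X = charpoly d \<gamma> * (X div charpoly d \<gamma>) + \<rho>" by (simp add: \<rho>_def)
  then have "functional (lseq d \<gamma> \<beta>) X = functional (lseq d \<gamma> \<beta>) \<rho>" for \<beta>
    using functional_add[of "lseq d \<gamma> \<beta>" "charpoly d \<gamma> * (X div charpoly d \<gamma>)" \<rho>]
      lseq_annihilated[OF d(1) \<gamma>, of \<beta> "X div charpoly d \<gamma>"] by simp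
  also have "functional (lseq d \<gamma> \<beta>) \<rho> = (\<Sum>i<d. coeff \<rho> i * of_bool (Bit_Operations.bit \<beta> i))" for \<beta>
  proof -
    have "functional (lseq d \<gamma> \<beta>) \<rho> = (\<Sum>i\<le>d - 1. coeff \<rho> i * lseq d \<gamma> \<beta> i)"
      by (rule functional_bound) (use \<rho> d in simp)
    also have "{..d - 1} = {..<d}" using d(1) by auto
    finally show ?thesis by (simp add: lseq_initial[OF d(1)])
  qed
  finally have eq: "functional (lseq d \<gamma> \<beta>) X = (\<Sum>i<d. coeff \<rho> i * of_bool (Bit_Operations.bit \<beta> i))" for \<beta> .
  define i0 where "i0 = degree \<rho>"
  have i0: "i0 < d" "coeff \<rho> i0 = 1"
    using \<rho> leading_coeff_0_iff[of \<rho>] bit_not_zero_iff unfolding i0_def by blast+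
  have "wt (2 ^ s) (\<lambda>\<beta>. functional (lseq d \<gamma> \<beta>) X) = 2 ^ (s - 1)"
  proof (rule wt_half)
    fix \<beta> :: nat
    have *: "of_bool (Bit_Operations.bit (flip_bit i0 \<beta>) i) = of_bool (Bit_Operations.bit \<beta> i) + (of_bool (i = i0) :: bit)" for i
      by (cases "i = i0"; cases "Bit_Operations.bit \<beta> i") (simp_all add: bit_flip_bit_iff)
    have "(\<Sum>i<d. coeff \<rho> i * of_bool (i = i0)) = (\<Sum>i<d. if i = i0 then coeff \<rho> i else 0)"
      by (intro sum.cong refl) simp
    also have "\<dots> = 1" using i0 by (simp only: sum.delta finite_lessThan lessThan_iff if_True)
    finally show "functional (lseq d \<gamma> (flip_bit i0 \<beta>)) X = functional (lseq d \<gamma> \<beta>) X + 1"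
      unfolding eq * distrib_left sum.distrib by (simp only:)
  qed (use i0 d in simp)
  then show ?thesis using False by simp
qed

text \<open>No product of two polynomials of degree below \<open>d\<close> equals the characteristic
  polynomial; comparing the coefficients below \<open>2 * d\<close> suffices. All quantifiers are
  bounded, so that irreducibility can be expressed in the arithmetic of the reduction.\<close>

definition irr :: "nat \<Rightarrow> nat \<Rightarrow> bool" where
  "irr d \<gamma> \<longleftrightarrow> (\<forall>a<2 ^ d :: nat. \<forall>b<2 ^ d :: nat. \<exists>m<2 * d. Bit_Operations.bit (2 ^ d + \<gamma>) m \<noteq>
     odd (\<Sum>i<Suc m. of_bool (Bit_Operations.bit a i \<and> Bit_Operations.bit b (m - i)) :: nat))"

lemma bit_less_power: "a < 2 ^ d \<Longrightarrow> Bit_Operations.bit (a :: nat) i \<Longrightarrow> i < d"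
  by (metis bit_take_bit_iff take_bit_nat_eq_self_iff)

lemma coeff_bp_mult:
  assumes "a < 2 ^ d" "b < 2 ^ d"
  shows "coeff (bp d a * bp d b) m = of_bool (odd (\<Sum>i<Suc m. of_bool (Bit_Operations.bit a i \<and> Bit_Operations.bit b (m - i)) :: nat))"
proof -
  have c: "coeff (bp d e) i = of_bool (Bit_Operations.bit e i)" if "e < 2 ^ d" for e i
    using bit_less_power[OF that] by (auto simp: coeff_bp)
  show ?thesis
    unfolding of_bool_odd_sum
    by (simp only: coeff_mult c[OF assms(1)] c[OF assms(2)] lessThan_Suc_atMost of_bool_conj)
qed

lemma irr_iff:
  assumes "0 < d" "\<gamma> < 2 ^ d"
  shows "irr d \<gamma> \<longleftrightarrow> irreducible (charpoly d \<gamma>)"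
proof
  let ?g = "charpoly d \<gamma>"
  have g0: "?g \<noteq> 0" using degree_charpoly[OF assms(2)] assms(1) by auto
  have lt: "2 ^ d + \<gamma> < 2 ^ Suc d" using assms(2) by simp
  have cg: "coeff ?g m = of_bool (Bit_Operations.bit (2 ^ d + \<gamma>) m)" for m
    using bit_less_power[OF lt] by (auto simp: charpoly_def coeff_bp)
  {
    assume irr: "irr d \<gamma>"
    show "irreducible ?g"
    proof (rule irreducibleI[OF g0])
      show "\<not> is_unit ?g" using degree_charpoly[OF assms(2)] assms(1) is_unit_iff_degree[OF g0] by simp
      fix p r assume pr: "?g = p * r"
      show "is_unit p \<or> is_unit r"
      proof (rule ccontr)
        assume n: "\<not> (is_unit p \<or> is_unit r)"
        have p0: "p \<noteq> 0" "r \<noteq> 0" using pr g0 by auto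
        then have "degree p \<noteq> 0" "degree r \<noteq> 0" using n by (simp_all add: is_unit_iff_degree)
        moreover have "d = degree p + degree r" using degree_mult_eq[OF p0] pr degree_charpoly[OF assms(2)] by simp
        ultimately have lt': "degree p < d" "degree r < d" by auto
        have "\<exists>a<2 ^ d. bp d a = p" "\<exists>a<2 ^ d. bp d a = r"
          using lt' by (intro bp_surj coeff_eq_0; linarith)+
        then obtain a b where a: "a < 2 ^ d" "bp d a = p" and b: "b < 2 ^ d" "bp d b = r" by blast
        have ob: "P = R" if "(of_bool P :: bit) = of_bool R" for P R
          using that by (cases P; cases R) simp_all
        have "Bit_Operations.bit (2 ^ d + \<gamma>) m = odd (\<Sum>i<Suc m. of_bool (Bit_Operations.bit a i \<and> Bit_Operations.bit b (m - i)) :: nat)" for m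
        proof (rule ob)
          have "coeff ?g m = coeff (bp d a * bp d b) m" using pr a b by simp
          then show "(of_bool (Bit_Operations.bit (2 ^ d + \<gamma>) m) :: bit) = of_bool (odd (\<Sum>i<Suc m. of_bool (Bit_Operations.bit a i \<and> Bit_Operations.bit b (m - i)) :: nat))"
            unfolding cg coeff_bp_mult[OF a(1) b(1)] .
        qed
        then show False using irr a b unfolding irr_def by blast
      qed
    qed
  }
  {
    assume irr: "irreducible ?g"
    show "irr d \<gamma>"
    proof (rule ccontr)
      assume "\<not> irr d \<gamma>"
      then obtain a b :: nat where ab: "a < 2 ^ d" "b < 2 ^ d"
        "\<forall>m<2 * d. Bit_Operations.bit (2 ^ d + \<gamma>) m = odd (\<Sum>i<Suc m. of_bool (Bit_Operations.bit a i \<and> Bit_Operations.bit b (m - i)) :: nat)"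
        unfolding irr_def by blast
      have dab: "degree (bp d a) < d" "degree (bp d b) < d" using degree_bp_less[OF assms(1)] by auto
      have "?g = bp d a * bp d b"
      proof (rule poly_eqI)
        fix m
        show "coeff ?g m = coeff (bp d a * bp d b) m"
        proof (cases "m < 2 * d")
          case True
          then show ?thesis using ab(3) unfolding cg coeff_bp_mult[OF ab(1,2)] by simp
        next
          case False
          then have "degree (bp d a * bp d b) < m" "degree ?g < m"
            using dab degree_mult_le[of "bp d a" "bp d b"] degree_charpoly[OF assms(2)] assms(1) by linarith+
          then show ?thesis by (simp add: coeff_eq_0)
        qed
      qed
      moreover from this have nz: "bp d a \<noteq> 0" "bp d b \<noteq> 0" using g0 by auto
      moreover have "d = degree (bp d a) + degree (bp d b)"
        using calculation degree_mult_eq[OF nz] degree_charpoly[OF assms(2)] by simp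
      ultimately show False using irr dab is_unit_iff_degree[OF nz(1)] is_unit_iff_degree[OF nz(2)]
        unfolding irreducible_def by fastforce
    qed
  }
qed

definition active :: "nat \<Rightarrow> nat \<Rightarrow> nat \<Rightarrow> bool" where
  "active s d \<gamma> \<longleftrightarrow> 0 < d \<and> d \<le> s \<and> \<gamma> < 2 ^ d \<and> irr d \<gamma>"

definition nact :: "nat \<Rightarrow> nat" where
  "nact s = (\<Sum>b<Suc s * 2 ^ s. of_bool (active s (b div 2 ^ s) (b mod 2 ^ s)))"

text \<open>The small-bias construction from linear feedback shift registers. A row is a degree, a
  feedback vector and a seed; pairs that give no irreducible polynomial get zero rows, which keeps
  the indexing uniform.\<close>

definition bal :: "nat \<Rightarrow> nat \<Rightarrow> nat \<Rightarrow> bool" where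
  "bal s r i \<longleftrightarrow> active s (r div 2 ^ s div 2 ^ s) (r div 2 ^ s mod 2 ^ s) \<and>
     odd (lstate (r div 2 ^ s div 2 ^ s) (r div 2 ^ s mod 2 ^ s) (r mod 2 ^ s) i)"

definition bal_rows :: "nat \<Rightarrow> nat" where "bal_rows s = 2 ^ s * (Suc s * 2 ^ s)"

lemma coeff_vec: "coeff (\<Sum>i<n. monom (x i) i) j = (if j < n then x j else 0)"
proof -
  have "coeff (\<Sum>i<n. monom (x i) i) j = (\<Sum>i<n. if i = j then x i else 0)"
    unfolding coeff_sum by (intro sum.cong refl) simp
  then show ?thesis by (simp only: sum.delta finite_lessThan lessThan_iff)
qed

lemma wt_bal:
  "wt (bal_rows s) (mv n (bal s) x) = (\<Sum>b<Suc s * 2 ^ s. of_bool (active s (b div 2 ^ s) (b mod 2 ^ s) \<and>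
     \<not> charpoly (b div 2 ^ s) (b mod 2 ^ s) dvd (\<Sum>i<n. monom (x i) i))) * 2 ^ (s - 1)"
proof -
  let ?X = "\<Sum>i<n. monom (x i) i" and ?M = "(2::nat) ^ s"
  have fX: "functional U ?X = (\<Sum>i<n. x i * U i)" for U
  proof -
    have "functional U ?X = (\<Sum>i\<le>n. coeff ?X i * U i)"
      by (rule functional_bound, rule degree_le) (simp add: coeff_vec)
    then show ?thesis by (simp add: lessThan_Suc_atMost[symmetric] coeff_vec)
  qed
  have "wt (bal_rows s) (mv n (bal s) x) = (\<Sum>b<Suc s * ?M. wt ?M (\<lambda>\<beta>. mv n (bal s) x (b * ?M + \<beta>)))"
    unfolding bal_rows_def by (rule wt_blocks)
  also have "\<dots> = (\<Sum>b<Suc s * ?M. of_bool (active s (b div ?M) (b mod ?M) \<and> \<not> charpoly (b div ?M) (b mod ?M) dvd ?X) * 2 ^ (s - 1))"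
  proof (intro sum.cong refl)
    fix b
    let ?d = "b div ?M" and ?\<gamma> = "b mod ?M"
    show "wt ?M (\<lambda>\<beta>. mv n (bal s) x (b * ?M + \<beta>)) = of_bool (active s ?d ?\<gamma> \<and> \<not> charpoly ?d ?\<gamma> dvd ?X) * 2 ^ (s - 1)"
    proof (cases "active s ?d ?\<gamma>")
      case False
      then have "wt ?M (\<lambda>\<beta>. mv n (bal s) x (b * ?M + \<beta>)) = wt ?M (\<lambda>_. 0)"
        by (intro wt_cong) (simp add: mv_def bal_def)
      then show ?thesis using False by (simp add: wt_def)
    next
      case True
      have "wt ?M (\<lambda>\<beta>. mv n (bal s) x (b * ?M + \<beta>)) = wt ?M (\<lambda>\<beta>. functional (lseq ?d ?\<gamma> \<beta>) ?X)"
      proof (rule wt_cong)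
        fix \<beta> assume "\<beta> < ?M"
        then have "(b * ?M + \<beta>) div ?M = b" "(b * ?M + \<beta>) mod ?M = \<beta>" by simp_all
        then show "mv n (bal s) x (b * ?M + \<beta>) = functional (lseq ?d ?\<gamma> \<beta>) ?X"
          unfolding mv_def bal_def fX lseq_def using True by (intro sum.cong refl) (simp add: mult.commute)
      qed
      then show ?thesis using True wt_functional[of ?d s ?\<gamma> ?X] by (simp add: active_def)
    qed
  qed
  finally show ?thesis by (simp only: sum_distrib_right)
qed

lemma wt_bal_le: "wt (bal_rows s) (mv n (bal s) x) \<le> nact s * 2 ^ (s - 1)"
  unfolding wt_bal nact_def by (intro mult_right_mono sum_mono) auto

lemma charpoly_inj:
  assumes "\<gamma> < 2 ^ d" "\<gamma>' < 2 ^ d'" "charpoly d \<gamma> = charpoly d' \<gamma>'"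
  shows "d = d' \<and> \<gamma> = \<gamma>'"
proof -
  have d: "d = d'" using degree_charpoly[OF assms(1)] degree_charpoly[OF assms(2)] assms(3) by simp
  have "\<gamma> = \<gamma>'"
  proof (rule nat_bits_eq[of _ d])
    fix j assume "j < d"
    then have "(of_bool (Bit_Operations.bit \<gamma> j) :: bit) = of_bool (Bit_Operations.bit \<gamma>' j)"
      using coeff_charpoly[OF assms(1), of j] coeff_charpoly[OF assms(2), of j] assms(3) d by simp
    then show "Bit_Operations.bit \<gamma> j = Bit_Operations.bit \<gamma>' j"
      by (cases "Bit_Operations.bit \<gamma> j"; cases "Bit_Operations.bit \<gamma>' j") simp_all
  qed (use assms d in auto)
  then show ?thesis using d by simp
qed

lemma sum_of_bool_card: "(\<Sum>b<L. of_bool (P b)) = card {b. b < L \<and> P b}" for L :: nat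
proof -
  have "{..<L} \<inter> {b. P b} = {b. b < L \<and> P b}" by auto
  then show ?thesis by (simp add: sum_of_bool_eq)
qed

text \<open>A nonzero message polynomial has at most \<open>n\<close> irreducible divisors, so all
  but at most \<open>n\<close> active blocks contribute half of their seeds.\<close>

lemma mindist_bal: "mindist (bal_rows s) n (bal s) ((nact s - n) * 2 ^ (s - 1))"
  unfolding mindist_def
proof (intro allI impI)
  fix x :: "nat \<Rightarrow> bit" assume x: "\<exists>c<n. x c = 1"
  let ?X = "\<Sum>i<n. monom (x i) i" and ?M = "(2::nat) ^ s" and ?L = "Suc s * 2 ^ s"
  let ?A = "\<lambda>b. active s (b div ?M) (b mod ?M)" and ?g = "\<lambda>b. charpoly (b div ?M) (b mod ?M)"
  obtain c where c: "c < n" "x c = 1" using x by blast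
  have "coeff ?X c = 1" using c by (simp add: coeff_vec)
  then have X0: "?X \<noteq> 0" by auto
  have dX: "degree ?X \<le> n" by (rule degree_le) (simp add: coeff_vec)
  have "card {b. b < ?L \<and> ?A b \<and> ?g b dvd ?X} = card (?g ` {b. b < ?L \<and> ?A b \<and> ?g b dvd ?X})"
  proof (rule card_image[symmetric], rule inj_onI)
    fix b b' assume "b \<in> {b. b < ?L \<and> ?A b \<and> ?g b dvd ?X}" "b' \<in> {b. b < ?L \<and> ?A b \<and> ?g b dvd ?X}" "?g b = ?g b'"
    then have "b div ?M = b' div ?M \<and> b mod ?M = b' mod ?M" by (intro charpoly_inj) (auto simp: active_def)
    then show "b = b'" by (metis div_mult_mod_eq)
  qed
  also have "\<dots> \<le> card (irr_divs ?X)"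
    using finite_irr_divs[OF X0] by (intro card_mono) (auto simp: irr_divs_def active_def irr_iff)
  also have "\<dots> \<le> n" using card_irr_divs_le[OF X0] dX by linarith
  finally have bad: "(\<Sum>b<?L. of_bool (?A b \<and> ?g b dvd ?X)) \<le> n" unfolding sum_of_bool_card .
  have "nact s = (\<Sum>b<?L. of_bool (?A b \<and> \<not> ?g b dvd ?X) + of_bool (?A b \<and> ?g b dvd ?X))"
    unfolding nact_def by (intro sum.cong refl) auto
  then have "nact s = (\<Sum>b<?L. of_bool (?A b \<and> \<not> ?g b dvd ?X)) + (\<Sum>b<?L. of_bool (?A b \<and> ?g b dvd ?X))"
    by (simp only: sum.distrib)
  then have "nact s - n \<le> (\<Sum>b<?L. of_bool (?A b \<and> \<not> ?g b dvd ?X))" using bad by linarith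
  then show "(nact s - n) * 2 ^ (s - 1) \<le> wt (bal_rows s) (mv n (bal s) x)"
    unfolding wt_bal by (rule mult_right_mono) simp
qed

lemma nact_ge: "0 < s \<Longrightarrow> 2 ^ s \<le> s * nact s"
proof -
  assume s: "0 < s"
  let ?M = "(2::nat) ^ s" and ?L = "Suc s * 2 ^ s"
  let ?B = "{b. b < ?L \<and> active s (b div ?M) (b mod ?M)}"
  have "{g :: bit poly. irreducible g \<and> degree g \<le> s} \<subseteq> (\<lambda>b. charpoly (b div ?M) (b mod ?M)) ` ?B"
  proof
    fix g :: "bit poly" assume "g \<in> {g. irreducible g \<and> degree g \<le> s}"
    then have g: "irreducible g" "degree g \<le> s" by auto
    define d where "d = degree g"
    have g0: "g \<noteq> 0" using g(1) by auto
    have d: "0 < d" using g(1) is_unit_iff_degree[OF g0] unfolding d_def irreducible_def by blast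
    have lc: "coeff g d = 1" using leading_coeff_0_iff[of g] g0 bit_not_zero_iff unfolding d_def by blast
    \<comment> \<open>In characteristic two, adding the leading monomial removes it; what remains is
      the feedback vector.\<close>
    have "\<exists>a<2 ^ d. bp d a = g + monom 1 d"
    proof (rule bp_surj)
      fix j assume "d \<le> j"
      then show "coeff (g + monom 1 d) j = 0" using lc by (cases "j = d") (auto simp: coeff_eq_0 d_def)
    qed
    then obtain \<gamma> where \<gamma>: "\<gamma> < 2 ^ d" "bp d \<gamma> = g + monom 1 d" by blast
    have "charpoly d \<gamma> = g"
    proof (rule poly_eqI)
      fix j
      consider "j < d" | "j = d" | "j > d" by linarith
      then show "coeff (charpoly d \<gamma>) j = coeff g j"
      proof cases
        case 1
        have "coeff (bp d \<gamma>) j = coeff (g + monom 1 d) j" using \<gamma>(2) by simp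
        then show ?thesis using 1 by (simp add: coeff_charpoly[OF \<gamma>(1)] coeff_bp)
      next
        case 2
        then show ?thesis using lc by (simp add: coeff_charpoly[OF \<gamma>(1)])
      next
        case 3
        then have "coeff (charpoly d \<gamma>) j = 0" by (simp add: coeff_charpoly[OF \<gamma>(1)])
        then show ?thesis using 3 by (simp add: coeff_eq_0 d_def)
      qed
    qed
    moreover have "\<gamma> < ?M" using \<gamma>(1) g(2) power_increasing[of d s "2::nat"] unfolding d_def by linarith
    then have "(d * ?M + \<gamma>) div ?M = d" "(d * ?M + \<gamma>) mod ?M = \<gamma>" by simp_all
    moreover have "d * ?M + \<gamma> < ?L"
    proof -
      have "d * ?M + \<gamma> < Suc d * ?M" using \<open>\<gamma> < ?M\<close> by simp
      also have "\<dots> \<le> ?L" using g(2) unfolding d_def by (intro mult_right_mono) auto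
      finally show ?thesis .
    qed
    moreover have "active s d \<gamma>" using d g \<gamma>(1) calculation(1) irr_iff[OF d \<gamma>(1)] unfolding active_def d_def by simp
    ultimately show "g \<in> (\<lambda>b. charpoly (b div ?M) (b mod ?M)) ` ?B"
      by (intro image_eqI[of _ _ "d * ?M + \<gamma>"]) simp_all
  qed
  then have "card {g :: bit poly. irreducible g \<and> degree g \<le> s} \<le> card ((\<lambda>b. charpoly (b div ?M) (b mod ?M)) ` ?B)"
    by (intro card_mono) auto
  also have "\<dots> \<le> nact s" unfolding nact_def sum_of_bool_card by (rule card_image_le) simp
  finally have "s * card {g :: bit poly. irreducible g \<and> degree g \<le> s} \<le> s * nact s" by (rule mult_left_mono) simp
  then show ?thesis using card_irreducible_ge[OF s] by linarith
qed

section \<open>Accepting computations as solutions of a quadratic system\<close>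

definition valid_reads :: "turing_machine \<Rightarrow> (nat \<times> nat list) set" where
  "valid_reads M = {(q, ss). q \<le> states M \<and> length ss = tapes M \<and> set ss \<subseteq> {..<symbols M}}"

text \<open>A list of all combinations of a state and scanned symbols. The halting state is
  included, and \<open>tnext\<close> lets it idle, so all time steps obey the same rules.\<close>

definition trs :: "turing_machine \<Rightarrow> (nat \<times> nat list) list" where
  "trs M = (SOME l. set l = valid_reads M \<and> distinct l)"

definition tnext :: "turing_machine \<Rightarrow> nat \<times> nat list \<Rightarrow> nat \<times> (nat \<times> move) list" where
  "tnext M qs = (if fst qs < states M then delta M (fst qs) (snd qs) else (fst qs, map (\<lambda>s. (s, Stay)) (snd qs)))"

definition tst :: "turing_machine \<Rightarrow> nat \<Rightarrow> nat" where "tst M \<tau> = fst (trs M ! \<tau>)"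
definition trd :: "turing_machine \<Rightarrow> nat \<Rightarrow> nat \<Rightarrow> nat" where "trd M \<tau> i = snd (trs M ! \<tau>) ! i"
definition tnx :: "turing_machine \<Rightarrow> nat \<Rightarrow> nat" where "tnx M \<tau> = fst (tnext M (trs M ! \<tau>))"
definition twr :: "turing_machine \<Rightarrow> nat \<Rightarrow> nat \<Rightarrow> nat" where "twr M \<tau> i = fst (snd (tnext M (trs M ! \<tau>)) ! i)"
text \<open>Moves are coded as 0, 1, 2 so that displacements can be added to positions within the
  natural numbers.\<close>

definition tmo :: "turing_machine \<Rightarrow> nat \<Rightarrow> nat \<Rightarrow> nat" where
  "tmo M \<tau> i = nat (move_head (snd (snd (tnext M (trs M ! \<tau>)) ! i)) 1)"

lemma trs: "set (trs M) = valid_reads M" "distinct (trs M)"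
proof -
  have "valid_reads M \<subseteq> {..states M} \<times> {ss. set ss \<subseteq> {..<symbols M} \<and> length ss = tapes M}"
    by (auto simp: valid_reads_def)
  then have "finite (valid_reads M)"
    by (rule finite_subset) (intro finite_cartesian_product finite_lists_length_eq; simp)
  then have "\<exists>l. set l = valid_reads M \<and> distinct l" by (rule finite_distinct_list)
  from someI_ex[OF this] show "set (trs M) = valid_reads M" "distinct (trs M)" unfolding trs_def by auto
qed

definition good_config :: "turing_machine \<Rightarrow> config \<Rightarrow> bool" where
  "good_config M c \<longleftrightarrow> fst c \<le> states M \<and> length (snd c) = tapes M \<and> (\<forall>t\<in>set (snd c). \<forall>p. snd t p < symbols M)"

definition reads :: "config \<Rightarrow> nat \<times> nat list" where
  "reads c = (fst c, map read_tape (snd c))"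

lemma read_tape_snd: "read_tape t = snd t (fst t)"
  by (cases t) simp

lemma reads_valid: "good_config M c \<Longrightarrow> reads c \<in> valid_reads M"
  by (auto simp: good_config_def reads_def valid_reads_def read_tape_snd)

lemma tnext_valid:
  assumes "wf_tm M" "qs \<in> valid_reads M"
  shows "fst (tnext M qs) \<le> states M \<and> length (snd (tnext M qs)) = tapes M \<and>
    (\<forall>a\<in>set (snd (tnext M qs)). fst a < symbols M)"
proof (cases "fst qs < states M")
  case True
  have "length (snd qs) = tapes M" "set (snd qs) \<subseteq> {..<symbols M}"
    using assms(2) by (auto simp: valid_reads_def)
  then show ?thesis
    using True assms(1) unfolding wf_tm_def tnext_def
    by (elim conjE allE[of _ "fst qs"] allE[of _ "snd qs"]) (auto split: prod.splits)
next
  case False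
  then show ?thesis using assms(2) by (auto simp: tnext_def valid_reads_def)
qed

lemma step_tnext:
  assumes "good_config M c"
  shows "step M c = (fst (tnext M (reads c)), map2 act (snd (tnext M (reads c))) (snd c))"
proof -
  obtain q ts where c: "c = (q, ts)" by fastforce
  have "map2 act (map (\<lambda>s. (s, Stay)) (map read_tape ts)) ts = ts"
    by (rule nth_equalityI) simp_all
  then show ?thesis by (auto simp: c tnext_def reads_def split: prod.splits)
qed

lemma good_step:
  assumes "wf_tm M" "good_config M c"
  shows "good_config M (step M c)"
proof -
  note v = tnext_valid[OF assms(1) reads_valid[OF assms(2)]]
  have "snd t p < symbols M" if "t \<in> set (map2 act (snd (tnext M (reads c))) (snd c))" for t p
  proof -
    obtain a T where aT: "(a, T) \<in> set (zip (snd (tnext M (reads c))) (snd c))" "t = act a T" using \<open>t \<in> _\<close> by auto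
    then have "fst a < symbols M" "\<forall>p. snd T p < symbols M"
      using v assms(2) by (auto simp: good_config_def dest: set_zip_leftD set_zip_rightD)
    then show ?thesis using aT(2) by (cases a; cases T) auto
  qed
  then show ?thesis using v assms(2) unfolding step_tnext[OF assms(2)] by (auto simp: good_config_def)
qed

lemma good_run: "wf_tm M \<Longrightarrow> good_config M ((step M ^^ t) (init_config M w))"
proof (induction t)
  case 0
  have "3 \<le> symbols M" "1 \<le> tapes M" using 0 by (auto simp: wf_tm_def)
  then show ?case by (auto simp: good_config_def init_config_def blank_tape_def input_tape_def bit_symbol_def)
next
  case (Suc t)
  then show ?case using good_step by simp
qed

text \<open>The content of a cell whose position is given relative to the head, shifted by \<open>W\<close>.\<close>

definition cell :: "nat \<Rightarrow> config \<Rightarrow> nat \<Rightarrow> nat \<Rightarrow> nat" where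
  "cell W c i p = snd (snd c ! i) (fst (snd c ! i) + int p - int W)"

lemma cell_lt: "good_config M c \<Longrightarrow> i < tapes M \<Longrightarrow> cell W c i p < symbols M"
  by (auto simp: good_config_def cell_def)

lemma cell_head: "good_config M c \<Longrightarrow> i < tapes M \<Longrightarrow> cell W c i W = snd (reads c) ! i"
  by (simp add: good_config_def cell_def reads_def read_tape_snd)

text \<open>Relative to the head, the tape moves in the opposite direction: position
  \<open>p\<close> after the step was \<open>p + tmo M \<tau> i - 1\<close> before, and only the
  scanned position \<open>W\<close> has been rewritten.\<close>

lemma cell_step:
  assumes "wf_tm M" "good_config M c" "\<tau> < length (trs M)" "trs M ! \<tau> = reads c" "i < tapes M" "0 < p"
  shows "cell W (step M c) i p = (if p + tmo M \<tau> i = W + 1 then twr M \<tau> i else cell W c i (p + tmo M \<tau> i - 1))"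
proof -
  note v = tnext_valid[OF assms(1) reads_valid[OF assms(2)]]
  obtain a d where ad: "snd (tnext M (reads c)) ! i = (a, d)" by fastforce
  obtain h f where hf: "snd c ! i = (h, f)" by fastforce
  have "length (snd c) = tapes M" using assms(2) by (simp add: good_config_def)
  then have "snd (step M c) ! i = act (a, d) (h, f)"
    using v assms(5) ad hf unfolding step_tnext[OF assms(2)] by simp
  then show ?thesis
    using assms(6) hf ad unfolding cell_def twr_def tmo_def assms(4)
    by (cases d) (auto simp: of_nat_diff algebra_simps)
qed

lemma tmo_le: "tmo M \<tau> i \<le> 2"
  unfolding tmo_def by (cases "snd (snd (tnext M (trs M ! \<tau>)) ! i)") auto

text \<open>Digits in base \<open>V\<close>. The leading digit of a genuine variable is 1 or 2, so
  it differs from the variable 0 of the constant; the value comes last, so that the alternatives of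
  one choice form an interval, as needed for \<open>cS\<close>.\<close>

definition enc :: "nat \<Rightarrow> nat \<Rightarrow> nat \<Rightarrow> nat \<Rightarrow> nat \<Rightarrow> nat \<Rightarrow> nat" where
  "enc V k t i p s = (((k * V + t) * V + i) * V + p) * V + s"

abbreviation vD :: "nat \<Rightarrow> nat \<Rightarrow> nat \<Rightarrow> nat" where "vD V t \<tau> \<equiv> enc V (Suc 0) t 0 0 \<tau>"
abbreviation vC :: "nat \<Rightarrow> nat \<Rightarrow> nat \<Rightarrow> nat \<Rightarrow> nat \<Rightarrow> nat" where "vC V t i p s \<equiv> enc V 2 t i p s"

lemma mult_add_inj: "a * V + b = a' * V + b' \<Longrightarrow> b < V \<Longrightarrow> b' < V \<Longrightarrow> a = a' \<and> b = b'" for a b V :: nat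
proof -
  assume "a * V + b = a' * V + b'" "b < V" "b' < V"
  then have "(a * V + b) div V = (a' * V + b') div V" "(a * V + b) mod V = (a' * V + b') mod V" by simp_all
  then show ?thesis using \<open>b < V\<close> \<open>b' < V\<close> by simp
qed

lemma enc_eq_iff:
  assumes "t < V" "i < V" "p < V" "s < V" "t' < V" "i' < V" "p' < V" "s' < V"
  shows "enc V k t i p s = enc V k' t' i' p' s' \<longleftrightarrow> k = k' \<and> t = t' \<and> i = i' \<and> p = p' \<and> s = s'"
proof
  assume "enc V k t i p s = enc V k' t' i' p' s'"
  then have 1: "((k * V + t) * V + i) * V + p = ((k' * V + t') * V + i') * V + p'" "s = s'"
    unfolding enc_def using mult_add_inj assms by blast+
  then have 2: "(k * V + t) * V + i = (k' * V + t') * V + i'" "p = p'" using mult_add_inj assms by blast+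
  then have 3: "k * V + t = k' * V + t'" "i = i'" using mult_add_inj assms by blast+
  then have "k = k'" "t = t'" using mult_add_inj assms by blast+
  then show "k = k' \<and> t = t' \<and> i = i' \<and> p = p' \<and> s = s'" using 1 2 3 by simp
qed simp

lemma mult_add_less: "a < A \<Longrightarrow> b < V \<Longrightarrow> a * V + b < A * V" for a b A V :: nat
proof -
  assume "a < A" "b < V"
  then have "a * V + b < Suc a * V" by simp
  also have "\<dots> \<le> A * V" using \<open>a < A\<close> by (intro mult_right_mono) auto
  finally show ?thesis .
qed

lemma enc_less: "k < 3 \<Longrightarrow> t < V \<Longrightarrow> i < V \<Longrightarrow> p < V \<Longrightarrow> s < V \<Longrightarrow> enc V k t i p s < 3 * V ^ 4"
proof -
  assume "k < 3" "t < V" "i < V" "p < V" "s < V"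
  then have "enc V k t i p s < (((3 * V) * V) * V) * V" unfolding enc_def by (intro mult_add_less)
  also have "\<dots> = 3 * V ^ 4" by (simp only: power4_eq_xxxx mult.assoc)
  finally show ?thesis .
qed

text \<open>The variable \<open>vD V t \<tau>\<close> says that at time \<open>t\<close> the machine is in the \<open>\<tau>\<close>-th combination of a state
  and scanned symbols, \<open>vC V t i p s\<close> that the cell \<open>p\<close> of tape \<open>i\<close> (relative to its head) then contains
  \<open>s\<close>; the variable 0 stands for the constant 1, which makes the equations homogeneous. A time step
  loses one cell at either end of the window, so only the light cone below it is constrained.\<close>

definition allowed :: "bool list \<Rightarrow> nat \<Rightarrow> nat \<Rightarrow> nat \<Rightarrow> nat \<Rightarrow> nat \<Rightarrow> bool" where
  "allowed x P W i p s \<longleftrightarrow>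
     (if i \<noteq> 0 \<or> p < W then s = 0
      else if p < W + 2 * length x then s = (if even (p - W) then 2 else inp x ((p - W) div 2))
      else if p = W + 2 * length x then s = 1
      else if p \<le> W + 2 * length x + P then s \<le> 2
      else s = 0)"

text \<open>Pairs that cannot both hold; \<open>b = 0\<close> forbids \<open>a\<close> outright. The
  cases are a wrong successor state, a wrong start state, a wrong written symbol, a forbidden
  initial symbol and two symbols in one initial cell.\<close>

definition cZ :: "turing_machine \<Rightarrow> nat \<Rightarrow> nat \<Rightarrow> nat \<Rightarrow> bool list \<Rightarrow> nat \<Rightarrow> nat \<Rightarrow> bool" where
  "cZ M T P V x a b \<longleftrightarrow>
     (\<exists>t<T. \<exists>\<tau><length (trs M). \<exists>\<tau>'<length (trs M). a = vD V t \<tau> \<and> b = vD V (Suc t) \<tau>' \<and> tnx M \<tau> \<noteq> tst M \<tau>') \<or>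
     (\<exists>\<tau><length (trs M). a = vD V 0 \<tau> \<and> b = 0 \<and> tst M \<tau> \<noteq> 0) \<or>
     (\<exists>t<T. \<exists>\<tau><length (trs M). \<exists>i<tapes M. \<exists>s<symbols M. a = vD V t \<tau> \<and>
        b = vC V (Suc t) i (T + 2 - tmo M \<tau> i) s \<and> s \<noteq> twr M \<tau> i) \<or>
     (\<exists>i<tapes M. \<exists>p<2 * T + 3. \<exists>s<symbols M. a = vC V 0 i p s \<and> b = 0 \<and> \<not> allowed x P (T + 1) i p s) \<or>
     (\<exists>i<tapes M. \<exists>p<2 * T + 3. \<exists>s<symbols M. \<exists>s'<symbols M. a = vC V 0 i p s \<and> b = vC V 0 i p s' \<and> s < s')"

text \<open>If \<open>d\<close> holds, then \<open>a\<close> and \<open>b\<close> agree; with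
  \<open>a = 0\<close> this is an implication. In order: every variable implies the constant; a
  transition fixes the scanned symbols, the written symbols and the cells that are merely shifted;
  blanks after the input continue to the right; the answer cell finally contains 2.\<close>

definition cQ :: "turing_machine \<Rightarrow> nat \<Rightarrow> nat \<Rightarrow> bool list \<Rightarrow> nat \<Rightarrow> nat \<Rightarrow> nat \<Rightarrow> bool" where
  "cQ M T V x d a b \<longleftrightarrow>
     (d = a \<and> b = 0) \<or>
     (\<exists>t<Suc T. \<exists>\<tau><length (trs M). \<exists>i<tapes M. d = vD V t \<tau> \<and> a = 0 \<and> b = vC V t i (T + 1) (trd M \<tau> i)) \<or>
     (\<exists>t<T. \<exists>\<tau><length (trs M). \<exists>i<tapes M. d = vD V t \<tau> \<and> a = 0 \<and> b = vC V (Suc t) i (T + 2 - tmo M \<tau> i) (twr M \<tau> i)) \<or>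
     (\<exists>t<T. \<exists>\<tau><length (trs M). \<exists>i<tapes M. \<exists>p<2 * T + 3. \<exists>s<symbols M. t < p \<and> p + t < 2 * T + 2 \<and> p + tmo M \<tau> i \<noteq> T + 2 \<and>
        d = vD V t \<tau> \<and> a = vC V t i (p + tmo M \<tau> i - 1) s \<and> b = vC V (Suc t) i p s) \<or>
     (\<exists>p<2 * T + 2. T + 1 + 2 * length x < p \<and> d = vC V 0 0 p 0 \<and> a = 0 \<and> b = vC V 0 0 (Suc p) 0) \<or>
     (d = 0 \<and> a = 0 \<and> b = vC V T (tapes M - 1) (T + 1) 2)"

text \<open>An odd number of alternatives is the algebraic way to say that at least one of them
  holds. This is asked only of transitions and initial cells; later cells are determined by
  them.\<close>

definition cS :: "turing_machine \<Rightarrow> nat \<Rightarrow> nat \<Rightarrow> nat \<Rightarrow> nat \<Rightarrow> bool" where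
  "cS M T V a l \<longleftrightarrow>
     (\<exists>t<Suc T. a = vD V t 0 \<and> l = length (trs M)) \<or>
     (\<exists>i<tapes M. \<exists>p<2 * T + 3. a = vC V 0 i p 0 \<and> l = symbols M)"

text \<open>\<open>V\<close> bounds all index ranges, and the last condition makes the window of
  \<open>T\<close> cells on either side wide enough for the encoded pair.\<close>

locale tableau =
  fixes M :: turing_machine and x :: "bool list" and T P V :: nat
  assumes wf: "wf_tm M"
    and V: "2 * T + 4 \<le> V" "symbols M \<le> V" "tapes M \<le> V" "length (trs M) \<le> V"
    and T: "2 * length x + 1 + P \<le> T"
begin

abbreviation "W \<equiv> T + 1"
abbreviation "\<Theta> \<equiv> length (trs M)"
abbreviation "run u t \<equiv> (step M ^^ t) (init_config M (encode_pair x u))"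

lemma wf': "1 \<le> tapes M" "3 \<le> symbols M"
  using wf by (auto simp: wf_tm_def)

lemma good: "good_config M (run u t)"
  by (rule good_run[OF wf])

lemma trs_nth: "\<tau> < \<Theta> \<Longrightarrow> trs M ! \<tau> \<in> valid_reads M"
  using trs(1)[of M] nth_mem by blast

lemma trd_lt: "\<tau> < \<Theta> \<Longrightarrow> i < tapes M \<Longrightarrow> trd M \<tau> i < symbols M"
proof -
  assume a: "\<tau> < \<Theta>" "i < tapes M"
  then have "length (snd (trs M ! \<tau>)) = tapes M" "set (snd (trs M ! \<tau>)) \<subseteq> {..<symbols M}"
    using trs_nth[of \<tau>] by (auto simp: valid_reads_def)
  then show ?thesis using nth_mem[of i "snd (trs M ! \<tau>)"] a unfolding trd_def by (metis lessThan_iff subsetD)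
qed

lemma twr_lt: "\<tau> < \<Theta> \<Longrightarrow> i < tapes M \<Longrightarrow> twr M \<tau> i < symbols M"
  using tnext_valid[OF wf trs_nth[of \<tau>]] nth_mem[of i "snd (tnext M (trs M ! \<tau>))"] by (auto simp: twr_def)

lemma actual: "\<exists>\<tau><\<Theta>. trs M ! \<tau> = reads (run u t)"
  using reads_valid[OF good] trs(1)[of M] by (metis in_set_conv_nth)

lemma actual_unique: "\<tau> < \<Theta> \<Longrightarrow> \<tau>' < \<Theta> \<Longrightarrow> trs M ! \<tau> = trs M ! \<tau>' \<Longrightarrow> \<tau> = \<tau>'"
  using trs(2)[of M] nth_eq_iff_index_eq by blast

lemma reads_eqI:
  assumes "\<tau> < \<Theta>" "tst M \<tau> = fst (run u t)" "\<And>i. i < tapes M \<Longrightarrow> trd M \<tau> i = cell W (run u t) i W"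
  shows "trs M ! \<tau> = reads (run u t)"
proof (rule prod_eqI)
  show "fst (trs M ! \<tau>) = fst (reads (run u t))" using assms(2) by (simp add: tst_def reads_def)
  have "length (snd (trs M ! \<tau>)) = tapes M" using trs_nth[OF assms(1)] by (auto simp: valid_reads_def)
  moreover have "length (snd (reads (run u t))) = tapes M" using good[of t u] by (simp add: reads_def good_config_def)
  ultimately show "snd (trs M ! \<tau>) = snd (reads (run u t))"
    using assms(3) cell_head[OF good] by (auto simp: trd_def intro!: nth_equalityI)
qed

lemma run_next: "\<tau> < \<Theta> \<Longrightarrow> trs M ! \<tau> = reads (run u t) \<Longrightarrow> fst (run u (Suc t)) = tnx M \<tau>"
  by (simp add: tnx_def step_tnext[OF good])

lemma run_cell:
  assumes "\<tau> < \<Theta>" "trs M ! \<tau> = reads (run u t)" "i < tapes M" "0 < p"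
  shows "cell W (run u (Suc t)) i p = (if p + tmo M \<tau> i = T + 2 then twr M \<tau> i else cell W (run u t) i (p + tmo M \<tau> i - 1))"
  using cell_step[OF wf good assms, of W] by simp

lemma init_cell:
  assumes "i < tapes M"
  shows "cell W (run u 0) i p = (if i \<noteq> 0 \<or> p < W then 0 else inp (encode_pair x u) (p - W))"
proof (cases "i = 0")
  case True
  then have "cell W (run u 0) i p = snd (input_tape (encode_pair x u)) (int p - int W)"
    by (simp add: cell_def init_config_def input_tape_def)
  also have "\<dots> = (if p < W then 0 else inp (encode_pair x u) (p - W))"
  proof (cases "p < W")
    case False
    then have e: "int p - int W = int (p - W)" by simp
    show ?thesis unfolding input_tape_def inp_def snd_conv e using False by (simp del: of_nat_diff)
  qed (simp add: input_tape_def)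
  finally show ?thesis using True by (simp only: simp_thms)
next
  case False
  then show ?thesis using assms by (simp add: cell_def init_config_def blank_tape_def nth_Cons')
qed

lemma allowed_init:
  assumes "i < tapes M" "length u \<le> P"
  shows "allowed x P W i p (cell W (run u 0) i p)"
proof (cases "i \<noteq> 0 \<or> p < W")
  case True
  then show ?thesis using init_cell[OF assms(1)] by (simp add: allowed_def)
next
  case False
  then obtain j where j: "p = W + j" using le_Suc_ex not_less by metis
  have c: "cell W (run u 0) i p = inp (encode_pair x u) j" using init_cell[OF assms(1)] False j by simp
  have i: "i = 0" using False by simp
  consider k where "j = 2 * k" "k < length x" | k where "j = Suc (2 * k)" "k < length x" | "j = 2 * length x"
    | k where "j = Suc (2 * length x + k)"
  proof -
    consider "j < 2 * length x" "even j" | "j < 2 * length x" "odd j" | "j = 2 * length x"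
      | "2 * length x < j" by linarith
    then show ?thesis
    proof cases
      case 1
      then show ?thesis using that(1) by (auto elim: evenE)
    next
      case 2
      then show ?thesis using that(2) by (auto elim!: oddE)
    next
      case 3
      then show ?thesis using that(3) by simp
    next
      case 4
      then show ?thesis using that(4) less_imp_Suc_add by blast
    qed
  qed
  then have "allowed x P W i (W + j) (inp (encode_pair x u) j)"
  proof cases
    case (1 k)
    then show ?thesis unfolding allowed_def i by (simp add: inp_encode_pair)
  next
    case (2 k)
    then show ?thesis unfolding allowed_def i by (simp add: inp_encode_pair)
  next
    case 3
    then show ?thesis unfolding allowed_def i by (simp add: inp_encode_pair)
  next
    case (4 k)
    have "inp u k \<le> 2" "P \<le> k \<Longrightarrow> inp u k = 0" using assms(2) by (auto simp: inp_def bit_symbol_def)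
    then show ?thesis unfolding allowed_def i 4 by (simp add: inp_encode_pair)
  qed
  then show ?thesis unfolding c unfolding j .
qed

text \<open>The equations as propositional statements, which separates the argument about runs from
  the algebra over two elements.\<close>

definition consistent :: "(nat \<Rightarrow> nat \<Rightarrow> bool) \<Rightarrow> (nat \<Rightarrow> nat \<Rightarrow> nat \<Rightarrow> nat \<Rightarrow> bool) \<Rightarrow> bool" where
  "consistent D C \<longleftrightarrow>
     (\<forall>t<T. \<forall>\<tau><\<Theta>. \<forall>\<tau>'<\<Theta>. D t \<tau> \<longrightarrow> D (Suc t) \<tau>' \<longrightarrow> tnx M \<tau> = tst M \<tau>') \<and>
     (\<forall>\<tau><\<Theta>. D 0 \<tau> \<longrightarrow> tst M \<tau> = 0) \<and>
     (\<forall>t<T. \<forall>\<tau><\<Theta>. \<forall>i<tapes M. \<forall>s<symbols M. D t \<tau> \<longrightarrow> C (Suc t) i (T + 2 - tmo M \<tau> i) s \<longrightarrow> s = twr M \<tau> i) \<and>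
     (\<forall>i<tapes M. \<forall>p<2 * T + 3. \<forall>s<symbols M. C 0 i p s \<longrightarrow> allowed x P W i p s) \<and>
     (\<forall>i<tapes M. \<forall>p<2 * T + 3. \<forall>s<symbols M. \<forall>s'<symbols M. s < s' \<longrightarrow> C 0 i p s \<longrightarrow> \<not> C 0 i p s') \<and>
     (\<forall>t<Suc T. \<forall>\<tau><\<Theta>. \<forall>i<tapes M. D t \<tau> \<longrightarrow> C t i W (trd M \<tau> i)) \<and>
     (\<forall>t<T. \<forall>\<tau><\<Theta>. \<forall>i<tapes M. D t \<tau> \<longrightarrow> C (Suc t) i (T + 2 - tmo M \<tau> i) (twr M \<tau> i)) \<and>
     (\<forall>t<T. \<forall>\<tau><\<Theta>. \<forall>i<tapes M. \<forall>p<2 * T + 3. \<forall>s<symbols M.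
        D t \<tau> \<longrightarrow> t < p \<longrightarrow> p + t < 2 * T + 2 \<longrightarrow> p + tmo M \<tau> i \<noteq> T + 2 \<longrightarrow>
        C t i (p + tmo M \<tau> i - 1) s = C (Suc t) i p s) \<and>
     (\<forall>p<2 * T + 2. W + 2 * length x < p \<longrightarrow> C 0 0 p 0 \<longrightarrow> C 0 0 (Suc p) 0) \<and>
     C T (tapes M - 1) W 2 \<and>
     (\<forall>t<Suc T. \<exists>\<tau><\<Theta>. D t \<tau>) \<and>
     (\<forall>i<tapes M. \<forall>p<2 * T + 3. \<exists>s<symbols M. C 0 i p s)"

lemma consistent_run:
  assumes "length u \<le> P" "cell W (run u T) (tapes M - 1) W = 2"
  shows "consistent (\<lambda>t \<tau>. trs M ! \<tau> = reads (run u t)) (\<lambda>t i p s. cell W (run u t) i p = s)"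
  unfolding consistent_def
proof (intro conjI allI impI)
  fix t \<tau> \<tau>' assume "\<tau> < \<Theta>" "trs M ! \<tau> = reads (run u t)" "trs M ! \<tau>' = reads (run u (Suc t))"
  then show "tnx M \<tau> = tst M \<tau>'" using run_next[where \<tau>=\<tau> and u=u and t=t] unfolding tst_def by (simp only: reads_def fst_conv)
next
  fix \<tau> assume "trs M ! \<tau> = reads (run u 0)"
  then show "tst M \<tau> = 0" by (simp add: tst_def reads_def init_config_def)
next
  fix t \<tau> i s assume a: "\<tau> < \<Theta>" "trs M ! \<tau> = reads (run u t)" "i < tapes M"
    "cell W (run u (Suc t)) i (T + 2 - tmo M \<tau> i) = s" and "t < T"
  show "s = twr M \<tau> i"
    using run_cell[OF a(1,2,3), of "T + 2 - tmo M \<tau> i"] a(4) tmo_le[of M \<tau> i] \<open>t < T\<close> by auto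
next
  fix i p s assume "i < tapes M" "cell W (run u 0) i p = s"
  then show "allowed x P W i p s" using allowed_init[OF _ assms(1)] by blast
next
  fix i p and s s' :: nat assume "s < s'" "cell W (run u 0) i p = s"
  then show "cell W (run u 0) i p \<noteq> s'" by linarith
next
  fix t \<tau> i assume "\<tau> < \<Theta>" "i < tapes M" "trs M ! \<tau> = reads (run u t)"
  then show "cell W (run u t) i W = trd M \<tau> i" using cell_head[OF good] by (simp only: trd_def)
next
  fix t \<tau> i assume a: "\<tau> < \<Theta>" "i < tapes M" "trs M ! \<tau> = reads (run u t)" and "t < T"
  show "cell W (run u (Suc t)) i (T + 2 - tmo M \<tau> i) = twr M \<tau> i"
    using run_cell[OF a(1,3,2), of "T + 2 - tmo M \<tau> i"] tmo_le[of M \<tau> i] \<open>t < T\<close> by auto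
next
  fix t \<tau> i p s assume a: "\<tau> < \<Theta>" "i < tapes M" "trs M ! \<tau> = reads (run u t)" "t < p" "p + tmo M \<tau> i \<noteq> T + 2"
  show "(cell W (run u t) i (p + tmo M \<tau> i - 1) = s) = (cell W (run u (Suc t)) i p = s)"
    using run_cell[OF a(1,3,2), of p] a(4,5) by simp
next
  fix p assume p: "W + 2 * length x < p" "cell W (run u 0) 0 p = 0"
  have t: "0 < tapes M" using wf' by simp
  obtain j where "p = Suc (W + 2 * length x + j)"
    using less_imp_Suc_add[OF p(1)] by blast
  then have j: "p - W = Suc (2 * length x + j)" "Suc p - W = Suc (2 * length x + Suc j)" by simp_all
  then have "cell W (run u 0) 0 (Suc p) = inp u (Suc j)" "cell W (run u 0) 0 p = inp u j"
    using init_cell[OF t, where u=u] p(1) unfolding inp_encode_pair(4)[of x u, symmetric] j[symmetric] by simp_all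
  then show "cell W (run u 0) 0 (Suc p) = 0" using p(2) by (auto simp: inp_def bit_symbol_def split: if_splits)
next
  show "cell W (run u T) (tapes M - 1) W = 2" by (rule assms(2))
next
  fix t show "\<exists>\<tau><\<Theta>. trs M ! \<tau> = reads (run u t)" by (rule actual)
next
  fix i p assume "i < tapes M"
  then show "\<exists>s<symbols M. cell W (run u 0) i p = s" using cell_lt[OF good] by blast
qed

lemma consistentD:
  assumes "consistent D C"
  shows "t < T \<Longrightarrow> \<tau> < \<Theta> \<Longrightarrow> \<tau>' < \<Theta> \<Longrightarrow> D t \<tau> \<Longrightarrow> D (Suc t) \<tau>' \<Longrightarrow> tnx M \<tau> = tst M \<tau>'"
    and "\<tau> < \<Theta> \<Longrightarrow> D 0 \<tau> \<Longrightarrow> tst M \<tau> = 0"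
    and "t < T \<Longrightarrow> \<tau> < \<Theta> \<Longrightarrow> i < tapes M \<Longrightarrow> s < symbols M \<Longrightarrow> D t \<tau> \<Longrightarrow> C (Suc t) i (T + 2 - tmo M \<tau> i) s \<Longrightarrow> s = twr M \<tau> i"
    and "i < tapes M \<Longrightarrow> p < 2 * T + 3 \<Longrightarrow> s < symbols M \<Longrightarrow> C 0 i p s \<Longrightarrow> allowed x P W i p s"
    and "i < tapes M \<Longrightarrow> p < 2 * T + 3 \<Longrightarrow> s < symbols M \<Longrightarrow> s' < symbols M \<Longrightarrow> s < s' \<Longrightarrow> C 0 i p s \<Longrightarrow> \<not> C 0 i p s'"
    and "t < Suc T \<Longrightarrow> \<tau> < \<Theta> \<Longrightarrow> i < tapes M \<Longrightarrow> D t \<tau> \<Longrightarrow> C t i W (trd M \<tau> i)"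
    and "t < T \<Longrightarrow> \<tau> < \<Theta> \<Longrightarrow> i < tapes M \<Longrightarrow> D t \<tau> \<Longrightarrow> C (Suc t) i (T + 2 - tmo M \<tau> i) (twr M \<tau> i)"
    and "t < T \<Longrightarrow> \<tau> < \<Theta> \<Longrightarrow> i < tapes M \<Longrightarrow> p < 2 * T + 3 \<Longrightarrow> s < symbols M \<Longrightarrow> D t \<tau> \<Longrightarrow> t < p \<Longrightarrow> p + t < 2 * T + 2 \<Longrightarrow>
      p + tmo M \<tau> i \<noteq> T + 2 \<Longrightarrow> C t i (p + tmo M \<tau> i - 1) s = C (Suc t) i p s"
    and "p < 2 * T + 2 \<Longrightarrow> W + 2 * length x < p \<Longrightarrow> C 0 0 p 0 \<Longrightarrow> C 0 0 (Suc p) 0"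
    and "C T (tapes M - 1) W 2"
    and "t < Suc T \<Longrightarrow> \<exists>\<tau><\<Theta>. D t \<tau>"
    and "i < tapes M \<Longrightarrow> p < 2 * T + 3 \<Longrightarrow> \<exists>s<symbols M. C 0 i p s"
  using assms unfolding consistent_def by (elim conjE; simp only: simp_thms; fast)+

text \<open>The initial cells determine a witness, which ends at its first blank. The run on it is
  then recovered by induction on time within the shrinking light cone, which at time
  \<open>T\<close> still contains the answer cell.\<close>

lemma run_consistent:
  assumes "consistent D C"
  shows "\<exists>u. length u \<le> P \<and> cell W (run u T) (tapes M - 1) W = 2"
proof -
  note c1 = consistentD(1)[OF assms] and c2 = consistentD(2)[OF assms] and c3 = consistentD(3)[OF assms] and c4 = consistentD(4)[OF assms] and c5 = consistentD(5)[OF assms] and c6 = consistentD(6)[OF assms] and c7 = consistentD(7)[OF assms] and c8 = consistentD(8)[OF assms] and c9 = consistentD(9)[OF assms] and c10 = consistentD(10)[OF assms] and c11 = consistentD(11)[OF assms] and c12 = consistentD(12)[OF assms]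
  define g where "g i p = (SOME s. s < symbols M \<and> C 0 i p s)" for i p
  have g: "g i p < symbols M \<and> C 0 i p (g i p)" if "i < tapes M" "p < 2 * T + 3" for i p
    unfolding g_def by (rule someI_ex[OF c12[OF that]])
  have gI: "C 0 i p s \<longleftrightarrow> s = g i p" if "i < tapes M" "p < 2 * T + 3" "s < symbols M" for i p s
    using g[OF that(1,2)] c5[OF that(1,2)] that(3) by (metis linorder_neqE_nat)
  have al: "allowed x P W i p (g i p)" if "i < tapes M" "p < 2 * T + 3" for i p
    using c4[OF that] g[OF that] by blast
  have t0: "0 < tapes M" "0 < symbols M" using wf' by simp_all
  \<comment> \<open>The first cell of the witness, behind the doubled input and its end
    mark.\<close>
  define b where "b = W + 2 * length x + 1"
  have bP: "b + P < 2 * T + 3" using T by (simp add: b_def)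
  \<comment> \<open>The cell \<open>b + P\<close> is forced to be blank, so the minimum exists and
    is at most \<open>P\<close>.\<close>
  define m where "m = (LEAST j. g 0 (b + j) = 0)"
  have "g 0 (b + P) = 0" using al[OF t0(1) bP] by (simp add: allowed_def b_def)
  then have m: "g 0 (b + m) = 0" "m \<le> P" and m': "j < m \<Longrightarrow> g 0 (b + j) \<noteq> 0" for j
    unfolding m_def by (rule LeastI, rule Least_le, metis not_less_Least)
  have bl: "g 0 (b + j) = 0" if "m \<le> j" "b + j < 2 * T + 3" for j
    using that
  proof (induction j rule: dec_induct)
    case base
    then show ?case using m by simp
  next
    case (step j)
    then have "g 0 (b + j) = 0" by simp
    then have "C 0 0 (b + j) 0" using gI[OF t0(1) _ t0(2), of "b + j"] step.prems by simp
    then have "C 0 0 (Suc (b + j)) 0" using c9[of "b + j"] step.prems by (simp add: b_def)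
    then show ?case using gI[OF t0(1) _ t0(2), of "Suc (b + j)"] step.prems by simp
  qed
  define u where "u = map (\<lambda>j. g 0 (b + j) = 2) [0..<m]"
  have u: "length u \<le> P" using m by (simp add: u_def)
  have iu: "inp u j = g 0 (b + j)" if "b + j < 2 * T + 3" for j
  proof (cases "j < m")
    case True
    then have "b + j \<le> W + 2 * length x + P" using m(2) by (simp add: b_def)
    then have "g 0 (b + j) \<le> 2" using al[OF t0(1) that] by (simp add: allowed_def b_def)
    then have "g 0 (b + j) = 1 \<or> g 0 (b + j) = 2" using m'[OF True] by linarith
    then show ?thesis using True by (auto simp: u_def inp_def bit_symbol_def)
  next
    case False
    then show ?thesis using bl[of j] that by (simp add: u_def inp_def)
  qed
  have base: "cell W (run u 0) i p = g i p" if ip: "i < tapes M" "p < 2 * T + 3" for i p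
  proof -
    consider "i \<noteq> 0 \<or> p < W" | "i = 0" "W \<le> p" "p \<le> W + 2 * length x" | "i = 0" "b \<le> p"
      unfolding b_def by linarith
    then show ?thesis
    proof cases
      case 1
      then show ?thesis using al[OF ip] init_cell[OF ip(1)] by (simp add: allowed_def)
    next
      case 2
      then have "p \<le> W + 2 * length x + P" by simp
      have "allowed x P W i p (cell W (run u 0) i p)" by (rule allowed_init[OF ip(1) u])
      then show ?thesis using al[OF ip] 2 by (simp add: allowed_def split: if_splits)
    next
      case 3
      then obtain j where j: "p = b + j" using le_Suc_ex by blast
      then have "p - W = Suc (2 * length x + j)" "\<not> p < W" by (simp_all add: b_def)
      then show ?thesis using iu[of j] init_cell[OF ip(1), where u=u and p=p] 3 ip j by (simp add: inp_encode_pair)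
    qed
  qed
  \<comment> \<open>The invariant asks for one true transition variable that names the actual
    configuration, not for the absence of others; one is enough to drive the next step.\<close>
  have "(\<forall>i<tapes M. \<forall>p s. t \<le> p \<longrightarrow> p + t < 2 * T + 3 \<longrightarrow> s < symbols M \<longrightarrow> C t i p s \<longleftrightarrow> cell W (run u t) i p = s) \<and>
    (\<exists>\<tau><\<Theta>. D t \<tau> \<and> trs M ! \<tau> = reads (run u t))" if "t \<le> T" for t
    using that
  proof (induction t)
    case 0
    have C: "C 0 i p s \<longleftrightarrow> cell W (run u 0) i p = s" if "i < tapes M" "p < 2 * T + 3" "s < symbols M" for i p s
      unfolding gI[OF that] base[OF that(1,2)] by (rule eq_commute)
    obtain \<tau> where \<tau>: "\<tau> < \<Theta>" "D 0 \<tau>" using c11[of 0] by auto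
    have "trs M ! \<tau> = reads (run u 0)"
    proof (rule reads_eqI[OF \<tau>(1)])
      show "tst M \<tau> = fst (run u 0)" using c2[OF \<tau>] by (simp add: init_config_def)
      show "trd M \<tau> i = cell W (run u 0) i W" if "i < tapes M" for i
        using c6[OF _ \<tau>(1) that \<tau>(2)] C[OF that _ trd_lt[OF \<tau>(1) that], of W] by simp
    qed
    then show ?case using C \<tau> by auto
  next
    case (Suc t)
    then have t: "t < T" by simp
    then have C: "C t i p s \<longleftrightarrow> cell W (run u t) i p = s"
      if "i < tapes M" "t \<le> p" "p + t < 2 * T + 3" "s < symbols M" for i p s
      using Suc.IH that by simp
    obtain \<tau> where \<tau>: "\<tau> < \<Theta>" "D t \<tau>" "trs M ! \<tau> = reads (run u t)" using Suc.IH t by auto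
    have C': "C (Suc t) i p s \<longleftrightarrow> cell W (run u (Suc t)) i p = s"
      if i: "i < tapes M" "Suc t \<le> p" "p + Suc t < 2 * T + 3" "s < symbols M" for i p s
    proof (cases "p + tmo M \<tau> i = T + 2")
      case True
      then have p: "p = T + 2 - tmo M \<tau> i" by simp
      have "C (Suc t) i p s \<longleftrightarrow> s = twr M \<tau> i"
        using c3[OF t \<tau>(1) i(1,4) \<tau>(2)] c7[OF t \<tau>(1) i(1) \<tau>(2)] unfolding p by blast
      moreover have "cell W (run u (Suc t)) i p = twr M \<tau> i"
        using run_cell[OF \<tau>(1,3) i(1), of p] i(2) True by simp
      ultimately show ?thesis by (simp only: eq_commute)
    next
      case False
      have "C (Suc t) i p s \<longleftrightarrow> C t i (p + tmo M \<tau> i - 1) s"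
        using c8[OF t \<tau>(1) i(1) _ i(4) \<tau>(2), of p] i False by simp
      also have "\<dots> \<longleftrightarrow> cell W (run u t) i (p + tmo M \<tau> i - 1) = s"
        using tmo_le[of M \<tau> i] i by (intro C) simp_all
      also have "cell W (run u t) i (p + tmo M \<tau> i - 1) = cell W (run u (Suc t)) i p"
        using run_cell[OF \<tau>(1,3) i(1), of p] i(2) False by (simp only: if_False)
      finally show ?thesis .
    qed
    obtain \<tau>' where \<tau>': "\<tau>' < \<Theta>" "D (Suc t) \<tau>'" using c11[of "Suc t"] t by auto
    have "trs M ! \<tau>' = reads (run u (Suc t))"
    proof (rule reads_eqI[OF \<tau>'(1)])
      show "tst M \<tau>' = fst (run u (Suc t))"
        using c1[OF t \<tau>(1) \<tau>'(1) \<tau>(2) \<tau>'(2)] run_next[OF \<tau>(1,3)] by simp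
      show "trd M \<tau>' i = cell W (run u (Suc t)) i W" if "i < tapes M" for i
        using c6[OF _ \<tau>'(1) that \<tau>'(2)] C'[OF that _ _ trd_lt[OF \<tau>'(1) that], of W] t by simp
    qed
    then show ?case using C' \<tau>' by blast
  qed
  from this[of T] have "C T (tapes M - 1) W 2 \<longleftrightarrow> cell W (run u T) (tapes M - 1) W = 2"
    using wf' by simp
  then show ?thesis using c10 u by blast
qed


lemma bounds:
  "t < Suc T \<Longrightarrow> t < V" "i < tapes M \<Longrightarrow> i < V" "p < 2 * T + 3 \<Longrightarrow> p < V" "s < symbols M \<Longrightarrow> s < V" "\<tau> < \<Theta> \<Longrightarrow> \<tau> < V" "0 < V"
  using V by linarith+

abbreviation "n \<equiv> 3 * V ^ 4"

lemma vD_less: "t < Suc T \<Longrightarrow> \<tau> < \<Theta> \<Longrightarrow> vD V t \<tau> < n"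
  by (intro enc_less bounds) simp_all

lemma vC_less: "t < Suc T \<Longrightarrow> i < tapes M \<Longrightarrow> p < 2 * T + 3 \<Longrightarrow> s < symbols M \<Longrightarrow> vC V t i p s < n"
  by (intro enc_less bounds) simp_all

lemma n_gt: "V < n" "0 < n"
proof -
  have "V * 1 \<le> V * V ^ 3" using bounds(6) by (intro mult_left_mono) simp_all
  also have "\<dots> = V ^ 4" by (simp add: numeral_eq_Suc)
  also have "\<dots> < n" using bounds(6) by simp
  finally show "V < n" by simp
  show "0 < n" using bounds(6) by simp
qed

text \<open>The summed interval has to stay inside the matrix, because its constraint refers to the
  entries of column 0 in these rows.\<close>

lemma cS_bound:
  assumes "cS M T V a l"
  shows "a + l \<le> n" "l < n"
proof -
  have *: "enc V k t i p 0 + l \<le> n" if "k < 3" "t < Suc T" "i < tapes M" "p < 2 * T + 3" "0 < l" "l \<le> V" for k t i p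
  proof -
    have "t < V" "i < V" "p < V" "l - 1 < V" using that bounds by auto
    then have "enc V k t i p (l - 1) < n" using that(1) by (intro enc_less)
    then show ?thesis using that(5) unfolding enc_def by linarith
  qed
  have 0: "0 < tapes M" "0 < symbols M" using wf' by simp_all
  have T: "0 < \<Theta>" using actual[where t=0 and u="[]"] by (metis not_gr0 not_less_zero)
  show "a + l \<le> n" using assms 0 T V *[where k="Suc 0" and p=0 and i=0] *[where k=2] unfolding cS_def by auto
  show "l < n" using assms V n_gt unfolding cS_def by auto
qed

lemma sum_indicator:
  fixes m :: nat
  assumes "\<exists>!i. i < m \<and> Q i"
  shows "(\<Sum>i<m. of_bool (Q i) :: bit) = 1"
proof -
  obtain j where j: "j < m" "Q j" and u: "\<And>i. i < m \<Longrightarrow> Q i \<Longrightarrow> i = j" using assms by blast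
  have "(\<Sum>i<m. of_bool (Q i) :: bit) = (\<Sum>i<m. if i = j then 1 else 0)"
  proof (rule sum.cong)
    fix i assume i: "i \<in> {..<m}"
    show "(of_bool (Q i) :: bit) = (if i = j then 1 else 0)"
    proof (cases "i = j")
      case False
      then have "\<not> Q i" using u[of i] i by blast
      then show ?thesis using False by (simp only: of_bool_eq if_False)
    qed (simp only: j of_bool_eq if_True simp_thms)
  qed simp
  also have "\<dots> = (if j \<in> {..<m} then 1 else 0)" by (rule sum.delta) simp
  finally show ?thesis using j by simp
qed

text \<open>The solution is the characteristic function of the true variables together with the
  constant. The uniqueness assumptions turn existence into a block sum equal to 1.\<close>

lemma solves_consistent:
  assumes con: "consistent D C"
    and D1: "\<And>t. t < Suc T \<Longrightarrow> \<exists>!\<tau>. \<tau> < \<Theta> \<and> D t \<tau>"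
    and C1: "\<And>i p. i < tapes M \<Longrightarrow> p < 2 * T + 3 \<Longrightarrow> \<exists>!s. s < symbols M \<and> C 0 i p s"
  shows "\<exists>z. solves n (cZ M T P V x) (cQ M T V x) (cS M T V) z"
proof -
  define A where "A a \<longleftrightarrow> a = 0 \<or> (\<exists>t<Suc T. \<exists>\<tau><\<Theta>. a = vD V t \<tau> \<and> D t \<tau>) \<or>
    (\<exists>t<Suc T. \<exists>i<tapes M. \<exists>p<2 * T + 3. \<exists>s<symbols M. a = vC V t i p s \<and> C t i p s)" for a
  define z :: "nat \<Rightarrow> bit" where "z a = of_bool (A a)" for a
  have pos: "0 < k \<Longrightarrow> enc V k t i p s \<noteq> 0" for k t i p s
    using bounds(6) by (simp add: enc_def)
  have t0: "0 < tapes M" "2 < symbols M" using wf' by simp_all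
  have A0: "A 0" by (simp add: A_def)
  have AD: "A (vD V t \<tau>) \<longleftrightarrow> D t \<tau>" if "t < Suc T" "\<tau> < \<Theta>" for t \<tau>
  proof -
    have 1: "vD V t \<tau> = vD V t' \<tau>' \<longleftrightarrow> t = t' \<and> \<tau> = \<tau>'" if "t' < Suc T" "\<tau>' < \<Theta>" for t' \<tau>'
      using enc_eq_iff[of t V 0 0 \<tau> t' 0 0 \<tau>' "Suc 0" "Suc 0"] bounds that \<open>t < Suc T\<close> \<open>\<tau> < \<Theta>\<close> by simp
    have 2: "vD V t \<tau> \<noteq> vC V t' i p s" if "t' < Suc T" "i < tapes M" "p < 2 * T + 3" "s < symbols M" for t' i p s
      using enc_eq_iff[of t V 0 0 \<tau> t' i p s "Suc 0" 2] bounds that \<open>t < Suc T\<close> \<open>\<tau> < \<Theta>\<close> by simp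
    show ?thesis unfolding A_def using 1 2 pos[of "Suc 0" t 0 0 \<tau>] that by (metis zero_less_Suc)
  qed
  have AC: "A (vC V t i p s) \<longleftrightarrow> C t i p s" if "t < Suc T" "i < tapes M" "p < 2 * T + 3" "s < symbols M" for t i p s
  proof -
    have 1: "vC V t i p s \<noteq> vD V t' \<tau>'" if "t' < Suc T" "\<tau>' < \<Theta>" for t' \<tau>'
      using enc_eq_iff[of t V i p s t' 0 0 \<tau>' 2 "Suc 0"] bounds that \<open>t < Suc T\<close> \<open>i < _\<close> \<open>p < _\<close> \<open>s < _\<close> by simp
    have 2: "vC V t i p s = vC V t' i' p' s' \<longleftrightarrow> t = t' \<and> i = i' \<and> p = p' \<and> s = s'"
      if "t' < Suc T" "i' < tapes M" "p' < 2 * T + 3" "s' < symbols M" for t' i' p' s'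
      using enc_eq_iff[of t V i p s t' i' p' s' 2 2] bounds that \<open>t < Suc T\<close> \<open>i < _\<close> \<open>p < _\<close> \<open>s < _\<close> by simp
    show ?thesis unfolding A_def using 1 2 pos[of 2 t i p s] that by (metis zero_less_numeral)
  qed
  note c1 = consistentD(1)[OF con] and c2 = consistentD(2)[OF con] and c3 = consistentD(3)[OF con] and c4 = consistentD(4)[OF con] and c5 = consistentD(5)[OF con] and c6 = consistentD(6)[OF con] and c7 = consistentD(7)[OF con] and c8 = consistentD(8)[OF con] and c9 = consistentD(9)[OF con] and c10 = consistentD(10)[OF con] and c11 = consistentD(11)[OF con] and c12 = consistentD(12)[OF con]
  have Z: "\<not> (A a \<and> A b)" if "cZ M T P V x a b" for a b
    using that unfolding cZ_def
  proof (elim disjE exE conjE)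
    fix t \<tau> \<tau>' assume *: "t < T" "\<tau> < \<Theta>" "\<tau>' < \<Theta>" "a = vD V t \<tau>" "b = vD V (Suc t) \<tau>'" "tnx M \<tau> \<noteq> tst M \<tau>'"
    then have "A a \<longleftrightarrow> D t \<tau>" "A b \<longleftrightarrow> D (Suc t) \<tau>'" by (simp_all add: AD)
    then show ?thesis using c1[OF *(1-3)] *(6) by blast
  next
    fix \<tau> assume *: "\<tau> < \<Theta>" "a = vD V 0 \<tau>" "b = 0" "tst M \<tau> \<noteq> 0"
    then have "A a \<longleftrightarrow> D 0 \<tau>" by (simp add: AD)
    then show ?thesis using c2[OF *(1)] *(4) by blast
  next
    fix t \<tau> i s assume *: "t < T" "\<tau> < \<Theta>" "i < tapes M" "s < symbols M" "a = vD V t \<tau>"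
      "b = vC V (Suc t) i (T + 2 - tmo M \<tau> i) s" "s \<noteq> twr M \<tau> i"
    then have "A a \<longleftrightarrow> D t \<tau>" "A b \<longleftrightarrow> C (Suc t) i (T + 2 - tmo M \<tau> i) s" by (simp_all add: AD AC)
    then show ?thesis using c3[OF *(1-4)] *(7) by blast
  next
    fix i p s assume *: "i < tapes M" "p < 2 * T + 3" "s < symbols M" "a = vC V 0 i p s" "\<not> allowed x P (T + 1) i p s"
    then have "A a \<longleftrightarrow> C 0 i p s" by (simp add: AC)
    then show ?thesis using c4[OF *(1-3)] *(5) by blast
  next
    fix i p s s' assume *: "i < tapes M" "p < 2 * T + 3" "s < symbols M" "s' < symbols M" "a = vC V 0 i p s" "b = vC V 0 i p s'" "s < s'"
    then have "A a \<longleftrightarrow> C 0 i p s" "A b \<longleftrightarrow> C 0 i p s'" by (simp_all add: AC)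
    then show ?thesis using c5[OF *(1-4,7)] by blast
  qed
  have Q: "A d \<Longrightarrow> A a = A b" if "cQ M T V x d a b" for d a b
    using that unfolding cQ_def
  proof (elim disjE exE conjE)
    assume "A d" "d = a" "b = 0"
    then show ?thesis using A0 by simp
  next
    fix t \<tau> i assume "A d" and *: "t < Suc T" "\<tau> < \<Theta>" "i < tapes M" "d = vD V t \<tau>" "a = 0" "b = vC V t i (T + 1) (trd M \<tau> i)"
    then have "A d \<longleftrightarrow> D t \<tau>" "A b \<longleftrightarrow> C t i W (trd M \<tau> i)" by (simp_all add: AD AC trd_lt)
    then show ?thesis using c6[OF *(1-3)] *(5) A0 \<open>A d\<close> by blast
  next
    fix t \<tau> i assume "A d" and *: "t < T" "\<tau> < \<Theta>" "i < tapes M" "d = vD V t \<tau>" "a = 0"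
      "b = vC V (Suc t) i (T + 2 - tmo M \<tau> i) (twr M \<tau> i)"
    then have "A d \<longleftrightarrow> D t \<tau>" "A b \<longleftrightarrow> C (Suc t) i (T + 2 - tmo M \<tau> i) (twr M \<tau> i)" by (simp_all add: AD AC twr_lt)
    then show ?thesis using c7[OF *(1-3)] *(5) A0 \<open>A d\<close> by blast
  next
    fix t \<tau> i p s assume "A d" and *: "t < T" "\<tau> < \<Theta>" "i < tapes M" "p < 2 * T + 3" "s < symbols M" "t < p" "p + t < 2 * T + 2"
      "p + tmo M \<tau> i \<noteq> T + 2" "d = vD V t \<tau>" "a = vC V t i (p + tmo M \<tau> i - 1) s" "b = vC V (Suc t) i p s"
    then have "p + tmo M \<tau> i - 1 < 2 * T + 3" using tmo_le[of M \<tau> i] by linarith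
    then have "A d \<longleftrightarrow> D t \<tau>" "A a \<longleftrightarrow> C t i (p + tmo M \<tau> i - 1) s" "A b \<longleftrightarrow> C (Suc t) i p s"
      using * by (simp_all add: AD AC)
    then show ?thesis using c8[OF *(1-5) _ *(6-8)] \<open>A d\<close> by blast
  next
    fix p assume "A d" and *: "p < 2 * T + 2" "T + 1 + 2 * length x < p" "d = vC V 0 0 p 0" "a = 0" "b = vC V 0 0 (Suc p) 0"
    then have "A d \<longleftrightarrow> C 0 0 p 0" "A b \<longleftrightarrow> C 0 0 (Suc p) 0" using t0 by (simp_all add: AC)
    then show ?thesis using c9[OF *(1,2)] *(4) A0 \<open>A d\<close> by blast
  next
    assume *: "d = 0" "a = 0" "b = vC V T (tapes M - 1) (T + 1) 2"
    then have "A b \<longleftrightarrow> C T (tapes M - 1) W 2" using t0 by (simp add: AC)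
    then show ?thesis using c10 *(2) A0 by blast
  qed
  have S: "(\<Sum>i<l. z (a + i)) = 1" if "cS M T V a l" for a l
    using that unfolding cS_def
  proof (elim disjE exE conjE)
    fix t assume *: "t < Suc T" "a = vD V t 0" "l = \<Theta>"
    have "(\<Sum>i<l. z (a + i)) = (\<Sum>\<tau><\<Theta>. of_bool (D t \<tau>))"
    proof (rule sum.cong)
      fix \<tau> assume "\<tau> \<in> {..<\<Theta>}"
      moreover have "a + \<tau> = vD V t \<tau>" using * by (simp add: enc_def)
      ultimately show "z (a + \<tau>) = of_bool (D t \<tau>)" using * by (simp only: z_def AD lessThan_iff)
    qed (simp add: *)
    then show ?thesis using sum_indicator[OF D1[OF *(1)]] by (simp only:)
  next
    fix i p assume *: "i < tapes M" "p < 2 * T + 3" "a = vC V 0 i p 0" "l = symbols M"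
    have "(\<Sum>i<l. z (a + i)) = (\<Sum>s<symbols M. of_bool (C 0 i p s))"
    proof (rule sum.cong)
      fix s assume "s \<in> {..<symbols M}"
      moreover have "a + s = vC V 0 i p s" using * by (simp add: enc_def)
      ultimately show "z (a + s) = of_bool (C 0 i p s)" using * by (simp only: z_def AC lessThan_iff zero_less_Suc)
    qed (simp add: *)
    then show ?thesis using sum_indicator[OF C1[OF *(1,2)]] by (simp only:)
  qed
  have "solves n (cZ M T P V x) (cQ M T V x) (cS M T V) z"
    unfolding solves_def
  proof (intro conjI allI impI)
    show "\<exists>a<n. z a = 1" using A0 n_gt by (auto simp: z_def intro!: exI[of _ 0])
  next
    fix a b assume "cZ M T P V x a b"
    then show "z a * z b = 0" using Z by (auto simp: z_def)
  next
    fix d a b assume "cQ M T V x d a b"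
    then have "A d \<Longrightarrow> A a = A b" by (rule Q)
    then show "z d * (z a + z b) = 0" by (cases "A d") (auto simp: z_def)
  next
    fix a l assume "cS M T V a l"
    then have "(\<Sum>i<l. z (a + i)) = 1" by (rule S)
    then show "z 0 * ((\<Sum>i<l. z (a + i)) + z 0) = 0" using A0 by (simp only: z_def of_bool_eq(2) bit_add_self) simp
  qed
  then show ?thesis by blast
qed

lemma consistent_solves:
  assumes "solves n (cZ M T P V x) (cQ M T V x) (cS M T V) z"
  shows "consistent (\<lambda>t \<tau>. z (vD V t \<tau>) = 1) (\<lambda>t i p s. z (vC V t i p s) = 1)"
proof -
  have bit: "(b :: bit) = 0 \<or> b = 1" for b by (cases b) auto
  \<comment> \<open>Some entry of a solution is 1, and the equations in which every variable implies
    the constant pass this on to \<open>z 0\<close>.\<close>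
  have z0: "z 0 = 1"
  proof -
    obtain a where a: "a < n" "z a = 1" using assms unfolding solves_def by blast
    have "cQ M T V x a a 0" by (simp add: cQ_def)
    then have "z a * (z a + z 0) = 0" using assms a n_gt unfolding solves_def by blast
    then show ?thesis using a bit[of "z 0"] by auto
  qed
  have Z: "z a = 1 \<Longrightarrow> z b = 1 \<Longrightarrow> False" if "a < n" "b < n" "cZ M T P V x a b" for a b
  proof -
    have "z a * z b = 0" using assms that unfolding solves_def by blast
    then show "z a = 1 \<Longrightarrow> z b = 1 \<Longrightarrow> False" by simp
  qed
  have Q: "z d = 1 \<Longrightarrow> z a = z b" if "d < n" "a < n" "b < n" "cQ M T V x d a b" for d a b
  proof -
    have "z d * (z a + z b) = 0" using assms that unfolding solves_def by blast
    then show "z d = 1 \<Longrightarrow> z a = z b" using bit[of "z a"] bit[of "z b"] by auto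
  qed
  have S: "\<exists>i<l. z (a + i) = 1" if "a < n" "cS M T V a l" for a l
  proof (rule ccontr)
    assume "\<not> ?thesis"
    then have "z (a + i) = 0" if "i < l" for i using bit[of "z (a + i)"] that by blast
    then have "(\<Sum>i<l. z (a + i)) = 0" by (intro sum.neutral) simp
    moreover have "z 0 * ((\<Sum>i<l. z (a + i)) + z 0) = 0" using assms that cS_bound(2)[OF that(2)] unfolding solves_def by blast
    ultimately show False using z0 by simp
  qed
  have t0: "0 < tapes M" "0 < symbols M" "2 < symbols M" "tapes M - 1 < tapes M" "0 < \<Theta>"
    using wf' actual[where t=0 and u="[]"] by auto
  note l = vD_less vC_less n_gt t0
  show ?thesis unfolding consistent_def
  proof (intro conjI allI impI)
    fix t \<tau> \<tau>' assume *: "t < T" "\<tau> < \<Theta>" "\<tau>' < \<Theta>" "z (vD V t \<tau>) = 1" "z (vD V (Suc t) \<tau>') = 1"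
    show "tnx M \<tau> = tst M \<tau>'"
    proof (rule ccontr)
      assume "tnx M \<tau> \<noteq> tst M \<tau>'"
      then have "cZ M T P V x (vD V t \<tau>) (vD V (Suc t) \<tau>')" unfolding cZ_def using * by blast
      then show False by (rule Z[rotated 2]) (use * l in simp_all)
    qed
  next
    fix \<tau> assume *: "\<tau> < \<Theta>" "z (vD V 0 \<tau>) = 1"
    show "tst M \<tau> = 0"
    proof (rule ccontr)
      assume "tst M \<tau> \<noteq> 0"
      then have "cZ M T P V x (vD V 0 \<tau>) 0" unfolding cZ_def using * by blast
      then show False by (rule Z[rotated 2]) (use * l z0 in simp_all)
    qed
  next
    fix t \<tau> i s assume *: "t < T" "\<tau> < \<Theta>" "i < tapes M" "s < symbols M" "z (vD V t \<tau>) = 1"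
      "z (vC V (Suc t) i (T + 2 - tmo M \<tau> i) s) = 1"
    show "s = twr M \<tau> i"
    proof (rule ccontr)
      assume "s \<noteq> twr M \<tau> i"
      then have "cZ M T P V x (vD V t \<tau>) (vC V (Suc t) i (T + 2 - tmo M \<tau> i) s)" unfolding cZ_def using * by blast
      then show False by (rule Z[rotated 2]) (use * l in simp_all)
    qed
  next
    fix i p s assume *: "i < tapes M" "p < 2 * T + 3" "s < symbols M" "z (vC V 0 i p s) = 1"
    show "allowed x P W i p s"
    proof (rule ccontr)
      assume "\<not> allowed x P W i p s"
      then have "cZ M T P V x (vC V 0 i p s) 0" unfolding cZ_def using * by blast
      then show False by (rule Z[rotated 2]) (use * l z0 in simp_all)
    qed
  next
    fix i p s s' assume *: "i < tapes M" "p < 2 * T + 3" "s < symbols M" "s' < symbols M" "s < s'" "z (vC V 0 i p s) = 1"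
    show "z (vC V 0 i p s') \<noteq> 1"
    proof
      assume c: "z (vC V 0 i p s') = 1"
      have "cZ M T P V x (vC V 0 i p s) (vC V 0 i p s')" unfolding cZ_def using * by blast
      then show False by (rule Z[rotated 2]) (use * c l in simp_all)
    qed
  next
    fix t \<tau> i assume *: "t < Suc T" "\<tau> < \<Theta>" "i < tapes M" "z (vD V t \<tau>) = 1"
    then have "cQ M T V x (vD V t \<tau>) 0 (vC V t i W (trd M \<tau> i))" unfolding cQ_def by blast
    then have "z 0 = z (vC V t i W (trd M \<tau> i))" by (rule Q[rotated 3]) (use * l trd_lt in simp_all)
    then show "z (vC V t i W (trd M \<tau> i)) = 1" using z0 by (simp only:)
  next
    fix t \<tau> i assume *: "t < T" "\<tau> < \<Theta>" "i < tapes M" "z (vD V t \<tau>) = 1"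
    then have "cQ M T V x (vD V t \<tau>) 0 (vC V (Suc t) i (T + 2 - tmo M \<tau> i) (twr M \<tau> i))" unfolding cQ_def by blast
    then have "z 0 = z (vC V (Suc t) i (T + 2 - tmo M \<tau> i) (twr M \<tau> i))" by (rule Q[rotated 3]) (use * l twr_lt in simp_all)
    then show "z (vC V (Suc t) i (T + 2 - tmo M \<tau> i) (twr M \<tau> i)) = 1" using z0 by (simp only:)
  next
    fix t \<tau> i p s assume *: "t < T" "\<tau> < \<Theta>" "i < tapes M" "p < 2 * T + 3" "s < symbols M"
      "z (vD V t \<tau>) = 1" "t < p" "p + t < 2 * T + 2" "p + tmo M \<tau> i \<noteq> T + 2"
    then have "cQ M T V x (vD V t \<tau>) (vC V t i (p + tmo M \<tau> i - 1) s) (vC V (Suc t) i p s)" unfolding cQ_def by blast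
    moreover have "p + tmo M \<tau> i - 1 < 2 * T + 3" using tmo_le[of M \<tau> i] *(7,8) by linarith
    ultimately have "z (vC V t i (p + tmo M \<tau> i - 1) s) = z (vC V (Suc t) i p s)"
      by (intro Q[of "vD V t \<tau>"]) (use * l in simp_all)
    then show "(z (vC V t i (p + tmo M \<tau> i - 1) s) = 1) = (z (vC V (Suc t) i p s) = 1)" by (simp only:)
  next
    fix p assume *: "p < 2 * T + 2" "W + 2 * length x < p" "z (vC V 0 0 p 0) = 1"
    then have "cQ M T V x (vC V 0 0 p 0) 0 (vC V 0 0 (Suc p) 0)" unfolding cQ_def by blast
    then have "z 0 = z (vC V 0 0 (Suc p) 0)" by (rule Q[rotated 3]) (use * l in simp_all)
    then show "z (vC V 0 0 (Suc p) 0) = 1" using z0 by (simp only:)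
  next
    have "cQ M T V x 0 0 (vC V T (tapes M - 1) W 2)" unfolding cQ_def by blast
    then have "z 0 = z (vC V T (tapes M - 1) W 2)" by (rule Q[rotated 3]) (use l z0 in simp_all)
    then show "z (vC V T (tapes M - 1) W 2) = 1" using z0 by (simp only:)
  next
    fix t assume *: "t < Suc T"
    then have "cS M T V (vD V t 0) \<Theta>" unfolding cS_def by blast
    then have "\<exists>i<\<Theta>. z (vD V t 0 + i) = 1" by (rule S[rotated]) (use * l in simp_all)
    then show "\<exists>\<tau><\<Theta>. z (vD V t \<tau>) = 1" unfolding enc_def by simp
  next
    fix i p assume *: "i < tapes M" "p < 2 * T + 3"
    then have "cS M T V (vC V 0 i p 0) (symbols M)" unfolding cS_def by blast
    then have "\<exists>s<symbols M. z (vC V 0 i p 0 + s) = 1" by (rule S[rotated]) (use * l in simp_all)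
    then show "\<exists>s<symbols M. z (vC V 0 i p s) = 1" unfolding enc_def by simp
  qed
qed

lemma solves_iff:
  "(\<exists>z. solves n (cZ M T P V x) (cQ M T V x) (cS M T V) z) \<longleftrightarrow>
     (\<exists>u. length u \<le> P \<and> cell W (run u T) (tapes M - 1) W = 2)"
proof
  assume "\<exists>z. solves n (cZ M T P V x) (cQ M T V x) (cS M T V) z"
  then show "\<exists>u. length u \<le> P \<and> cell W (run u T) (tapes M - 1) W = 2"
    using consistent_solves run_consistent by blast
next
  assume "\<exists>u. length u \<le> P \<and> cell W (run u T) (tapes M - 1) W = 2"
  then obtain u where u: "length u \<le> P" "cell W (run u T) (tapes M - 1) W = 2" by blast
  show "\<exists>z. solves n (cZ M T P V x) (cQ M T V x) (cS M T V) z"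
  proof (rule solves_consistent[OF consistent_run[OF u]])
    show "\<exists>!\<tau>. \<tau> < \<Theta> \<and> trs M ! \<tau> = reads (run u t)" for t
      using actual[where u=u and t=t] actual_unique by metis
    show "\<exists>!s. s < symbols M \<and> cell W (run u 0) i p = s" if "i < tapes M" for i p
      using cell_lt[OF good that] by blast
  qed
qed

end

text \<open>In the normal form \<open>decides\<close>, the head of the last tape rests on the
  answer, and halted configurations stay put; so acceptance is the symbol 2 in the central cell at
  time \<open>T\<close>.\<close>

lemma solves_iff_witness:
  assumes dec: "decides M q R" and "tableau M x T P V"
    and q: "\<And>u. length u \<le> P \<Longrightarrow> poly q (length (encode_pair x u)) \<le> T"
  shows "(\<exists>z. solves (3 * V ^ 4) (cZ M T P V x) (cQ M T V x) (cS M T V) z) \<longleftrightarrow>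
    (\<exists>u. length u \<le> P \<and> encode_pair x u \<in> R)"
proof -
  have "cell (T + 1) ((step M ^^ T) (init_config M (encode_pair x u))) (tapes M - 1) (T + 1) = bit_symbol (encode_pair x u \<in> R)"
    if u: "length u \<le> P" for u
  proof -
    have w: "wf_tm M" using dec by (simp add: decides_def)
    obtain ts where "(step M ^^ poly q (length (encode_pair x u))) (init_config M (encode_pair x u)) = (states M, ts)"
      and ts: "length ts = tapes M" "last ts = (0, (\<lambda>_. 0)(0 := bit_symbol (encode_pair x u \<in> R)))"
      using dec unfolding decides_def by blast
    then have s: "(step M ^^ T) (init_config M (encode_pair x u)) = (states M, ts)"
      using step_pow_halted q[OF u] by blast
    have "ts \<noteq> []" using ts w by (auto simp: wf_tm_def)
    then have "ts ! (tapes M - 1) = (0, (\<lambda>_. 0)(0 := bit_symbol (encode_pair x u \<in> R)))"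
      using ts by (simp add: last_conv_nth)
    then show ?thesis unfolding s cell_def by simp
  qed
  then show ?thesis unfolding tableau.solves_iff[OF assms(2)]
    by (metis bit_symbol_def numeral_eq_one_iff verit_eq_simplify(10))
qed

section \<open>The reduction is polynomial-time computable\<close>

lemma pf_comp5:
  assumes "pf (\<lambda>x v. G x (v 0) (v 1) (v 2) (v 3) (v 4))" "pf a" "pf b" "pf c" "pf d" "pf e"
  shows "pf (\<lambda>x v. G x (a x v) (b x v) (c x v) (d x v) (e x v))"
  using pf_subst[OF assms(1), of "\<lambda>k. if k = 0 then a else if k = 1 then b else if k = 2 then c else if k = 3 then d else e"] assms
  by simp

lemma pp_bit: "pf f \<Longrightarrow> pf g \<Longrightarrow> pp (\<lambda>x v. Bit_Operations.bit (f x v) (g x v))"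
  unfolding bit_iff_odd by (intro pf_intros)

lemma pf_ldot:
  assumes "pf d" "pf a" "pf b"
  shows "pf (\<lambda>x v. ldot (d x v) (a x v) (b x v))"
proof -
  have "pf (\<lambda>x v. ldot (v 0) (v 1) (v 2))" unfolding ldot_def by (intro pf_intros pp_bit)
  from pf_comp3[OF this assms] show ?thesis .
qed

text \<open>The shift register with its powers of two truncated at \<open>q\<close>. Nothing is lost
  for \<open>q = 2 ^ s\<close> and degrees up to \<open>s\<close>, and this \<open>q\<close> will be
  polynomial in the input length because \<open>s\<close> is a logarithm.\<close>

definition lstate_below :: "nat \<Rightarrow> nat \<Rightarrow> nat \<Rightarrow> nat \<Rightarrow> nat \<Rightarrow> nat" where
  "lstate_below q d \<gamma> \<beta> i = biter (\<beta> mod min (2 ^ d) q) q (\<lambda>i y. y div 2 + min (2 ^ (d - 1)) q * ldot d y \<gamma>) i"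

lemma lstate_below: "0 < d \<Longrightarrow> d \<le> s \<Longrightarrow> lstate_below (2 ^ s) d \<gamma> \<beta> i = lstate d \<gamma> \<beta> i"
proof (induction i)
  case 0
  then show ?case by (simp add: lstate_below_def min_def)
next
  case (Suc i)
  have m: "min (2 ^ d) (2 ^ s) = (2 :: nat) ^ d" "min (2 ^ (d - 1)) (2 ^ s) = (2 :: nat) ^ (d - 1)"
    using Suc.prems by (auto simp: min_def)
  have "lstate d \<gamma> \<beta> (Suc i) < 2 ^ d" using lstate_less Suc.prems by blast
  also have "2 ^ d \<le> (2 :: nat) ^ s" using Suc.prems by simp
  finally have "min (lstate d \<gamma> \<beta> (Suc i)) (2 ^ s) = lstate d \<gamma> \<beta> (Suc i)" by simp
  then show ?case using Suc.IH[OF Suc.prems] unfolding lstate_below_def m biter_simps lstate.simps by simp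
qed

lemma pf_lstate_below:
  assumes "pf q" "pf d" "pf \<gamma>" "pf \<beta>" "pf i"
  shows "pf (\<lambda>x v. lstate_below (q x v) (d x v) (\<gamma> x v) (\<beta> x v) (i x v))"
proof -
  have "pf (\<lambda>x v. lstate_below (v 0) (v 1) (v 2) (v 3) (v 4))"
    unfolding lstate_below_def by (intro pf_biter pf_ldot pf_intros)
  from pf_comp5[OF this assms] show ?thesis .
qed

definition active_below :: "nat \<Rightarrow> nat \<Rightarrow> nat \<Rightarrow> nat \<Rightarrow> bool" where
  "active_below q s d \<gamma> \<longleftrightarrow> 0 < d \<and> d \<le> s \<and> \<gamma> < min (2 ^ d) q \<and>
    (\<forall>a<min (2 ^ d) q. \<forall>b<min (2 ^ d) q. \<exists>m<2 * d. Bit_Operations.bit (min (2 ^ d) q + \<gamma>) m \<noteq>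
     odd (\<Sum>i<Suc m. of_bool (Bit_Operations.bit a i \<and> Bit_Operations.bit b (m - i)) :: nat))"

lemma active_below: "active_below (2 ^ s) s d \<gamma> \<longleftrightarrow> active s d \<gamma>"
proof (cases "d \<le> s")
  case True
  then have "min (2 ^ d) (2 ^ s) = (2 :: nat) ^ d" by (auto simp: min_def)
  then show ?thesis unfolding active_below_def active_def irr_def by (simp only:)
qed (auto simp: active_below_def active_def)

text \<open>Irreducibility is tested by exhaustive search for factors, which is affordable because
  the candidates lie below \<open>2 ^ s\<close>, itself a computed value.\<close>

lemma pp_active:
  assumes s: "pf (\<lambda>x v. s x)" "pf (\<lambda>x v. 2 ^ s x)" and "pf d" "pf \<gamma>"
  shows "pp (\<lambda>x v. active (s x) (d x v) (\<gamma> x v))"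
proof -
  have "pp (\<lambda>x v. active_below (2 ^ s x) (s x) (v 0) (v 1))"
    unfolding active_below_def by (intro pf_intros pp_bit s)
  then have "pp (\<lambda>x v. active (s x) (v 0) (v 1))" unfolding active_below .
  from pp_comp2[OF this assms(3,4)] show ?thesis .
qed

lemma pf_nact:
  assumes s: "pf (\<lambda>x v. s x)" "pf (\<lambda>x v. 2 ^ s x)"
  shows "pf (\<lambda>x v. nact (s x))"
  unfolding nact_def by (intro pf_intros pp_active s)

lemma pf_bal_rows:
  assumes s: "pf (\<lambda>x v. s x)" "pf (\<lambda>x v. 2 ^ s x)"
  shows "pf (\<lambda>x v. bal_rows (s x))"
  unfolding bal_rows_def by (intro pf_intros s)

lemma pp_bal:
  assumes s: "pf (\<lambda>x v. s x)" "pf (\<lambda>x v. 2 ^ s x)"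
  shows "pp (\<lambda>x v. bal (s x) (v 0) (v 1))"
proof -
  have *: "bal s r i \<longleftrightarrow> active s (r div 2 ^ s div 2 ^ s) (r div 2 ^ s mod 2 ^ s) \<and>
     odd (lstate_below (2 ^ s) (r div 2 ^ s div 2 ^ s) (r div 2 ^ s mod 2 ^ s) (r mod 2 ^ s) i)" for s r i
    unfolding bal_def using lstate_below[of "r div 2 ^ s div 2 ^ s" s] by (auto simp: active_def)
  show ?thesis unfolding * by (intro pf_intros pp_active pf_lstate_below s)
qed

lemma pp_tens:
  assumes "pp (\<lambda>x v. A x (v 0) (v 1))" "pp (\<lambda>x v. B x (v 0) (v 1))" "pf (\<lambda>x v. N x)" "pf (\<lambda>x v. K x)" "pf r" "pf c"
  shows "pp (\<lambda>x v. tens (A x) (N x) (K x) (B x) (r x v) (c x v))"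
  unfolding tens_def
  by (intro pp_conj pp_comp2[OF assms(1)] pp_comp2[OF assms(2)] pf_mod pf_div assms)

lemma pp_tpow:
  assumes "pp (\<lambda>x v. A x (v 0) (v 1))" "pf (\<lambda>x v. N x)" "pf (\<lambda>x v. K x)"
  shows "pp (\<lambda>x v. tpow (A x) (N x) (K x) t (v 0) (v 1))"
proof (induction t)
  case 0
  show ?case unfolding tpow.simps by (rule pp_const)
next
  case (Suc t)
  show ?case unfolding tpow.simps by (intro pp_tens assms Suc pf_var)
qed

lemma if_bool: "(if b then P else Q) = ((b \<longrightarrow> P) \<and> (\<not> b \<longrightarrow> Q))"
  by simp

lemma pp_base_code:
  assumes E: "pp (\<lambda>x v. E x (v 0) (v 1))" and N: "pf (\<lambda>x v. N x)" and n: "pf (\<lambda>x v. n x)"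
    and Z: "pp (\<lambda>x v. Z x (v 0) (v 1))" and Q: "pp (\<lambda>x v. Q x (v 0) (v 1) (v 2))" and S: "pp (\<lambda>x v. S x (v 0) (v 1))"
  shows "pp (\<lambda>x v. base_code (E x) (N x) (n x) (Z x) (Q x) (S x) (v 0) (v 1))"
  unfolding base_code_def constr_def if_bool
  by (intro pp_tens pp_comp2[OF Z] pp_comp2[OF S] pp_comp3[OF Q] E N n pf_intros)

lemma pp_incident:
  assumes "pf w" "pf p" "pf l"
  shows "pp (\<lambda>x v. incident (w x v) (p x v) (l x v))"
  unfolding incident_def by (intro pf_intros assms)

lemma pp_code_adj:
  assumes A: "pp (\<lambda>x v. A x (v 0) (v 1))" and R: "pf (\<lambda>x v. R x)" and K: "pf (\<lambda>x v. K x)" and "pf i" "pf j"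
  shows "pp (\<lambda>x v. code_adj (A x) (R x) (K x) (i x v) (j x v))"
  unfolding code_adj_def nlines_def if_bool
  by (intro pp_comp2[OF A] pp_incident pf_intros assms)

text \<open>Cut off outside their finite ranges, the data of the machine become finite tables; under
  the bounded quantifiers of \<open>cZ\<close> and \<open>cQ\<close> the cut is invisible.\<close>

definition tab :: "nat \<Rightarrow> (nat \<Rightarrow> nat) \<Rightarrow> nat \<Rightarrow> nat" where
  "tab N f i = (if i < N then f i else 0)"

definition tab2 :: "nat \<Rightarrow> nat \<Rightarrow> (nat \<Rightarrow> nat \<Rightarrow> nat) \<Rightarrow> nat \<Rightarrow> nat \<Rightarrow> nat" where
  "tab2 N K f i j = (if i < N \<and> j < K then f i j else 0)"

lemma pf_tab: "pf i \<Longrightarrow> pf (\<lambda>x v. tab N f (i x v))"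
  unfolding tab_def by (rule pf_table)

lemma pf_tab2: "pf i \<Longrightarrow> pf j \<Longrightarrow> pf (\<lambda>x v. tab2 N K f (i x v) (j x v))"
  unfolding tab2_def by (rule pf_table2)

lemma tab_cong: "\<tau> < length (trs M) \<Longrightarrow> tab (length (trs M)) f \<tau> = f \<tau>"
  "\<tau> < length (trs M) \<Longrightarrow> i < tapes M \<Longrightarrow> tab2 (length (trs M)) (tapes M) g \<tau> i = g \<tau> i"
  by (simp_all add: tab_def tab2_def)

lemma cZ_tab: "cZ M T P V x a b \<longleftrightarrow>
     (\<exists>t<T. \<exists>\<tau><length (trs M). \<exists>\<tau>'<length (trs M). a = vD V t \<tau> \<and> b = vD V (Suc t) \<tau>' \<and>
        tab (length (trs M)) (tnx M) \<tau> \<noteq> tab (length (trs M)) (tst M) \<tau>') \<or>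
     (\<exists>\<tau><length (trs M). a = vD V 0 \<tau> \<and> b = 0 \<and> tab (length (trs M)) (tst M) \<tau> \<noteq> 0) \<or>
     (\<exists>t<T. \<exists>\<tau><length (trs M). \<exists>i<tapes M. \<exists>s<symbols M. a = vD V t \<tau> \<and>
        b = vC V (Suc t) i (T + 2 - tab2 (length (trs M)) (tapes M) (tmo M) \<tau> i) s \<and> s \<noteq> tab2 (length (trs M)) (tapes M) (twr M) \<tau> i) \<or>
     (\<exists>i<tapes M. \<exists>p<2 * T + 3. \<exists>s<symbols M. a = vC V 0 i p s \<and> b = 0 \<and> \<not> allowed x P (T + 1) i p s) \<or>
     (\<exists>i<tapes M. \<exists>p<2 * T + 3. \<exists>s<symbols M. \<exists>s'<symbols M. a = vC V 0 i p s \<and> b = vC V 0 i p s' \<and> s < s')"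
  unfolding cZ_def by (simp only: tab_cong cong: conj_cong)

lemma cQ_tab: "cQ M T V x d a b \<longleftrightarrow>
     (d = a \<and> b = 0) \<or>
     (\<exists>t<Suc T. \<exists>\<tau><length (trs M). \<exists>i<tapes M. d = vD V t \<tau> \<and> a = 0 \<and>
        b = vC V t i (T + 1) (tab2 (length (trs M)) (tapes M) (trd M) \<tau> i)) \<or>
     (\<exists>t<T. \<exists>\<tau><length (trs M). \<exists>i<tapes M. d = vD V t \<tau> \<and> a = 0 \<and>
        b = vC V (Suc t) i (T + 2 - tab2 (length (trs M)) (tapes M) (tmo M) \<tau> i) (tab2 (length (trs M)) (tapes M) (twr M) \<tau> i)) \<or>
     (\<exists>t<T. \<exists>\<tau><length (trs M). \<exists>i<tapes M. \<exists>p<2 * T + 3. \<exists>s<symbols M. t < p \<and> p + t < 2 * T + 2 \<and>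
        p + tab2 (length (trs M)) (tapes M) (tmo M) \<tau> i \<noteq> T + 2 \<and>
        d = vD V t \<tau> \<and> a = vC V t i (p + tab2 (length (trs M)) (tapes M) (tmo M) \<tau> i - 1) s \<and> b = vC V (Suc t) i p s) \<or>
     (\<exists>p<2 * T + 2. T + 1 + 2 * length x < p \<and> d = vC V 0 0 p 0 \<and> a = 0 \<and> b = vC V 0 0 (Suc p) 0) \<or>
     (d = 0 \<and> a = 0 \<and> b = vC V T (tapes M - 1) (T + 1) 2)"
  unfolding cQ_def by (simp only: tab_cong cong: conj_cong)

lemma pp_cZ:
  assumes "pf (\<lambda>x v. T x)" "pf (\<lambda>x v. P x)" "pf (\<lambda>x v. V x)"
  shows "pp (\<lambda>x v. cZ M (T x) (P x) (V x) x (v 0) (v 1))"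
  unfolding cZ_tab enc_def allowed_def if_bool by (intro pf_tab pf_tab2 pf_intros assms)

lemma pp_cQ:
  assumes "pf (\<lambda>x v. T x)" "pf (\<lambda>x v. V x)"
  shows "pp (\<lambda>x v. cQ M (T x) (V x) x (v 0) (v 1) (v 2))"
  unfolding cQ_tab enc_def by (intro pf_tab pf_tab2 pf_intros assms)

lemma pp_cS:
  assumes "pf (\<lambda>x v. T x)" "pf (\<lambda>x v. V x)"
  shows "pp (\<lambda>x v. cS M (T x) (V x) (v 0) (v 1))"
  unfolding cS_def enc_def by (intro pf_intros assms)

text \<open>The binary logarithm rounded up, as the number of powers of two below \<open>y\<close>;
  the \<open>min\<close> keeps the powers expressible without affecting the comparison.\<close>

definition lg :: "nat \<Rightarrow> nat" where
  "lg y = (\<Sum>i<y. of_bool (min (2 ^ i) y < y))"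

lemma pf_lg: "pf f \<Longrightarrow> pf (\<lambda>x v. lg (f x v))"
proof -
  assume f: "pf f"
  have "pf (\<lambda>x v. lg (v 0))" unfolding lg_def by (intro pf_intros)
  from pf_comp1[OF this f] show ?thesis .
qed

lemma lg_bounds: "y \<le> 2 ^ lg y" "0 < y \<Longrightarrow> 2 ^ lg y < 2 * y"
proof -
  define k where "k = (LEAST i. y \<le> 2 ^ i)"
  have k: "y \<le> 2 ^ k" unfolding k_def by (rule LeastI[of _ y]) (simp add: less_imp_le)
  have k': "y \<le> 2 ^ i \<longleftrightarrow> k \<le> i" for i
  proof
    show "y \<le> 2 ^ i \<Longrightarrow> k \<le> i" unfolding k_def by (rule Least_le)
    assume "k \<le> i"
    then have "(2 :: nat) ^ k \<le> 2 ^ i" by simp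
    then show "y \<le> 2 ^ i" using k by linarith
  qed
  have "k \<le> y" using k'[of y] less_exp[of y] by simp
  moreover have "min (2 ^ i) y < y \<longleftrightarrow> i < k" for i
    unfolding min_less_iff_disj using k'[of i] by (metis not_le less_irrefl)
  ultimately have "{..<y} \<inter> {i. min (2 ^ i) y < y} = {..<k}" by fastforce
  moreover have "lg y = card ({..<y} \<inter> {i. min (2 ^ i) y < y})"
    unfolding lg_def using sum_of_bool_eq[of "{..<y}" "\<lambda>i. min (2 ^ i) y < y", where 'a = nat] by simp
  ultimately have lg: "lg y = k" by simp
  show "y \<le> 2 ^ lg y" using k lg by simp
  assume "0 < y"
  show "2 ^ lg y < 2 * y"
  proof (cases k)
    case 0
    then show ?thesis using \<open>0 < y\<close> lg by simp
  next
    case (Suc j)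
    then have "2 ^ j < y" using k'[of j] by simp
    then show ?thesis using Suc lg by simp
  qed
qed

lemma pf_pow_lg:
  assumes "pf f"
  shows "pf (\<lambda>x v. 2 ^ lg (f x v))"
proof -
  have "2 ^ lg y = min (2 ^ lg y) (2 * y + 1)" for y :: nat
    using lg_bounds(2)[of y] by (cases "y = 0") (simp_all add: lg_def)
  moreover have "pf (\<lambda>x v. min (2 ^ lg (f x v)) (2 * f x v + 1))" by (intro pf_intros pf_lg assms)
  ultimately show ?thesis by simp
qed

section \<open>The gap reduction\<close>

lemma square_le_pow2: "s * s \<le> 9 * 2 ^ s" for s :: nat
proof (induction s)
  case (Suc s)
  have "s < 2 ^ s" by (rule less_exp)
  then have "1 + 2 * s \<le> 9 * 2 ^ s" by linarith
  then show ?case using Suc by simp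
qed simp

text \<open>From \<open>2 ^ s \<le> s * nact s\<close> and \<open>s * s \<le> 9 * 2 ^ s\<close> one
  gets \<open>2 ^ s \<le> 9 * (nact s * nact s)\<close>, hence 1296 = 9 * 12^2. At least
  \<open>12 * n\<close> active polynomials, of which at most \<open>n\<close> are lost, leave 11/12
  of the maximal weight.\<close>

lemma nact_lg:
  fixes n :: nat
  assumes n: "0 < n" and s: "1296 * (n * n) \<le> 2 ^ s"
  shows "2 \<le> s" "12 * n \<le> nact s" "2 * (nact s * 2 ^ (s - 1)) \<le> bal_rows s"
proof -
  have nn: "1 \<le> n * n" using n by simp
  show s2: "2 \<le> s"
  proof (rule ccontr)
    assume "\<not> 2 \<le> s"
    then have "(2 :: nat) ^ s \<le> 2 ^ 1" by (intro power_increasing) auto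
    then show False using s nn by simp
  qed
  show "12 * n \<le> nact s"
  proof -
    have g: "2 ^ s \<le> s * nact s" using nact_ge s2 by simp
    have "2 ^ s * 2 ^ s \<le> (s * nact s) * (s * nact s)" by (rule mult_mono[OF g g]) simp_all
    also have "\<dots> = (s * s) * (nact s * nact s)" by (simp add: ac_simps)
    also have "\<dots> \<le> (9 * 2 ^ s) * (nact s * nact s)" by (rule mult_right_mono[OF square_le_pow2]) simp
    finally have "2 ^ s * 2 ^ s \<le> 2 ^ s * (9 * (nact s * nact s))" by (simp add: ac_simps)
    then have "2 ^ s \<le> 9 * (nact s * nact s)" by simp
    then have "144 * (n * n) \<le> nact s * nact s" using s by linarith
    then have "(12 * n) ^ 2 \<le> nact s ^ 2" by (simp add: power2_eq_square)
    then show ?thesis by (rule power2_le_imp_le) simp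
  qed
  have "nact s \<le> (\<Sum>b<Suc s * 2 ^ s. 1)" unfolding nact_def by (intro sum_mono) simp
  then have "nact s \<le> Suc s * 2 ^ s" by simp
  then have "nact s * 2 ^ (s - 1) \<le> (Suc s * 2 ^ s) * 2 ^ (s - 1)" by (rule mult_right_mono) simp
  then have "2 * (nact s * 2 ^ (s - 1)) \<le> 2 * ((Suc s * 2 ^ s) * 2 ^ (s - 1))" by (rule mult_left_mono) simp
  also have "\<dots> = (2 * 2 ^ (s - 1)) * (Suc s * 2 ^ s)" by (simp only: ac_simps)
  also have "2 * (2 :: nat) ^ (s - 1) = 2 ^ s" using s2 by (cases s) simp_all
  finally show "2 * (nact s * 2 ^ (s - 1)) \<le> bal_rows s" unfolding bal_rows_def .
qed

definition top_weight :: "nat \<Rightarrow> nat" where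
  "top_weight s = nact s * 2 ^ (s - 1)"

abbreviation gap_rows :: "nat \<Rightarrow> nat \<Rightarrow> nat" where
  "gap_rows n s \<equiv> bal_rows s * bal_rows s * (1 + 4 * n ^ 3)"

definition gap_graph where
  "gap_graph n s Z Q S t =
     code_graph (tpow (base_code (bal s) (bal_rows s) n Z Q S) (gap_rows n s) (n * n) t)
       (gap_rows n s ^ t) ((n * n) ^ t)"

context
  fixes n s :: nat and Z :: "nat \<Rightarrow> nat \<Rightarrow> bool" and Q :: "nat \<Rightarrow> nat \<Rightarrow> nat \<Rightarrow> bool" and S :: "nat \<Rightarrow> nat \<Rightarrow> bool"
  assumes n: "0 < n" and s: "1296 * (n * n) \<le> 2 ^ s" and S: "\<And>a l. S a l \<Longrightarrow> a + l \<le> n"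
begin

text \<open>The factor 2 pays for the dimension of the code, which is at most the weight
  bound.\<close>

lemma local_min_degree_gap_graph_less:
  assumes "solves n Z Q S z"
  shows "local_min_degree (gap_graph n s Z Q S t) < 2 * (top_weight s * top_weight s) ^ t"
proof -
  let ?h = "top_weight s"
  have "wt (bal_rows s) (mv n (bal s) z) \<le> ?h" unfolding top_weight_def by (rule wt_bal_le)
  from base_code_weight_le[where S = S, OF assms S this, of "1 + 4 * n ^ 3"] obtain x where x: "\<exists>c<n * n. x c = 1"
    "wt (gap_rows n s) (mv (n * n) (base_code (bal s) (bal_rows s) n Z Q S) x) \<le> ?h * ?h" by blast
  from wt_tpow[OF x(1), of t "gap_rows n s" "base_code (bal s) (bal_rows s) n Z Q S"]
  obtain y where y: "\<exists>c<(n * n) ^ t. y c = 1"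
    and w: "wt (gap_rows n s ^ t) (mv ((n * n) ^ t) (tpow (base_code (bal s) (bal_rows s) n Z Q S) (gap_rows n s) (n * n) t) y) =
      wt (gap_rows n s) (mv (n * n) (base_code (bal s) (bal_rows s) n Z Q S) x) ^ t" by blast
  have "n \<le> ?h * 1"
    using nact_lg[OF n s] mult_le_mono[of n "nact s" 1 "2 ^ (s - 1)"] unfolding top_weight_def by simp
  then have K: "(n * n) ^ t \<le> (?h * ?h) ^ t" by (intro power_mono mult_mono) simp_all
  have "wt (gap_rows n s) (mv (n * n) (base_code (bal s) (bal_rows s) n Z Q S) x) ^ t \<le> (?h * ?h) ^ t"
    using x(2) by (rule power_mono) simp
  then show ?thesis
    using code_graph_upper[OF y, of "tpow (base_code (bal s) (bal_rows s) n Z Q S) (gap_rows n s) (n * n) t" "gap_rows n s ^ t"] K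
    unfolding gap_graph_def w by linarith
qed

text \<open>With h = 2 g, the bound 6 d \<ge> 11 g gives 36 d^2 \<ge> 121 g^2 and hence 3 d^2 \<ge>
  10 g^2. Halving h keeps the target B = 5 g^2, which is 5/4 of h^2, integral.\<close>

lemma local_min_degree_gap_graph_ge:
  assumes "\<And>z. \<not> solves n Z Q S z"
  shows "5 ^ t * (top_weight s * top_weight s) ^ t \<le> 4 ^ t * Suc (local_min_degree (gap_graph n s Z Q S t))"
proof -
  define g where "g = nact s * 2 ^ (s - 2)"
  have "(2 :: nat) ^ (s - 1) = 2 * 2 ^ (s - 2)" using nact_lg(1)[OF n s] by (cases s; cases "s - 1") auto
  then have h: "top_weight s = 2 * g" by (simp add: top_weight_def g_def)
  define d where "d = (nact s - n) * 2 ^ (s - 1)"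
  define B where "B = 5 * (g * g)"
  have "11 * nact s \<le> 12 * (nact s - n)" using nact_lg(2)[OF n s] by linarith
  then have "11 * nact s * 2 ^ (s - 1) \<le> 12 * (nact s - n) * 2 ^ (s - 1)" by (rule mult_right_mono) simp
  then have "22 * g \<le> 12 * d" using h unfolding top_weight_def d_def by (simp only: mult.assoc)
  then have "11 * g \<le> 6 * d" by simp
  from mult_le_mono[OF this this] have B1: "2 * B \<le> 3 * d * d" unfolding B_def by simp
  have "4 * g \<le> bal_rows s" using nact_lg(3)[OF n s] h unfolding top_weight_def by simp
  from mult_le_mono[OF this this] have B2: "B \<le> bal_rows s * bal_rows s" unfolding B_def by simp
  have md: "mindist (gap_rows n s) (n * n) (base_code (bal s) (bal_rows s) n Z Q S) B"
    by (rule mindist_base_code[where S = S, OF assms S mindist_bal B1[unfolded d_def] B2])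
  have "B \<le> gap_rows n s" using B2 by simp
  then have B3: "B ^ t \<le> gap_rows n s ^ t" by (intro power_mono) simp_all
  have "0 < bal_rows s" by (simp add: bal_rows_def)
  then have "0 < gap_rows n s ^ t" by simp
  from code_graph_lower[OF mindist_tpow[OF md] B3 this]
  have "B ^ t \<le> Suc (local_min_degree (gap_graph n s Z Q S t))" by (simp only: gap_graph_def)
  then have "4 ^ t * B ^ t \<le> 4 ^ t * Suc (local_min_degree (gap_graph n s Z Q S t))" by (rule mult_left_mono) simp
  moreover have "4 ^ t * B ^ t = 5 ^ t * (top_weight s * top_weight s) ^ t"
  proof -
    have "4 * B = 5 * (top_weight s * top_weight s)" by (simp add: B_def h)
    then show ?thesis by (simp only: power_mult_distrib[symmetric])
  qed
  ultimately show ?thesis by (simp only:)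
qed

end

section \<open>The adjacency matrix as a computed word\<close>

lemma concat_map_upt:
  "concat (map (\<lambda>i. map (\<lambda>j. f i j) [0..<n]) [0..<m]) = map (\<lambda>k. f (k div n) (k mod n)) [0..<m * n]"
proof (induction m)
  case (Suc m)
  have "map (\<lambda>k. f (k div n) (k mod n)) [m * n..<m * n + n] = map (\<lambda>j. f m j) [0..<n]"
    by (rule nth_equalityI) simp_all
  moreover have "[0..<Suc m * n] = [0..<m * n] @ [m * n..<m * n + n]"
    using upt_add_eq_append[of 0 "m * n" n] by (simp add: add.commute)
  ultimately show ?case using Suc by (simp only: upt_Suc_append map_append concat_append list.map concat.simps append_Nil2 zero_le map_map)
qed simp

lemma encode_code_graph:
  assumes "m = K + 2 * nlines R"
  shows "encode_graph (code_graph A R K) =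
    map (\<lambda>i. code_adj A R K (i div m) (i mod m) \<or> code_adj A R K (i mod m) (i div m)) [0..<m * m]"
  unfolding encode_graph_def Let_def verts_code_graph card_lessThan assms[symmetric] code_graph_edge concat_map_upt ..

lemma pf_fun: "pf (\<lambda>x v. f x v) \<Longrightarrow> \<exists>e. \<forall>x v. ev e x v = f x v"
  by (simp add: pf_def)

lemma emitted_eq:
  assumes "\<And>x v. ev el x v = f x" "\<And>x v. ev eb x v = of_bool (Q x (v 0))"
  shows "emitted el eb x = map (Q x) [0..<f x]"
  unfolding emitted_def assms by (simp add: env1_def)

text \<open>Comparison with a power of two needs no arithmetic on the output, whose value is not
  known in advance to be polynomial; this is why the threshold is a power of two.\<close>

lemma horner_sum_less_iff: "horner_sum of_bool 2 y < (2 :: nat) ^ k \<longleftrightarrow> \<not> (\<exists>i<length y. k \<le> i \<and> y ! i)"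
proof -
  let ?v = "horner_sum of_bool 2 y :: nat"
  have b: "Bit_Operations.bit ?v i \<longleftrightarrow> i < length y \<and> y ! i" for i
    by (simp add: bit_horner_sum_bit_iff)
  have "?v < 2 ^ k \<longleftrightarrow> take_bit k ?v = ?v" by (simp only: take_bit_nat_eq_self_iff)
  also have "\<dots> \<longleftrightarrow> (\<forall>i. Bit_Operations.bit ?v i \<longrightarrow> i < k)"
    by (auto simp: bit_eq_iff bit_take_bit_iff)
  finally show ?thesis unfolding b by (metis not_less)
qed

lemma class_NP_subset_class_P:
  assumes "polytime_approximates_local_min_degree l M0" "L \<in> class_NP"
  shows "L \<in> class_P"
proof -
  obtain R p where R: "R \<in> class_P" and L: "\<And>x. x \<in> L \<longleftrightarrow> (\<exists>u. length u \<le> poly p (length x) \<and> encode_pair x u \<in> R)"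
    using assms(2) unfolding class_NP_def by blast
  obtain M q where M: "decides M q R" using class_P_decides[OF R] by blast
  obtain p0 where M0: "wf_tm M0" "\<And>G n. simple_graph (G :: nat ugraph) \<Longrightarrow> bipartite G \<Longrightarrow> verts G = {..<n} \<Longrightarrow> 0 < n \<Longrightarrow>
       (\<exists>y. outputs_within M0 (encode_graph G) (poly p0 (length (encode_graph G))) y \<and>
            within_factor l (local_min_degree G) (horner_sum of_bool 2 y))"
    using assms(1) unfolding polytime_approximates_local_min_degree_def by blast
  \<comment> \<open>A natural number at least \<open>l\<close>; being at least 1, it covers small
    and negative factors as well.\<close>
  obtain \<kappa> :: nat where \<kappa>: "l \<le> real \<kappa>" "1 \<le> \<kappa>"
    by (metis le_add1 of_nat_add order_trans real_arch_simple of_nat_le_iff le_add2)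
  \<comment> \<open>The approximation may err by \<kappa> in either direction, hence the square; 100
    generously covers the factor 2 from the dimension and the rounding of the threshold.\<close>
  obtain t where t: "100 * (\<kappa> * \<kappa>) * 4 ^ t \<le> (5 :: nat) ^ t"
  proof -
    obtain t where "real (100 * (\<kappa> * \<kappa>)) < (5 / 4) ^ t" using real_arch_pow[of "5 / 4"] by auto
    then have "real (100 * (\<kappa> * \<kappa>)) * 4 ^ t \<le> 5 ^ t" by (simp add: power_divide field_simps)
    then have "real (100 * (\<kappa> * \<kappa>) * 4 ^ t) \<le> real (5 ^ t)" by simp
    then show ?thesis using that of_nat_le_iff by blast
  qed
  define P where "P x = poly p (length x)" for x :: "bool list"
  \<comment> \<open>The first summand bounds the length of the encoded pair, as
    \<open>tableau\<close> demands; the second is the running time of the verifier on it.\<close>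
  define T where "T x = (2 * length x + 1 + P x) + poly q (2 * length x + 1 + P x)" for x
  define V where "V x = 2 * T x + 4 + symbols M + tapes M + length (trs M)" for x
  define n where "n x = 3 * V x ^ 4" for x
  define s where "s x = lg (1296 * (n x * n x))" for x
  let ?Z = "\<lambda>x. cZ M (T x) (P x) (V x) x" and ?Q = "\<lambda>x. cQ M (T x) (V x) x" and ?S = "\<lambda>x. cS M (T x) (V x)"
  define A where "A x = base_code (bal (s x)) (bal_rows (s x)) (n x) (?Z x) (?Q x) (?S x)" for x
  define H where "H x = (top_weight (s x) * top_weight (s x)) ^ t" for x
  define R' where "R' x = gap_rows (n x) (s x) ^ t" for x
  define K where "K x = (n x * n x) ^ t" for x
  define A' where "A' x = tpow (A x) (gap_rows (n x) (s x)) (n x * n x) t" for x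
  define m where "m x = K x + 2 * nlines (R' x)" for x
  define G where "G x = gap_graph (n x) (s x) (?Z x) (?Q x) (?S x) t" for x
  have G: "G x = code_graph (A' x) (R' x) (K x)" for x
    unfolding G_def gap_graph_def A'_def R'_def K_def A_def ..
  have tab: "tableau M x (T x) (P x) (V x)" for x
    using M by unfold_locales (simp_all add: decides_def V_def T_def)
  have npos: "0 < n x" for x by (simp add: n_def V_def)
  have s: "1296 * (n x * n x) \<le> 2 ^ s x" for x unfolding s_def by (rule lg_bounds)
  have S: "?S x a i \<Longrightarrow> a + i \<le> n x" for x a i
    using tableau.cS_bound(1)[OF tab] unfolding n_def .
  have sol: "(\<exists>z. solves (n x) (?Z x) (?Q x) (?S x) z) \<longleftrightarrow> x \<in> L" for x
    unfolding n_def L P_def[symmetric]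
  proof (rule solves_iff_witness[OF M tab])
    fix u :: "bool list" assume "length u \<le> P x"
    then have "poly q (length (encode_pair x u)) \<le> poly q (2 * length x + 1 + P x)"
      by (intro poly_nat_mono) (simp add: length_encode_pair)
    then show "poly q (length (encode_pair x u)) \<le> T x" by (simp add: T_def)
  qed
  have yes: "local_min_degree (G x) < 2 * H x" if "x \<in> L" for x
    using that local_min_degree_gap_graph_less[OF npos s S] unfolding sol[symmetric] G_def H_def by blast
  have no: "5 ^ t * H x \<le> 4 ^ t * Suc (local_min_degree (G x))" if "x \<notin> L" for x
    using that local_min_degree_gap_graph_ge[OF npos s S] unfolding sol[symmetric] G_def H_def by blast
  have Hpos: "1 \<le> H x" for x
  proof -
    have "0 < nact (s x)" using nact_lg(2)[OF npos s, of x] npos[of x] by linarith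
    then show ?thesis unfolding H_def top_weight_def by simp
  qed
  have P: "pf (\<lambda>x v. P x)" unfolding P_def by (intro pf_intros)
  have T: "pf (\<lambda>x v. T x)" unfolding T_def by (intro pf_intros P)
  have V: "pf (\<lambda>x v. V x)" unfolding V_def by (intro pf_intros T)
  have n: "pf (\<lambda>x v. n x)" unfolding n_def by (intro pf_intros V)
  have s1: "pf (\<lambda>x v. s x)" and s2: "pf (\<lambda>x v. 2 ^ s x)"
    unfolding s_def by (intro pf_lg pf_pow_lg pf_intros n)+
  have h: "pf (\<lambda>x v. top_weight (s x))"
  proof -
    have "pf (\<lambda>x v. nact (s x) * (2 ^ s x div 2))" by (intro pf_intros pf_nact s1 s2)
    moreover have "(2 :: nat) ^ s x div 2 = 2 ^ (s x - 1)" for x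
      using nact_lg(1)[OF npos s, of x] by (cases "s x") simp_all
    ultimately show ?thesis by (simp add: top_weight_def)
  qed
  have H: "pf (\<lambda>x v. H x)" unfolding H_def by (intro pf_intros h)
  have br: "pf (\<lambda>x v. gap_rows (n x) (s x))" by (intro pf_intros pf_bal_rows s1 s2 n)
  have R': "pf (\<lambda>x v. R' x)" unfolding R'_def by (intro pf_intros br)
  have K: "pf (\<lambda>x v. K x)" unfolding K_def by (intro pf_intros n)
  have m: "pf (\<lambda>x v. m x)" unfolding m_def nlines_def by (intro pf_intros R' K)
  have A: "pp (\<lambda>x v. A x (v 0) (v 1))"
    unfolding A_def by (intro pp_base_code pp_bal pf_bal_rows s1 s2 n pp_cZ pp_cQ pp_cS T P V)
  have A': "pp (\<lambda>x v. A' x (v 0) (v 1))"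
    unfolding A'_def by (intro pp_tpow A br pf_mult n)
  obtain el where el: "\<And>x v. ev el x v = m x * m x"
    using pf_fun[OF pf_mult[OF m m]] by blast
  have "pp (\<lambda>x v. code_adj (A' x) (R' x) (K x) (v 0 div m x) (v 0 mod m x) \<or>
      code_adj (A' x) (R' x) (K x) (v 0 mod m x) (v 0 div m x))"
    by (intro pp_disj pp_code_adj A' R' K pf_div pf_mod pf_var m)
  then obtain eb where eb: "\<And>x v. ev eb x v = of_bool (code_adj (A' x) (R' x) (K x) (v 0 div m x) (v 0 mod m x) \<or>
      code_adj (A' x) (R' x) (K x) (v 0 mod m x) (v 0 div m x))"
    unfolding pp_def using pf_fun by blast
  \<comment> \<open>For members the output is at most \<open>2 * \<kappa> * H x\<close>, which lies
    strictly below the power of two chosen here.\<close>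
  have "pf (\<lambda>x v. lg (2 * \<kappa> * H x + 1))" by (intro pf_lg pf_intros H)
  then obtain et where et: "\<And>x v. ev et x v = lg (2 * \<kappa> * H x + 1)"
    using pf_fun by blast
  have em: "emitted el eb x = encode_graph (G x)" for x
    unfolding G encode_code_graph[OF m_def]
    by (rule emitted_eq[where f = "\<lambda>x. m x * m x" and Q = "\<lambda>x i. code_adj (A' x) (R' x) (K x) (i div m x) (i mod m x) \<or>
      code_adj (A' x) (R' x) (K x) (i mod m x) (i div m x)", OF el eb])
  \<comment> \<open>Members have small values, that is, no \<open>True\<close> at or beyond the
    threshold position; hence \<open>False\<close> on the right.\<close>
  have "\<exists>y. outputs_within M0 (emitted el eb x) (poly p0 (length (emitted el eb x))) y \<and>
      (x \<in> L \<longleftrightarrow> ((\<exists>i<length y. ev et x (\<lambda>_. 0) \<le> i \<and> y ! i) = False))" for x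
  proof -
    have "0 < K x" using npos by (simp add: K_def)
    then have "0 < m x" by (simp add: m_def)
    moreover have "simple_graph (G x)" "bipartite (G x)" "verts (G x) = {..<m x}"
      unfolding G by (simp_all add: simple_code_graph bipartite_code_graph verts_code_graph m_def)
    ultimately obtain y where y: "outputs_within M0 (encode_graph (G x)) (poly p0 (length (encode_graph (G x)))) y"
      "within_factor l (local_min_degree (G x)) (horner_sum of_bool 2 y)"
      using M0(2) by blast
    define v :: nat where "v = horner_sum of_bool 2 y"
    have le: "a \<le> \<kappa> * b" if "real a \<le> l * real b" for a b
    proof -
      have "real a \<le> real \<kappa> * real b" using that \<kappa>(1) mult_right_mono[of l "real \<kappa>" "real b"] by linarith
      then show ?thesis by (simp flip: of_nat_mult)
    qed
    have v1: "local_min_degree (G x) \<le> \<kappa> * v" and v2: "v \<le> \<kappa> * local_min_degree (G x)"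
      using y(2) le unfolding within_factor_def v_def by blast+
    define \<tau> where "\<tau> = lg (2 * \<kappa> * H x + 1)"
    have \<tau>: "2 * \<kappa> * H x + 1 \<le> 2 ^ \<tau>" "2 ^ \<tau> < 2 * (2 * \<kappa> * H x + 1)"
      unfolding \<tau>_def by (rule lg_bounds, rule lg_bounds) simp
    have "x \<in> L \<longleftrightarrow> v < 2 ^ \<tau>"
    proof (cases "x \<in> L")
      case True
      then have "\<kappa> * local_min_degree (G x) \<le> \<kappa> * (2 * H x)" using yes[of x] by (intro mult_left_mono) auto
      with v2 have "v \<le> \<kappa> * (2 * H x)" by (rule order_trans)
      then have "v < 2 ^ \<tau>" using \<tau>(1) by (simp add: ac_simps)
      then show ?thesis using True by simp
    next
      case False
      have "4 ^ t * (100 * (\<kappa> * \<kappa>) * H x) = 100 * (\<kappa> * \<kappa>) * 4 ^ t * H x" by simp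
      also have "\<dots> \<le> 5 ^ t * H x" using t by (rule mult_right_mono) simp
      also have "\<dots> \<le> 4 ^ t * Suc (local_min_degree (G x))" by (rule no[OF False])
      finally have "100 * (\<kappa> * \<kappa>) * H x \<le> Suc (local_min_degree (G x))"
        by (rule mult_left_le_imp_le) simp
      then have *: "100 * (\<kappa> * \<kappa> * H x) \<le> Suc (\<kappa> * v)" using v1 by simp
      \<comment> \<open>A value below the threshold is at most 4 \<kappa> H + 1; multiplied by
        \<kappa> it is at most 5 \<kappa>^2 H, which contradicts the lower bound of about 100
        \<kappa>^2 H.\<close>
      have "\<not> v < 2 ^ \<tau>"
      proof
        assume "v < 2 ^ \<tau>"
        then have "v \<le> 4 * (\<kappa> * H x) + 1" using \<tau>(2) by simp
        then have "\<kappa> * v \<le> \<kappa> * (4 * (\<kappa> * H x) + 1)" by (rule mult_left_mono) simp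
        then have "\<kappa> * v \<le> 4 * (\<kappa> * \<kappa> * H x) + \<kappa>" by (simp add: algebra_simps)
        moreover have "\<kappa> * 1 * 1 \<le> \<kappa> * \<kappa> * H x" using \<kappa>(2) Hpos[of x] by (intro mult_mono) simp_all
        ultimately show False using * \<kappa>(2) by linarith
      qed
      then show ?thesis using False by simp
    qed
    then show ?thesis using y(1) unfolding em et v_def \<tau>_def[symmetric] horner_sum_less_iff by blast
  qed
  then show ?thesis using ex_decides[OF M0(1), of el eb p0 L et False] decides_class_P by blast
qed

text \<open>The inclusion is a matter of input format: the relation receives a pair, whose first
  component has to be recovered before the decider can run. The zero polynomial admits only the
  empty witness.\<close>

lemma class_P_subset_class_NP:
  assumes "L \<in> class_P"
  shows "L \<in> class_NP"
proof -
  obtain M p where M: "decides M p L" using class_P_decides[OF assms] by blast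
  \<comment> \<open>The first component ends at the first even position that does not carry 2. Later
    even positions may carry 2 by accident, so all earlier markers are tested too.\<close>
  define len where "len w = (\<Sum>i<length w. of_bool (\<forall>j<Suc i. inp w (2 * j) = 2) :: nat)" for w :: "bool list"
  define dec where "dec w = map (\<lambda>i. inp w (Suc (2 * i)) = 2) [0..<len w]" for w
  have dec: "dec (encode_pair x u) = x" for x u
  proof -
    let ?w = "encode_pair x u"
    have "(\<forall>j<Suc i. inp ?w (2 * j) = 2) \<longleftrightarrow> i < length x" for i
    proof
      assume a: "\<forall>j<Suc i. inp ?w (2 * j) = 2"
      show "i < length x"
      proof (rule ccontr)
        assume "\<not> i < length x"
        then have "inp ?w (2 * length x) = 2" using a by simp
        then show False by (simp add: inp_encode_pair)
      qed
    qed (simp add: inp_encode_pair)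
    then have "len ?w = (\<Sum>i<length ?w. of_bool (i < length x))" by (simp only: len_def)
    also have "\<dots> = card ({..<length ?w} \<inter> {i. i < length x})"
      using sum_of_bool_eq[of "{..<length ?w}" "\<lambda>i. i < length x", where 'a = nat] by simp
    also have "{..<length ?w} \<inter> {i. i < length x} = {..<length x}" by (auto simp: length_encode_pair)
    finally have "len ?w = length x" by simp
    then show ?thesis unfolding dec_def
      by (intro nth_equalityI) (simp_all add: inp_encode_pair, simp add: inp_def bit_symbol_def)
  qed
  have "pf (\<lambda>x v. len x)" unfolding len_def by (intro pf_intros)
  then obtain el where el: "\<And>x v. ev el x v = len x" using pf_fun by blast
  have "pp (\<lambda>x v. inp x (Suc (2 * v 0)) = 2)" by (intro pf_intros)
  then obtain eb where eb: "\<And>x v. ev eb x v = of_bool (inp x (Suc (2 * v 0)) = 2)" unfolding pp_def using pf_fun by blast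
  have em: "emitted el eb w = dec w" for w
    unfolding dec_def by (rule emitted_eq[where f = len and Q = "\<lambda>x i. inp x (Suc (2 * i)) = 2", OF el eb])
  have "\<exists>y. outputs_within M (emitted el eb w) (poly p (length (emitted el eb w))) y \<and>
      (w \<in> {w. dec w \<in> L} \<longleftrightarrow> ((\<exists>i<length y. ev (Const 0) w (\<lambda>_. 0) \<le> i \<and> y ! i) = True))" for w
  proof -
    obtain ts where ts: "(step M ^^ poly p (length (dec w))) (init_config M (dec w)) = (states M, ts)"
      "last ts = (0, (\<lambda>_. 0)(0 := bit_symbol (dec w \<in> L)))"
      using M unfolding decides_def by blast
    then have "outputs_within M (dec w) (poly p (length (dec w))) [dec w \<in> L]"
      by (simp add: outputs_within_def tape_holds_def)
    then show ?thesis unfolding em by (intro exI[of _ "[dec w \<in> L]"]) simp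
  qed
  then obtain M' p' where "decides M' p' {w. dec w \<in> L}"
    using ex_decides[of M el eb p "{w. dec w \<in> L}" "Const 0" True] M unfolding decides_def[of M] by blast
  then have "{w. dec w \<in> L} \<in> class_P" by (rule decides_class_P)
  moreover have "x \<in> L \<longleftrightarrow> (\<exists>u. length u \<le> poly 0 (length x) \<and> encode_pair x u \<in> {w. dec w \<in> L})" for x
    by (simp add: dec)
  ultimately show ?thesis unfolding class_NP_def by blast
qed

theorem theorem5:
  assumes "class_P \<noteq> class_NP"
  shows "\<forall>l :: real. \<not> (\<exists>M. polytime_approximates_local_min_degree l M)"
  using class_NP_subset_class_P class_P_subset_class_NP assms by blast

end
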